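(* Let $\mathcal{I}$ be a quasi-convex definition of energy. Let $\Gamma$ be a Jordan curve in a proper metric space $X$. Any map $u\in\Lambda(\Gamma,X)$ with minimal $\mathcal{I}$-energy in $\Lambda(\Gamma,X)$ has minimal $\mu^{\mathcal{I}}$-area in $\Lambda(\Gamma,X)$. Moreover, $u$ is $Q_{\mathcal{I}}$-quasiconformal.
   Context: $D\subset\mathbb{R}^2$ is the open Euclidean unit disc and $S^1$ its boundary. Metric spaces are complete; a metric space is proper if its closed bounded subsets are compact. A Jordan curve $\Gamma\subset X$ is a subset homeomorphic to $S^1$. $\mathfrak{S}_2$ is the space of seminorms on $\mathbb{R}^2$ with distance $d(s,s')=\max_{v\in S^1}|s(v)-s'(v)|$; $s_0$ is the Euclidean norm. Sobolev maps: $W^{1,2}(D,X)$ is the set of measurable, essentially separably valued maps $u:D\to X$ (identified if equal a.e.) for which there is $g\in L^2(D)$ such that for every $1$-Lipschitz $f:X\to\mathbb{R}$ the composition $f\circ u$ is in the classical Sobolev space $W^{1,2}(D)$ and $|\nabla(f\circ u)|\le g$ a.e. For a.e. $z\in D$ such a $u$ has an approximate metric derivative $\operatorname{apmd}u_z$: the unique seminorm $s$ on $\mathbb{R}^2$ such that the approximate limit (limit along a measurable set with Lebesgue density $1$ at $z$) of $\frac{d(u(z),u(y))-s(y-z)}{|y-z|}$ as $y\to z$ equals $0$. Trace: for a.e. $v\in S^1$ the curve $t\mapsto u(tv)$ (for a suitable representative of $u$) has a limit as $t\to1^-$, denoted $\operatorname{tr}(u)(v)$. $\Lambda(\Gamma,X)$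 is the set of $u\in W^{1,2}(D,X)$ whose trace $\operatorname{tr}(u):S^1\to X$ is a reparametrization of $\Gamma$, i.e. has a continuous representative which is a weakly monotone parametrization of $\Gamma$ (a uniform limit of homeomorphisms $S^1\to\Gamma$). A definition of energy is a continuous map $\mathcal{I}:\mathfrak{S}_2\to[0,\infty)$ such that: (1) $\mathcal{I}(s)\ge\mathcal{I}(s')$ whenever $s\ge s'$; (2) $\mathcal{I}(\lambda s)=\lambda^2\mathcal{I}(s)$ for $\lambda\ge0$; (3) $\mathcal{I}(s\circ T)=\mathcal{I}(s)$ for $T\in\mathrm{SO}_2$; (4) $\mathcal{I}^{-1}([0,1])$ is compact. The $\mathcal{I}$-energy is $E_{\mathcal{I}}(u)=\int_D\mathcal{I}(\operatorname{apmd}u_z)\,dz$. $\mathcal{I}$ is quasi-convex if for every finite-dimensional normed space $Y$, every linear map $L:\mathbb{R}^2\to Y$ and every smooth immersion $\psi:\bar D\to Y$ with $\psi|_{\partial D}=L|_{\partial D}$ one has $E_{\mathcal{I}}(L|_D)\le E_{\mathcal{I}}(\psi)$. The definition of area $\mu^{\mathcal{I}}$ has Jacobian $\mathbf{J}^{\mathcal{I}}(s)=\lambda_{\mathcal{I}}\hat J(s)$, where $\hat J(s)=\inf\{\mathcal{I}(s\circ T):T\in\mathrm{SL}_2\}$ and $\lambda_{\mathcal{I}}=1/\hat J(s_0)$; the $\mu^{\mathcal{I}}$-area is $\operatorname{Area}_{\mu^{\mathcal{I}}}(u)=\int_D\mathbf{J}^{\mathcal{I}}(\operatorname{apmd}u_z)\,dz$.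 A seminorm $s$ is $\mathcal{I}$-minimal if $\mathcal{I}(s)\le\mathcal{I}(s\circ T)$ for all $T\in\mathrm{SL}_2$. A seminorm $s$ is $Q$-quasiconformal if $s(v)\le Q\,s(w)$ for all $v,w\in S^1$; a map $u\in W^{1,2}(D,X)$ is $Q$-quasiconformal if $\operatorname{apmd}u_z$ is $Q$-quasiconformal for a.e. $z\in D$. $Q_{\mathcal{I}}>0$ denotes a number, depending only on $\mathcal{I}$, such that every $\mathcal{I}$-minimal seminorm is $Q_{\mathcal{I}}$-quasiconformal (such a number exists). *)

theory Defs
  imports "HOL-Analysis.Analysis"
begin

section \<open>Seminorms on the plane\<close>

typedef seminorm2 =
  "{s :: real^2 \<Rightarrow> real. (\<forall>x y. s (x + y) \<le> s x + s y) \<and> (\<forall>c x. s (c *\<^sub>R x) = \<bar>c\<bar> * s x)}"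
  morphisms sn Abs_seminorm2
  by (rule exI[of _ "\<lambda>_. 0"]) simp

setup_lifting type_definition_seminorm2

lemma sn_triangle: "sn s (x + y) \<le> sn s x + sn s y"
  and sn_scaleR: "sn s (c *\<^sub>R x) = \<bar>c\<bar> * sn s x"
  using sn[of s] by auto

lemma sn_zero [simp]: "sn s 0 = 0"
  using sn_scaleR[of s 0 0] by simp

lemma sn_nonneg: "0 \<le> sn s x"
  using sn_triangle[of s x "- x"] sn_scaleR[of s "- 1" x] by simp

lemma sn_le_norm: "sn s x \<le> (sn s (axis 1 1) + sn s (axis 2 1)) * norm x"
proof -
  have "x = (x $ 1) *\<^sub>R axis 1 1 + (x $ 2) *\<^sub>R axis 2 1"
    by (simp add: vec_eq_iff forall_2 axis_def)
  then have "sn s x \<le> \<bar>x $ 1\<bar> * sn s (axis 1 1) + \<bar>x $ 2\<bar> * sn s (axis 2 1)"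
    by (metis sn_triangle sn_scaleR)
  also have "\<dots> \<le> norm x * sn s (axis 1 1) + norm x * sn s (axis 2 1)"
    by (intro add_mono mult_right_mono component_le_norm_cart sn_nonneg)
  finally show ?thesis by (simp add: algebra_simps)
qed

lemma bdd_sn_diff: "bdd_above ((\<lambda>v. \<bar>sn s v - sn s' v\<bar>) ` sphere 0 1)"
proof (rule bdd_aboveI2)
  fix v :: "real^2" assume "v \<in> sphere 0 1"
  then show "\<bar>sn s v - sn s' v\<bar>
      \<le> (sn s (axis 1 1) + sn s (axis 2 1)) + (sn s' (axis 1 1) + sn s' (axis 2 1))"
    using sn_le_norm[of s v] sn_le_norm[of s' v] sn_nonneg[of s v] sn_nonneg[of s' v] by simp
qed

lemma sphere2_nonempty: "sphere (0 :: real^2) 1 \<noteq> {}"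
  by simp

instantiation seminorm2 :: metric_space
begin

text \<open>The supremum is a maximum: seminorms are continuous and the circle is compact.\<close>

definition dist_seminorm2 :: "seminorm2 \<Rightarrow> seminorm2 \<Rightarrow> real" where
  "dist_seminorm2 s s' = (SUP v\<in>sphere 0 1. \<bar>sn s v - sn s' v\<bar>)"

definition uniformity_seminorm2 :: "(seminorm2 \<times> seminorm2) filter" where
  "uniformity_seminorm2 = (INF e\<in>{0<..}. principal {(x, y). dist x y < e})"

definition open_seminorm2 :: "seminorm2 set \<Rightarrow> bool" where
  "open_seminorm2 U = (\<forall>x\<in>U. \<forall>\<^sub>F (x', y) in uniformity. x' = x \<longrightarrow> y \<in> U)"

instance
proof
  fix s t r :: seminorm2
  have up: "\<bar>sn a v - sn b v\<bar> \<le> dist a b" if "v \<in> sphere 0 1" for a b v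
    unfolding dist_seminorm2_def by (rule cSUP_upper[OF that bdd_sn_diff])
  show "dist s t = 0 \<longleftrightarrow> s = t"
  proof
    assume 0: "dist s t = 0"
    have "sn s x = sn t x" for x
    proof (cases "x = 0")
      case False
      let ?y = "x /\<^sub>R norm x"
      have "?y \<in> sphere 0 1" using False by simp
      with up[of ?y s t] 0 have "sn s ?y = sn t ?y" by simp
      then have "sn s (norm x *\<^sub>R ?y) = sn t (norm x *\<^sub>R ?y)" by (simp only: sn_scaleR)
      then show ?thesis using False by simp
    qed simp
    then show "s = t" by (simp add: sn_inject[symmetric] fun_eq_iff)
  qed (simp add: dist_seminorm2_def sphere2_nonempty)
  show "dist s t \<le> dist s r + dist t r"
    unfolding dist_seminorm2_def[of s t]
  proof (rule cSUP_least[OF sphere2_nonempty])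
    fix v :: "real^2" assume "v \<in> sphere 0 1"
    from up[OF this, of s r] up[OF this, of t r]
    show "\<bar>sn s v - sn t v\<bar> \<le> dist s r + dist t r" by linarith
  qed
qed (simp_all add: uniformity_seminorm2_def open_seminorm2_def)

end

lift_definition sn_euclid :: seminorm2 is norm
  by (simp add: norm_triangle_ineq)

text \<open>Only used for \<^term>\<open>c \<ge> 0\<close>; the absolute value makes the operation total.\<close>

lift_definition sn_scale :: "real \<Rightarrow> seminorm2 \<Rightarrow> seminorm2" is "\<lambda>c s v. \<bar>c\<bar> * s v"
  by (auto simp: mult_left_mono ring_distribs[symmetric])

lift_definition sn_comp :: "seminorm2 \<Rightarrow> real^2^2 \<Rightarrow> seminorm2" is "\<lambda>s T v. s (T *v v)"
  by (simp add: matrix_vector_right_distrib matrix_vector_mult_scaleR)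

definition sn_quasiconformal :: "real \<Rightarrow> seminorm2 \<Rightarrow> bool" where
  "sn_quasiconformal Q s \<longleftrightarrow> (\<forall>v\<in>sphere 0 1. \<forall>w\<in>sphere 0 1. sn s v \<le> Q * sn s w)"


section \<open>Approximate metric derivative and energy\<close>

abbreviation disc :: "(real^2) set" where
  "disc \<equiv> ball 0 1"

definition density_one :: "(real^2) set \<Rightarrow> real^2 \<Rightarrow> bool" where
  "density_one A z \<longleftrightarrow> A \<in> sets lebesgue \<and>
     ((\<lambda>r. measure lebesgue (A \<inter> ball z r) / measure lebesgue (ball z r)) \<longlongrightarrow> 1) (at_right 0)"

text \<open>The distance \<open>d\<close> is a parameter, since below the target is not only a type of class
  \<^class>\<open>metric_space\<close> but also \<open>\<real>\<^sup>n\<close> with an arbitrary norm.\<close>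

definition has_apmd ::
    "('b \<Rightarrow> 'b \<Rightarrow> real) \<Rightarrow> (real^2 \<Rightarrow> 'b) \<Rightarrow> real^2 \<Rightarrow> seminorm2 \<Rightarrow> bool" where
  "has_apmd d u z s \<longleftrightarrow> (\<exists>A\<subseteq>disc. density_one A z \<and>
     ((\<lambda>y. (d (u z) (u y) - sn s (y - z)) / norm (y - z)) \<longlongrightarrow> 0) (at z within A))"

definition apmd :: "('b \<Rightarrow> 'b \<Rightarrow> real) \<Rightarrow> (real^2 \<Rightarrow> 'b) \<Rightarrow> real^2 \<Rightarrow> seminorm2" where
  "apmd d u z = (THE s. has_apmd d u z s)"

definition energy ::
    "(seminorm2 \<Rightarrow> real) \<Rightarrow> ('b \<Rightarrow> 'b \<Rightarrow> real) \<Rightarrow> (real^2 \<Rightarrow> 'b) \<Rightarrow> ennreal" where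
  "energy I d u = (\<integral>\<^sup>+z. ennreal (I (apmd d u z)) \<partial>lebesgue_on disc)"

definition definition_of_energy :: "(seminorm2 \<Rightarrow> real) \<Rightarrow> bool" where
  "definition_of_energy I \<longleftrightarrow>
     (\<forall>s. 0 \<le> I s) \<and>
     continuous_on UNIV I \<and>
     (\<forall>s s'. (\<forall>v. sn s' v \<le> sn s v) \<longrightarrow> I s' \<le> I s) \<and>
     (\<forall>c s. 0 \<le> c \<longrightarrow> I (sn_scale c s) = c\<^sup>2 * I s) \<and>
     (\<forall>s T. orthogonal_matrix T \<and> det T = 1 \<longrightarrow> I (sn_comp s T) = I s) \<and>
     compact (I -` {0..1})"

definition energy_minimal :: "(seminorm2 \<Rightarrow> real) \<Rightarrow> seminorm2 \<Rightarrow> bool" where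
  "energy_minimal I s \<longleftrightarrow> (\<forall>T. det T = 1 \<longrightarrow> I s \<le> I (sn_comp s T))"

definition jac_hat :: "(seminorm2 \<Rightarrow> real) \<Rightarrow> seminorm2 \<Rightarrow> real" where
  "jac_hat I s = (INF T\<in>{T. det T = 1}. I (sn_comp s T))"

definition jacobian :: "(seminorm2 \<Rightarrow> real) \<Rightarrow> seminorm2 \<Rightarrow> real" where
  "jacobian I s = 1 / jac_hat I sn_euclid * jac_hat I s"

definition area ::
    "(seminorm2 \<Rightarrow> real) \<Rightarrow> ('b \<Rightarrow> 'b \<Rightarrow> real) \<Rightarrow> (real^2 \<Rightarrow> 'b) \<Rightarrow> ennreal" where
  "area I d u = (\<integral>\<^sup>+z. ennreal (jacobian I (apmd d u z)) \<partial>lebesgue_on disc)"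


section \<open>Smooth maps and quasi-convexity\<close>

primrec times_differentiable_on :: "nat \<Rightarrow> (real^2 \<Rightarrow> real) \<Rightarrow> (real^2) set \<Rightarrow> bool" where
  "times_differentiable_on 0 f U \<longleftrightarrow> continuous_on U f"
| "times_differentiable_on (Suc k) f U \<longleftrightarrow>
     (\<forall>x\<in>U. f differentiable at x) \<and>
     (\<forall>v. times_differentiable_on k (\<lambda>x. frechet_derivative f (at x) v) U)"

text \<open>Intended for open \<open>U\<close>.\<close>

definition smooth_on :: "(real^2 \<Rightarrow> real) \<Rightarrow> (real^2) set \<Rightarrow> bool" where
  "smooth_on f U \<longleftrightarrow> (\<forall>k. times_differentiable_on k f U)"

text \<open>A formula cannot quantify over types, so a finite-dimensional normed space is given in
  coordinates, as \<open>\<real>\<^sup>n\<close> with an arbitrary norm \<open>N\<close>. Vectors are functions vanishing from \<open>n\<close> on.\<close>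

definition coord_space :: "nat \<Rightarrow> (nat \<Rightarrow> real) set" where
  "coord_space n = {y. \<forall>i\<ge>n. y i = 0}"

definition norm_on_coord_space :: "nat \<Rightarrow> ((nat \<Rightarrow> real) \<Rightarrow> real) \<Rightarrow> bool" where
  "norm_on_coord_space n N \<longleftrightarrow>
     (\<forall>x\<in>coord_space n. 0 \<le> N x \<and> (N x = 0 \<longleftrightarrow> x = (\<lambda>_. 0))) \<and>
     (\<forall>c. \<forall>x\<in>coord_space n. N (\<lambda>i. c * x i) = \<bar>c\<bar> * N x) \<and>
     (\<forall>x\<in>coord_space n. \<forall>y\<in>coord_space n. N (\<lambda>i. x i + y i) \<le> N x + N y)"

definition linear_map :: "nat \<Rightarrow> (real^2 \<Rightarrow> nat \<Rightarrow> real) \<Rightarrow> bool" where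
  "linear_map n L \<longleftrightarrow> (\<forall>x. L x \<in> coord_space n) \<and> (\<forall>i<n. linear (\<lambda>x. L x i))"

text \<open>Smooth up to the boundary: smooth on some open neighbourhood of the closed disc.\<close>

definition smooth_immersion :: "nat \<Rightarrow> (real^2 \<Rightarrow> nat \<Rightarrow> real) \<Rightarrow> bool" where
  "smooth_immersion n \<psi> \<longleftrightarrow>
     (\<forall>x. \<psi> x \<in> coord_space n) \<and>
     (\<exists>U. open U \<and> cball 0 1 \<subseteq> U \<and> (\<forall>i<n. smooth_on (\<lambda>x. \<psi> x i) U)) \<and>
     (\<forall>x\<in>cball 0 1. inj (\<lambda>v. \<lambda>i\<in>{..<n}. frechet_derivative (\<lambda>y. \<psi> y i) (at x) v))"

definition quasi_convex :: "(seminorm2 \<Rightarrow> real) \<Rightarrow> bool" where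
  "quasi_convex I \<longleftrightarrow>
     (\<forall>n N L \<psi>. norm_on_coord_space n N \<longrightarrow> linear_map n L \<longrightarrow> smooth_immersion n \<psi> \<longrightarrow>
        (\<forall>x\<in>sphere 0 1. \<psi> x = L x) \<longrightarrow>
        energy I (\<lambda>x y. N (\<lambda>i. x i - y i)) L \<le> energy I (\<lambda>x y. N (\<lambda>i. x i - y i)) \<psi>)"


section \<open>Sobolev maps\<close>

definition L2_disc :: "(real^2 \<Rightarrow> 'b :: euclidean_space) \<Rightarrow> bool" where
  "L2_disc f \<longleftrightarrow> f \<in> borel_measurable (lebesgue_on disc) \<and>
     integrable (lebesgue_on disc) (\<lambda>z. (norm (f z))\<^sup>2)"

definition test_function :: "(real^2 \<Rightarrow> real) \<Rightarrow> bool" where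
  "test_function \<phi> \<longleftrightarrow> smooth_on \<phi> UNIV \<and> (\<exists>K. compact K \<and> K \<subseteq> disc \<and> (\<forall>x. x \<notin> K \<longrightarrow> \<phi> x = 0))"

text \<open>\<open>f\<close> is in the classical Sobolev space \<open>W\<^sup>1\<^sup>,\<^sup>2(D)\<close>, with weak gradient \<open>G\<close>.\<close>

definition sobolev_gradient :: "(real^2 \<Rightarrow> real) \<Rightarrow> (real^2 \<Rightarrow> real^2) \<Rightarrow> bool" where
  "sobolev_gradient f G \<longleftrightarrow> L2_disc f \<and> L2_disc G \<and>
     (\<forall>\<phi> i. test_function \<phi> \<longrightarrow>
        (LINT z|lebesgue_on disc. f z * frechet_derivative \<phi> (at z) (axis i 1))
        = - (LINT z|lebesgue_on disc. G z $ i * \<phi> z))"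

text \<open>Maps on the disc are total functions whose values off \<^const>\<open>disc\<close> are irrelevant. Maps that
  agree almost everywhere are not identified; all notions below respect that equivalence.\<close>

definition essentially_separably_valued :: "(real^2 \<Rightarrow> 'a :: metric_space) \<Rightarrow> bool" where
  "essentially_separably_valued u \<longleftrightarrow>
     (\<exists>N\<in>null_sets lebesgue. separable_space (top_of_set (u ` (disc - N))))"

definition sobolev_map :: "(real^2 \<Rightarrow> 'a :: metric_space) \<Rightarrow> bool" where
  "sobolev_map u \<longleftrightarrow>
     u \<in> borel_measurable (lebesgue_on disc) \<and>
     essentially_separably_valued u \<and>
     (\<exists>g :: real^2 \<Rightarrow> real. L2_disc g \<and>
        (\<forall>f :: 'a \<Rightarrow> real. 1-lipschitz_on UNIV f \<longrightarrow>
           (\<exists>G. sobolev_gradient (f \<circ> u) G \<and> (AE z in lebesgue_on disc. norm (G z) \<le> g z))))"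

definition quasiconformal :: "real \<Rightarrow> (real^2 \<Rightarrow> 'a :: metric_space) \<Rightarrow> bool" where
  "quasiconformal Q u \<longleftrightarrow>
     sobolev_map u \<and> (AE z in lebesgue_on disc. sn_quasiconformal Q (apmd dist u z))"


section \<open>Traces and the space of discs spanning a Jordan curve\<close>

definition circle_point :: "real \<Rightarrow> real^2" where
  "circle_point t = vector [cos t, sin t]"

text \<open>\<open>\<tau>\<close> is (a representative of) the trace of \<open>u\<close>. The choice of the representative \<open>u'\<close> does not
  matter: by Fubini, two of them agree at almost every point of almost every radius, so wherever
  both have a radial limit these limits coincide for almost every direction.\<close>

definition has_trace :: "(real^2 \<Rightarrow> 'a :: metric_space) \<Rightarrow> (real^2 \<Rightarrow> 'a) \<Rightarrow> bool" where
  "has_trace u \<tau> \<longleftrightarrow>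
     (\<exists>u'. (AE z in lebesgue_on disc. u' z = u z) \<and>
        (AE \<theta> in lebesgue_on {0..2 * pi}.
           ((\<lambda>t. u' (t *\<^sub>R circle_point \<theta>)) \<longlongrightarrow> \<tau> (circle_point \<theta>)) (at_left 1)))"

definition jordan_curve :: "'a :: metric_space set \<Rightarrow> bool" where
  "jordan_curve \<Gamma> \<longleftrightarrow> \<Gamma> homeomorphic sphere (0 :: real^2) 1"

definition weakly_monotone_param :: "'a :: metric_space set \<Rightarrow> (real^2 \<Rightarrow> 'a) \<Rightarrow> bool" where
  "weakly_monotone_param \<Gamma> \<gamma> \<longleftrightarrow>
     (\<exists>h. (\<forall>k::nat. \<exists>h'. homeomorphism (sphere 0 1) \<Gamma> (h k) h') \<and>
          uniform_limit (sphere 0 1) h \<gamma> sequentially)"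

definition spanning_maps :: "'a :: metric_space set \<Rightarrow> (real^2 \<Rightarrow> 'a) set" where
  "spanning_maps \<Gamma> = {u. sobolev_map u \<and>
     (\<exists>\<gamma>. has_trace u \<gamma> \<and> continuous_on (sphere 0 1) \<gamma> \<and> weakly_monotone_param \<Gamma> \<gamma>)}"

end

theory Submission
 imports Defs "HOL-Complex_Analysis.Complex_Analysis"
begin

text \<open>
A bi-Lipschitz reparametrization \<open>P\<close> of the disc with Beltrami coefficient \<open>m\<close> turns the energy of \<open>v \<circ> P\<close> into the
integral of \<open>I (apmd v \<circ> T)\<close>, where \<open>T\<close> in \<open>SL\<^sub>2\<close> is, up to rotation, determined by \<open>m\<close>. Choosing \<open>m\<close> measurably so that \<open>T\<close>
nearly attains the infimum defining the Jacobian makes this energy exceed the integral of \<open>jac_hat I (apmd v)\<close> by as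
little as desired. Hence the minimal energy is at most that integral for every spanning \<open>v\<close>. For \<open>v = u\<close> this gives
\<open>I = jac_hat I\<close> at almost all \<open>apmd u\<close>, so these are \<open>I\<close>-minimal and \<open>u\<close> is quasiconformal; for general \<open>v\<close> it then is the
area comparison.

The Beltrami equation need only be solved up to a small error off a set of small measure. This is done by hand: start
with the identity, and inside disjoint balls exhausting the disc successively compose with Moebius and Joukowski-type
maps having constant dilatation on a small disc and conformal outside. A final correction makes the map radial near the
circle, so that traces can be composed. Since \<open>apmd v\<close> is the supremum of the weak gradients of the distance functions
from a countable dense set, its chain rule reduces to the one for real Sobolev functions.
\<close>

text \<open>An exact solution for a merely measurable coefficient is avoided. Approximate ones
  suffice because all energy densities with dilatation at most a fixed \<open>k < 1\<close> share
  one integrable majorant, so that errors on sets of summable measure disappear by Borel-Cantelli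
  and dominated convergence. Two rules for the quotient \<open>b/a\<close> in
  \<open>a*w + b*cnj w\<close> shape the construction. Composing on the left with a holomorphic map
  leaves it unchanged, so an earlier success is never destroyed; composing on the right with one
  only turns its phase, which the next coefficient can compensate. The iteration does not stall
  because the fraction of a ball settled in one step is independent of the map built so far. This is
  a Koebe-type distortion bound for univalent functions; it makes the untreated area decay
  geometrically. The bi-Lipschitz constants may degenerate meanwhile, but only finitely many maps
  are composed and the energy estimates see the dilatation alone. Traces are limits along radii, and
  a map that is conformal near the circle need not send radii to radii; hence the correction
  there.\<close>

abbreviation nnl (binder "LN " 10) where "nnl f == nn_integral lborel f"

abbreviation lbi (binder "LI " 10) where "lbi f == integral\<^sup>L lborel f"

abbreviation AE_disc (binder "AED " 10) where "AE_disc P == almost_everywhere (lebesgue_on disc) P"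

abbreviation BD where "BD == borel_measurable (lebesgue_on disc)"

abbreviation fder where "fder f z == frechet_derivative f (at z)"

subsection \<open>Self-maps of the disc that are conformal near the circle\<close>

text \<open>That the open disc is mapped onto itself is a consequence, proved in
  \<open>disc_map_image\<close>. Holomorphy on a neighbourhood of the circle is kept because the
  radial correction takes a logarithm of the map there.\<close>

definition disc_map :: "(complex => complex) => bool" where
 "disc_map F \<longleftrightarrow>
  (\<exists>l>0. \<exists>L. \<forall>z\<in>cball 0 1. \<forall>w\<in>cball 0 1.
    l*norm (z - w) <= norm (F z - F w) \<and> norm (F z - F w) <= L*norm (z - w)) \<and>
  F ` sphere 0 1 \<subseteq> sphere 0 1 \<and>
  (\<exists>U. open U \<and> sphere 0 1 \<subseteq> U \<and> F holomorphic_on U)"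

lemma disc_mapI:
 assumes "0 < l"
  and "!!z w. norm z <= 1 ==> norm w <= 1 ==> l*norm (z - w) <= norm (F z - F w)"
  and "!!z w. norm z <= 1 ==> norm w <= 1 ==> norm (F z - F w) <= L*norm (z - w)"
  and "!!z. norm z = 1 ==> norm (F z) = 1"
  and "open U" "sphere 0 1 \<subseteq> U" "F holomorphic_on U"
 shows "disc_map F"
proof -
 have "\<forall>z\<in>cball 0 1. \<forall>w\<in>cball 0 1.
    l*norm (z - w) <= norm (F z - F w) \<and> norm (F z - F w) <= L*norm (z - w)"
  using assms(2,3) by auto
 moreover have "F ` sphere 0 1 \<subseteq> sphere 0 1" using assms(4) by auto
 ultimately show ?thesis
  unfolding disc_map_def using assms(1,5,6,7)
  by blast
qed

lemma disc_map_bilipschitz: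
 assumes "disc_map F"
 obtains l L where "0 < l" "0 < L"
  "!!z w. norm z <= 1 ==> norm w <= 1 ==> l*norm (z - w) <= norm (F z - F w)"
  "!!z w. norm z <= 1 ==> norm w <= 1 ==> norm (F z - F w) <= L*norm (z - w)"
proof -
 obtain l L where "l > 0" and lL: "\<forall>z\<in>cball 0 1. \<forall>w\<in>cball 0 1.
    l*norm (z - w) <= norm (F z - F w) \<and> norm (F z - F w) <= L*norm (z - w)"
  using assms unfolding disc_map_def by blast
 have "L > 0"
  using lL[rule_format, of 0 1] \<open>l > 0\<close> by force
 with \<open>l > 0\<close> lL show ?thesis by(intro that[of l L]) auto
qed

lemma disc_map_continuous:
 assumes "disc_map F"
 shows "continuous_on (cball 0 1) F"
proof -
 obtain l L where "0 < L" and L: "!!z w. norm z <= 1 ==> norm w <= 1 ==> norm (F z - F w) <= L*norm (z - w)"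
  using disc_map_bilipschitz[OF assms] by metis
 hence "L-lipschitz_on (cball 0 1) F"
  by(intro lipschitz_onI) (auto simp: dist_norm)
 thus ?thesis by(rule lipschitz_on_continuous_on)
qed

lemma disc_map_inj:
 assumes "disc_map F"
 shows "inj_on F (cball 0 1)"
proof -
 obtain l L where "0 < l" and l: "!!z w. norm z <= 1 ==> norm w <= 1 ==> l*norm (z - w) <= norm (F z - F w)"
  using disc_map_bilipschitz[OF assms] by metis
 show ?thesis
 proof(rule inj_onI)
  fix z w assume "z \<in> cball 0 1" "w \<in> cball 0 1" "F z = F w"
  with l[of z w] \<open>0 < l\<close> show "z = w"
   by(simp add: mult_le_0_iff)
 qed
qed

text \<open>By invariance of domain the image of the open disc is open, so the modulus can only be
  maximal on the circle. Hence the disc goes into the disc, and its image is open and closed there;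
  connectedness does the rest.\<close>

lemma injective_disc_image:
 fixes F :: "complex => complex"
 assumes cont: "continuous_on (cball 0 1) F" and inj: "inj_on F (cball 0 1)"
  and sph: "F ` sphere 0 1 \<subseteq> sphere 0 1"
 shows "F ` ball 0 1 = ball 0 1" "F ` sphere 0 1 = sphere 0 1"
proof -
 have opn: "open (F ` ball 0 1)"
  using invariance_of_domain[of "ball 0 1" F] cont inj
  by(meson ball_subset_cball continuous_on_subset inj_on_subset open_ball)
 have le: "norm (F z) <= 1" if "z \<in> cball 0 1" for z
 proof -
  obtain z0 where z0: "z0 \<in> cball 0 1" "!!y. y \<in> cball 0 1 ==> norm (F y) <= norm (F z0)"
   using continuous_attains_sup[of "cball 0 1" "%z. norm (F z)"] cont
   by(metis compact_cball continuous_on_norm cball_eq_empty not_one_less_zero)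
  have "norm z0 = 1"
  proof(rule ccontr)
   assume "norm z0 ~= 1"
   hence "F z0 \<in> F ` ball 0 1" using z0(1) by auto
   then obtain e where e: "e > 0" "ball (F z0) e \<subseteq> F ` ball 0 1"
    using opn open_contains_ball by blast
   \<comment> \<open>An outward direction at \<open>F z0\<close>; for the value 0 every direction is
     outward and 1 is taken. Moving by \<open>e/2\<close> along \<open>v\<close> stays in the open
     image and increases the modulus.\<close>
   define v where "v = (if F z0 = 0 then 1 else sgn (F z0))"
   have nv: "norm v = 1" by(simp add: v_def norm_sgn)
   have fv: "F z0 = norm (F z0) *\<^sub>R v" by(simp add: v_def sgn_div_norm)
   have "F z0 + (e/2) *\<^sub>R v \<in> F ` ball 0 1"
    using e nv by(auto intro!: subsetD[OF e(2)] simp: dist_norm)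
   hence "norm (F z0 + (e/2) *\<^sub>R v) <= norm (F z0)"
    using z0(2) by(auto simp: less_imp_le)
   moreover have "F z0 + (e/2) *\<^sub>R v = (norm (F z0) + e/2) *\<^sub>R v"
    by(subst fv) (simp add: scaleR_left_distrib)
   ultimately show False using nv e(1) by simp
  qed
  hence "norm (F z0) = 1" using sph by force
  thus ?thesis using z0(2)[OF that] by simp
 qed
 have sub: "F ` ball 0 1 \<subseteq> ball 0 1"
 proof -
  have "F ` ball 0 1 \<subseteq> interior (cball 0 1)"
   using le by(intro interior_maximal opn) auto
  thus ?thesis by simp
 qed
 have cpt: "compact (F ` cball 0 1)"
  using cont compact_continuous_image compact_cball by blast
 have eq: "F ` ball 0 1 = F ` cball 0 1 \<inter> ball 0 1"
 proof
  show "F ` cball 0 1 \<inter> ball 0 1 \<subseteq> F ` ball 0 1"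
  proof
   fix y assume "y \<in> F ` cball 0 1 \<inter> ball 0 1"
   then obtain z where z: "norm z <= 1" "y = F z" "norm (F z) < 1" by auto
   hence "norm z ~= 1" using sph by force
   thus "y \<in> F ` ball 0 1" using z by auto
  qed
 qed (use sub in auto)
 show 1: "F ` ball 0 1 = ball 0 1"
 proof -
  have "openin (top_of_set (ball 0 1)) (F ` ball 0 1)"
   using opn sub openin_open_eq by blast
  moreover have "closedin (top_of_set (ball 0 1)) (F ` ball 0 1)"
   unfolding eq using cpt by(metis closedin_closed_Int compact_imp_closed inf_commute)
  ultimately show ?thesis
   using connected_clopen[of "ball (0::complex) 1"] by auto
 qed
 show "F ` sphere 0 1 = sphere 0 1"
 proof
  have "closure (ball 0 1) \<subseteq> F ` cball 0 1"
  proof(rule closure_minimal)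
   show "ball 0 1 \<subseteq> F ` cball 0 1"
    using 1 image_mono[OF ball_subset_cball, of F 0 1] by simp
  qed (use cpt in \<open>rule compact_imp_closed\<close>)
  hence "cball 0 1 \<subseteq> F ` cball 0 1" by simp
  thus "sphere 0 1 \<subseteq> F ` sphere 0 1"
  proof(intro subsetI)
   fix y :: complex assume s: "cball 0 1 \<subseteq> F ` cball 0 1" and "y \<in> sphere 0 1"
   then obtain z where z: "norm z <= 1" "y = F z" "norm (F z) = 1" by force
   hence "\<not> norm z < 1" using sub by force
   thus "y \<in> F ` sphere 0 1" using z by auto
  qed
 qed (use sph in auto)
qed

lemma disc_map_image:
 assumes "disc_map F"
 shows "F ` ball 0 1 = ball 0 1" "F ` sphere 0 1 = sphere 0 1"
 using injective_disc_image[OF disc_map_continuous[OF assms] disc_map_inj[OF assms]] assms unfolding disc_map_def by blast+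

lemma disc_map_norm:
 assumes "disc_map F" "norm z <= 1"
 shows "norm (F z) <= 1" "norm (F z) < 1 \<longleftrightarrow> norm z < 1"
proof -
 have "norm (F z) < 1" if "norm z < 1"
  using disc_map_image(1)[OF assms(1)] that by force
 moreover have "norm (F z) = 1" if "norm z = 1"
  using disc_map_image(2)[OF assms(1)] that by force
 ultimately show "norm (F z) <= 1" "norm (F z) < 1 \<longleftrightarrow> norm z < 1"
  using assms(2) by linarith+
qed

lemma disc_map_id: "disc_map (%z. z)"
 by(rule disc_mapI[of 1 _ 1 UNIV]) auto

lemma disc_map_compose:
 assumes F: "disc_map F" and G: "disc_map G"
 shows "disc_map (%z. G (F z))"
proof -
 obtain l L where l: "0 < l" "0 < L"
  "!!z w. norm z <= 1 ==> norm w <= 1 ==> l*norm (z - w) <= norm (F z - F w)"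
  "!!z w. norm z <= 1 ==> norm w <= 1 ==> norm (F z - F w) <= L*norm (z - w)"
  using disc_map_bilipschitz[OF F] by metis
 obtain m M where m: "0 < m" "0 < M"
  "!!z w. norm z <= 1 ==> norm w <= 1 ==> m*norm (z - w) <= norm (G z - G w)"
  "!!z w. norm z <= 1 ==> norm w <= 1 ==> norm (G z - G w) <= M*norm (z - w)"
  using disc_map_bilipschitz[OF G] by metis
 obtain U where U: "open U" "sphere 0 1 \<subseteq> U" "F holomorphic_on U"
  using F unfolding disc_map_def by auto
 obtain V where V: "open V" "sphere 0 1 \<subseteq> V" "G holomorphic_on V"
  using G unfolding disc_map_def by auto
 have n: "norm (F z) <= 1" if "norm z <= 1" for z using disc_map_norm[OF F that] by simp
 show ?thesis
 proof(rule disc_mapI[of "m*l" _ "M*L" "U \<inter> F -` V"])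
  fix z w :: complex assume zw: "norm z <= 1" "norm w <= 1"
  have "m*l*norm (z - w) <= m*norm (F z - F w)"
   using mult_left_mono[OF l(3)[OF zw], of m] m(1) by(simp add: mult.assoc)
  also have "... <= norm (G (F z) - G (F w))" using m(3) n zw by blast
  finally show "m*l*norm (z - w) <= norm (G (F z) - G (F w))" .
  have "norm (G (F z) - G (F w)) <= M*norm (F z - F w)" using m(4) n zw by blast
  also have "... <= M*L*norm (z - w)"
   using mult_left_mono[OF l(4)[OF zw], of M] m(2) by(simp add: mult.assoc)
  finally show "norm (G (F z) - G (F w)) <= M*L*norm (z - w)" .
 next
  show "norm (G (F z)) = 1" if "norm z = 1" for z
  proof -
   have "F ` sphere 0 1 \<subseteq> sphere 0 1" "G ` sphere 0 1 \<subseteq> sphere 0 1"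
    using F G unfolding disc_map_def by blast+
   thus ?thesis using that by(simp add: image_subset_iff)
  qed
  show "open (U \<inter> F -` V)"
   using U V by(metis continuous_open_preimage holomorphic_on_imp_continuous_on)
  show "sphere 0 1 \<subseteq> U \<inter> F -` V"
  proof
   fix x :: complex assume x: "x \<in> sphere 0 1"
   hence "F x \<in> sphere 0 1" using F unfolding disc_map_def by blast
   thus "x \<in> U \<inter> F -` V" using U V x by blast
  qed
  show "(%z. G (F z)) holomorphic_on U \<inter> F -` V"
   using holomorphic_on_compose_gen[of F "U \<inter> F -` V" G V] U(3) V(3)
   by(auto simp: o_def intro: holomorphic_on_subset)
 qed (use l m in simp)
qed

text \<open>The inverse is Lipschitz on the image. The lemma discards the points that are sent to
  the circle on which a Joukowski-type map fails to be differentiable.\<close>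

lemma disc_map_negligible_vimage:
 assumes F: "disc_map F" and N: "negligible N"
 shows "negligible {z \<in> cball 0 1. F z \<in> N}"
proof -
 obtain l L where l: "0 < l" "0 < L"
  "!!z w. norm z <= 1 ==> norm w <= 1 ==> l*norm (z - w) <= norm (F z - F w)"
  "!!z w. norm z <= 1 ==> norm w <= 1 ==> norm (F z - F w) <= L*norm (z - w)"
  using disc_map_bilipschitz[OF F] by metis
 define g where "g = inv_into (cball 0 1) F"
 have g: "g (F z) = z" if "z \<in> cball 0 1" for z
  using that disc_map_inj[OF F] by(simp add: g_def)
 have "negligible (g ` (N \<inter> F ` cball 0 1))"
 proof(rule negligible_locally_Lipschitz_image)
  show "negligible (N \<inter> F ` cball 0 1)" using N by(rule negligible_subset) auto
  fix x assume x: "x \<in> N \<inter> F ` cball 0 1"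
  have "norm (g y - g x) <= (1/l)*norm (y - x)" if y: "y \<in> N \<inter> F ` cball 0 1" for y
  proof -
   obtain a where a: "norm a <= 1" "x = F a" using x by auto
   obtain b where b: "norm b <= 1" "y = F b" using y by auto
   have "g x = a" "g y = b" using g a b by auto
   moreover have "l*norm (b - a) <= norm (y - x)" using l(3)[OF b(1) a(1)] a b by simp
   ultimately show ?thesis using l(1) by(simp add: pos_le_divide_eq mult.commute)
  qed
  thus "\<exists>T B. open T \<and> x \<in> T \<and>
    (\<forall>y\<in>N \<inter> F ` cball 0 1 \<inter> T. norm (g y - g x) <= B*norm (y - x))"
   by(intro exI[of _ UNIV] exI[of _ "1/l"]) auto
 qed auto
 moreover have "{z \<in> cball 0 1. F z \<in> N} \<subseteq> g ` (N \<inter> F ` cball 0 1)"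
  using g by force
 ultimately show ?thesis using negligible_subset by blast
qed

section \<open>Moebius maps of the disc\<close>

definition moeb :: "complex => complex => complex" where
 "moeb a z = (z - a)/(1 - cnj a*z)"

lemma moeb_denom:
 assumes "norm a < 1" "norm z <= 1"
 shows "1 - norm a <= norm (1 - cnj a*z)" "1 - cnj a*z ~= 0"
proof -
 have "norm (cnj a*z) <= norm a*1"
  unfolding norm_mult using assms by(intro mult_mono) auto
 thus "1 - norm a <= norm (1 - cnj a*z)"
  using norm_triangle_ineq2[of 1 "cnj a*z"] by simp
 with assms(1) show "1 - cnj a*z ~= 0" by auto
qed

text \<open>Both bi-Lipschitz bounds of \<open>moeb a\<close> are read off from this formula, since
  on the closed disc the moduli of the two factors in the denominator lie between
  \<open>1 - norm a\<close> and 2.\<close>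

lemma moeb_diff:
 assumes "norm a < 1" "norm z <= 1" "norm w <= 1"
 shows "moeb a z - moeb a w = (z - w)*(1 - cnj a*a)/((1 - cnj a*z)*(1 - cnj a*w))"
proof -
 have "1 - cnj a*z ~= 0" "1 - cnj a*w ~= 0" using moeb_denom assms by blast+
 thus ?thesis unfolding moeb_def by(simp add: field_simps)
qed

lemma disc_map_moeb:
 assumes a: "norm a < 1"
 shows "disc_map (moeb a)"
proof -
 have u: "cmod (1 - cnj a*a) = 1 - (norm a)^2"
 proof -
  have "1 - cnj a*a = of_real (1 - (norm a)^2)"
   by(metis complex_norm_square mult.commute of_real_1 of_real_diff)
  thus ?thesis using a by(simp add: norm_of_real abs_square_le_1 del: of_real_diff) 
 qed
 have pos: "0 < 1 - (norm a)^2" using a by(simp add: abs_square_less_1)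
 show ?thesis
 proof(rule disc_mapI[of "(1 - (norm a)^2)/(2*2)" _ "(1 - (norm a)^2)/((1 - norm a)*(1 - norm a))" "- {z. 1 - cnj a*z = 0}"])
  fix z w :: complex assume zw: "norm z <= 1" "norm w <= 1"
  have e: "cmod (moeb a z - moeb a w) = cmod (z - w)*(1 - (norm a)^2)/(cmod (1 - cnj a*z)*cmod (1 - cnj a*w))"
   using moeb_diff[OF a zw] u by(simp add: norm_mult norm_divide)
  have ub: "cmod (1 - cnj a*x) <= 2" if "norm x <= 1" for x
  proof -
   have "norm (cnj a*x) <= 1*1"
    unfolding norm_mult using a that by(intro mult_mono) auto
   thus ?thesis using norm_triangle_ineq4[of 1 "cnj a*x"] by simp
  qed
  have lb: "1 - norm a <= cmod (1 - cnj a*x)" if "norm x <= 1" for x using moeb_denom a that by blast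
  have "cmod (z - w)*(1 - (norm a)^2)/(2*2) <= cmod (moeb a z - moeb a w)"
   unfolding e using pos ub zw moeb_denom(2)[OF a]
   by(intro divide_left_mono mult_mono mult_pos_pos) auto
  thus "(1 - (norm a)^2)/(2*2)*cmod (z - w) <= cmod (moeb a z - moeb a w)"
   by(simp add: mult.commute)
  have "cmod (moeb a z - moeb a w) <= cmod (z - w)*(1 - (norm a)^2)/((1 - norm a)*(1 - norm a))"
   unfolding e using pos lb zw moeb_denom(2)[OF a] a
   by(intro divide_left_mono mult_mono mult_pos_pos) auto
  thus "cmod (moeb a z - moeb a w) <= (1 - (norm a)^2)/((1 - norm a)*(1 - norm a))*cmod (z - w)"
   by(simp add: mult.commute)
 next
  fix z :: complex assume z: "norm z = 1"
  \<comment> \<open>On the circle \<open>cnj z\<close> inverts \<open>z\<close>, so the denominator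
    is \<open>z\<close> times the conjugate of the numerator.\<close>
  hence "z*cnj z = 1" by(simp add: complex_norm_square[symmetric])
  hence "1 - cnj a*z = z*cnj (z - a)" by(simp add: algebra_simps)
  hence "norm (1 - cnj a*z) = norm (z*cnj (z - a))" by(rule arg_cong)
  hence A: "norm (1 - cnj a*z) = norm (z - a)"
   by(simp only: norm_mult z complex_mod_cnj mult_1)
  have "1 - cnj a*z ~= 0" using moeb_denom(2)[OF a, of z] z by simp
  hence "norm (1 - cnj a*z) ~= 0" by(simp only: norm_eq_zero not_False_eq_True)
  hence "norm (z - a)/norm (1 - cnj a*z) = 1" by(simp add: A)
  thus "norm (moeb a z) = 1"
   by(simp only: moeb_def norm_divide)
 next
  have "closed {z. 1 - cnj a*z = 0}" by(intro closed_Collect_eq continuous_intros)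
  thus "open (- {z. 1 - cnj a*z = 0})" by auto
  show "sphere 0 1 \<subseteq> - {z. 1 - cnj a*z = 0}" using moeb_denom a by auto
  show "moeb a holomorphic_on - {z. 1 - cnj a*z = 0}"
   unfolding moeb_def by(intro holomorphic_intros) auto
 qed (use pos in auto)
qed

lemma moeb_holomorphic:
 assumes "norm a < 1"
 shows "moeb a holomorphic_on ball 0 1"
 unfolding moeb_def using moeb_denom[OF assms] by(intro holomorphic_intros) auto

text \<open>Conjugation on the disc of radius \<open>s\<close>; outside, conjugation after inversion
  in its circle, which is holomorphic. The branches agree for \<open>norm z = s\<close>. So
  \<open>z + m*joukq s z\<close> is affine with dilatation \<open>m\<close> inside and the classical
  Joukowski map \<open>z + m*s^2/z\<close> outside.\<close>

definition joukq :: "real => complex => complex" where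
 "joukq s z = (if norm z <= s then cnj z else of_real (s^2)/z)"

lemma joukq_norm_le:
 assumes "0 < s"
 shows "norm (joukq s z) <= norm z" "norm (joukq s z) <= s"
proof -
 have "s^2/norm z <= s" if "norm z > s"
 proof -
  have "norm z > 0" using that assms by linarith
  thus ?thesis
   using that assms by(simp add: field_simps power2_eq_square)
 qed
 hence "norm (joukq s z) <= s \<and> norm (joukq s z) <= norm z"
  unfolding joukq_def using assms by(cases "norm z <= s") (force simp: norm_divide norm_power not_le)+
 thus "norm (joukq s z) <= norm z" "norm (joukq s z) <= s" by auto
qed

text \<open>Up to conjugation the second point is \<open>c *\<^sub>R w\<close>, the inversion of
  \<open>w\<close> in the circle of radius \<open>si\<close>. Inversion brings an outer point closer
  to every inner one: the difference of the squared distances factors into \<open>1 - c\<close> and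
  a term that \<open>2*(z \<bullet> w) \<le> (norm z)^2 + (norm w)^2\<close> shows to be
  nonnegative.\<close>

lemma joukq_mixed:
 assumes s: "0 < si" and z: "norm z <= si" and w: "si < norm w"
 shows "norm (cnj z - of_real (si^2)/w) <= norm (z - w)"
proof -
 define c where "c = si^2/(norm w)^2"
 have w0: "w ~= 0" using s w by auto
 have "si^2 <= (norm w)^2" using s w by(intro power_mono) auto
 hence c: "0 <= c" "c <= 1" using s w0 by(auto simp: c_def)
 have cw: "c*(norm w)^2 = si^2" using w0 by(simp add: c_def)
 have "of_real c*cnj w*w = of_real (c*(norm w)^2)"
  using complex_norm_square[of w] by(simp add: mult.commute mult.left_commute del: of_real_power)
 hence "of_real (si^2)/w = of_real c*cnj w"
  using w0 unfolding cw by(simp add: divide_eq_eq)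
 hence "cnj z - of_real (si^2)/w = cnj (z - c *\<^sub>R w)"
  by(simp add: scaleR_conv_of_real)
 hence "norm (cnj z - of_real (si^2)/w) = norm (z - c *\<^sub>R w)"
  by(simp only: complex_mod_cnj)
 moreover have "(norm (z - c *\<^sub>R w))^2 <= (norm (z - w))^2"
 proof -
  have zz: "(norm z)^2 <= si^2" using z by(simp add: power_mono)
  have "2*(z \<bullet> w) <= (norm z)^2 + (norm w)^2"
   using zero_le_power2[of "norm (z - w)"]
   by(simp add: power2_norm_eq_inner inner_diff_left inner_diff_right inner_commute)
  hence ge: "0 <= (norm w)^2 + si^2 - 2*(z \<bullet> w)" using zz by linarith
  have "(norm (z - w))^2 - (norm (z - c *\<^sub>R w))^2 = (1 - c)*((norm w)^2 + c*(norm w)^2 - 2*(z \<bullet> w))"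
   unfolding power2_norm_eq_inner
   by(simp add: inner_diff_left inner_diff_right inner_commute algebra_simps)
  also have "... \<ge> 0" unfolding cw using ge c by(intro mult_nonneg_nonneg) auto
  finally show ?thesis by linarith
 qed
 ultimately show ?thesis by(metis norm_ge_zero power2_le_imp_le)
qed

text \<open>The constant 1 matters: multiplied by a coefficient of modulus less than 1, this map is
  a contraction, so adding it to the identity keeps injectivity.\<close>

lemma joukq_lipschitz:
 assumes s: "0 < si"
 shows "norm (joukq si z - joukq si w) <= norm (z - w)"
proof -
 have out: "norm (of_real (si^2)/z - of_real (si^2)/w) <= norm (z - w)" if "si < norm z" "si < norm w" for z w :: complex
 proof -
  have nz: "z ~= 0" "w ~= 0" using that s by auto
  have "of_real (si^2)/z - of_real (si^2)/w = of_real (si^2)*(w - z)/(z*w)"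
   using nz by(simp add: field_simps)
  hence "norm (of_real (si^2)/z - of_real (si^2)/w) = si^2*norm (z - w)/(norm z*norm w)"
   by(simp add: norm_mult norm_divide norm_minus_commute norm_power)
  also have "... <= si^2*norm (z - w)/(si * si)"
   using that s nz by(intro divide_left_mono mult_mono) auto
  also have "... = norm (z - w)" using s by(simp add: power2_eq_square)
  finally show ?thesis .
 qed
 consider "norm z <= si" "norm w <= si" | "norm z <= si" "si < norm w" | "si < norm z" "norm w <= si" | "si < norm z" "si < norm w"
  by linarith
 thus ?thesis
 proof cases
  case 1
  thus ?thesis unfolding joukq_def by(simp flip: complex_cnj_diff)
 next
  case 2
  thus ?thesis using joukq_mixed[OF s 2] unfolding joukq_def by simp
 next
  case 3
  thus ?thesis using joukq_mixed[OF s 3(2,1)] unfolding joukq_def by(simp add: norm_minus_commute)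
 next
  case 4
  thus ?thesis using out[OF 4] unfolding joukq_def by simp
 qed
qed

text \<open>Affine with dilatation \<open>m\<close> for \<open>norm z \<le> s\<close> up to the holomorphic denominator, and conformal for
\<open>norm z > s\<close>. On the unit circle the numerator is \<open>z\<close> times the conjugate of the denominator, so the circle is preserved.\<close>

definition jouk :: "complex => real => complex => complex" where
 "jouk m s z = (z + m*joukq s z)/(1 + cnj m * of_real (s^2)*z^2)"

lemma jouk_denom:
 assumes "norm m < 1" "0 < s" "s^2 <= 1/40" "norm z <= 1"
 shows "1/2 <= norm (1 + cnj m * of_real (s^2)*z^2)" "norm (1 + cnj m * of_real (s^2)*z^2) <= 2"
proof -
 have "norm (cnj m * of_real (s^2)*z^2) <= 1 * s^2*1"
  unfolding norm_mult using assms by(intro mult_mono) (auto simp: norm_power power_le_one)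
 hence "norm (cnj m * of_real (s^2)*z^2) <= 1/40" using assms by simp
 thus "1/2 <= norm (1 + cnj m * of_real (s^2)*z^2)" "norm (1 + cnj m * of_real (s^2)*z^2) <= 2"
  using norm_triangle_ineq[of 1 "cnj m * of_real (s^2)*z^2"]
   norm_diff_triangle_ineq[of 1 "cnj m * of_real (s^2)*z^2" 0 "cnj m * of_real (s^2)*z^2"]
   norm_triangle_ineq4[of "1 + cnj m * of_real (s^2)*z^2" "cnj m * of_real (s^2)*z^2"]
  by auto
qed

text \<open>A perturbation argument. The numerator \<open>h\<close> differs from the identity by a
  map with Lipschitz constant \<open>k\<close>, and dividing by \<open>D\<close> changes it by
  another one with constant \<open>32*si^2\<close>, at most \<open>(1 - k)/2\<close> by the bound on
  \<open>si\<close>. Altogether the constant is \<open>(1 + k)/2 < 1\<close>.\<close>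

lemma disc_map_jouk:
 assumes m: "norm m <= k" "k < 1" and s: "0 < si" "si^2 <= (1 - k)/80"
 shows "disc_map (jouk m si)"
proof -
 have k0: "0 <= k" using m by(meson norm_ge_zero order_trans)
 have s40: "si^2 <= 1/40" using s k0 by simp
 have m1: "norm m < 1" using m by simp
 define D where "D z = 1 + cnj m * of_real (si^2)*z^2" for z
 define h where "h z = z + m*joukq si z" for z
 define e where "e z = 1/D z - 1" for z
 have D: "1/2 <= norm (D z)" "norm (D z) <= 2" "D z ~= 0" if "norm z <= 1" for z
  using jouk_denom[OF m1 s(1) s40 that] by(auto simp: D_def)
 have J: "jouk m si z = h z + h z*e z" for z
  by(simp add: jouk_def h_def e_def D_def algebra_simps)
 have hdiff: "norm ((h z - h w) - (z - w)) <= k*norm (z - w)" for z w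
 proof -
  have "norm ((h z - h w) - (z - w)) = norm m*norm (joukq si z - joukq si w)"
   by(simp add: h_def algebra_simps flip: norm_mult)
  also have "... <= k*norm (z - w)"
   using m joukq_lipschitz[OF s(1)] k0 by(intro mult_mono) auto
  finally show ?thesis .
 qed
 have hn: "norm (h z) <= 2" if "norm z <= 1" for z
 proof -
  have "norm (m*joukq si z) <= 1*1" unfolding norm_mult
   using m1 joukq_norm_le[OF s(1), of z] that by(intro mult_mono) auto
  thus ?thesis unfolding h_def using norm_triangle_ineq[of z "m*joukq si z"] that by linarith
 qed
 have eD: "e z - e w = (D w - D z)/(D z*D w)" if "norm z <= 1" "norm w <= 1" for z w
  unfolding e_def using D that by(simp add: field_simps)
 have elip: "norm (e z - e w) <= 8 * si^2*norm (z - w)" if "norm z <= 1" "norm w <= 1" for z w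
 proof -
  have "D w - D z = cnj m * of_real (si^2)*(w - z)*(w + z)"
   by(simp add: D_def algebra_simps power2_eq_square)
  hence "norm (D w - D z) = norm m * si^2*norm (z - w)*norm (w + z)"
   by(simp add: norm_mult norm_minus_commute norm_power)
  also have "... <= 1 * si^2*norm (z - w)*2"
   using m1 that norm_triangle_ineq[of w z] by(intro mult_mono) auto
  finally have "norm (e z - e w) <= (1 * si^2*norm (z - w)*2)/(1/2*(1/2))"
   unfolding eD[OF that] norm_divide norm_mult using D that
   by(intro frac_le mult_mono) auto
  thus ?thesis by simp
 qed
 have en: "norm (e z) <= 8 * si^2" if "norm z <= 1" for z
 proof -
  have "norm (e z - e 0) <= 8 * si^2*norm (z - 0)" using elip[of z 0] that by simp
  also have "... <= 8 * si^2*1" using that by(intro mult_left_mono) auto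
  finally show ?thesis by(simp add: e_def D_def)
 qed
 have pert: "norm ((jouk m si z - jouk m si w) - (z - w)) <= (1 + k)/2*norm (z - w)"
  if zw: "norm z <= 1" "norm w <= 1" for z w
 proof -
  have h2: "norm (h z - h w) <= 2*norm (z - w)"
  proof -
   have "norm (h z - h w) <= k*norm (z - w) + norm (z - w)"
    using hdiff[of z w] norm_triangle_ineq[of "(h z - h w) - (z - w)" "z - w"] by simp
   also have "... <= 1*norm (z - w) + norm (z - w)" using m by(intro add_mono mult_right_mono) auto
   finally show ?thesis by simp
  qed
  have "h z*e z - h w*e w = (h z - h w)*e z + h w*(e z - e w)"
   by(simp add: algebra_simps)
  hence "norm (h z*e z - h w*e w) <= norm (h z - h w)*norm (e z) + norm (h w)*norm (e z - e w)"
   by(metis norm_triangle_ineq norm_mult)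
  also have "... <= (2*norm (z - w))*(8 * si^2) + 2*(8 * si^2*norm (z - w))"
   using h2 en elip hn zw by(intro add_mono mult_mono) auto
  also have "... = 32 * si^2*norm (z - w)" by simp
  also have "... <= (1 - k)/2*norm (z - w)"
  proof(intro mult_right_mono)
   show "32 * si^2 <= (1 - k)/2" using s(2) zero_le_power2[of si] by linarith
  qed auto
  finally have "norm (h z*e z - h w*e w) <= (1 - k)/2*norm (z - w)" .
  moreover have "(jouk m si z - jouk m si w) - (z - w) = ((h z - h w) - (z - w)) + (h z*e z - h w*e w)"
   by(simp add: J)
  ultimately have "norm ((jouk m si z - jouk m si w) - (z - w)) <= k*norm (z - w) + (1 - k)/2*norm (z - w)"
   using norm_triangle_le[OF add_mono[OF hdiff[of z w]]] by presburger
  thus ?thesis by(simp add: field_simps)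
 qed
 show ?thesis
 \<comment> \<open>On this annulus the outer branch is in force, and the term added to 1 in the
   denominator has modulus below \<open>1/40 * 2^2\<close>, so nothing vanishes.\<close>
 proof(rule disc_mapI[of "(1 - k)/2" _ 2 "{z. si < norm z} \<inter> {z. norm z < 2}"])
  fix z w :: complex assume zw: "norm z <= 1" "norm w <= 1"
  show "(1 - k)/2*cmod (z - w) <= cmod (jouk m si z - jouk m si w)"
   using pert[OF zw] norm_triangle_ineq2[of "z - w" "(z - w) - (jouk m si z - jouk m si w)"]
   by(simp add: norm_minus_commute field_simps)
  have "cmod (jouk m si z - jouk m si w) <= (1 + k)/2*norm (z - w) + norm (z - w)"
   using pert[OF zw] norm_triangle_ineq[of "(jouk m si z - jouk m si w) - (z - w)" "z - w"] by simp
  also have "... <= 1*norm (z - w) + norm (z - w)"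
   using m by(intro add_mono mult_right_mono) auto
  finally show "cmod (jouk m si z - jouk m si w) <= 2*cmod (z - w)" by simp
 next
  fix z :: complex assume z: "norm z = 1"
  have z0: "z ~= 0" using z by auto
  have "z*cnj z = 1" using z by(simp add: complex_norm_square[symmetric])
  hence zc: "cnj z = 1/z" using z0 by(simp add: eq_divide_eq mult.commute)
  have s1: "si < 1" using s40 s(1) abs_square_less_1[of si] by linarith
  have n: "norm (z + m * of_real (si^2)/z) = norm (D z)"
  proof -
   have "cnj (D z) = (z + m * of_real (si^2)/z)/z"
    unfolding D_def using z0 by(simp add: zc field_simps power2_eq_square)
   hence "norm (cnj (D z)) = norm ((z + m * of_real (si^2)/z)/z)" by(rule arg_cong)
   thus ?thesis using z by(simp only: complex_mod_cnj norm_divide div_by_1)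
  qed
  have "jouk m si z = (z + m * of_real (si^2)/z)/D z"
   using z s1 by(simp add: jouk_def joukq_def D_def)
  thus "norm (jouk m si z) = 1"
   using n D[of z] z by(simp add: norm_divide)
 next
  show "open ({z. si < cmod z} \<inter> {z. cmod z < 2})"
   by(intro open_Int open_Collect_less continuous_intros)
  have "si < 1" using s40 s(1) abs_square_less_1[of si] by linarith
  thus "sphere 0 1 \<subseteq> {z. si < cmod z} \<inter> {z. cmod z < 2}" by auto
  have "jouk m si holomorphic_on {z. si < cmod z} \<inter> {z. cmod z < 2} \<longleftrightarrow>
   (%z. (z + m * of_real (si^2)/z)/D z) holomorphic_on {z. si < cmod z} \<inter> {z. cmod z < 2}"
   by(rule holomorphic_cong) (auto simp: jouk_def joukq_def D_def)
  moreover have "(%z. (z + m * of_real (si^2)/z)/D z) holomorphic_on {z. si < cmod z} \<inter> {z. cmod z < 2}"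
  proof -
   have "D z ~= 0" if "norm z < 2" for z
   proof -
    have "norm (cnj m * of_real (si^2)*z^2) <= 1*(1/40)*2^2"
     unfolding norm_mult norm_power norm_of_real using m1 s40 that by(intro mult_mono power_mono) auto
    hence "norm (cnj m * of_real (si^2)*z^2) < 1" by simp
    hence "cnj m * of_real (si^2)*z^2 ~= - 1" by auto
    thus ?thesis unfolding D_def by(simp add: add_eq_0_iff)
   qed
   thus ?thesis unfolding D_def using s(1) by(intro holomorphic_intros) (auto simp: D_def)
  qed
  ultimately show "jouk m si holomorphic_on {z. si < cmod z} \<inter> {z. cmod z < 2}" by simp
 qed (use m in auto)
qed

lemma jouk_holomorphic:
 assumes "norm m < 1" "0 < s" "s^2 <= 1/40"
 shows "jouk m s holomorphic_on {z. s < norm z} \<inter> ball 0 1"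
proof -
 have "jouk m s holomorphic_on {z. s < cmod z} \<inter> ball 0 1 \<longleftrightarrow>
  (%z. (z + m * of_real (s^2)/z)/(1 + cnj m * of_real (s^2)*z^2)) holomorphic_on {z. s < cmod z} \<inter> ball 0 1"
  by(rule holomorphic_cong) (auto simp: jouk_def joukq_def)
 moreover have "1 + cnj m * of_real (s^2)*z^2 ~= 0" if "norm z < 1" for z
  using jouk_denom[OF assms, of z] that by force
 hence "(%z. (z + m * of_real (s^2)/z)/(1 + cnj m * of_real (s^2)*z^2)) holomorphic_on {z. s < cmod z} \<inter> ball 0 1"
  using assms(2) by(intro holomorphic_intros) auto
 ultimately show ?thesis by simp
qed

text \<open>The term \<open>t\<close> comes from differentiating the denominator; without it the
  dilatation would be exactly \<open>m\<close>. Here \<open>be - m*al = m*t\<close>, the modulus of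
  \<open>t\<close> is at most \<open>16*si^2\<close>, and that of \<open>al\<close> is at least
  \<open>1/2 - 2/5 = 1/10\<close>; this gives 160.\<close>

lemma jouk_has_derivative:
 assumes m: "norm m < 1" and s: "0 < si" "si^2 <= 1/40" and z: "norm z < si"
 obtains al be where "(jouk m si has_derivative (%w. al*w + be*cnj w)) (at z)"
  "norm (be - m*al) <= 160 * si^2*norm al" "al ~= 0"
proof -
 define D where "D z = 1 + cnj m * of_real (si^2)*z^2" for z
 have s1: "si < 1" using s abs_square_less_1[of si] by linarith
 have D: "1/2 <= norm (D z)" "norm (D z) <= 2" "D z ~= 0"
  using jouk_denom[OF m s, of z] z s1 by(auto simp: D_def)
 define t where "t = (z + m*cnj z)*(2*cnj m * of_real (si^2)*z)/(D z)^2"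
 define al be where "al = 1/D z - t" and "be = m/D z"
 have nt: "norm t <= 16 * si^2"
 proof -
  have a: "norm (z + m*cnj z) <= 2"
  proof -
   have "norm (m*cnj z) <= 1*1" unfolding norm_mult using m z s1 by(intro mult_mono) auto
   thus ?thesis using norm_triangle_ineq[of z "m*cnj z"] z s1 by linarith
  qed
  have b: "norm (2*cnj m * of_real (si^2)*z) <= 2*1 * si^2*1"
   unfolding norm_mult using m z s1 by(intro mult_mono) (auto simp: norm_power)
  have c: "(1/2)^2 <= norm ((D z)^2)" unfolding norm_power using D by(intro power_mono) auto
  have "norm t <= (2*(2*1 * si^2*1))/(1/2)^2"
   unfolding t_def norm_divide norm_mult[of "z + m*cnj z"]
   using a b c by(intro frac_le mult_mono) auto
  thus ?thesis by(simp add: power2_eq_square)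
 qed
 have "(jouk m si has_derivative (%w. al*w + be*cnj w)) (at z)"
 proof -
  have "((%z. (z + m*cnj z)/D z) has_derivative (%w. al*w + be*cnj w)) (at z)"
  proof -
   have D': "(D has_derivative (%w. 2*cnj m * of_real (si^2)*z*w)) (at z)"
    unfolding D_def by(auto intro!: derivative_eq_intros)
   have N': "((%z. z + m*cnj z) has_derivative (%w. w + m*cnj w)) (at z)"
    by(auto intro!: derivative_eq_intros)
   have alg: "- n*(inverse d*(c*w)*inverse d) + (w + m * v)/d = (1/d - n*c/d^2)*w + m/d * v"
    if "d ~= 0" for d n c w v :: complex
    using that by(simp add: field_simps power2_eq_square)
   show ?thesis
    using has_derivative_divide[OF N' D' D(3)] unfolding alg[OF D(3)] al_def be_def t_def .
  qed
  thus ?thesis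
   by(rule has_derivative_transform_within_open[of _ _ _ _ "ball 0 si"])
    (use z in \<open>auto simp: jouk_def joukq_def D_def\<close>)
 qed
 moreover have alb: "1/10 <= norm al"
 proof -
  have "1/2 <= norm (1/D z)" using D by(simp add: norm_divide field_simps)
  moreover have "norm t <= 2/5" using nt s by simp
  ultimately show ?thesis unfolding al_def using norm_triangle_ineq2[of "1/D z" t] by linarith
 qed
 moreover have "norm (be - m*al) <= 160 * si^2*norm al"
 proof -
  have "be - m*al = m*t" by(simp add: al_def be_def algebra_simps)
  moreover have "norm (m*t) <= 1*(16 * si^2)" unfolding norm_mult using m nt
   by(intro mult_mono) auto
  ultimately have "norm (be - m*al) <= 1*(16 * si^2)" by simp
  also have "... = 160 * si^2*(1/10)" by simp
  also have "... <= 160 * si^2*norm al" using alb by(intro mult_left_mono) auto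
  finally show ?thesis .
 qed
 ultimately show ?thesis by(intro that[of al be]) auto
qed

subsection \<open>Approximate solutions of the Beltrami equation\<close>

lemma univalent_omits_value:
 assumes hol: "f holomorphic_on ball 0 1" and inj: "inj_on f (ball 0 1)"
  and f0: "f 0 = 0" and d0: "deriv f 0 = 1"
 obtains w where "norm w <= 1" "w \<notin> f ` ball 0 1"
proof -
 \<comment> \<open>If the image contained the closed disc, the inverse \<open>g\<close> would map
   the open unit disc into itself with derivative 1 at 0. By the equality case of the Schwarz lemma
   it would be multiplication by some \<open>a\<close> of modulus 1. Then the preimage
   \<open>z\<close> of 1 is also the preimage of \<open>z/a\<close>, whose modulus is less than
   1.\<close>
 have False if all: "cball 0 1 \<subseteq> f ` ball 0 1"
 proof -
  obtain g where g: "g holomorphic_on (f ` ball 0 1)"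
   "!!z. z \<in> ball 0 1 ==> deriv f z*deriv g (f z) = 1"
   "!!z. z \<in> ball 0 1 ==> g (f z) = z"
   using holomorphic_has_inverse[OF hol open_ball inj] by metis
  have ga: "g holomorphic_on ball 0 1" using g(1) all
   by(meson ball_subset_cball holomorphic_on_subset subset_trans)
  have g0: "g 0 = 0" using g(3)[of 0] f0 by simp
  have gn: "norm (g z) < 1" if "norm z <= 1" for z
  proof -
   have "z \<in> f ` ball 0 1" using all that by auto
   thus ?thesis using g(3) by auto
  qed
  have dg: "deriv g 0 = 1" using g(2)[of 0] f0 d0 by simp
  obtain a where al: "!!z. norm z < 1 ==> g z = a*z" "norm a = 1"
   using Schwarz_Lemma(3)[of g 0, OF ga g0] gn dg by auto
  have "1 \<in> f ` ball 0 1" using all by(rule subsetD) simp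
  then obtain z where z: "norm z < 1" "f z = 1" by auto
  define w where "w = z/a"
  have w: "norm w < 1" using z al(2) by(simp add: w_def norm_divide)
  have "w \<in> f ` ball 0 1" using all w by auto
  then obtain y where y: "norm y < 1" "f y = w" by auto
  have "y = g w" using g(3)[of y] y by simp
  also have "... = z" using al w by(auto simp: w_def)
  finally have "w = 1" using y z by simp
  thus False using w by simp
 qed
 thus ?thesis using that by(auto simp: subset_iff)
qed

text \<open>A non-sharp growth theorem by way of Schottky. Since \<open>f\<close> omits a point
  \<open>w\<close> of the closed disc, \<open>1 - f/w\<close> has a holomorphic square root.
  Normalised suitably this root omits 0 and 1 and is -1 at the origin, so the constant
  \<open>K\<close> of Schottky's theorem for the radius 1/2 bounds it.\<close>

lemma univalent_bounded:
 obtains M where "M > 0"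
  "!!f z. [|f holomorphic_on ball 0 1; inj_on f (ball 0 1); f 0 = 0; deriv f 0 = 1; norm z <= 1/4|]
   ==> norm (f z) <= (M::real)"
proof -
 define K :: real where "K = exp (pi*exp (pi*(2 + 2*1 + 12*(1/2)/(1 - 1/2))))"
 have "norm (f z) <= 1 + K^2"
  if hol: "f holomorphic_on ball 0 1" and inj: "inj_on f (ball 0 1)"
  and f0: "f 0 = 0" and d0: "deriv f 0 = 1" and z: "norm z <= 1/4" for f z
 proof -
  obtain w where w: "norm w <= 1" "w \<notin> f ` ball 0 1"
   using univalent_omits_value[OF hol inj f0 d0] .
  have w0: "w ~= 0" using w(2) f0 by force
  define F where "F ze = 1 - f ze/w" for ze
  have F: "F holomorphic_on ball 0 1" unfolding F_def using hol w0 by(intro holomorphic_intros) auto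
  have F0: "F ze ~= 0" if "ze \<in> ball 0 1" for ze
  proof
   assume "F ze = 0"
   hence "f ze = w" using w0 by(simp add: F_def)
   thus False using w(2) that by blast
  qed
  obtain s where s: "s holomorphic_on ball 0 1" "!!ze. ze \<in> ball 0 1 ==> F ze = (s ze)^2"
   using contractible_imp_holomorphic_sqrt[OF F _ F0] convex_imp_contractible[OF convex_ball] by metis
  define c where "c = - s 0"
  have c2: "c^2 = 1" using s(2)[of 0] f0 by(simp add: F_def c_def)
  hence cc: "c*c = 1" "norm c = 1" 
   by(auto simp: power2_eq_square square_eq_1_iff)
  \<comment> \<open>Halving the argument gives holomorphy on the closed disc. The sign
    \<open>c\<close> makes \<open>G 0 = - 1\<close>, while \<open>G ze = 1\<close> would force
    \<open>f (ze/2) = 0\<close> and hence \<open>ze = 0\<close>.\<close>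
  define G where "G ze = c * s (ze/2)" for ze
  have half: "ze/2 \<in> ball 0 1" if "norm ze <= 1" for ze :: complex using that by(simp add: norm_divide)
  have "(%ze. ze/2) holomorphic_on cball (0::complex) 1" by(intro holomorphic_intros) auto
  hence "s \<circ> (%ze. ze/2) holomorphic_on cball 0 1"
   by(rule holomorphic_on_compose_gen[OF _ s(1)]) (use half in auto)
  hence "G holomorphic_on cball 0 1"
   unfolding G_def o_def by(intro holomorphic_on_mult holomorphic_on_const)
  moreover have "norm (G 0) <= 1"
  proof -
   have "G 0 = - (c*c)" by(simp add: G_def c_def)
   thus ?thesis using cc by simp
  qed
  moreover have "\<not> (G ze = 0 \<or> G ze = 1)" if "ze \<in> cball 0 1" for ze
  proof
   have b: "ze/2 \<in> ball 0 1" using half that by simp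
   have sq: "(G ze)^2 = F (ze/2)" using s(2)[OF b] c2 by(simp add: G_def power_mult_distrib)
   assume "G ze = 0 \<or> G ze = 1"
   thus False
   proof
    assume "G ze = 0" thus False using sq F0[OF b] by simp
   next
    assume g1: "G ze = 1"
    hence "f (ze/2) = 0" using sq w0 by(simp add: F_def)
    hence "ze/2 = 0" using inj f0 b by(metis inj_onD centre_in_ball zero_less_one)
    hence "G ze = - (c*c)" by(simp add: G_def c_def)
    thus False using g1 cc by simp
   qed
  qed
  ultimately have "norm (G (2*z)) <= K"
   unfolding K_def using Schottky[of G 1 "1/2" "2*z"] z by(simp add: norm_mult)
  hence "norm (s z) <= K" using cc by(simp add: G_def norm_mult)
  hence "(norm (s z))^2 <= K^2" by(intro power_mono) auto
  moreover have zb: "z \<in> ball 0 1" using z by simp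
  ultimately have "norm (F z) <= K^2" using s(2)[OF zb] by(simp add: norm_power)
  moreover have "f z = w*(1 - F z)" using w0 by(simp add: F_def)
  hence "norm (f z) = norm w*norm (1 - F z)" by(simp add: norm_mult)
  moreover have "norm (1 - F z) <= 1 + norm (F z)" using norm_triangle_ineq4[of 1 "F z"] by simp
  moreover have "norm w*norm (1 - F z) <= 1*norm (1 - F z)" using w(1) by(intro mult_right_mono) auto
  ultimately show ?thesis by linarith
 qed
 moreover have "1 + K^2 > 0" by(simp add: add_pos_nonneg)
 ultimately show ?thesis by(intro that[of "1 + K^2"]) blast+
qed

text \<open>The uniform bound on the disc of radius 1/4 and Cauchy's inequality on discs of radius
  1/8 control the second derivative.\<close>

lemma univalent_distortion:
 obtains C where "C > 0"
  "!!f z. [|f holomorphic_on ball 0 1; inj_on f (ball 0 1); f 0 = 0; deriv f 0 = 1; norm z <= 1/8|]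
   ==> norm (deriv f z - 1) <= (C::real)*norm z"
proof -
 obtain M :: real where M: "M > 0"
  "!!f z. [|f holomorphic_on ball 0 1; inj_on f (ball 0 1); f 0 = 0; deriv f 0 = 1; norm z <= 1/4|]
   ==> norm (f z) <= M"
  using univalent_bounded by blast
 define C where "C = 2*M/(1/8)^2"
 have "norm (deriv f z - 1) <= C*norm z"
  if hol: "f holomorphic_on ball 0 1" and inj: "inj_on f (ball 0 1)"
  and f0: "f 0 = 0" and d0: "deriv f 0 = 1" and z: "norm z <= 1/8" for f z
 proof -
  have "norm (deriv f z - deriv f 0) <= C*norm (z - 0)"
  proof(rule field_differentiable_bound[of "cball 0 (1/8)" _ "deriv (deriv f)"])
   fix w :: complex assume ze: "w \<in> cball 0 (1/8)"
   have "deriv f holomorphic_on ball 0 1" using hol open_ball by(rule holomorphic_deriv)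
   moreover have "w \<in> ball 0 1" using ze by auto
   ultimately have "(deriv f has_field_derivative deriv (deriv f) w) (at w)"
    by(rule holomorphic_derivI[OF _ open_ball])
   thus "(deriv f has_field_derivative deriv (deriv f) w) (at w within cball 0 (1/8))"
    by(rule has_field_derivative_at_within)
   have sub: "cball w (1/8) \<subseteq> cball 0 (1/4)"
   proof
    fix x assume "x \<in> cball w (1/8)"
    hence "norm (x - w) <= 1/8" by(simp add: dist_norm norm_minus_commute)
    thus "x \<in> cball 0 (1/4)" using norm_triangle_sub[of x w] ze by simp
   qed
   hence sub1: "cball w (1/8) \<subseteq> ball 0 1"
    by(rule subset_trans) (simp add: cball_subset_ball_iff)
   have "norm ((deriv ^^ 2) f w) <= fact 2*M/(1/8)^2"
   proof(rule Cauchy_inequality)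
    show "f holomorphic_on ball w (1/8)" "continuous_on (cball w (1/8)) f"
     using holomorphic_on_subset[OF hol sub1]
     by(auto intro: holomorphic_on_subset[OF _ ball_subset_cball] holomorphic_on_imp_continuous_on)
    fix x assume "norm (w - x) = 1/8"
    hence "x \<in> cball w (1/8)" by(simp add: dist_norm)
    thus "norm (f x) <= M" using sub M(2)[OF hol inj f0 d0, of x] by auto
   qed auto
   thus "norm (deriv (deriv f) w) <= C"
    by(simp add: C_def numeral_2_eq_2)
  qed (use z in auto)
  thus ?thesis using d0 by simp
 qed
 moreover have "C > 0" using M by(simp add: C_def)
 ultimately show ?thesis by(intro that[of C]) blast+
qed

text \<open>The number \<open>d\<close> depends on \<open>h\<close> alone: moving \<open>p\<close>
  to 0, scaling by \<open>r\<close> and dividing by \<open>r * deriv g p\<close> turns every such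
  \<open>g\<close> into a normalised univalent function. This uniformity is the source of the fixed
  proportion in \<open>qc_step\<close>.\<close>

lemma univalent_near_linear:
 fixes h :: real
 assumes h: "0 < h" "h <= 1/4"
 obtains d where "0 < d" "d <= 1/16"
  "!!g p r z. [|0 < r; g holomorphic_on ball p r; inj_on g (ball p r); g p = 0; norm (z - p) <= 2*d*r|]
   ==> norm (deriv g z - deriv g p) <= h*norm (deriv g p)"
  "!!g p r w. [|0 < r; g holomorphic_on ball p r; inj_on g (ball p r); g p = 0; norm w <= d*r*norm (deriv g p)|]
   ==> \<exists>z\<in>cball p (2*d*r). g z = w"
  "!!g p r z. [|0 < r; g holomorphic_on ball p r; inj_on g (ball p r); g p = 0; norm (z - p) <= d*r/2|]
   ==> norm (g z) <= d*r*norm (deriv g p)"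
proof -
 obtain C :: real where C: "C > 0"
  "!!f z. [|f holomorphic_on ball 0 1; inj_on f (ball 0 1); f 0 = 0; deriv f 0 = 1; norm z <= 1/8|]
   ==> norm (deriv f z - 1) <= C*norm z"
  using univalent_distortion by blast
 \<comment> \<open>The first bound keeps \<open>2*d\<close> within the radius 1/8 of the distortion
   estimate, the second turns \<open>C*norm z\<close> into at most \<open>h\<close>.\<close>
 define d where "d = min (1/16) (h/(2*C))"
 have d: "0 < d" "d <= 1/16" "C*(2*d) <= h"
  using C(1) h by(auto simp: d_def min_def field_simps)
 have main: "(\<forall>z. norm (z - p) <= 2*d*r --> norm (deriv g z - deriv g p) <= h*norm (deriv g p)) \<and>
  (\<forall>w. norm w <= d*r*norm (deriv g p) --> (\<exists>z\<in>cball p (2*d*r). g z = w)) \<and>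
  (\<forall>z. norm (z - p) <= d*r/2 --> norm (g z) <= d*r*norm (deriv g p))"
  if r: "0 < r" and hol: "g holomorphic_on ball p r" and inj: "inj_on g (ball p r)" and gp: "g p = 0" for g p r
 proof -
  define l where "l = deriv g p"
  have l0: "l ~= 0" unfolding l_def
   using holomorphic_injective_imp_regular[OF hol open_ball inj] r by auto
  define f where "f ze = g (p + of_real r*ze)/(of_real r*l)" for ze
  have inb: "p + of_real r*ze \<in> ball p r" if "norm ze < 1" for ze
   using that r by(simp add: dist_norm norm_mult)
  have fd: "(f has_field_derivative deriv g (p + of_real r*ze)/l) (at ze)" if "norm ze < 1" for ze
  proof -
   have "(g has_field_derivative deriv g (p + of_real r*ze)) (at (p + of_real r*ze))"
    by(rule holomorphic_derivI[OF hol open_ball inb[OF that]])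
   hence "((%ze. g (p + of_real r*ze)) has_field_derivative deriv g (p + of_real r*ze) * of_real r) (at ze)"
    by(rule DERIV_chain2) (auto intro!: derivative_eq_intros)
   hence "(f has_field_derivative deriv g (p + of_real r*ze) * of_real r/(of_real r*l)) (at ze)"
    unfolding f_def by(rule DERIV_cdivide)
   thus ?thesis using r by(simp add: mult.commute)
  qed
  have dfe: "deriv f ze = deriv g (p + of_real r*ze)/l" if "norm ze < 1" for ze
   using fd[OF that] by(rule DERIV_imp_deriv)
  have fhol: "f holomorphic_on ball 0 1"
   unfolding holomorphic_on_open[OF open_ball] using fd mem_ball_0 by metis
  have finj: "inj_on f (ball 0 1)"
  proof(rule inj_onI)
   fix x y :: complex assume xy: "x \<in> ball 0 1" "y \<in> ball 0 1" "f x = f y"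
   hence "g (p + of_real r*x) = g (p + of_real r*y)" using r l0 by(simp add: f_def)
   hence "p + of_real r*x = p + of_real r*y"
    using inj_onD[OF inj] inb xy by(metis mem_ball_0)
   thus "x = y" using r by simp
  qed
  have f0: "f 0 = 0" using gp by(simp add: f_def)
  have df0: "deriv f 0 = 1" using dfe[of 0] l0 by(simp add: l_def)
  have dist: "norm (deriv f ze - 1) <= h" if "norm ze <= 2*d" for ze
  proof -
   have "norm (deriv f ze - 1) <= C*norm ze"
    using C(2)[OF fhol finj f0 df0, of ze] that d(2) by linarith
   also have "... <= C*(2*d)" using C(1) that by(intro mult_left_mono) auto
   finally show ?thesis using d(3) by linarith
  qed
  have lin: "norm ((f x - x) - (f y - y)) <= 1/4*norm (x - y)" if "norm x <= 2*d" "norm y <= 2*d" for x y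
  proof(rule field_differentiable_bound[of "cball 0 (2*d)" "%x. f x - x" "%x. deriv f x - 1"])
   fix z :: complex assume z: "z \<in> cball 0 (2*d)"
   hence "norm z < 1" using d(2) by simp
   hence "(f has_field_derivative deriv f z) (at z)" using fd dfe by simp
   hence "((%x. f x - x) has_field_derivative deriv f z - 1) (at z)"
    by(auto intro!: derivative_eq_intros)
   thus "((%x. f x - x) has_field_derivative deriv f z - 1) (at z within cball 0 (2*d))"
    by(rule has_field_derivative_at_within)
   show "norm (deriv f z - 1) <= 1/4" using dist[of z] z h by simp
  qed (use that in auto)
  have geq: "g z = of_real r*l*f ((z - p) / of_real r)" for z
   using r l0 by(simp add: f_def)
  have div: "norm ((z - p) / of_real r) <= c" if "norm (z - p) <= c*r" for z c
   using that r by(simp add: norm_divide pos_divide_le_eq)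
  show ?thesis unfolding l_def[symmetric]
  proof(intro conjI allI impI)
   fix z assume z: "norm (z - p) <= 2*d*r"
   hence n: "norm ((z - p) / of_real r) <= 2*d" by(rule div)
   hence "norm ((z - p) / of_real r) < 1" using d by linarith
   hence "deriv f ((z - p) / of_real r) = deriv g z/l" using dfe r by simp
   hence "norm (deriv g z/l - 1) <= h" using dist[OF n] by simp
   moreover have "deriv g z - l = l*(deriv g z/l - 1)" using l0 by(simp add: algebra_simps)
   hence "norm (deriv g z - l) = norm (deriv g z/l - 1)*norm l"
    by(simp only: norm_mult mult.commute)
   ultimately show "norm (deriv g z - l) <= h*norm l"
    by(simp add: mult_right_mono)
  next
   fix w :: complex assume w: "norm w <= d*r*norm l"
   define v where "v = w/(of_real r*l)"
   have v: "norm v <= d" using w r l0 by(simp add: v_def norm_divide norm_mult pos_divide_le_eq mult.assoc)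
   \<comment> \<open>Solving \<open>f x = v\<close> as a fixed point problem: \<open>f x - x\<close>
     is Lipschitz with constant 1/4, and \<open>d + 2*d/4\<close> is below \<open>2*d\<close>, so
     the ball is mapped into itself.\<close>
   have "\<exists>!x. x \<in> cball 0 (2*d) \<and> v - (f x - x) = x"
   proof(rule Banach_fix[of _ "1/4"])
    show "(%x. v - (f x - x)) ` cball 0 (2*d) \<subseteq> cball 0 (2*d)"
    proof clarsimp
     fix x :: complex assume x: "norm x <= 2*d"
     have "norm (f x - x) <= 1/4*norm x" using lin[of x 0] x d f0 by simp
     thus "norm (v - (f x - x)) <= 2*d"
      using norm_triangle_ineq4[of v "f x - x"] x v d(1) by linarith
    qed
    fix x y :: complex assume xy: "x \<in> cball 0 (2*d)" "y \<in> cball 0 (2*d)"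
    have "dist (v - (f x - x)) (v - (f y - y)) = norm ((f x - x) - (f y - y))"
     by(simp add: dist_norm norm_minus_commute algebra_simps)
    thus "dist (v - (f x - x)) (v - (f y - y)) <= 1/4*dist x y"
     using lin[of x y] xy by(simp add: dist_norm)
   qed (use d in \<open>auto simp: complete_eq_closed\<close>)
   then obtain x where x: "norm x <= 2*d" "v - (f x - x) = x" by auto
   hence fx: "f x = v" by simp
   show "\<exists>z\<in>cball p (2*d*r). g z = w"
   proof(intro bexI)
    show "g (p + of_real r*x) = w" unfolding geq using r l0 fx by(simp add: v_def)
    show "p + of_real r*x \<in> cball p (2*d*r)"
     using x r mult_right_mono[OF x(1), of r] by(simp add: dist_norm norm_mult mult.commute)
   qed
  next
   fix z assume z: "norm (z - p) <= d*r/2"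
   have n: "norm ((z - p) / of_real r) <= d/2" using div[of z "d/2"] z by simp
   let ?x = "(z - p) / of_real r"
   have "norm (f ?x - ?x) <= 1/4*norm ?x" using lin[of ?x 0] n d f0 by simp
   hence "norm (f ?x) <= d" using norm_triangle_sub[of "f ?x" ?x] n d by linarith
   hence "r*norm l*norm (f ?x) <= r*norm l*d" using r by(intro mult_left_mono) auto
   thus "norm (g z) <= d*r*norm l"
    unfolding geq[of z] using r by(simp add: norm_mult mult.commute mult.left_commute)
  qed
 qed
 show ?thesis
  by(rule that[OF d(1,2)]) (use main in blast)+
qed

text \<open>The set \<open>U\<close> is what remains to be treated, and \<open>F\<close> is still
  conformal there. Elsewhere the Beltrami coefficient \<open>b/a\<close> is within \<open>e\<close>
  of \<open>m\<close>, almost everywhere; the inequality is written without division.\<close>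

definition qc_state :: "(complex => complex) => real => (complex => complex) => complex set => bool" where
 "qc_state m e F U \<longleftrightarrow> disc_map F \<and> open U \<and> U \<subseteq> ball 0 1 \<and> F holomorphic_on U \<and>
  (\<exists>Z. negligible Z \<and> (\<forall>z\<in>ball 0 1 - U - Z. \<exists>a b.
    (F has_derivative (%w. a*w + b*cnj w)) (at z) \<and> a ~= 0 \<and>
    norm (b - m z*a) <= e*norm a))"

section \<open>Complex derivatives and dilatations under holomorphic composition\<close>

lemma has_derivative_holomorphic_compose:
 assumes F: "(F has_derivative (%w. a*w + b*cnj w)) (at z)"
  and G: "(G has_field_derivative c) (at (F z))"
 shows "((%z. G (F z)) has_derivative (%w. (c*a)*w + (c*b)*cnj w)) (at z)"
proof -
 have "(G has_derivative (%w. c*w)) (at (F z))"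
  using G unfolding has_field_derivative_def .
 hence "(G \<circ> F has_derivative (%w. c*w) \<circ> (%w. a*w + b*cnj w)) (at z)"
  by(rule diff_chain_at[OF F])
 thus ?thesis by(simp add: o_def algebra_simps)
qed

lemma has_derivative_compose_holomorphic:
 assumes F: "(F has_derivative (%w. a*w + b*cnj w)) (at (G z))"
  and G: "(G has_field_derivative c) (at z)"
 shows "((%z. F (G z)) has_derivative (%w. (a*c)*w + (b*cnj c)*cnj w)) (at z)"
proof -
 have "(G has_derivative (%w. c*w)) (at z)"
  using G unfolding has_field_derivative_def .
 hence "(F \<circ> G has_derivative (%w. a*w + b*cnj w) \<circ> (%w. c*w)) (at z)"
  using F by(rule diff_chain_at)
 thus ?thesis by(simp add: o_def algebra_simps)
qed

text \<open>Composing with a conformal map of derivative \<open>c\<close> on the right multiplies a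
  dilatation by \<open>cnj c/c\<close>. If \<open>c\<close> is close to \<open>l\<close>, starting
  from \<open>m*(l/cnj l)\<close> therefore gives back nearly \<open>m\<close>. The factor 4 is 2
  for the two occurrences of \<open>c - l\<close> times 2 for
  \<open>norm l \<le> 2*norm c\<close>.\<close>

lemma dilatation_phase:
 fixes l c m n :: complex
 assumes l: "l ~= 0" and g: "norm (c - l) <= h*norm l" "0 < h" "h <= 1/4"
  and mm: "norm m <= 1" and nu: "norm (m - n) <= e"
 shows "norm (m*(l/cnj l)*cnj c - n*c) <= (4*h + e)*norm c" "c ~= 0"
proof -
 have gl: "norm l <= 2*norm c"
 proof -
  have "norm l <= norm c + norm (l - c)" by(rule norm_triangle_sub)
  also have "norm (l - c) <= 1/4*norm l"
   using g mult_right_mono[of h "1/4" "norm l"] by(simp add: norm_minus_commute)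
  finally show ?thesis using norm_ge_zero[of c] by linarith
 qed
 thus "c ~= 0" using l by auto
 have "(l/cnj l)*cnj c - c = (l/cnj l)*cnj (c - l) - (c - l)"
  using l by(simp add: algebra_simps)
 moreover have nl: "norm (l/cnj l) = 1" using l by(simp add: norm_divide)
 ultimately have "norm ((l/cnj l)*cnj c - c) <= norm (c - l) + norm (c - l)"
  using norm_triangle_ineq4[of "(l/cnj l)*cnj (c - l)" "c - l"]
  by(simp only: norm_mult complex_mod_cnj mult_1)
 also have "... <= 2*(h*norm l)" using g by simp
 also have "... <= 2*(h*(2*norm c))" using gl g by(intro mult_left_mono) auto
 finally have 1: "norm ((l/cnj l)*cnj c - c) <= 4*h*norm c" by simp
 have "m*(l/cnj l)*cnj c - n*c = m*((l/cnj l)*cnj c - c) + (m - n)*c"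
  by(simp add: algebra_simps)
 hence "norm (m*(l/cnj l)*cnj c - n*c) <=
   norm m*norm ((l/cnj l)*cnj c - c) + norm (m - n)*norm c"
  by(metis norm_triangle_ineq norm_mult)
 also have "... <= 1*(4*h*norm c) + e*norm c"
  using 1 mm nu by(intro add_mono mult_mono mult_right_mono) auto
 finally show "norm (m*(l/cnj l)*cnj c - n*c) <= (4*h + e)*norm c"
  by(simp add: algebra_simps)
qed

lemma disc_map_deriv_nonzero:
 assumes F: "disc_map F" and z: "norm z < 1" and d: "(F has_field_derivative c) (at z)"
 shows "c ~= 0"
proof
 assume "c = 0"
 obtain l L where l: "0 < l" "!!z w. norm z <= 1 ==> norm w <= 1 ==> l*norm (z - w) <= norm (F z - F w)"
  using disc_map_bilipschitz[OF F] by metis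
 have "((%w. (F w - F z)/(w - z)) \<longlongrightarrow> 0) (at z)"
  using d \<open>c = 0\<close> by(simp add: has_field_derivative_iff)
 hence "eventually (%w. norm ((F w - F z)/(w - z)) < l) (at z)"
  using l(1) by(simp add: tendsto_iff dist_norm)
 moreover have "eventually (%w. w \<in> ball 0 1 \<and> w ~= z) (at z)"
  using z by(auto simp: eventually_at_topological intro!: exI[of _ "ball 0 1"])
 ultimately have "eventually (%w. False) (at z)"
 proof eventually_elim
  case (elim w)
  hence "norm w <= 1" "norm z <= 1" "norm (w - z) > 0" using z by auto
  thus False using l(2)[of w z] elim by(simp add: norm_divide pos_divide_less_eq)
 qed
 thus False by(simp add: trivial_limit_at)
qed

text \<open>After a Moebius map sends \<open>F p\<close> to 0, the map is nearly linear on a small ball about \<open>p\<close>; composing it with the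
Joukowski-type map whose dilatation matches the coefficient at \<open>p\<close> settles a fixed proportion of the ball and stays conformal off the compact set \<open>S\<close>.\<close>

lemma qc_step:
 assumes k: "0 <= k" "k < 1" and e: "0 < e" "e <= 1"
  and mk: "!!z. norm (mu z) <= k"
 shows "\<exists>c>0. c <= 1 \<and> (\<forall>F U p r. qc_state mu e F U --> 0 < r --> ball p r \<subseteq> U -->
   (\<forall>z\<in>ball p r. norm (mu p - mu z) <= e/4) -->
   (\<exists>F' S. compact S \<and> S \<subseteq> ball p r \<and> ball p (c*r) \<subseteq> S \<and> qc_state mu e F' (U - S)))"
proof -
 have eta: "0 < e/16" "e/16 <= 1/4" using e by auto
 obtain d0 where d0: "0 < d0" "d0 <= 1/16"
  and Nd: "!!g p r z. [|0 < r; g holomorphic_on ball p r; inj_on g (ball p r); g p = 0; norm (z - p) <= 2*d0*r|]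
   ==> norm (deriv g z - deriv g p) <= e/16*norm (deriv g p)"
  and Ns: "!!g p r w. [|0 < r; g holomorphic_on ball p r; inj_on g (ball p r); g p = 0; norm w <= d0*r*norm (deriv g p)|]
   ==> \<exists>z\<in>cball p (2*d0*r). g z = w"
  and Nn: "!!g p r z. [|0 < r; g holomorphic_on ball p r; inj_on g (ball p r); g p = 0; norm (z - p) <= d0*r/2|]
   ==> norm (g z) <= d0*r*norm (deriv g p)"
  using univalent_near_linear[OF eta] by blast
 \<comment> \<open>the radius of the inner disc must also be small for the Joukowski map\<close>
 define q where "q = min 1 (min ((1 - k)/80) (e/640))"
 have q: "0 < q" "q <= 1" "q <= (1 - k)/80" "q <= e/640"
  using k e unfolding q_def by(simp_all only: min_less_iff_conj min.bounded_iff min.cobounded1 min.coboundedI2 min.cobounded2) auto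
 have main: "\<exists>F' S. compact S \<and> S \<subseteq> ball p r0 \<and> ball p (q*d0/2*r0) \<subseteq> S \<and> qc_state mu e F' (U - S)"
  if st: "qc_state mu e F U" and r0: "0 < r0" and sub: "ball p r0 \<subseteq> U"
   and near: "!!z. z \<in> ball p r0 ==> norm (mu p - mu z) <= e/4" for F U p r0
 proof -
  obtain Z where dm: "disc_map F" and U: "open U" "U \<subseteq> ball 0 1" "F holomorphic_on U"
   and Z: "negligible Z" "!!z. z \<in> ball 0 1 - U - Z ==> \<exists>al b.
    (F has_derivative (%w. al*w + b*cnj w)) (at z) \<and> al ~= 0 \<and>
    norm (b - mu z*al) <= e*norm al"
   using st unfolding qc_state_def by blast
  \<comment> \<open>This shrinking makes the radius \<open>s\<close> of the inner disc at most
    \<open>q\<close>, because \<open>r0*norm l\<close> is at most 1 by the Schwarz lemma.\<close>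
  define r where "r = q*r0"
  have r: "0 < r" "r <= r0" using q r0 by(auto simp: r_def)
  have pU: "p \<in> U" using sub r0 by auto
  have Fb: "norm (F z) < 1" if "norm z < 1" for z using disc_map_norm[OF dm, of z] that by simp
  define a where "a = F p"
  have a: "norm a < 1" "norm (- a) < 1" using Fb[of p] pU U by(auto simp: a_def)
  define g where "g z = moeb a (F z)" for z
  have dg: "disc_map g" unfolding g_def by(rule disc_map_compose[OF dm disc_map_moeb[OF a(1)]])
  have gb: "norm (g z) < 1" if "norm z < 1" for z using disc_map_norm[OF dg, of z] that by simp
  have ghol: "g holomorphic_on U"
  proof -
   have "moeb a \<circ> F holomorphic_on U"
    by(rule holomorphic_on_compose_gen[OF U(3) moeb_holomorphic[OF a(1)]]) (use Fb U(2) in auto)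
   thus ?thesis by(simp add: g_def[abs_def] o_def)
  qed
  have ginj: "inj_on g (ball p r0)"
   by(rule inj_on_subset[OF disc_map_inj[OF dg]]) (use sub U(2) ball_subset_cball in blast)
  have gp: "g p = 0" by(simp add: g_def a_def moeb_def)
  have g0: "g holomorphic_on ball p r0" using ghol sub by(rule holomorphic_on_subset)
  have sr: "ball p r \<subseteq> ball p r0" using r by auto
  have g1: "g holomorphic_on ball p r" using g0 sr by(rule holomorphic_on_subset)
  have ginj1: "inj_on g (ball p r)" using ginj sr by(rule inj_on_subset)
  define l where "l = deriv g p"
  have l0: "l ~= 0" unfolding l_def
   using holomorphic_injective_imp_regular[OF g0 open_ball ginj] r0 by auto
  have gder: "(g has_field_derivative deriv g z) (at z)" if "z \<in> U" for z
   by(rule holomorphic_derivI[OF ghol U(1) that])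
  have rl: "r0*norm l <= 1"
  proof -
   define h where "h ze = g (p + of_real r0*ze)" for ze
   have inb: "p + of_real r0*ze \<in> ball p r0" if "norm ze < 1" for ze
    using that r0 by(simp add: dist_norm norm_mult)
   have hd: "(h has_field_derivative deriv g (p + of_real r0*ze) * of_real r0) (at ze)" if "norm ze < 1" for ze
    unfolding h_def by(rule DERIV_chain2[OF gder]) (use inb[OF that] sub in \<open>auto intro!: derivative_eq_intros\<close>)
   have "h holomorphic_on ball 0 1"
    unfolding holomorphic_on_open[OF open_ball] using hd mem_ball_0 by metis
   moreover have "norm (h ze) < 1" if "norm ze < 1" for ze
   proof -
    have "p + of_real r0*ze \<in> ball 0 1" using inb[OF that] sub U(2) by blast
    thus ?thesis unfolding h_def using gb by simp
   qed
   ultimately have "norm (deriv h 0) <= 1"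
    using Schwarz_Lemma(2)[of h 0] gp by(simp add: h_def)
   moreover have "deriv h 0 = l * of_real r0" using DERIV_imp_deriv[OF hd[of 0]] by(simp add: l_def)
   ultimately show ?thesis using r0 by(simp add: norm_mult mult.commute)
  qed
  define s where "s = d0*r*norm l"
  have s: "0 < s" "s <= q"
  proof -
   show "0 < s" using d0 r l0 by(simp add: s_def)
   have "s = q*(d0*(r0*norm l))" by(simp add: s_def r_def)
   also have "... <= q*(1*1)" using q d0 rl r0 by(intro mult_left_mono mult_mono) auto
   finally show "s <= q" by simp
  qed
  have s2: "s^2 <= q"
  proof -
   have "s * s <= q*1" using s q by(intro mult_mono) auto
   thus ?thesis by(simp add: power2_eq_square)
  qed
  have s40: "s^2 <= 1/40" and s80: "s^2 <= (1 - k)/80" and s640: "160 * s^2 <= e/4"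
   using s2 q(3,4) k by auto
  define S where "S = {z \<in> cball p (2*d0*r). norm (g z) <= s}"
  have rr: "2*d0*r < r0"
  proof -
   have "2*d0*r <= 2*(1/16)*r" using d0 r by(intro mult_right_mono) auto
   thus ?thesis using r by linarith
  qed
  have Sb: "cball p (2*d0*r) \<subseteq> ball p r0" using rr by auto
  have Ssub: "S \<subseteq> ball p r0" using Sb by(auto simp: S_def)
  \<comment> \<open>Although \<open>S\<close> is cut out of a small ball, it is the whole preimage
    of the closed disc of radius \<open>s\<close>: the small ball already covers that disc, and
    \<open>g\<close> is injective on the entire disc. So the Joukowski-type map acts conformally on
    everything off \<open>S\<close>.\<close>
  have Sall: "z \<in> S" if z: "norm z < 1" "norm (g z) <= s" for z
  proof -
   obtain y where y: "y \<in> cball p (2*d0*r)" "g y = g z"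
    using Ns[OF r(1) g1 ginj1 gp, of "g z"] z by(auto simp: s_def l_def)
   have "y \<in> cball 0 1" using y(1) Sb sub U(2) ball_subset_cball by blast
   hence "y = z" using inj_onD[OF disc_map_inj[OF dg] y(2)] z by simp
   thus ?thesis using y z by(simp add: S_def)
  qed
  have Scpt: "compact S"
  proof -
   have "continuous_on (cball p (2*d0*r)) (%z. norm (g z))"
    by(intro continuous_on_norm continuous_on_subset[OF disc_map_continuous[OF dg]])
     (use Sb sub U(2) ball_subset_cball in blast)
   hence "closed (cball p (2*d0*r) \<inter> (%z. norm (g z)) -` {..s})"
    by(intro continuous_closed_preimage) auto
   moreover have "S = cball p (2*d0*r) \<inter> (%z. norm (g z)) -` {..s}" by(auto simp: S_def)
   ultimately show ?thesis using compact_Int_closed[OF compact_cball, of _ p "2*d0*r"] 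
    by(metis inf.left_idem)
  qed
  have Sball: "ball p (q*d0/2*r0) \<subseteq> S"
  proof
   fix z assume "z \<in> ball p (q*d0/2*r0)"
   hence z: "norm (z - p) <= d0*r/2" by(simp add: dist_norm norm_minus_commute r_def mult_ac)
   have "norm (g z) <= s" unfolding s_def l_def by(rule Nn[OF r(1) g1 ginj1 gp z])
   moreover have "d0*r/2 <= 2*d0*r" using d0 r by simp
   ultimately show "z \<in> S" using z by(simp add: S_def dist_norm norm_minus_commute)
  qed
  \<comment> \<open>The phase that precomposition with \<open>g\<close>, of derivative about
    \<open>l\<close>, is going to undo.\<close>
  define m where "m = mu p*(l/cnj l)"
  have mn: "norm m <= k" using mk[of p] l0 by(simp add: m_def norm_mult norm_divide)
  hence m1: "norm m < 1" using k by simp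
  define J where "J = jouk m s"
  have dJ: "disc_map J" unfolding J_def by(rule disc_map_jouk[OF mn k(2) s(1) s80])
  have Jb: "norm (J z) < 1" if "norm z < 1" for z using disc_map_norm[OF dJ, of z] that by simp
  define B where "B = moeb (- a)"
  have dB: "disc_map B" unfolding B_def by(rule disc_map_moeb[OF a(2)])
  have Bhol: "B holomorphic_on ball 0 1" unfolding B_def by(rule moeb_holomorphic[OF a(2)])
  have JBhol: "(%z. B (J z)) holomorphic_on {z. s < norm z} \<inter> ball 0 1"
  proof -
   have "B \<circ> J holomorphic_on {z. s < norm z} \<inter> ball 0 1"
    unfolding J_def
    by(rule holomorphic_on_compose_gen[OF jouk_holomorphic[OF m1 s(1) s40] Bhol])
     (use Jb in \<open>auto simp: J_def\<close>)
   thus ?thesis by(simp add: o_def)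
  qed
  define F' where "F' z = B (J (g z))" for z
  have dF': "disc_map F'" unfolding F'_def
   by(rule disc_map_compose[OF disc_map_compose[OF dg dJ] dB])
  have hol': "F' holomorphic_on U - S"
  proof -
   have "(%z. B (J z)) \<circ> g holomorphic_on U - S"
    by(rule holomorphic_on_compose_gen[OF holomorphic_on_subset[OF ghol] JBhol])
     (use Sall gb U(2) in \<open>auto simp: subset_iff not_le[symmetric]\<close>)
   thus ?thesis by(simp add: F'_def[abs_def] o_def)
  qed
  define Z' where "Z' = Z \<union> {z \<in> cball 0 1. g z \<in> sphere 0 s}"
  have Z': "negligible Z'" unfolding Z'_def
   by(intro negligible_Un Z disc_map_negligible_vimage[OF dg] negligible_sphere)
  have der': "\<exists>al b. (F' has_derivative (%w. al*w + b*cnj w)) (at z) \<and> al ~= 0 \<and>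
    norm (b - mu z*al) <= e*norm al" if z: "z \<in> ball 0 1 - (U - S) - Z'" for z
  proof(cases "z \<in> S")
   case True
   have zb: "z \<in> ball p r0" using True Ssub by auto
   hence zU: "z \<in> U" using sub by auto
   have z1: "norm z < 1" using z by simp
   have "norm (g z) ~= s" using z z1 by(auto simp: Z'_def)
   hence gz: "norm (g z) < s" using True by(auto simp: S_def)
   obtain al b where ab: "(J has_derivative (%w. al*w + b*cnj w)) (at (g z))"
    "norm (b - m*al) <= 160 * s^2*norm al" "al ~= 0"
    using jouk_has_derivative[OF m1 s(1) s40 gz] unfolding J_def by metis
   define ga where "ga = deriv g z"
   have "norm (z - p) <= 2*d0*r" using True by(simp add: S_def dist_norm norm_minus_commute)
   hence gl: "norm (ga - l) <= e/16*norm l"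
    unfolding ga_def l_def by(rule Nd[OF r(1) g1 ginj1 gp])
   have mp: "norm (mu p) <= 1" using mk[of p] k by simp
   note ph = dilatation_phase[OF l0 gl eta mp near[OF zb]]
   have JgD: "((%z. J (g z)) has_derivative (%w. (al*ga)*w + (b*cnj ga)*cnj w)) (at z)"
    using has_derivative_compose_holomorphic[OF ab(1) gder[OF zU]] unfolding ga_def .
   have Jg1: "norm (J (g z)) < 1" using Jb gb z1 by simp
   define c where "c = deriv B (J (g z))"
   have Bd: "(B has_field_derivative c) (at (J (g z)))"
    unfolding c_def by(rule holomorphic_derivI[OF Bhol open_ball]) (use Jg1 in simp)
   have c0: "c ~= 0" by(rule disc_map_deriv_nonzero[OF dB Jg1 Bd])
   have D: "(F' has_derivative (%w. (c*(al*ga))*w + (c*(b*cnj ga))*cnj w)) (at z)"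
    unfolding F'_def by(rule has_derivative_holomorphic_compose[OF JgD Bd])
   have "c*(b*cnj ga) - mu z*(c*(al*ga)) = c*((b - m*al)*cnj ga + al*(m*cnj ga - mu z*ga))"
    by(simp add: algebra_simps)
   hence "norm (c*(b*cnj ga) - mu z*(c*(al*ga))) =
     norm c*norm ((b - m*al)*cnj ga + al*(m*cnj ga - mu z*ga))"
    by(simp only: norm_mult)
   also have "... <= norm c*(norm (b - m*al)*norm ga + norm al*norm (m*cnj ga - mu z*ga))"
    by(intro mult_left_mono order_trans[OF norm_triangle_ineq]) (auto simp: norm_mult)
   \<comment> \<open>Three errors of size \<open>e/4\<close> each: the Joukowski denominator, the
     change of phase \<open>4*(e/16)\<close>, and the oscillation of \<open>mu\<close> on the
     ball.\<close>
   also have "... <= norm c*((e/4*norm al)*norm ga + norm al*((4*(e/16) + e/4)*norm ga))"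
   proof(intro mult_left_mono add_mono mult_right_mono)
    show "norm (b - m*al) <= e/4*norm al"
     using ab(2) mult_right_mono[OF s640, of "norm al"] by simp
    show "norm (m*cnj ga - mu z*ga) <= (4*(e/16) + e/4)*norm ga"
     using ph(1) unfolding m_def .
   qed auto
   also have "... = 3/4*e*(norm c*norm al*norm ga)" by(simp add: algebra_simps)
   also have "... <= e*(norm c*norm al*norm ga)" using e by(intro mult_right_mono) auto
   finally have "norm (c*(b*cnj ga) - mu z*(c*(al*ga))) <= e*norm (c*(al*ga))"
    by(simp add: norm_mult mult.assoc)
   moreover have "c*(al*ga) ~= 0" using c0 ab(3) ph(2) by simp
   ultimately show ?thesis using D by blast
  next
   case False
   have z1: "norm z < 1" using z by simp
   have "z \<in> ball 0 1 - U - Z" using z False by(auto simp: Z'_def)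
   from Z(2)[OF this] obtain al b where ab: "(F has_derivative (%w. al*w + b*cnj w)) (at z)"
    "al ~= 0" "norm (b - mu z*al) <= e*norm al" by blast
   \<comment> \<open>Off \<open>S\<close> the new map is \<open>H\<close> after the old one, and
     \<open>H\<close> is complex differentiable at \<open>F z\<close>; both coefficients get the
     same nonzero factor.\<close>
   define H where "H w = B (J (moeb a w))" for w
   have dH: "disc_map H" unfolding H_def
    by(rule disc_map_compose[OF disc_map_compose[OF disc_map_moeb[OF a(1)] dJ] dB])
   have big: "s < norm (g z)" using Sall[OF z1] False by(meson not_le)
   have op: "open ({z. s < cmod z} \<inter> ball 0 1)"
    by(intro open_Int open_Collect_less continuous_intros open_ball)
   obtain c1 where c1: "((%z. B (J z)) has_field_derivative c1) (at (g z))"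
    using holomorphic_derivI[OF JBhol op, of "g z"] big gb[OF z1] by auto
   obtain c2 where c2: "(moeb a has_field_derivative c2) (at (F z))"
    using holomorphic_derivI[OF moeb_holomorphic[OF a(1)] open_ball, of "F z"] Fb[OF z1] by auto
   have cH: "(H has_field_derivative c1*c2) (at (F z))"
    unfolding H_def by(rule DERIV_chain2[OF _ c2]) (use c1 in \<open>simp add: g_def\<close>)
   have c0: "c1*c2 ~= 0" by(rule disc_map_deriv_nonzero[OF dH Fb[OF z1] cH])
   have D: "(F' has_derivative (%w. (c1*c2*al)*w + (c1*c2*b)*cnj w)) (at z)"
    using has_derivative_holomorphic_compose[OF ab(1) cH] by(simp add: F'_def[abs_def] H_def g_def)
   have "c1*c2*b - mu z*(c1*c2*al) = (c1*c2)*(b - mu z*al)" by(simp add: algebra_simps)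
   hence "norm (c1*c2*b - mu z*(c1*c2*al)) <= norm (c1*c2)*(e*norm al)"
    using ab(3) by(simp only: norm_mult[of "c1*c2"] mult_left_mono norm_ge_zero)
   also have "... = e*norm (c1*c2*al)" by(simp only: norm_mult mult_ac)
   finally show ?thesis using D c0 ab(2) by(metis mult_eq_0_iff)
  qed
  have "qc_state mu e F' (U - S)"
   unfolding qc_state_def using dF' hol' Z' der' U compact_imp_closed[OF Scpt] by blast
  thus ?thesis using Scpt Ssub Sball by blast
 qed
 show ?thesis
 proof(intro exI[of _ "q*d0/2"] conjI allI impI)
  have "q*d0 <= 1*1" using q d0 by(intro mult_mono) auto
  thus "q*d0/2 <= 1" by simp
  fix F U p and r :: real
  assume "qc_state mu e F U" "0 < r" "ball p r \<subseteq> U" "\<forall>z\<in>ball p r. norm (mu p - mu z) <= e/4"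
  thus "\<exists>F' S. compact S \<and> S \<subseteq> ball p r \<and> ball p (q*d0/2*r) \<subseteq> S \<and> qc_state mu e F' (U - S)"
   by(intro main) auto
 qed (use q d0 in simp)
qed

text \<open>Disjointness keeps each ball inside the untreated set until its turn comes. The square
  in \<open>c^2\<close> is the area ratio of concentric discs.\<close>

lemma qc_finite_steps:
 assumes step: "!!F U p r. [|qc_state m e F U; 0 < r; ball p r \<subseteq> U; !!z. z \<in> ball p r ==> norm (m p - m z) <= e/4|]
   ==> \<exists>F' S. compact S \<and> S \<subseteq> ball p r \<and> ball p (c*r) \<subseteq> S \<and> qc_state m e F' (U - S)"
  and c: "0 < c" and st: "qc_state m e F U"
  and C: "finite C" "!!i. i \<in> C ==> 0 < r i \<and> ball (p i) (r i) \<subseteq> U \<and> (\<forall>z\<in>ball (p i) (r i). norm (m (p i) - m z) <= e/4)"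
  and disj: "pairwise (%i j. disjnt (ball (p i) (r i)) (ball (p j) (r j))) C"
 shows "\<exists>F' K. compact K \<and> K \<subseteq> (\<Union>i\<in>C. ball (p i) (r i)) \<and> qc_state m e F' (U - K) \<and>
     c^2*(\<Sum>i\<in>C. measure lebesgue (ball (p i) (r i))) <= measure lebesgue K"
 using C disj
proof(induction C rule: finite_induct)
 case empty
 thus ?case using st by(intro exI[of _ F] exI[of _ "{}"]) auto
next
 case (insert i C)
 have "!!j. j \<in> C ==> 0 < r j \<and> ball (p j) (r j) \<subseteq> U \<and> (\<forall>z\<in>ball (p j) (r j). norm (m (p j) - m z) <= e/4)"
  using insert.prems(1) by blast
 moreover have "pairwise (%i j. disjnt (ball (p i) (r i)) (ball (p j) (r j))) C"
  using insert.prems(2) by(rule pairwise_subset) auto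
 ultimately obtain F' K where K: "compact K" "K \<subseteq> (\<Union>i\<in>C. ball (p i) (r i))" "qc_state m e F' (U - K)"
  "c^2*(\<Sum>i\<in>C. measure lebesgue (ball (p i) (r i))) <= measure lebesgue K"
  using insert.IH by blast
 have i: "0 < r i" "ball (p i) (r i) \<subseteq> U" "!!z. z \<in> ball (p i) (r i) ==> norm (m (p i) - m z) <= e/4"
  using insert.prems(1)[of i] by auto
 have dj: "ball (p i) (r i) \<inter> K = {}"
 proof -
  have "ball (p i) (r i) \<inter> ball (p j) (r j) = {}" if "j \<in> C" for j
   using insert.prems(2) insert.hyps(2) that unfolding pairwise_def disjnt_def by(metis insertCI)
  thus ?thesis using K(2) by blast
 qed
 hence "ball (p i) (r i) \<subseteq> U - K" using i(2) by blast
 then obtain F'' S where S: "compact S" "S \<subseteq> ball (p i) (r i)" "ball (p i) (c*r i) \<subseteq> S" "qc_state m e F'' (U - K - S)"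
  using step[OF K(3) i(1) _ i(3)] by blast
 have lm: "K \<in> lmeasurable" "S \<in> lmeasurable" using K S lmeasurable_compact by auto
 have "measure lebesgue (ball (p i) (c*r i)) <= measure lebesgue S"
  using S lm by(intro measure_mono_fmeasurable) auto
 moreover have "measure lebesgue (ball (p i) (c*r i)) = c^2*measure lebesgue (ball (p i) (r i))"
  using c i(1) by(simp add: content_ball power_mult_distrib)
 ultimately have mS: "c^2*measure lebesgue (ball (p i) (r i)) <= measure lebesgue S" by simp
 have "measure lebesgue (K \<union> S) = measure lebesgue K + measure lebesgue S"
 proof(rule measure_Union)
  show "emeasure lebesgue K ~= \<infinity>" "emeasure lebesgue S ~= \<infinity>"
   unfolding infinity_ennreal_def using lm by(blast dest: fmeasurableD2)+
 qed (use lm dj S(2) in auto)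
 hence "c^2*(\<Sum>i\<in>insert i C. measure lebesgue (ball (p i) (r i))) <= measure lebesgue (K \<union> S)"
  using insert.hyps mS K(4) by(simp add: algebra_simps)
 moreover have "compact (K \<union> S)" using K S by auto
 moreover have "K \<union> S \<subseteq> (\<Union>i\<in>insert i C. ball (p i) (r i))" using K S by auto
 moreover have "qc_state m e F'' (U - (K \<union> S))" using S(4) by(simp add: Diff_Un Int_Diff set_diff_eq Un_def conj_ac)
 ultimately show ?case by blast
qed

text \<open>Vitali's theorem fills \<open>U\<close> up to a null set with countably many disjoint
  balls; by continuity of the measure finitely many of them already carry half of it, whence the
  factor 2.\<close>

lemma finite_disjoint_balls:
 fixes U :: "complex set"
 assumes U: "open U" "bounded U" and d: "0 < d"
 obtains C where "finite C" "!!i. i \<in> C ==> 0 < snd i \<and> snd i < d \<and> ball (fst i) (snd i) \<subseteq> U"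
  "pairwise (%i j. disjnt (ball (fst i) (snd i)) (ball (fst j) (snd j))) C"
  "measure lebesgue U <= 2*(\<Sum>i\<in>C. measure lebesgue (ball (fst i) (snd i)))"
proof(cases "measure lebesgue U = 0")
 case True
 thus ?thesis by(intro that[of "{}"]) auto
next
 case False
 have lmU: "U \<in> lmeasurable" using U by(simp add: lmeasurable_open)
 define K where "K = {i :: complex \<times> real. 0 < snd i \<and> snd i < d \<and> ball (fst i) (snd i) \<subseteq> U}"
 obtain C where C: "countable C" "C \<subseteq> K" "pairwise (%i j. disjnt (ball (fst i) (snd i)) (ball (fst j) (snd j))) C"
  "negligible (U - (\<Union>i\<in>C. ball (fst i) (snd i)))"
 proof(rule Vitali_covering_theorem_balls[of U K fst snd])
  fix x and e :: real assume x: "x \<in> U" and e: "0 < e"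
  obtain s where s: "s > 0" "ball x s \<subseteq> U" using U x open_contains_ball by blast
  let ?r = "min s (min (d/2) (e/2))"
  have "(x, ?r) \<in> K" using s d e by(auto simp: K_def subset_iff)
  moreover have "x \<in> ball (fst (x, ?r)) (snd (x, ?r))" using s d e by simp
  moreover have "snd (x, ?r) < e" using e by auto
  ultimately show "\<exists>i. i \<in> K \<and> x \<in> ball (fst i) (snd i) \<and> snd i < e" by blast
 qed auto
 define B where "B i = ball (fst i) (snd i)" for i :: "complex \<times> real"
 have Cne: "C ~= {}"
 proof
  assume "C = {}"
  hence "negligible U" using C(4) by simp
  thus False using False negligible_imp_measure0 by blast
 qed
 define A where "A n = (\<Union>k\<le>n. B (from_nat_into C k))" for n
 have BU: "B i \<subseteq> U" if "i \<in> C" for i using that C(2) by(auto simp: K_def B_def)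
 have AU: "A n \<subseteq> U" for n unfolding A_def using BU from_nat_into[OF Cne] by blast
 have Alm: "A n \<in> lmeasurable" for n unfolding A_def B_def by(intro fmeasurable.finite_UN) auto
 have UA: "(\<Union>n. A n) = (\<Union>i\<in>C. B i)"
 proof -
  have "(\<Union>n. A n) = (\<Union>k. B (from_nat_into C k))" unfolding A_def by blast
  also have "... = (\<Union>i\<in>range (from_nat_into C). B i)" by blast
  finally show ?thesis by(simp only: range_from_nat_into[OF Cne C(1)])
 qed
 have "incseq A" unfolding A_def by(intro monoI UN_mono) auto
 hence "(%n. measure lebesgue (A n)) \<longlonglongrightarrow> measure lebesgue (\<Union>n. A n)"
 proof(rule Lim_measure_incseq[rotated])
  have "(\<Union>n. A n) \<in> lmeasurable"
   using fmeasurableI2[OF lmU, of "\<Union>n. A n"] AU Alm by(meson UN_least fmeasurableD sets.countable_UN image_subsetI)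
  thus "emeasure lebesgue (\<Union>n. A n) ~= \<infinity>" unfolding infinity_ennreal_def by(rule fmeasurableD2)
 qed (use Alm in auto)
 moreover have "measure lebesgue (\<Union>n. A n) = measure lebesgue U"
 proof(rule measure_negligible_symdiff[OF lmU])
  have "U - (\<Union>n. A n) \<union> ((\<Union>n. A n) - U) = U - (\<Union>n. A n)" using AU by auto
  thus "negligible (U - (\<Union>n. A n) \<union> ((\<Union>n. A n) - U))" using C(4) unfolding UA B_def by simp
 qed
 ultimately have lim: "(%n. measure lebesgue (A n)) \<longlonglongrightarrow> measure lebesgue U" by simp
 have "measure lebesgue U/2 < measure lebesgue U" using False by(simp add: order_less_le)
 hence "eventually (%n. measure lebesgue U/2 < measure lebesgue (A n)) sequentially"
  by(rule order_tendstoD(1)[OF lim])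
 then obtain n where n: "measure lebesgue U/2 < measure lebesgue (A n)"
  by(auto simp: eventually_sequentially)
 define C' where "C' = from_nat_into C ` {..n}"
 have C': "finite C'" "C' \<subseteq> C" using from_nat_into[OF Cne] by(auto simp: C'_def)
 have An: "A n = (\<Union>i\<in>C'. B i)" by(auto simp: A_def C'_def)
 have "measure lebesgue (A n) <= (\<Sum>i\<in>C'. measure lebesgue (B i))"
  unfolding An by(intro measure_UNION_le C') (auto simp: B_def)
 hence "measure lebesgue U <= 2*(\<Sum>i\<in>C'. measure lebesgue (ball (fst i) (snd i)))"
  using n by(simp add: B_def)
 moreover have "pairwise (%i j. disjnt (ball (fst i) (snd i)) (ball (fst j) (snd j))) C'"
  using C(3) C'(2) by(rule pairwise_subset)
 ultimately show ?thesis using C' C(2) by(intro that[of C']) (auto simp: K_def)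
qed

text \<open>Uniform continuity of \<open>m\<close> supplies a radius below which every ball is
  admissible for \<open>qc_step\<close>, whatever the current state. Rounds of finitely many steps
  then shrink the remaining measure geometrically.\<close>

theorem qc_exhaust:
 assumes k: "0 <= k" "k < 1" and e: "0 < e" "e <= 1"
  and mk: "!!z. norm (m z) <= k" and cont: "continuous_on UNIV m" and h: "0 < h"
 obtains F U where "qc_state m e F U" "measure lebesgue U < h"
proof -
 have "\<exists>c. 0 < c \<and> c <= 1 \<and> (\<forall>F U p r. qc_state m e F U --> 0 < r --> ball p r \<subseteq> U -->
   (\<forall>z\<in>ball p r. norm (m p - m z) <= e/4) -->
   (\<exists>F' S. compact S \<and> S \<subseteq> ball p r \<and> ball p (c*r) \<subseteq> S \<and> qc_state m e F' (U - S)))"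
  by(rule qc_step[OF k e mk])
 then obtain c where c': "0 < c \<and> c <= 1 \<and> (\<forall>F U p r. qc_state m e F U --> 0 < r --> ball p r \<subseteq> U -->
   (\<forall>z\<in>ball p r. norm (m p - m z) <= e/4) -->
   (\<exists>F' S. compact S \<and> S \<subseteq> ball p r \<and> ball p (c*r) \<subseteq> S \<and> qc_state m e F' (U - S)))" ..
 hence c: "0 < c" "c <= 1" by auto
 have step: "\<exists>F' S. compact S \<and> S \<subseteq> ball p r \<and> ball p (c*r) \<subseteq> S \<and> qc_state m e F' (U - S)"
  if "qc_state m e F U" "0 < r" "ball p r \<subseteq> U" "!!z. z \<in> ball p r ==> norm (m p - m z) <= e/4" for F U p r
  using c' that by blast
 have uc: "uniformly_continuous_on (cball 0 1) m"
  by(rule compact_uniformly_continuous[OF continuous_on_subset[OF cont subset_UNIV] compact_cball])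
 have e4: "0 < e/4" using e(1) by simp
 have "\<exists>d>0. \<forall>x\<in>cball 0 1. \<forall>y\<in>cball 0 1. dist y x < d --> dist (m y) (m x) < e/4"
  by(rule mp[OF spec[OF uc[unfolded uniformly_continuous_on_def]] e4])
 then obtain d where d': "d > 0 \<and> (\<forall>x\<in>cball 0 1. \<forall>y\<in>cball 0 1. dist y x < d --> dist (m y) (m x) < e/4)" ..
 hence d: "d > 0" "!!x y. [|x \<in> cball 0 1; y \<in> cball 0 1; dist y x < d|] ==> dist (m y) (m x) < e/4"
  by simp_all
 \<comment> \<open>One round works on balls with at least half the measure of \<open>U\<close> and
   settles at least the share \<open>c^2\<close> of them.\<close>
 define q where "q = 1 - c^2/2"
 have c2: "c^2 <= 1" using c by(simp add: power_le_one)
 have q: "0 <= q" "q < 1" using c c2 by(auto simp: q_def)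
 have round: "\<exists>F' U'. qc_state m e F' U' \<and> measure lebesgue U' <= q*measure lebesgue U"
  if st: "qc_state m e F U" for F U
 proof -
  have U: "open U" "U \<subseteq> ball 0 1" using st by(auto simp: qc_state_def)
  have bU: "bounded U" using U(2) bounded_ball bounded_subset by blast
  obtain C where C: "finite C" "!!i. i \<in> C ==> 0 < snd i \<and> snd i < d \<and> ball (fst i) (snd i) \<subseteq> U"
   "pairwise (%i j. disjnt (ball (fst i) (snd i)) (ball (fst j) (snd j))) C"
   "measure lebesgue U <= 2*(\<Sum>i\<in>C. measure lebesgue (ball (fst i) (snd i)))"
   using finite_disjoint_balls[OF U(1) bU d(1)] by blast
  have near: "norm (m (fst i) - m z) <= e/4" if i: "i \<in> C" and z: "z \<in> ball (fst i) (snd i)" for i z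
  proof -
   have "ball (fst i) (snd i) \<subseteq> cball 0 1" "fst i \<in> ball (fst i) (snd i)"
    using C(2)[OF i] U(2) ball_subset_cball by(blast, simp)
   hence "fst i \<in> cball 0 1" "z \<in> cball 0 1" using z by blast+
   moreover have "dist (fst i) z < d" using z C(2)[OF i] by auto
   ultimately show ?thesis using d(2)[of z "fst i"] by(simp add: dist_norm)
  qed
  have "\<exists>F' K. compact K \<and> K \<subseteq> (\<Union>i\<in>C. ball (fst i) (snd i)) \<and> qc_state m e F' (U - K) \<and>
     c^2*(\<Sum>i\<in>C. measure lebesgue (ball (fst i) (snd i))) <= measure lebesgue K"
   by(rule qc_finite_steps[OF step c(1) st C(1) _ C(3)]) (use C(2) near in auto)
  then obtain F' K where K: "compact K" "K \<subseteq> (\<Union>i\<in>C. ball (fst i) (snd i))" "qc_state m e F' (U - K)"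
   "c^2*(\<Sum>i\<in>C. measure lebesgue (ball (fst i) (snd i))) <= measure lebesgue K" by blast
  have KU: "K \<subseteq> U" using K(2) C(2) by blast
  have lm: "U \<in> lmeasurable" "K \<in> lmeasurable" using U bU K(1) by(auto intro: lmeasurable_open lmeasurable_compact)
  have "measure lebesgue (U - K) = measure lebesgue U - measure lebesgue K"
   using lm KU by(intro measurable_measure_Diff) auto
  also have "... <= measure lebesgue U - c^2*(measure lebesgue U/2)"
   using K(4) mult_left_mono[OF C(4), of "c^2"] by simp
  also have "... = q*measure lebesgue U" by(simp add: q_def algebra_simps)
  finally show ?thesis using K(3) by blast
 qed
 have iter: "\<exists>F U. qc_state m e F U \<and> measure lebesgue U <= q ^ n*measure lebesgue (ball (0::complex) 1)" for n
 proof(induction n)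
  case 0
  have "qc_state m e (%z. z) (ball 0 1)"
   unfolding qc_state_def by(auto intro!: disc_map_id holomorphic_intros exI[of _ "{}"])
  thus ?case by(intro exI conjI) auto
 next
  case (Suc n)
  then obtain F U where FU: "qc_state m e F U" "measure lebesgue U <= q ^ n*measure lebesgue (ball (0::complex) 1)" by blast
  obtain F' U' where FU': "qc_state m e F' U'" "measure lebesgue U' <= q*measure lebesgue U"
   using round[OF FU(1)] by blast
  have "measure lebesgue U' <= q ^ Suc n*measure lebesgue (ball (0::complex) 1)"
   using FU'(2) mult_left_mono[OF FU(2) q(1)] by(simp add: mult.assoc)
  thus ?case using FU'(1) by blast
 qed
 have "(%n. q ^ n*measure lebesgue (ball (0::complex) 1)) \<longlonglongrightarrow> 0*measure lebesgue (ball (0::complex) 1)"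
  using q by(intro tendsto_intros LIMSEQ_power_zero) auto
 hence "eventually (%n. q ^ n*measure lebesgue (ball (0::complex) 1) < h) sequentially"
  using h by(intro order_tendstoD) auto
 then obtain n where "q ^ n*measure lebesgue (ball (0::complex) 1) < h"
  by(auto simp: eventually_sequentially)
 with iter[of n] show ?thesis using that by(meson le_less_trans)
qed

subsection \<open>Radial modification near the circle\<close>

text \<open>Close to 1 the derivative of \<open>Ln\<close> is at most 2; further away
  \<open>norm (t - 1)\<close> exceeds 1/2 while \<open>norm (Ln t)\<close> is at most
  \<open>1 + pi\<close>, hence at most 5.\<close>

lemma norm_Ln_le:
 assumes "1/2 <= norm t" "norm t <= 2"
 shows "norm (Ln t) <= 10*norm (t - 1)"
proof(cases "norm (t - 1) <= 1/2")
 case True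
 have "norm (Ln t - Ln 1) <= 2*norm (t - 1)"
 proof(rule field_differentiable_bound[of "cball 1 (1/2)" Ln "%z. inverse z"])
  fix z :: complex assume z: "z \<in> cball 1 (1/2)"
  hence n: "norm (z - 1) <= 1/2" by(simp add: dist_norm norm_minus_commute)
  have "\<bar>Re (z - 1)\<bar> <= 1/2" using n abs_Re_le_cmod[of "z - 1"] by linarith
  hence "Re z > 0" unfolding minus_complex.sel one_complex.sel by arith
  hence "z \<notin> \<real>\<^sub>\<le>\<^sub>0" by(auto simp: complex_nonpos_Reals_iff)
  thus "(Ln has_field_derivative inverse z) (at z within cball 1 (1/2))"
   by(rule has_field_derivative_Ln[THEN has_field_derivative_at_within])
  have "1/2 <= norm z" using norm_triangle_ineq2[of 1 "1 - z"] n by(simp add: norm_minus_commute)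
  hence "inverse (norm z) <= inverse (1/2)" by(intro le_imp_inverse_le) auto
  thus "norm (inverse z) <= 2" by(simp add: norm_inverse)
 qed (use True in \<open>auto simp: dist_norm norm_minus_commute\<close>)
 thus ?thesis using norm_ge_zero[of "t - 1"] unfolding Ln_1 diff_zero by linarith
next
 case False
 have t0: "t ~= 0" using assms by auto
 have ln2: "ln 2 <= (1::real)" using ln_add_one_self_le_self[of 1] by simp
 have "\<bar>ln (norm t)\<bar> <= 1"
 proof -
  have "ln (norm t) <= ln 2" using assms t0 by(subst ln_le_cancel_iff) auto
  moreover have "ln (1/2) <= ln (norm t)" using assms t0 by(subst ln_le_cancel_iff) auto
  moreover have "ln (1/2) = - ln (2::real)" by(simp add: ln_div)
  ultimately show ?thesis using ln2 by linarith
 qed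
 hence "norm (Ln t) <= 1 + pi"
  using cmod_le[of "Ln t"] mpi_less_Im_Ln[OF t0] Im_Ln_le_pi[OF t0] t0 by(simp add: Re_Ln)
 also have "... <= 5" using pi_less_4 by simp
 finally show ?thesis using False by linarith
qed

lemma lipschitz_has_derivative_bound:
 fixes f :: "'a::real_normed_vector => 'b::real_normed_vector"
 assumes d: "(f has_derivative D) (at z)" and U: "open U" "z \<in> U"
  and lip: "!!w. w \<in> U ==> norm (f w - f z) <= K*norm (w - z)"
 shows "norm (D w) <= K*norm w"
proof(cases "w = 0")
 case True
 have "D 0 = 0" using d by(simp add: has_derivative_def bounded_linear.linear linear_0)
 thus ?thesis using True by simp
next
 case False
 have sc: "D (t *\<^sub>R w) = t *\<^sub>R D w" for t
  using d by(simp add: has_derivative_def bounded_linear.linear linear_scale)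
 show ?thesis
 proof(rule field_le_epsilon)
  fix e0 :: real assume "0 < e0"
  define e where "e = e0/norm w"
  have e: "0 < e" "e*norm w = e0" using \<open>0 < e0\<close> False by(auto simp: e_def)
  obtain r where r: "r > 0" "!!y. norm (y - z) < r ==> norm (f y - f z - D (y - z)) <= e*norm (y - z)"
   using d e(1) unfolding has_derivative_at_alt by blast
  obtain s where s: "s > 0" "ball z s \<subseteq> U" using U open_contains_ball by blast
  define t where "t = min r s/(2*norm w)"
  have t: "0 < t" "t*norm w < r" "t*norm w < s" using r(1) s(1) False by(auto simp: t_def min_def)
  let ?y = "z + t *\<^sub>R w"
  have "?y \<in> U" using s t by(intro subsetD[OF s(2)]) (simp add: dist_norm)
  hence "norm (f ?y - f z) <= K*(t*norm w)" using lip[of ?y] t(1) by simp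
  moreover have "norm (f ?y - f z - t *\<^sub>R D w) <= e*(t*norm w)" using r(2)[of ?y] t by(simp add: sc)
  ultimately have "norm (t *\<^sub>R D w) <= K*(t*norm w) + e*(t*norm w)"
   using norm_triangle_ineq4[of "f ?y - f z" "f ?y - f z - t *\<^sub>R D w"] by simp
  hence "t*norm (D w) <= t*(K*norm w + e*norm w)" using t(1) by(simp add: algebra_simps)
  thus "norm (D w) <= K*norm w + e0" using t(1) e(2) by simp
 qed
qed

lemma sphere_annulus:
 fixes V :: "complex set"
 assumes "open V" "sphere 0 1 \<subseteq> V"
 obtains c where "0 < c" "!!z. \<bar>Re z\<bar> < c ==> exp z \<in> V"
proof -
 obtain e where e: "e > 0" "(\<Union>x\<in>sphere 0 1. ball x e) \<subseteq> V"
  using compact_subset_open_imp_ball_epsilon_subset[OF compact_sphere assms] by blast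
 have "((%x. exp x - 1 :: real) \<longlongrightarrow> exp 0 - 1) (at 0)" by(intro tendsto_intros)
 hence "eventually (%x::real. dist (exp x - 1) 0 < e) (at 0)" using e(1) by(simp add: tendsto_iff)
 then obtain d where d: "d > 0" "!!x::real. x ~= 0 ==> \<bar>x\<bar> < d ==> \<bar>exp x - 1\<bar> < e"
  by(auto simp: eventually_at dist_norm)
 have "exp z \<in> V" if "\<bar>Re z\<bar> < d" for z
 proof -
  have b: "\<bar>exp (Re z) - 1\<bar> < e" using d(2)[of "Re z"] that e(1) by(cases "Re z = 0") auto
  have "exp z = of_real (exp (Re z))*cis (Im z)" by(rule exp_eq_polar)
  hence "exp z - cis (Im z) = of_real (exp (Re z) - 1)*cis (Im z)" by(simp add: algebra_simps)
  hence "norm (exp z - cis (Im z)) = \<bar>exp (Re z) - 1\<bar>"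
   by(simp only: norm_mult norm_of_real norm_cis mult_1_right)
  hence "exp z \<in> ball (cis (Im z)) e" using b by(simp add: dist_norm norm_minus_commute)
  moreover have "cis (Im z) \<in> sphere 0 1" by simp
  ultimately show ?thesis using e(2) by blast
 qed
 with d(1) show ?thesis by(rule that)
qed

text \<open>The exponential unrolls an annulus around the circle to a strip around the imaginary
  axis, where \<open>F\<close> lifts to \<open>g\<close>. As \<open>F\<close> preserves the circle,
  \<open>g\<close> preserves the imaginary axis, and its derivative \<open>G\<close> is real on
  it.\<close>

lemma disc_map_log_coordinates:
 assumes F: "disc_map F"
 obtains V c g G M where "open V" "sphere 0 1 \<subseteq> V" "F holomorphic_on V" "0 < c"
  "!!w. \<bar>Re w\<bar> <= c ==> exp w \<in> V"
  "!!w. \<bar>Re w\<bar> <= c ==> F (exp w) = exp (g w)"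
  "!!w. \<bar>Re w\<bar> <= c ==> (g has_field_derivative G w) (at w)"
  "!!w. Re w = 0 ==> Re (g w) = 0" "!!w. Re w = 0 ==> Im (G w) = 0"
  "0 < M" "!!w. \<bar>Re w\<bar> <= c ==> norm (G w) <= M"
  "!!w om. \<bar>Re w\<bar> <= c ==> \<bar>Re om\<bar> <= c ==> norm (G w - G om) <= M*norm (w - om)"
proof -
 obtain V0 where V0: "open V0" "sphere 0 1 \<subseteq> V0" "F holomorphic_on V0"
  using F unfolding disc_map_def by blast
 define V where "V = V0 \<inter> F -` (- {0})"
 have V: "open V" "F holomorphic_on V" "!!z. z \<in> V ==> F z ~= 0"
  unfolding V_def using V0 holomorphic_on_imp_continuous_on[OF V0(3)]
  by(auto intro!: continuous_open_preimage intro: holomorphic_on_subset)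
 have Fs: "norm (F z) = 1" if "norm z = 1" for z
  using disc_map_image(2)[OF F] that by force
 have sV: "sphere 0 1 \<subseteq> V" unfolding V_def using V0(2) Fs by force
 obtain c where c: "0 < c" "!!w. \<bar>Re w\<bar> < c ==> exp w \<in> V"
  using sphere_annulus[OF V(1) sV] by blast
 define S where "S = {w. - c < Re w} \<inter> {w. Re w < c}"
 have S: "open S" "convex S" "!!w. w \<in> S \<longleftrightarrow> \<bar>Re w\<bar> < c"
  unfolding S_def by(auto intro!: open_Int open_halfspace_Re_lt open_halfspace_Re_gt convex_Int convex_halfspace_Re_lt convex_halfspace_Re_gt)
 have "F \<circ> exp holomorphic_on S"
  by(rule holomorphic_on_compose_gen[OF holomorphic_on_exp V(2)]) (use c S in auto)
 hence Feh: "(%w. F (exp w)) holomorphic_on S" by(simp add: o_def)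
 obtain g where g: "g holomorphic_on S" "!!w. w \<in> S ==> F (exp w) = exp (g w)"
  using contractible_imp_holomorphic_log[OF Feh convex_imp_contractible[OF S(2)]] V(3) c(2) S(3) by metis
 \<comment> \<open>In the variable \<open>z = exp w\<close> the derivative of \<open>g\<close> is
   the logarithmic derivative of \<open>F\<close>. Being a function of \<open>exp w\<close>, it has
   bounds on the unbounded strip that come from a compact annulus.\<close>
 define K where "K z = z*deriv F z/F z" for z
 have Kh: "K holomorphic_on V" unfolding K_def
  using V by(intro holomorphic_intros holomorphic_deriv) auto
 define G where "G w = K (exp w)" for w
 have gd: "(g has_field_derivative G w) (at w)" if z: "w \<in> S" for w
 proof -
  have eV: "exp w \<in> V" using z c S by auto
  have d1: "(g has_field_derivative deriv g w) (at w)"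
   by(rule holomorphic_derivI[OF g(1) S(1) z])
  hence "((%w. exp (g w)) has_field_derivative exp (g w)*deriv g w) (at w)"
   by(auto intro!: derivative_eq_intros)
  hence "((%w. F (exp w)) has_field_derivative exp (g w)*deriv g w) (at w)"
   by(rule has_field_derivative_transform_within_open[OF _ S(1) z]) (simp add: g(2))
  moreover have "((%w. F (exp w)) has_field_derivative deriv F (exp w)*exp w) (at w)"
   using DERIV_chain2[of F "deriv F (exp w)" exp w "exp w" UNIV] holomorphic_derivI[OF V(2,1) eV]
   by(auto intro: DERIV_exp)
  ultimately have "exp (g w)*deriv g w = deriv F (exp w)*exp w" by(rule DERIV_unique)
  hence "deriv g w = G w"
   unfolding G_def K_def g(2)[OF z] by(simp add: field_simps)
  thus ?thesis using d1 by simp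
 qed
 have re0: "Re (g w) = 0" if "Re w = 0" for w
 proof -
  have "w \<in> S" using that c S by simp
  hence "norm (exp (g w)) = norm (F (exp w))" using g(2) by simp
  also have "... = 1" using Fs that by(simp add: norm_exp_eq_Re)
  finally show ?thesis by(simp add: norm_exp_eq_Re)
 qed
 \<comment> \<open>Differentiating \<open>Re (g w) = 0\<close> along the imaginary axis yields
   \<open>Re (\<i>*G w) = 0\<close>.\<close>
 have im0: "Im (G w) = 0" if "Re w = 0" for w
 proof -
  define y where "y = Im w"
  have z: "w = \<i> * of_real y" using that by(simp add: complex_eq_iff y_def)
  have zS: "\<i> * of_real y \<in> S" using c S by simp
  have "((%t. g (\<i> * of_real t)) has_vector_derivative (\<i>*G w)) (at y)"
  proof -
   have "((%t. \<i> * of_real t) has_vector_derivative \<i>) (at y)"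
    by(auto intro!: derivative_eq_intros)
   from field_vector_diff_chain_at[OF this, of g "G w"] gd[OF zS] show ?thesis
    by(simp add: o_def z)
  qed
  hence "((%t. Re (g (\<i> * of_real t))) has_vector_derivative Re (\<i>*G w)) (at y)"
   by(rule bounded_linear.has_vector_derivative[OF bounded_linear_Re])
  moreover have "(%t. Re (g (\<i> * of_real t))) = (%t. 0)" by(rule ext) (rule re0, simp)
  ultimately have "((%t. 0) has_vector_derivative Re (\<i>*G w)) (at y)" by simp
  moreover have "((%t. 0 :: real) has_vector_derivative 0) (at y)" by simp
  ultimately have "Re (\<i>*G w) = 0" by(rule vector_derivative_unique_at)
  thus ?thesis by simp
 qed
 define A where "A = cball (0::complex) (exp (c/2)) - ball 0 (exp (- c/2))"
 have A: "compact A" unfolding A_def by(intro compact_diff) auto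
 have expA: "exp w \<in> A" if "\<bar>Re w\<bar> <= c/2" for w
  using that unfolding A_def by(auto simp: norm_exp_eq_Re)
 have AV: "A \<subseteq> V"
 proof
  fix z assume z: "z \<in> A"
  hence zn: "exp (- c/2) <= norm z" "norm z <= exp (c/2)" by(auto simp: A_def)
  hence z0: "z ~= 0" by(metis exp_gt_zero norm_zero not_le)
  have "- c/2 <= ln (norm z)" "ln (norm z) <= c/2"
   using zn z0 ln_mono[of "exp (- c/2)" "norm z"] ln_mono[of "norm z" "exp (c/2)"] by simp_all
  hence "exp (Ln z) \<in> V" using c z0 by(intro c(2)) (simp add: Re_Ln)
  thus "z \<in> V" using z0 by simp
 qed
 have dK: "(K has_field_derivative deriv K z) (at z)" if "z \<in> V" for z
  by(rule holomorphic_derivI[OF Kh V(1) that])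
 have "continuous_on V (%z. deriv K z*z)"
  by(intro continuous_intros holomorphic_on_imp_continuous_on holomorphic_deriv Kh V)
 hence "bounded ((%z. deriv K z*z) ` A)" "bounded (K ` A)"
  using AV A holomorphic_on_imp_continuous_on[OF Kh]
  by(auto intro!: compact_imp_bounded compact_continuous_image intro: continuous_on_subset)
 then obtain M1 M2 where M: "!!z. z \<in> A ==> norm (deriv K z*z) <= M1" "!!z. z \<in> A ==> norm (K z) <= M2"
  unfolding bounded_iff by(metis imageI)
 define M where "M = max 1 (max M1 M2)"
 have Glip: "norm (G w - G om) <= M*norm (w - om)" if "\<bar>Re w\<bar> <= c/2" "\<bar>Re om\<bar> <= c/2" for w om
 proof(rule field_differentiable_bound[of "{w. Re w \<ge> - c/2} \<inter> {w. Re w <= c/2}" G "%w. deriv K (exp w)*exp w"])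
  show "convex ({w. Re w \<ge> - c/2} \<inter> {w. Re w <= c/2})"
   by(intro convex_Int convex_halfspace_Re_ge convex_halfspace_Re_le)
  fix z assume "z \<in> {w. Re w \<ge> - c/2} \<inter> {w. Re w <= c/2}"
  hence zc: "\<bar>Re z\<bar> <= c/2" by(auto simp: abs_le_iff)
  have "(G has_field_derivative deriv K (exp z)*exp z) (at z)"
   unfolding G_def by(rule DERIV_chain2[OF dK]) (use expA[OF zc] AV in \<open>auto intro!: derivative_eq_intros\<close>)
  thus "(G has_field_derivative deriv K (exp z)*exp z) (at z within {w. Re w \<ge> - c/2} \<inter> {w. Re w <= c/2})"
   by(rule has_field_derivative_at_within)
  show "norm (deriv K (exp z)*exp z) <= M" using M(1)[OF expA[OF zc]] by(simp add: M_def)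
 qed (use that in \<open>auto simp: abs_le_iff\<close>)
 have inS: "w \<in> S" if "\<bar>Re w\<bar> <= c/2" for w using that c S by simp
 show ?thesis
 proof(rule that[of V "c/2" g G M])
  show "norm (G w) <= M" if "\<bar>Re w\<bar> <= c/2" for w
   using M(2)[OF expA[OF that]] by(simp add: G_def M_def)
  show "exp w \<in> V" if "\<bar>Re w\<bar> <= c/2" for w using expA[OF that] AV by blast
  show "F (exp w) = exp (g w)" if "\<bar>Re w\<bar> <= c/2" for w using g(2) inS that by blast
  show "(g has_field_derivative G w) (at w)" if "\<bar>Re w\<bar> <= c/2" for w using gd inS that by blast
 qed (use V sV c re0 im0 Glip in \<open>simp_all add: M_def\<close>)
qed

text \<open>The phase correction makes \<open>F\<close> commute with radial projection near the circle. It is Lipschitz with a small constant and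
vanishes on the circle, so it changes the dilatation little and keeps the boundary values.\<close>

definition collar_phase ::
  "(complex => complex) => real => real => real => complex set => (complex => real) => complex set => bool" where
 "collar_phase F k r0 r1 V q Z \<longleftrightarrow>
  0 < r0 \<and> r0 < r1 \<and> r1 < 1 \<and> 1 - k < r0 \<and>
  open V \<and> F holomorphic_on V \<and> (\<forall>z. r0 <= norm z --> norm z <= 1 --> z \<in> V) \<and>
  (\<forall>z. norm z <= r0 --> q z = 0) \<and> (\<forall>z. norm z = 1 --> q z = 0) \<and>
  (\<forall>z w. norm z <= 1 --> norm w <= 1 --> \<bar>q z - q w\<bar> <= k*norm (z - w)) \<and>
  (\<forall>z. r1 <= norm z --> norm z <= 1 -->
    F z*exp (- \<i> * of_real (q z)) = of_real (norm (F z))*F (sgn z)) \<and>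
  negligible Z \<and> (\<forall>z. r0 < norm z --> norm z < 1 --> z \<notin> Z --> q differentiable (at z))"

text \<open>In logarithmic coordinates \<open>e\<close> is the angle by which \<open>F\<close> fails
  to commute with radial projection. As \<open>G\<close> is real on the axis, the gradient of
  \<open>e\<close> is of order \<open>h\<close> on a strip of width \<open>h\<close>, and
  \<open>e\<close> itself of order \<open>h^2\<close>; so a cutoff of slope \<open>2/h\<close>
  leaves a Lipschitz constant of order \<open>h\<close>.\<close>

lemma disc_map_collar_phase:
 assumes F: "disc_map F" and k: "0 < k" "k <= 1"
 obtains r0 r1 V q Z where "collar_phase F k r0 r1 V q Z"
proof -
 obtain V c g G M where V: "open V" "sphere 0 1 \<subseteq> V" "F holomorphic_on V" and c: "0 < c"
  and cV: "!!u. \<bar>Re u\<bar> <= c ==> exp u \<in> V"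
  and Fg: "!!u. \<bar>Re u\<bar> <= c ==> F (exp u) = exp (g u)"
  and gG: "!!u. \<bar>Re u\<bar> <= c ==> (g has_field_derivative G u) (at u)"
  and Re0: "!!u. Re u = 0 ==> Re (g u) = 0" and Im0: "!!u. Re u = 0 ==> Im (G u) = 0"
  and M: "0 < M" and GM: "!!u. \<bar>Re u\<bar> <= c ==> norm (G u) <= M"
  and Glip: "!!u om. \<bar>Re u\<bar> <= c ==> \<bar>Re om\<bar> <= c ==> norm (G u - G om) <= M*norm (u - om)"
  using disc_map_log_coordinates[OF F] by blast
 \<comment> \<open>The number 120 is 6 times 20: \<open>6*M*h\<close> is the Lipschitz constant of
   the cut-off phase in logarithmic coordinates, and 20 bounds that of the logarithm for moduli
   between 1/2 and 1. The bound \<open>k/2\<close> places the collar outside the radius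
   \<open>1 - k\<close>.\<close>
 define h where "h = min c (min (1/2) (min (k/2) (k/(120*M))))"
 have h: "0 < h" "h <= c" "h <= 1/2" "h <= k/2" "h <= k/(120*M)"
  using c M k unfolding h_def by(simp_all del: min.bounded_iff add: min.coboundedI1 min.coboundedI2)
 have Mh: "120*M*h <= k" using h(5) M by(simp add: field_simps)
 have eeta: "1 - h <= exp (- h)" using exp_ge_add_one_self[of "- h"] by simp
 hence half: "1/2 <= exp (- h)" using h by simp
 have exp2: "exp h <= 2" using half by(simp add: exp_minus field_simps)
 define T where "T = {u. - h <= Re u} \<inter> {u. Re u <= 0}"
 have T: "convex T" "!!u. u \<in> T \<longleftrightarrow> - h <= Re u \<and> Re u <= 0" "!!u. u \<in> T ==> \<bar>Re u\<bar> <= c"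
  unfolding T_def using h convex_Int[OF convex_halfspace_Re_ge[of "- h"] convex_halfspace_Re_le[of 0]] by auto
 define e where "e u = Im (g u - g (\<i> * of_real (Im u)))" for u
 have gc: "\<bar>Re (\<i> * of_real y)\<bar> <= c" for y using c by simp
 have ed: "(e has_derivative (%w. Im (G u*w - G (\<i> * of_real (Im u))*(\<i> * of_real (Im w))))) (at u)"
  if z: "\<bar>Re u\<bar> <= c" for u
 proof -
  have 1: "(g has_derivative (*) (G u)) (at u)" using gG[OF z] by(simp add: has_field_derivative_def)
  have 2: "(g has_derivative (*) (G (\<i> * of_real (Im u)))) (at (\<i> * of_real (Im u)))"
   using gG[OF gc] by(simp add: has_field_derivative_def)
  have 3: "((%u. \<i> * of_real (Im u)) has_derivative (%w. \<i> * of_real (Im w))) (at u)"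
   by(auto intro!: derivative_eq_intros)
  have "((%u. g (\<i> * of_real (Im u))) has_derivative (%w. G (\<i> * of_real (Im u))*(\<i> * of_real (Im w)))) (at u)"
   using diff_chain_at[OF 3 2] by(simp add: o_def)
  hence "((%u. g u - g (\<i> * of_real (Im u))) has_derivative
    (%w. G u*w - G (\<i> * of_real (Im u))*(\<i> * of_real (Im w)))) (at u)"
   by(rule has_derivative_diff[OF 1])
  thus ?thesis unfolding e_def by(rule bounded_linear.has_derivative[OF bounded_linear_Im])
 qed
 have elip: "\<bar>e u - e om\<bar> <= 2*M*h*norm (u - om)" if "u \<in> T" "om \<in> T" for u om
 proof -
  have "norm (e u - e om) <= 2*M*h*norm (u - om)"
  proof(rule differentiable_bound[OF T(1) _ _ that])
   fix z assume z: "z \<in> T"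
   show "(e has_derivative (%w. Im (G z*w - G (\<i> * of_real (Im z))*(\<i> * of_real (Im w))))) (at z within T)"
    using ed[OF T(3)[OF z]] by(rule has_derivative_at_withinI)
   show "onorm (%w. Im (G z*w - G (\<i> * of_real (Im z))*(\<i> * of_real (Im w)))) <= 2*M*h"
   proof(rule onorm_bound)
    fix w
    let ?y = "\<i> * of_real (Im z)"
    have zy: "z - ?y = of_real (Re z)" by(simp add: complex_eq_iff)
    have d: "norm (G z - G ?y) <= M*h"
    proof -
     have "norm (G z - G ?y) <= M*norm (z - ?y)" by(rule Glip[OF T(3)[OF z] gc])
     also have "... <= M*h" unfolding zy using z T(2) M by(intro mult_left_mono) auto
     finally show ?thesis .
    qed
    have "\<bar>Im (G z)\<bar> = \<bar>Im (G z - G ?y)\<bar>" using Im0[of ?y] by simp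
    also have "... <= M*h" using d abs_Im_le_cmod[of "G z - G ?y"] by linarith
    finally have i: "\<bar>Im (G z)\<bar> <= M*h" .
    have "Im (G z*w - G ?y*(\<i> * of_real (Im w))) = Im (G z) * Re w + Im ((G z - G ?y)*(\<i> * of_real (Im w)))"
     by(simp add: algebra_simps)
    also have "\<bar>...\<bar> <= \<bar>Im (G z)\<bar>*\<bar>Re w\<bar> + norm ((G z - G ?y)*(\<i> * of_real (Im w)))"
     by(rule order_trans[OF abs_triangle_ineq]) (intro add_mono abs_Im_le_cmod, simp add: abs_mult)
    also have "... <= M*h*norm w + M*h*norm w"
     unfolding norm_mult using i d M h abs_Re_le_cmod[of w] abs_Im_le_cmod[of w]
     by(intro add_mono mult_mono) auto
    finally show "norm (Im (G z*w - G ?y*(\<i> * of_real (Im w)))) <= 2*M*h*norm w" by simp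
   qed (use M h in simp)
  qed
  thus ?thesis by simp
 qed
 have e0: "e u = 0" if "Re u = 0" for u
 proof -
  have "\<i> * of_real (Im u) = u" using that by(simp add: complex_eq_iff)
  thus ?thesis by(simp add: e_def)
 qed
 have eb: "\<bar>e u\<bar> <= 2*M*h*h" if z: "u \<in> T" for u
 proof -
  let ?y = "\<i> * of_real (Im u)"
  have zy: "u - ?y = of_real (Re u)" by(simp add: complex_eq_iff)
  have "?y \<in> T" using h T(2) by simp
  hence "\<bar>e u - e ?y\<bar> <= 2*M*h*\<bar>Re u\<bar>" using elip[OF z, of ?y] unfolding zy by simp
  also have "... <= 2*M*h*h" using z T(2) M h by(intro mult_left_mono) auto
  finally show ?thesis using e0[of ?y] by simp
 qed
 define X where "X x = max 0 (min 1 (2*(x + h)/h))" for x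
 have X01: "0 <= X x" "X x <= 1" for x by(auto simp: X_def)
 have clamp: "\<bar>max 0 (min 1 a) - max 0 (min 1 b)\<bar> <= \<bar>a - b\<bar>" for a b :: real by auto
 have Xlip: "\<bar>X x - X y\<bar> <= 2/h*\<bar>x - y\<bar>" for x y
 proof -
  have "\<bar>X x - X y\<bar> <= \<bar>2*(x + h)/h - 2*(y + h)/h\<bar>" unfolding X_def using clamp by blast
  also have "2*(x + h)/h - 2*(y + h)/h = 2/h*(x - y)" using h by(simp add: field_simps)
  also have "\<bar>2/h*(x - y)\<bar> = 2/h*\<bar>x - y\<bar>" unfolding abs_mult using h(1) by simp
  finally show ?thesis .
 qed
 have X0: "X (- h) = 0" by(simp add: X_def)
 have plip: "\<bar>X (Re u)*e u - X (Re om)*e om\<bar> <= 6*M*h*norm (u - om)" if zw: "u \<in> T" "om \<in> T" for u om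
 proof -
  have "X (Re u)*e u - X (Re om)*e om = (X (Re u) - X (Re om))*e u + X (Re om)*(e u - e om)"
   by(simp add: algebra_simps)
  hence "\<bar>X (Re u)*e u - X (Re om)*e om\<bar> <= \<bar>X (Re u) - X (Re om)\<bar>*\<bar>e u\<bar> + \<bar>X (Re om)\<bar>*\<bar>e u - e om\<bar>"
   using abs_triangle_ineq by(metis abs_mult)
  also have "... <= (2/h*\<bar>Re u - Re om\<bar>)*(2*M*h*h) + 1*(2*M*h*norm (u - om))"
   using Xlip eb[OF zw(1)] elip[OF zw] X01 h by(intro add_mono mult_mono) auto
  also have "... = 4*M*h*\<bar>Re u - Re om\<bar> + 2*M*h*norm (u - om)" using h by(simp add: field_simps)
  also have "... <= 4*M*h*norm (u - om) + 2*M*h*norm (u - om)"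
   using M h abs_Re_le_cmod[of "u - om"] by(intro add_mono mult_left_mono) auto
  finally show ?thesis by simp
 qed
 \<comment> \<open>The quotient equals \<open>exp (g u - g (\<i> * of_real (Im u)))\<close> with
   imaginary part of the exponent less than \<open>pi\<close> in modulus, so the principal logarithm
   recovers \<open>e\<close> without a choice of branch for \<open>z\<close>.\<close>
 define q where "q z = (if norm z <= exp (- h) then 0 else X (ln (norm z))*Im (Ln (F z/F (sgn z))))" for z :: complex
 have sgnexp: "sgn (exp u) = exp (\<i> * of_real (Im u))" for u
  by(simp add: sgn_eq norm_exp_eq_Re exp_eq_polar[of u] cis_conv_exp[symmetric] norm_mult)
 have small: "\<bar>Im (g u - g (\<i> * of_real (Im u)))\<bar> < pi" if z: "u \<in> T" for u
 proof -
  have "2*M*h*h <= 120*M*h*1" using M h by(intro mult_mono) auto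
  hence "\<bar>e u\<bar> <= k" using eb[OF z] Mh by linarith
  thus ?thesis using k pi_gt3 unfolding e_def by linarith
 qed
 have Fr: "F (exp u)/F (sgn (exp u)) = exp (g u - g (\<i> * of_real (Im u)))" if "u \<in> T" for u
  unfolding sgnexp Fg[OF T(3)[OF that]] Fg[OF gc] exp_diff ..
 have pexp: "q (exp u) = X (Re u)*e u" if z: "u \<in> T" for u
 proof(cases "Re u = - h")
  case True
  thus ?thesis by(simp add: q_def norm_exp_eq_Re X0)
 next
  case False
  hence "- h < Re u" using z T(2) by force
  moreover have "Ln (F (exp u)/F (sgn (exp u))) = g u - g (\<i> * of_real (Im u))"
   unfolding Fr[OF z] using small[OF z] by(intro Ln_exp) auto
  ultimately show ?thesis by(simp add: q_def norm_exp_eq_Re e_def)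
 qed
 have LnT: "Ln z \<in> T" if "exp (- h) <= norm z" "norm z <= 1" for z
 proof -
  have z0: "z ~= 0" using that half by auto
  show ?thesis using that z0 ln_mono[of "exp (- h)" "norm z"] by(simp add: T(2) Re_Ln)
 qed
 have pLn: "q z = X (ln (norm z))*e (Ln z)" if "exp (- h) <= norm z" "norm z <= 1" for z
 proof -
  have z0: "z ~= 0" using that half by auto
  show ?thesis using pexp[OF LnT[OF that]] z0 by(simp add: Re_Ln)
 qed
 have lip1: "\<bar>q z - q w\<bar> <= k*norm (z - w)" if z: "exp (- h) <= norm z" "norm z <= 1" and w: "exp (- h) <= norm w" "norm w <= 1" for z w
 proof -
  have zw0: "z ~= 0" "w ~= 0" using z w half by auto
  define u where "u = Ln z"
  \<comment> \<open>Not \<open>Ln w\<close>: across the branch cut the two principal logarithms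
    would be far apart, whereas this logarithm of \<open>w\<close> is close to
    \<open>u\<close>.\<close>
  define om where "om = u + Ln (w/z)"
  have ez: "exp u = z" using zw0 by(simp add: u_def)
  have ew: "exp om = w" using zw0 by(simp add: om_def exp_add ez)
  have zT: "u \<in> T" unfolding u_def by(rule LnT[OF z])
  have "norm w = exp (Re om)" using ew norm_exp_eq_Re by metis
  hence wT: "om \<in> T" using w by(simp add: T(2))
  have n: "1/2 <= norm z" "1/2 <= norm w" using z w half by linarith+
  have "norm (u - om) = norm (Ln (w/z))" by(simp add: om_def)
  also have "... <= 10*norm (w/z - 1)"
  proof(rule norm_Ln_le)
   have "1/2/1 <= norm w/norm z" using n z by(intro frac_le) auto
   thus "1/2 <= norm (w/z)" by(simp add: norm_divide)
   have "norm w/norm z <= 1/(1/2)" using n w by(intro frac_le) auto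
   thus "norm (w/z) <= 2" by(simp add: norm_divide)
  qed
  also have "w/z - 1 = (w - z)/z" using zw0 by(simp add: field_simps)
  also have "10*norm ((w - z)/z) <= 10*(norm (w - z)/(1/2))"
   unfolding norm_divide using n by(intro mult_left_mono divide_left_mono) (auto simp: zw0)
  finally have d: "norm (u - om) <= 20*norm (z - w)" by(simp add: norm_minus_commute)
  have "\<bar>q z - q w\<bar> <= 6*M*h*norm (u - om)"
   using plip[OF zT wT] pexp[OF zT] pexp[OF wT] ez ew by simp
  also have "... <= 6*M*h*(20*norm (z - w))" using d M h by(intro mult_left_mono) auto
  also have "... = 120*M*h*norm (z - w)" by simp
  also have "... <= k*norm (z - w)" using Mh by(rule mult_right_mono) simp
  finally show ?thesis .
 qed
 have lip2: "\<bar>q z\<bar> <= k*norm (z - w)" if z: "exp (- h) <= norm z" "norm z <= 1" and w: "norm w <= exp (- h)" for z w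
 proof -
  have z0: "0 < norm z" using z half by linarith
  have "ln (norm z) + h = ln (norm z*exp h)" using z0 by(simp add: ln_mult)
  also have "... <= norm z*exp h - 1" using z0 by(intro ln_le_minus_one) simp
  also have "... = (norm z - exp (- h))*exp h" by(simp add: algebra_simps exp_minus)
  also have "... <= norm (z - w)*2"
   using z w exp2 norm_triangle_ineq2[of z w] by(intro mult_mono) auto
  finally have l: "ln (norm z) + h <= norm (z - w)*2" .
  have "X (ln (norm z)) = \<bar>X (ln (norm z)) - X (- h)\<bar>" using X0 X01 by simp
  also have "... <= 2/h*\<bar>ln (norm z) - (- h)\<bar>" by(rule Xlip)
  also have "\<bar>ln (norm z) - (- h)\<bar> = ln (norm z) + h"
   using LnT[OF z] z0 T(2) by(simp add: Re_Ln)
  also have "2/h*(ln (norm z) + h) <= 2/h*(norm (z - w)*2)" using l h by(intro mult_left_mono) auto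
  finally have Xb: "X (ln (norm z)) <= 2/h*(norm (z - w)*2)" .
  have "\<bar>q z\<bar> = X (ln (norm z))*\<bar>e (Ln z)\<bar>" unfolding pLn[OF z] using X01 by(simp add: abs_mult)
  also have "... <= (2/h*(norm (z - w)*2))*(2*M*h*h)"
   using Xb eb[OF LnT[OF z]] h(1) by(intro mult_mono) auto
  also have "... = 8*M*h*norm (z - w)" using h by(simp add: field_simps)
  also have "... <= k*norm (z - w)" using Mh M h by(intro mult_right_mono) auto
  finally show ?thesis .
 qed
 have lip: "\<bar>q z - q w\<bar> <= k*norm (z - w)" if zw: "norm z <= 1" "norm w <= 1" for z w
 proof -
  consider "exp (- h) <= norm z" "exp (- h) <= norm w" | "exp (- h) <= norm z" "norm w < exp (- h)"
   | "norm z < exp (- h)" "exp (- h) <= norm w" | "norm z < exp (- h)" "norm w < exp (- h)" by linarith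
  thus ?thesis
  proof cases
   case 1 thus ?thesis using lip1 zw by blast
  next
   case 2 thus ?thesis using lip2[of z w] zw by(simp add: q_def)
  next
   case 3 thus ?thesis using lip2[of w z] zw by(simp add: q_def norm_minus_commute)
  next
   case 4 thus ?thesis using k by(simp add: q_def)
  qed
 qed
 \<comment> \<open>The real axis contains the cut of \<open>Ln\<close>, and on the circle the cutoff
   has its corner.\<close>
 define Z where "Z = {z. Im z = 0} \<union> sphere 0 (exp (- h/2))"
 have negZ: "negligible Z"
 proof -
  have "{z. Im z = 0} = {z. \<i> \<bullet> z = 0}" by(simp add: inner_complex_def)
  hence "negligible {z. Im z = 0}" using negligible_hyperplane[of \<i> 0] by simp
  thus ?thesis unfolding Z_def using negligible_sphere by(rule negligible_Un)
 qed
 have pd: "q differentiable (at z)" if z: "exp (- h) < norm z" "norm z < 1" "z \<notin> Z" for z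
 proof -
  have z0: "z ~= 0" using z by auto
  have Imz: "Im z ~= 0" and nz: "norm z ~= exp (- h/2)" using z(3) by(auto simp: Z_def)
  have zR: "z \<notin> \<real>\<^sub>\<le>\<^sub>0" using Imz by(auto simp: complex_nonpos_Reals_iff)
  have "Ln z \<in> T" using LnT z by simp
  hence "e differentiable (at (Ln z))" using ed[OF T(3)] unfolding differentiable_def by blast
  moreover have dLn: "Ln differentiable (at z)"
   using has_field_derivative_Ln[OF zR] by(auto simp: has_field_derivative_def differentiable_def)
  ultimately have de: "(%z. e (Ln z)) differentiable (at z)"
   using differentiable_chain_at[of Ln z e] by(simp add: o_def)
  have dl: "(%z. ln (norm z)) differentiable (at z)"
  proof -
   have "(%z. Re (Ln z)) differentiable (at z)"
    using dLn by(auto simp: differentiable_def intro: bounded_linear.has_derivative[OF bounded_linear_Re])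
   then obtain D where "((%z. Re (Ln z)) has_derivative D) (at z)" unfolding differentiable_def by blast
   hence "((%z. ln (norm z)) has_derivative D) (at z)"
    by(rule has_derivative_transform_within_open[of _ _ _ _ "- {0}"]) (use z0 in \<open>auto simp: Re_Ln\<close>)
   thus ?thesis unfolding differentiable_def by blast
  qed
  define W where "W = {y :: complex. exp (- h) < norm y} \<inter> {y. norm y < 1}"
  have W: "open W" "z \<in> W" unfolding W_def using z by(auto intro!: open_Int open_Collect_less continuous_intros)
  have pW: "q y = X (ln (norm y))*e (Ln y)" if "y \<in> W" for y using pLn[of y] that by(simp add: W_def)
  consider "norm z < exp (- h/2)" | "exp (- h/2) < norm z" using nz by linarith
  thus ?thesis
  proof cases
   case 1
   have op: "open (W \<inter> {y. norm y < exp (- h/2)})" using W by(intro open_Int open_Collect_less continuous_intros)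
   have "(%z. (2*(ln (norm z) + h)/h)*e (Ln z)) differentiable (at z)"
    using h by(intro derivative_intros differentiable_mult differentiable_divide differentiable_add de dl differentiable_const) auto
   then obtain D where D: "((%z. (2*(ln (norm z) + h)/h)*e (Ln z)) has_derivative D) (at z)"
    unfolding differentiable_def by blast
   have "(q has_derivative D) (at z)"
   proof(rule has_derivative_transform_within_open[OF D op])
    show "z \<in> W \<inter> {y. norm y < exp (- h/2)}" using 1 W by simp
    fix y assume y: "y \<in> W \<inter> {y. norm y < exp (- h/2)}"
    hence y0: "0 < norm y" "exp (- h) < norm y" using exp_gt_zero[of "- h"] unfolding W_def by(auto intro: less_trans)
    have "ln (norm y) < - h/2" using y y0 ln_less_cancel_iff[of "norm y" "exp (- h/2)"] by simp
    moreover have "- h < ln (norm y)" using y0 ln_less_cancel_iff[of "exp (- h)" "norm y"] by simp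
    ultimately have "X (ln (norm y)) = 2*(ln (norm y) + h)/h" using h by(auto simp: X_def max_def min_def field_simps)
    thus "2*(ln (norm y) + h)/h*e (Ln y) = q y" using pW y by simp
   qed
   thus ?thesis unfolding differentiable_def by blast
  next
   case 2
   have op: "open (W \<inter> {y. exp (- h/2) < norm y})" using W by(intro open_Int open_Collect_less continuous_intros)
   obtain D where D: "((%z. e (Ln z)) has_derivative D) (at z)" using de unfolding differentiable_def by blast
   have "(q has_derivative D) (at z)"
   proof(rule has_derivative_transform_within_open[OF D op])
    show "z \<in> W \<inter> {y. exp (- h/2) < norm y}" using 2 W by simp
    fix y assume y: "y \<in> W \<inter> {y. exp (- h/2) < norm y}"
    hence "- h/2 < ln (norm y)" using ln_less_cancel_iff[of "exp (- h/2)" "norm y"] exp_gt_zero[of "- h/2"] by force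
    hence "X (ln (norm y)) = 1" using h by(auto simp: X_def max_def min_def field_simps)
    thus "e (Ln y) = q y" using pW y by simp
   qed
   thus ?thesis unfolding differentiable_def by blast
  qed
 qed
 have rad: "F z*exp (- \<i> * of_real (q z)) = of_real (norm (F z))*F (sgn z)"
  if z: "exp (- h/2) <= norm z" "norm z <= 1" for z
 proof -
  have "exp (- h) <= exp (- h/2)" using h by simp
  hence ze: "exp (- h) <= norm z" using z by linarith
  have z0: "z ~= 0" using ze half by auto
  have "- h/2 <= ln (norm z)" using ln_mono[of "exp (- h/2)" "norm z"] z z0 by simp
  hence "X (ln (norm z)) = 1" using h by(auto simp: X_def max_def min_def field_simps)
  hence p: "q z = e (Ln z)" using pLn[OF ze z(2)] by simp
  define u where "u = Ln z"
  define y where "y = \<i> * of_real (Im u)"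
  have zT: "u \<in> T" unfolding u_def by(rule LnT[OF ze z(2)])
  have ez: "exp u = z" using z0 by(simp add: u_def)
  have Fz: "F z = exp (g u)" using Fg[OF T(3)[OF zT]] ez by simp
  have Fs: "F (sgn z) = exp (g y)" unfolding y_def using Fg[OF gc] sgnexp[of u] ez by simp
  have ry: "Re (g y) = 0" by(rule Re0) (simp add: y_def)
  have "g u + (- \<i> * of_real (q z)) = of_real (Re (g u)) + g y"
   unfolding p e_def u_def[symmetric] y_def[symmetric] using ry by(simp add: complex_eq_iff)
  hence "exp (g u)*exp (- \<i> * of_real (q z)) = exp (of_real (Re (g u)))*exp (g y)"
   by(metis exp_add)
  thus ?thesis unfolding Fz Fs by(simp add: norm_exp_eq_Re exp_of_real)
 qed
 have "collar_phase F k (exp (- h)) (exp (- h/2)) V q Z"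
  unfolding collar_phase_def
 proof(intro conjI allI impI)
  show "1 - k < exp (- h)" using eeta h k by linarith
  show "z \<in> V" if "exp (- h) <= norm z" "norm z <= 1" for z
  proof -
   have "z ~= 0" using that half by auto
   thus ?thesis using cV[OF T(3)[OF LnT[OF that]]] by simp
  qed
  show "q z = 0" if "norm z = 1" for z
   using pLn[of z] e0[of "Ln z"] that h by(cases "z = 0") (auto simp: Re_Ln)
 qed (use h V lip rad negZ pd in \<open>auto simp: q_def\<close>)
 thus ?thesis by(rule that)
qed

section \<open>Approximate Beltrami solutions that are radial near the circle\<close>

lemma norm_exp_ii_diff_le:
 fixes a b :: real
 shows "norm (exp (- \<i> * of_real a) - exp (- \<i> * of_real b)) <= \<bar>a - b\<bar>"
proof -
 have "norm ((%t::real. exp (- \<i> * of_real t)) a - exp (- \<i> * of_real b)) <= 1*norm (a - b)"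
 proof(rule differentiable_bound[where S = UNIV and f' = "%t x. x *\<^sub>R (- \<i>*exp (- \<i> * of_real t))"])
  fix t :: real
  have "((%t::real. exp (- \<i> * of_real t)) has_vector_derivative (- \<i>*exp (- \<i> * of_real t))) (at t)"
  proof -
   have "((%t::real. - \<i> * of_real t) has_vector_derivative - \<i>) (at t)"
    by(auto intro!: derivative_eq_intros)
   from field_vector_diff_chain_at[OF this DERIV_exp] show ?thesis by(simp add: o_def)
  qed
  thus "((%t::real. exp (- \<i> * of_real t)) has_derivative (%x. x *\<^sub>R (- \<i>*exp (- \<i> * of_real t)))) (at t within UNIV)"
   by(simp add: has_vector_derivative_def)
  show "onorm (%x. x *\<^sub>R (- \<i>*exp (- \<i> * of_real t))) <= 1"
   by(rule onorm_bound) (auto simp: norm_mult norm_exp_eq_Re)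
 qed auto
 thus ?thesis by simp
qed

lemma disc_map_deriv_lower_bound:
 assumes l: "!!w. norm w <= 1 ==> l*norm (w - z) <= norm (F w - F z)" and z: "norm z < 1"
  and d: "(F has_field_derivative c) (at z)"
 shows "l <= norm c"
proof -
 have "((%w. (F w - F z)/(w - z)) \<longlongrightarrow> c) (at z)"
  using d by(simp add: has_field_derivative_iff)
 hence "((%w. norm ((F w - F z)/(w - z))) \<longlongrightarrow> norm c) (at z)" by(rule tendsto_norm)
 moreover have "eventually (%w. l <= norm ((F w - F z)/(w - z))) (at z)"
 proof -
  have "eventually (%w. w \<in> ball 0 1 \<and> w ~= z) (at z)"
   using z by(auto simp: eventually_at_topological intro!: exI[of _ "ball 0 1"])
  thus ?thesis
  proof eventually_elim
   case (elim w)
   hence "norm w <= 1" "norm (w - z) > 0" by auto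
   thus ?case using l[of w] by(simp add: norm_divide pos_le_divide_eq)
  qed
 qed
 ultimately show ?thesis by(rule tendsto_lowerbound) (simp add: trivial_limit_at)
qed

lemma real_linear_complex:
 fixes D :: "complex => real"
 assumes D: "linear D" and b: "!!w. \<bar>D w\<bar> <= k*norm w"
 obtains a where "!!w. of_real (D w) = a*w + cnj a*cnj w" "norm a <= k"
proof -
 define a where "a = Complex (D 1/2) (- D \<i>/2)"
 have Dw: "D w = Re w*D 1 + Im w*D \<i>" for w
 proof -
  have "w = Re w *\<^sub>R 1 + Im w *\<^sub>R \<i>" by(simp add: complex_eq_iff)
  hence "D w = D (Re w *\<^sub>R 1 + Im w *\<^sub>R \<i>)" by simp
  also have "... = Re w*D 1 + Im w*D \<i>"
   by(simp only: linear_add[OF D] linear_scale[OF D] real_scaleR_def)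
  finally show ?thesis .
 qed
 have 1: "of_real (D w) = a*w + cnj a*cnj w" for w
  by(subst Dw) (simp add: complex_eq_iff a_def algebra_simps)
 have "\<bar>D 1\<bar> <= k" "\<bar>D \<i>\<bar> <= k" using b[of 1] b[of \<i>] by simp_all
 hence "norm a <= k" using cmod_le[of a] by(simp add: a_def)
 with 1 show ?thesis by(rule that)
qed

text \<open>The exceptional set \<open>B\<close> is the untreated remainder together with the
  collar. The bound \<open>(1 + k)/2\<close> for the dilatation persists on it: the map is conformal
  on the remainder inside the collar, and \<open>norm b\<close> is at most half of
  \<open>norm al\<close> in the collar. Off \<open>B\<close> the bound is
  \<open>k + ep\<close>.\<close>

theorem beltrami_approximation:
 assumes k: "0 <= k" "k < 1" and ep: "0 < ep" "ep <= (1 - k)/2"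
  and mk: "!!z. norm (m z) <= k" and cont: "continuous_on UNIV m"
 obtains F l L r B Z where "0 < l" "0 < L"
  "!!z w. norm z <= 1 ==> norm w <= 1 ==> l*norm (z - w) <= norm (F z - F w)"
  "!!z w. norm z <= 1 ==> norm w <= 1 ==> norm (F z - F w) <= L*norm (z - w)"
  "F ` ball 0 1 = ball 0 1" "F ` sphere 0 1 = sphere 0 1"
  "0 < r" "r < 1" "!!z :: complex. r <= norm z ==> norm z <= 1 ==> F z = of_real (norm (F z))*F (sgn z)"
  "negligible Z" "B \<in> lmeasurable" "measure lebesgue B < ep"
  "!!z. norm z < 1 ==> z \<notin> Z ==> \<exists>al b. (F has_derivative (%w. al*w + b*cnj w)) (at z) \<and> al ~= 0 \<and>
    norm b <= (1 + k)/2*norm al \<and> (z \<notin> B --> norm (b - m z*al) <= ep*norm al)"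
proof -
 have e1: "ep <= 1" "0 < ep/2" using ep k by auto
 obtain F0 U where st: "qc_state m ep F0 U" and mU: "measure lebesgue U < ep/2"
  using qc_exhaust[OF k ep(1) e1(1) mk cont e1(2)] by blast
 obtain Z0 where dm: "disc_map F0" and U: "open U" "U \<subseteq> ball 0 1" "F0 holomorphic_on U"
  and Z0: "negligible Z0" "!!z. z \<in> ball 0 1 - U - Z0 ==> \<exists>al b.
   (F0 has_derivative (%w. al*w + b*cnj w)) (at z) \<and> al ~= 0 \<and>
   norm (b - m z*al) <= ep*norm al"
  using st unfolding qc_state_def by blast
 obtain l L where lL: "0 < l" "0 < L"
  "!!z w. norm z <= 1 ==> norm w <= 1 ==> l*norm (z - w) <= norm (F0 z - F0 w)"
  "!!z w. norm z <= 1 ==> norm w <= 1 ==> norm (F0 z - F0 w) <= L*norm (z - w)"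
  using disc_map_bilipschitz[OF dm] by metis
 \<comment> \<open>The entries serve, in this order: the bound 2 on \<open>1 + r0\<close> and the
   like, the area of the collar (\<open>8*ka\<close> is at most \<open>ep/2\<close>),
   \<open>norm b\<close> at most half of \<open>norm al\<close> there, and the lower Lipschitz bound
   \<open>l/2\<close>.\<close>
 define ka where "ka = min 1 (min (ep/16) (min (l/4) (l/(2*(L + 1)))))"
 have ka: "0 < ka" "ka <= 1" "ka <= ep/16" "ka <= l/4" "ka <= l/(2*(L + 1))"
 proof -
  show "0 < ka" using lL(1,2) ep by(simp add: ka_def)
  show "ka <= 1" unfolding ka_def by(rule min.cobounded1)
  show "ka <= ep/16" unfolding ka_def by(rule min.coboundedI2) (rule min.cobounded1)
  show "ka <= l/4" unfolding ka_def by(rule min.coboundedI2, rule min.coboundedI2) (rule min.cobounded1)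
  show "ka <= l/(2*(L + 1))" unfolding ka_def by(rule min.coboundedI2, rule min.coboundedI2) (rule min.cobounded2)
 qed
 have kL: "ka*(L + 1) <= l/2" using ka(5) lL(2) by(simp add: field_simps)
 obtain r0 r1 V q Zp where cp: "collar_phase F0 ka r0 r1 V q Zp"
  using disc_map_collar_phase[OF dm ka(1,2)] .
 have r: "0 < r0" "r0 < r1" "r1 < 1" "1 - ka < r0"
  and V: "open V" "!!z. r0 <= norm z ==> norm z <= 1 ==> z \<in> V" "F0 holomorphic_on V"
  and q0: "!!z. norm z <= r0 ==> q z = 0" "!!z. norm z = 1 ==> q z = 0"
  and ql: "!!z w. norm z <= 1 ==> norm w <= 1 ==> \<bar>q z - q w\<bar> <= ka*norm (z - w)"
  and rad: "!!z. r1 <= norm z ==> norm z <= 1 ==> F0 z*exp (- \<i> * of_real (q z)) = of_real (norm (F0 z))*F0 (sgn z)"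
  and Zp: "negligible Zp" "!!z. r0 < norm z ==> norm z < 1 ==> z \<notin> Zp ==> q differentiable (at z)"
  using cp unfolding collar_phase_def by(elim conjE; blast)+
 define F where "F z = F0 z*exp (- \<i> * of_real (q z))" for z
 have Fn: "norm (F z) = norm (F0 z)" for z by(simp add: F_def norm_mult norm_exp_eq_Re)
 have F0n: "norm (F0 z) <= 1" if "norm z <= 1" for z using disc_map_norm[OF dm that] by simp
 have qb: "\<bar>q z\<bar> <= ka" if "norm z <= 1" for z
 proof -
  have "\<bar>q z - q 0\<bar> <= ka*norm (z - 0)" using ql[of z 0] that by simp
  also have "... <= ka*1" using that ka by(intro mult_left_mono) auto
  finally show ?thesis using q0(1)[of 0] r by simp
 qed
 have pert: "norm ((F z - F w) - (F0 z - F0 w)) <= l/2*norm (z - w)" if zw: "norm z <= 1" "norm w <= 1" for z w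
 proof -
  let ?e = "%z. exp (- \<i> * of_real (q z))"
  have "(F z - F w) - (F0 z - F0 w) = (F0 z - F0 w)*(?e z - 1) + F0 w*(?e z - ?e w)"
   by(simp add: F_def algebra_simps)
  hence "norm ((F z - F w) - (F0 z - F0 w)) <= norm (F0 z - F0 w)*norm (?e z - 1) + norm (F0 w)*norm (?e z - ?e w)"
   by(metis norm_triangle_ineq norm_mult)
  also have "... <= (L*norm (z - w)) * ka + 1*(ka*norm (z - w))"
  proof(intro add_mono mult_mono)
   show "norm (?e z - 1) <= ka" using norm_exp_ii_diff_le[of "q z" 0] qb[OF zw(1)] by simp
   show "norm (?e z - ?e w) <= ka*norm (z - w)"
    using norm_exp_ii_diff_le[of "q z" "q w"] ql[OF zw] by linarith
  qed (use lL(4)[OF zw] F0n zw lL(2) in auto)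
  also have "... = ka*(L + 1)*norm (z - w)" by(simp add: algebra_simps)
  also have "... <= l/2*norm (z - w)" using kL by(rule mult_right_mono) simp
  finally show ?thesis .
 qed
 have Flow: "l/2*norm (z - w) <= norm (F z - F w)" if "norm z <= 1" "norm w <= 1" for z w
  using pert[OF that] lL(3)[OF that] norm_triangle_ineq3[of "F z - F w" "F0 z - F0 w"] by linarith
 have Fup: "norm (F z - F w) <= (L + l)*norm (z - w)" if "norm z <= 1" "norm w <= 1" for z w
 proof -
  have "norm (F z - F w) <= L*norm (z - w) + l/2*norm (z - w)"
   using pert[OF that] lL(4)[OF that] norm_triangle_ineq3[of "F z - F w" "F0 z - F0 w"] by linarith
  also have "... <= L*norm (z - w) + l*norm (z - w)" using lL(1) by(intro add_left_mono mult_right_mono) auto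
  finally show ?thesis by(simp add: algebra_simps)
 qed
 have img: "F ` ball 0 1 = ball 0 1" "F ` sphere 0 1 = sphere 0 1"
 proof -
  have "(L + l)-lipschitz_on (cball 0 1) F"
   using Fup lL by(intro lipschitz_onI) (auto simp: dist_norm)
  hence c: "continuous_on (cball 0 1) F" by(rule lipschitz_on_continuous_on)
  have i: "inj_on F (cball 0 1)"
  proof(rule inj_onI)
   fix z w assume "z \<in> cball 0 1" "w \<in> cball 0 1" "F z = F w"
   thus "z = w" using Flow[of z w] lL(1) by(simp add: mult_le_0_iff)
  qed
  have "F ` sphere 0 1 \<subseteq> sphere 0 1"
   using disc_map_image(2)[OF dm] by(auto simp: F_def q0(2))
  thus "F ` ball 0 1 = ball 0 1" "F ` sphere 0 1 = sphere 0 1"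
   using injective_disc_image[OF c i] by auto
 qed
 define B where "B = U \<union> (ball 0 1 - ball 0 r0)"
 have lmU: "U \<in> lmeasurable" using U(1) bounded_subset[OF bounded_ball U(2)] by(rule lmeasurable_open[rotated])
 have B: "B \<in> lmeasurable" unfolding B_def using lmU by(intro fmeasurable.Un fmeasurable.Diff) auto
 have mB: "measure lebesgue B < ep"
 proof -
  have "measure lebesgue (ball 0 1 - ball (0::complex) r0) = measure lebesgue (ball (0::complex) 1) - measure lebesgue (ball (0::complex) r0)"
   using r by(intro measurable_measure_Diff) auto
  also have "... = pi*(1 - r0^2)"
   using r by(simp add: content_ball unit_ball_vol_2 algebra_simps)
  also have "... <= 4*(2 * ka)"
  proof(intro mult_mono)
   have "1 - r0^2 = (1 - r0)*(1 + r0)" by(simp add: power2_eq_square algebra_simps)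
   also have "... <= ka*2" using r ka by(intro mult_mono) auto
   finally show "1 - r0^2 <= 2 * ka" by simp
  qed (use pi_less_4 r in \<open>auto simp: power_le_one\<close>)
  also have "... <= ep/2" using ka by simp
  finally have "measure lebesgue (ball 0 1 - ball (0::complex) r0) <= ep/2" .
  moreover have "measure lebesgue B <= measure lebesgue U + measure lebesgue (ball 0 1 - ball (0::complex) r0)"
   unfolding B_def using lmU by(intro measure_Un_le) auto
  ultimately show ?thesis using mU by linarith
 qed
 define Z where "Z = Z0 \<union> Zp \<union> sphere 0 r0"
 have Z: "negligible Z" unfolding Z_def by(intro negligible_Un Z0 Zp negligible_sphere)
 have der: "\<exists>al b. (F has_derivative (%w. al*w + b*cnj w)) (at z) \<and> al ~= 0 \<and>
    norm b <= (1 + k)/2*norm al \<and> (z \<notin> B --> norm (b - m z*al) <= ep*norm al)"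
  if z1: "norm z < 1" and zZ: "z \<notin> Z" for z
 proof -
  consider "norm z < r0" "z \<in> U" | "norm z < r0" "z \<notin> U" | "r0 < norm z"
   using zZ by(force simp: Z_def)
  thus ?thesis
  proof cases
   case 1
   have "(F0 has_field_derivative deriv F0 z) (at z)" by(rule holomorphic_derivI[OF U(3,1) 1(2)])
   moreover from disc_map_deriv_nonzero[OF dm z1 this] have "deriv F0 z ~= 0" .
   ultimately have "(F0 has_derivative (%w. deriv F0 z*w + 0*cnj w)) (at z)" "deriv F0 z ~= 0"
    by(simp_all add: has_field_derivative_def)
   moreover from this(1) have "(F has_derivative (%w. deriv F0 z*w + 0*cnj w)) (at z)"
    by(rule has_derivative_transform_within_open[of _ _ _ _ "ball 0 r0"])
     (use 1 q0 in \<open>auto simp: F_def\<close>)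
   moreover have "z \<in> B" using 1 by(simp add: B_def)
   ultimately show ?thesis using k by(intro exI[of _ "deriv F0 z"] exI[of _ 0]) auto
  next
   case 2
   hence "z \<in> ball 0 1 - U - Z0" using z1 zZ by(auto simp: Z_def)
   from Z0(2)[OF this] obtain al b where ab: "(F0 has_derivative (%w. al*w + b*cnj w)) (at z)"
    "al ~= 0" "norm (b - m z*al) <= ep*norm al" by blast
   have "(F has_derivative (%w. al*w + b*cnj w)) (at z)"
    by(rule has_derivative_transform_within_open[OF ab(1), of "ball 0 r0"])
     (use 2 q0 in \<open>auto simp: F_def\<close>)
   moreover have "norm b <= (1 + k)/2*norm al"
   proof -
    have "norm b <= norm (m z*al) + norm (b - m z*al)" by(rule norm_triangle_sub)
    also have "... <= k*norm al + ep*norm al"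
     using ab(3) mk[of z] by(intro add_mono) (auto simp: norm_mult intro: mult_right_mono)
    also have "... = (k + ep)*norm al" by(simp add: algebra_simps)
    also have "... <= (1 + k)/2*norm al" using ep(2) by(intro mult_right_mono) (auto simp: field_simps)
    finally show ?thesis .
   qed
   ultimately show ?thesis using ab by blast
  next
   case 3
   have zV: "z \<in> V" using V(2) 3 z1 by simp
   define c where "c = deriv F0 z"
   have F0d: "(F0 has_field_derivative c) (at z)" unfolding c_def by(rule holomorphic_derivI[OF V(3,1) zV])
   have lc: "l <= norm c" by(rule disc_map_deriv_lower_bound[OF _ z1 F0d]) (use lL(3) z1 in auto)
   obtain D where D: "(q has_derivative D) (at z)"
    using Zp(2)[OF 3 z1] zZ unfolding Z_def differentiable_def by blast
   have Dl: "linear D" using D by(rule has_derivative_linear)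
   have Db: "\<bar>D w\<bar> <= ka*norm w" for w
    using lipschitz_has_derivative_bound[OF D open_ball, of 0 1 ka w] ql z1 by simp
   obtain a where a: "!!w. of_real (D w) = a*w + cnj a*cnj w" "norm a <= ka"
    using real_linear_complex[OF Dl Db] by blast
   let ?e = "exp (- \<i> * of_real (q z))"
   have ed: "((%z. exp (- \<i> * of_real (q z))) has_derivative (%w. ?e*(- \<i> * of_real (D w)))) (at z)"
   proof -
    have "((%z. - \<i> * of_real (q z)) has_derivative (%w. - \<i> * of_real (D w))) (at z)"
     by(intro has_derivative_mult_right has_derivative_of_real D)
    moreover have "(exp has_derivative (%w. ?e*w)) (at (- \<i> * of_real (q z)))"
     using DERIV_exp[of "- \<i> * of_real (q z)"] by(simp add: has_field_derivative_def)
    ultimately show ?thesis using diff_chain_at by(fastforce simp: o_def)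
   qed
   have "(F0 has_derivative (%w. c*w)) (at z)" using F0d by(simp add: has_field_derivative_def)
   from has_derivative_mult[OF this ed]
   have FD: "(F has_derivative (%w. F0 z*(?e*(- \<i> * of_real (D w))) + c*w*?e)) (at z)"
    unfolding F_def .
   define al b where "al = ?e*(c - \<i>*F0 z*a)" and "b = ?e*(- \<i>*F0 z*cnj a)"
   have "(%w. F0 z*(?e*(- \<i> * of_real (D w))) + c*w*?e) = (%w. al*w + b*cnj w)"
    unfolding a(1) al_def b_def by(rule ext) (simp add: algebra_simps)
   hence FD': "(F has_derivative (%w. al*w + b*cnj w)) (at z)" using FD by simp
   have en: "norm ?e = 1" by(simp add: norm_exp_eq_Re)
   have Fa: "norm (F0 z*a) <= 1 * ka" unfolding norm_mult using F0n[of z] z1 a(2) by(intro mult_mono) auto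
   have bn: "norm b <= ka" unfolding b_def norm_mult en using Fa by(simp add: norm_mult)
   have "norm c <= norm (c - \<i>*F0 z*a) + norm (\<i>*F0 z*a)"
    using norm_triangle_sub[of c "\<i>*F0 z*a"] by linarith
   moreover have "norm (\<i>*F0 z*a) <= ka" using Fa by(simp add: norm_mult)
   moreover have "norm al = norm (c - \<i>*F0 z*a)" unfolding al_def norm_mult en by simp
   ultimately have an: "3 * ka <= norm al" using lc ka(4) by linarith
   have "norm b <= 1/2*norm al" using an bn ka(1) by linarith
   also have "... <= (1 + k)/2*norm al" using k by(intro mult_right_mono) auto
   finally have "norm b <= (1 + k)/2*norm al" .
   moreover have "al ~= 0" using an ka(1) by auto
   moreover have "z \<in> B" using 3 z1 by(simp add: B_def)
   ultimately show ?thesis using FD' by blast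
  qed
 qed
 have rad': "F z = of_real (norm (F z))*F (sgn z)" if "r1 <= norm z" "norm z <= 1" for z
 proof -
  have "z ~= 0" using that r by auto
  hence "norm (sgn z) = 1" by(simp add: norm_sgn)
  hence Fs: "F (sgn z) = F0 (sgn z)" by(simp add: F_def q0(2))
  show ?thesis unfolding Fs Fn using rad[OF that] unfolding F_def .
 qed
 show ?thesis
  by(rule that[of "l/2" "L + l" F r1 Z B]) (use Flow Fup img rad' r Z B mB der lL(1,2) in simp_all)
qed

subsection \<open>Test functions and weak gradients\<close>

text \<open>Polynomials in \<open>1/t\<close> times \<open>exp (- 1/t)\<close>, extended by 0, form
  a family closed under differentiation; smoothness of the usual bump becomes an induction on the
  order.\<close>

definition flatexp :: "real poly => real => real" where
 "flatexp p t = (if t <= 0 then 0 else poly p (inverse t)*exp (- inverse t))"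

lemma poly_times_exp_tendsto_0:
 "((%x. x ^ n*poly p x*exp (- x)) \<longlongrightarrow> (0::real)) at_top"
proof(induction p arbitrary: n)
 case 0
 thus ?case by simp
next
 case (pCons a p)
 have "((%x. a*(x ^ n/exp x)) \<longlongrightarrow> a*0) at_top"
  by(intro tendsto_mult_left tendsto_power_div_exp_0)
 from tendsto_add[OF this pCons.IH[of "Suc n"]] show ?case
  by(simp add: exp_minus divide_inverse algebra_simps)
qed

text \<open>With \<open>x = 1/t\<close> the derivative of \<open>p(x) * exp (- x)\<close> in
  \<open>t\<close> is \<open>x^2 * (p(x) - p'(x)) * exp (- x)\<close>.\<close>

definition flatexp_deriv :: "real poly => real poly" where
 "flatexp_deriv p = [:0, 0, 1:]*(p - pderiv p)"

lemma DERIV_flatexp: "(flatexp p has_real_derivative flatexp (flatexp_deriv p) t) (at t)"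
proof -
 consider "t > 0" | "t < 0" | "t = 0" by linarith
 thus ?thesis
 proof cases
  case 1
  have "((%t. poly p (inverse t)*exp (- inverse t)) has_real_derivative
    flatexp (flatexp_deriv p) t) (at t)"
   using 1 by(auto intro!: derivative_eq_intros simp: flatexp_def flatexp_deriv_def power2_eq_square algebra_simps)
  thus ?thesis
   by(rule has_field_derivative_transform_within_open[of _ _ _ "{0<..}"]) (use 1 in \<open>auto simp: flatexp_def\<close>)
 next
  case 2
  have "((%t. 0) has_real_derivative flatexp (flatexp_deriv p) t) (at t)"
   using 2 by(simp add: flatexp_def)
  thus ?thesis
   by(rule has_field_derivative_transform_within_open[of _ _ _ "{..<0}"]) (use 2 in \<open>auto simp: flatexp_def\<close>)
 next
  case 3
  have "((%h. flatexp p h/h) \<longlongrightarrow> 0) (at 0)"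
  proof(rule filterlim_split_at)
   have "((%h. 0) \<longlongrightarrow> (0::real)) (at_left 0)" by simp
   thus "((%h. flatexp p h/h) \<longlongrightarrow> 0) (at_left 0)"
    by(rule Lim_transform_eventually) (auto simp: eventually_at_filter flatexp_def)
   have "((%h. (inverse h) ^ 1*poly p (inverse h)*exp (- inverse h)) \<longlongrightarrow> (0::real)) (at_right 0)"
    by(rule filterlim_compose[OF poly_times_exp_tendsto_0 filterlim_inverse_at_top_right])
   thus "((%h. flatexp p h/h) \<longlongrightarrow> 0) (at_right 0)"
    by(rule Lim_transform_eventually)
     (auto simp: eventually_at_filter flatexp_def divide_inverse mult_ac)
  qed
  thus ?thesis using 3 by(simp add: DERIV_def flatexp_def)
 qed
qed

lemma times_differentiable_on_SucD:
 "times_differentiable_on (Suc k) f U ==> times_differentiable_on k f U"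
proof(induction k arbitrary: f)
 case 0
 thus ?case
  by(auto intro!: differentiable_imp_continuous_on differentiable_at_imp_differentiable_on)
next
 case (Suc k)
 thus ?case by(metis times_differentiable_on.simps(2))
qed

lemma times_differentiable_on_add:
 "times_differentiable_on k f UNIV ==> times_differentiable_on k g UNIV ==>
 times_differentiable_on k (%x. f x + g x) UNIV"
proof(induction k arbitrary: f g)
 case 0
 thus ?case by(auto intro: continuous_intros)
next
 case (Suc k)
 have d: "f differentiable at x" "g differentiable at x" for x using Suc.prems by auto
 have "frechet_derivative (%x. f x + g x) (at x) = (%v. fder f x v + fder g x v)" for x
  by(rule frechet_derivative_at[symmetric])
   (intro has_derivative_add d[unfolded frechet_derivative_works])
 thus ?case using Suc d by(auto intro: differentiable_add)
qed

lemma times_differentiable_on_mult: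
 "times_differentiable_on k f UNIV ==> times_differentiable_on k g UNIV ==>
 times_differentiable_on k (%x. f x*g x) UNIV"
proof(induction k arbitrary: f g)
 case 0
 thus ?case by(auto intro: continuous_intros)
next
 case (Suc k)
 have d: "f differentiable at x" "g differentiable at x" for x using Suc.prems by auto
 have fd: "frechet_derivative (%x. f x*g x) (at x) =
   (%v. f x*fder g x v + fder f x v * g x)" for x
  by(rule frechet_derivative_at[symmetric])
   (intro has_derivative_mult d[unfolded frechet_derivative_works])
 have "times_differentiable_on k f UNIV" "times_differentiable_on k g UNIV"
  using Suc.prems times_differentiable_on_SucD by blast+
 moreover have "times_differentiable_on k (%x. fder f x v) UNIV"
  "times_differentiable_on k (%x. fder g x v) UNIV" for v
  using Suc.prems by simp_all
 ultimately have "times_differentiable_on k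
   (%x. f x*fder g x v + fder f x v * g x) UNIV" for v
  by(intro times_differentiable_on_add Suc.IH)
 thus ?case using fd d by(auto intro: differentiable_mult)
qed

lemma times_differentiable_on_flatexp:
 "times_differentiable_on k (%x::real^2. flatexp p (c*x $ i + d)*a) UNIV"
proof(induction k arbitrary: p a)
 case 0
 have "continuous_on UNIV (flatexp p)"
  using DERIV_flatexp by(intro DERIV_continuous_on[of _ _ "%t. flatexp (flatexp_deriv p) t"]) (auto intro: has_field_derivative_at_within)
 hence "continuous_on UNIV (%x::real^2. flatexp p (c*x $ i + d))"
  by(rule continuous_on_compose2) (auto intro!: continuous_intros)
 thus ?case by(auto intro: continuous_intros)
next
 case (Suc k)
 have hd: "((%x::real^2. flatexp p (c*x $ i + d)*a) has_derivative
   (%v. flatexp (flatexp_deriv p) (c*x $ i + d)*(c * v $ i*a))) (at x)" for x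
 proof -
  have 1: "((%x::real^2. c*x $ i + d) has_derivative (%v. c * v $ i)) (at x)"
   by(auto intro!: derivative_eq_intros bounded_linear.has_derivative[OF bounded_linear_vec_nth])
  have 2: "(flatexp p has_derivative (%h. h*flatexp (flatexp_deriv p) (c*x $ i + d))) (at (c*x $ i + d))"
   using DERIV_flatexp[of p "c*x $ i + d"] by(simp add: has_field_derivative_def mult_commute_abs)
  have "((%x::real^2. flatexp p (c*x $ i + d)) has_derivative
   (%v. c * v $ i*flatexp (flatexp_deriv p) (c*x $ i + d))) (at x)"
   using diff_chain_at[OF 1 2] by(simp add: o_def)
  from has_derivative_mult_left[OF this, of a] show ?thesis by(simp add: mult_ac)
 qed
 hence "frechet_derivative (%x::real^2. flatexp p (c*x $ i + d)*a) (at x) =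
   (%v. flatexp (flatexp_deriv p) (c*x $ i + d)*(c * v $ i*a))" for x
  by(rule frechet_derivative_at[symmetric])
 thus ?case using hd Suc.IH by(auto simp: differentiable_def)
qed

text \<open>A product of one flat factor for each side of the box. The parameter \<open>n\<close>
  steepens them, so the bumps tend to the indicator of the open box; translating the box translates
  the bump exactly, so translated bumps are test functions again.\<close>

definition boxbump :: "nat => real^2 => real^2 => real^2 => real" where
 "boxbump n a b x =
  flatexp 1 (real n*x $ 1 + - real n*a $ 1)*flatexp 1 (- real n*x $ 1 + real n*b $ 1) *
  (flatexp 1 (real n*x $ 2 + - real n*a $ 2)*flatexp 1 (- real n*x $ 2 + real n*b $ 2))"

lemma smooth_boxbump: "smooth_on (boxbump n a b) UNIV"
proof -
 have "times_differentiable_on k (%x::real^2. flatexp p (c*x $ i + d)) UNIV" for k p c i d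
  using times_differentiable_on_flatexp[of k p c i d 1] by simp
 thus ?thesis
  unfolding smooth_on_def boxbump_def[abs_def] by(intro allI times_differentiable_on_mult)
qed

lemma flatexp_1_bounds: "0 <= flatexp 1 t" "flatexp 1 t <= 1"
 by(auto simp: flatexp_def)

lemma boxbump_bounds: "0 <= boxbump n a b x" "boxbump n a b x <= 1"
 unfolding boxbump_def by(auto intro!: mult_nonneg_nonneg mult_le_one flatexp_1_bounds)

lemma boxbump_outside:
 assumes "x \<notin> box a b"
 shows "boxbump n a b x = 0"
proof -
 have "flatexp 1 (real n*x $ i + - real n*a $ i) = 0" if "x $ i <= a $ i" for i
  using mult_left_mono[OF that, of "real n"] by(simp add: flatexp_def)
 moreover have "flatexp 1 (- real n*x $ i + real n*b $ i) = 0" if "b $ i <= x $ i" for i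
  using mult_left_mono[OF that, of "real n"] by(simp add: flatexp_def)
 moreover obtain i where "\<not> (a $ i < x $ i \<and> x $ i < b $ i)" using assms by(auto simp: mem_box_cart)
 moreover have "i = 1 \<or> i = 2" by(rule exhaust_2)
 ultimately show ?thesis unfolding boxbump_def by(auto simp: not_less)
qed

lemma test_function_boxbump:
 assumes "cbox a b \<subseteq> disc"
 shows "test_function (boxbump n a b)"
proof -
 have "boxbump n a b x = 0" if "x \<notin> cbox a b" for x
  using that box_subset_cbox by(intro boxbump_outside) blast
 thus ?thesis
  unfolding test_function_def using smooth_boxbump assms
  by(intro conjI exI[of _ "cbox a b"]) auto
qed

lemma boxbump_tendsto: "(%n. boxbump n a b x) \<longlonglongrightarrow> indicator (box a b) x"
proof(cases "x \<in> box a b")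
 case False
 thus ?thesis by(simp add: boxbump_outside)
next
 case True
 have *: "(%n. flatexp 1 (real n*t)) \<longlonglongrightarrow> 1" if "t > 0" for t
 proof -
  have "filterlim (%n. real n*t) at_top sequentially"
   by(rule filterlim_at_top_mult_tendsto_pos[OF tendsto_const that filterlim_real_sequentially, THEN filterlim_cong[THEN iffD1, rotated -1]])
    (auto simp: mult_ac)
  hence "(%n. exp (- inverse (real n*t))) \<longlonglongrightarrow> exp (- 0)"
   by(intro tendsto_exp tendsto_minus tendsto_inverse_0_at_top)
  hence "(%n. exp (- inverse (real n*t))) \<longlonglongrightarrow> 1" by simp
  thus ?thesis
   by(rule Lim_transform_eventually)
    (use that in \<open>auto simp: eventually_sequentially flatexp_def mult_le_0_iff intro!: exI[of _ 1]\<close>)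
 qed
 have c: "a $ i < x $ i" "x $ i < b $ i" for i using True by(auto simp: mem_box_cart)
 have e: "real n*x $ i + - real n*a $ i = real n*(x $ i - a $ i)"
  "- real n*x $ i + real n*b $ i = real n*(b $ i - x $ i)" for n i by(simp_all add: algebra_simps)
 have "(%n. boxbump n a b x) \<longlonglongrightarrow> 1*1*(1*1)"
  unfolding boxbump_def e using c by(intro tendsto_mult *) auto
 thus ?thesis using True by simp
qed

lemma boxbump_translate: "boxbump n a b (x - w) = boxbump n (a + w) (b + w) x"
 by(simp add: boxbump_def algebra_simps)

text \<open>Extension by 0 to the whole plane makes Fubini and translation invariance available
  without boundary terms; integrability replaces square integrability, and all directions
  \<open>w\<close> are tested at once.\<close>

definition weak_gradient :: "(real^2 => real) => (real^2 => real^2) => bool" where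
 "weak_gradient h G \<longleftrightarrow> integrable lborel h \<and> integrable lborel G \<and>
  (\<forall>z. z \<notin> disc --> h z = 0 \<and> G z = 0) \<and>
  (\<forall>p w. test_function p -->
    (LI z. h z*fder p z w) = - (LI z. (G z \<bullet> w)*p z))"

lemma test_functionD:
 assumes "test_function p"
 shows "(p has_derivative fder p z) (at z)"
  "continuous_on UNIV p" "continuous_on UNIV (%z. fder p z w)"
proof -
 have "times_differentiable_on 1 p UNIV" "times_differentiable_on 0 p UNIV"
  using assms unfolding test_function_def smooth_on_def by blast+
 thus "(p has_derivative fder p z) (at z)"
  "continuous_on UNIV p" "continuous_on UNIV (%z. fder p z w)"
  by(simp_all add: frechet_derivative_works[symmetric])
qed

lemma test_function_support:
 assumes "test_function p"
 obtains K where "compact K" "K \<subseteq> disc" "!!z. z \<notin> K ==> p z = 0"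
  "!!z w. z \<notin> K ==> fder p z w = 0"
proof -
 obtain K where K: "compact K" "K \<subseteq> disc" "!!z. z \<notin> K ==> p z = 0"
  using assms unfolding test_function_def by blast
 have "fder p z w = 0" if "z \<notin> K" for z w
 proof -
  have "((%z. 0) has_derivative (%w. 0)) (at z)" by simp
  hence "(p has_derivative (%w. 0)) (at z)"
   by(rule has_derivative_transform_within_open[of _ _ _ _ "- K"])
    (use that K compact_imp_closed[OF K(1)] in auto)
  hence "fder p z = (%w. 0)" by(rule frechet_derivative_at[symmetric])
  thus ?thesis by simp
 qed
 with K show ?thesis by(rule that)
qed

lemma continuous_compact_support_bounded:
 fixes f :: "'a::metric_space => 'b::real_normed_vector"
 assumes "continuous_on UNIV f" "compact K" "!!z. z \<notin> K ==> f z = 0"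
 obtains B where "0 < B" "!!z. norm (f z) <= B"
proof -
 have "bounded (f ` K)"
  using assms by(intro compact_imp_bounded compact_continuous_image) (auto intro: continuous_on_subset)
 then obtain B where "0 < B" "!!z. z \<in> K ==> norm (f z) <= B" by(auto simp: bounded_pos)
 thus ?thesis using assms(3) by(intro that[of B]) (auto, metis less_imp_le norm_zero)
qed

lemma test_function_bounded:
 assumes "test_function p"
 obtains B where "0 < B" "!!z. \<bar>p z\<bar> <= B" "!!z. \<bar>fder p z w\<bar> <= B"
proof -
 obtain K where K: "compact K" "K \<subseteq> disc" "!!z. z \<notin> K ==> p z = 0"
  "!!z w. z \<notin> K ==> fder p z w = 0"
  using test_function_support[OF assms] by blast
 obtain B1 where B1: "0 < B1" "!!z. norm (p z) <= B1"
  using continuous_compact_support_bounded[OF test_functionD(2)[OF assms] K(1,3)] by blast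
 obtain B2 where B2: "0 < B2" "!!z. norm (fder p z w) <= B2"
  using continuous_compact_support_bounded[OF test_functionD(3)[OF assms] K(1) K(4)] by blast
 show ?thesis
 proof(rule that[of "max B1 B2"])
  show "\<bar>p z\<bar> <= max B1 B2" for z using B1(2)[of z] by simp
  show "\<bar>fder p z w\<bar> <= max B1 B2" for z using B2(2)[of z] by simp
 qed (use B1 in auto)
qed

lemma test_function_measurable:
 assumes "test_function p"
 shows "p \<in> borel_measurable borel" "(%z. fder p z w) \<in> borel_measurable borel"
 using test_functionD[OF assms] by(auto intro: borel_measurable_continuous_onI)

section \<open>Translations, corner averages and increments along segments\<close>

lemma integral_lborel_translate:
 fixes f :: "'a::euclidean_space => 'b::{banach, second_countable_topology}"
 assumes "f \<in> borel_measurable borel"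
 shows "(LI z. f (c + z)) = (LI z. f z)"
proof -
 have "(\<integral>z. f z \<partial>distr lborel borel ((+) c)) = (LI z. f (c + z))"
  using assms by(intro integral_distr) auto
 thus ?thesis by(simp add: lborel_distr_plus)
qed

lemma integrable_lborel_translate:
 fixes f :: "'a::euclidean_space => 'b::{banach, second_countable_topology}"
 assumes "integrable lborel f"
 shows "integrable lborel (%z. f (c + z))"
 by(rule integrable_distr[of "(+) c" lborel borel]) (use assms in \<open>auto simp: lborel_distr_plus\<close>)

lemma AE_not_negligible:
 fixes N :: "'a::euclidean_space set"
 assumes "negligible N"
 shows "AE z in lebesgue. z \<notin> N" "AE z in lborel. z \<notin> N"
proof -
 show "AE z in lebesgue. z \<notin> N" using assms by(intro AE_not_in) (simp add: negligible_iff_null_sets)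
 thus "AE z in lborel. z \<notin> N" by(simp add: AE_completion_iff)
qed

lemma AE_disc_not_negligible:
 assumes "negligible N"
 shows "AED z. z \<in> disc - N"
 using AE_not_negligible(1)[OF assms] by(subst AE_restrict_space_iff) auto

lemma One_vec: "(One :: real^2) = 1"
proof(rule euclidean_eqI)
 fix b :: "real^2" assume b: "b \<in> Basis"
 then obtain i where i: "b = axis i 1" by(auto simp: Basis_vec_def)
 have "(\<Sum>j\<in>Basis. 1 *\<^sub>R j) \<bullet> b = 1" using b by(rule inner_sum_left_Basis)
 thus "One \<bullet> b = 1 \<bullet> b" by(simp add: i inner_axis)
qed

lemma AE_corner_average:
 fixes f :: "real^2 => real"
 assumes f: "integrable lborel f"
 shows "AE z in lborel. ((%h. (LI q. indicator (cbox z (z + h *\<^sub>R 1)) q*f q)/h^2) \<longlongrightarrow> f z) (at_right 0)"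
proof -
 have fint: "f integrable_on cbox a b" for a b
  using integrable_on_subcbox[OF integrable_on_lborel[OF f]] by auto
 obtain N where N: "negligible N" "!!x e. [|x \<notin> N; 0 < e|] ==>
   \<exists>d>0. \<forall>h. 0 < h \<and> h < d --> norm (integral (cbox x (x + h *\<^sub>R One)) f /\<^sub>R h ^ DIM(real^2) - f x) < e"
  using integrable_ccontinuous_explicit[of f, OF fint] by blast
 have eq: "(LI q. indicator (cbox z (z + h *\<^sub>R 1)) q*f q)/h^2 = integral (cbox z (z + h *\<^sub>R One)) f /\<^sub>R h ^ DIM(real^2)" for z h
 proof -
  have "set_integrable lborel (cbox z (z + h *\<^sub>R 1)) f"
   unfolding set_integrable_def using f by(intro integrable_mult_indicator) auto
  from set_borel_integral_eq_integral(2)[OF this] show ?thesis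
   unfolding One_vec set_lebesgue_integral_def by(simp add: divide_inverse mult.commute)
 qed
 show ?thesis using AE_not_negligible(2)[OF N(1)]
 proof eventually_elim
  case (elim z)
  show ?case unfolding eq
  proof(rule tendstoI)
   fix e :: real assume "0 < e"
   from N(2)[OF elim this]
   show "eventually (%h. dist (integral (cbox z (z + h *\<^sub>R One)) f /\<^sub>R h ^ DIM(real^2)) (f z) < e) (at_right 0)"
    unfolding eventually_at_right_field dist_norm by blast
  qed
 qed
qed

text \<open>The averages over small cubes with corner \<open>z\<close> vanish, and almost everywhere
  they tend to \<open>k z\<close>.\<close>

lemma AE_zero_if_box_integrals_zero:
 fixes k :: "real^2 => real"
 assumes k: "integrable lborel k" and U: "open U"
  and zero: "!!a b. cbox a b \<subseteq> U ==> (LI z. indicator (box a b) z * k z) = 0"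
 shows "AE z in lborel. z \<in> U --> k z = 0"
 using AE_corner_average[OF k]
proof eventually_elim
 case (elim z)
 have [measurable]: "k \<in> borel_measurable borel" using k by simp
 show ?case
 proof
  assume "z \<in> U"
  then obtain e where e: "e > 0" "ball z e \<subseteq> U" using U open_contains_ball by blast
  have "(LI q. indicator (cbox z (z + h *\<^sub>R 1)) q * k q) = 0" if h: "0 < h" "h < e/2" for h
  proof -
   have "norm (y - z) <= 2*h" if "y \<in> cbox z (z + h *\<^sub>R 1)" for y
    using norm_le_l1_cart[of "y - z"] that by(auto simp: mem_box_cart sum_2 forall_2)
   hence "cbox z (z + h *\<^sub>R 1) \<subseteq> U" using e(2) h by(force simp: dist_norm norm_minus_commute)
   from zero[OF this] show ?thesis
    by(rule trans[OF integral_cong_AE, rotated -1])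
     (use AE_not_negligible(2)[OF negligible_frontier_interval[of z "z + h *\<^sub>R 1"]] box_subset_cbox in \<open>auto simp: indicator_def elim!: eventually_mono\<close>)
  qed
  hence "eventually (%h. (LI q. indicator (cbox z (z + h *\<^sub>R 1)) q * k q)/h^2 = 0) (at_right 0)"
   unfolding eventually_at_right_field using e(1) by(intro exI[of _ "e/2"]) simp
  from tendsto_unique[OF _ elim tendsto_eventually[OF this]] show "k z = 0" by simp
 qed
qed

lemma frechet_boxbump_translate:
 "frechet_derivative (boxbump n (a + w) (b + w)) (at z) v = frechet_derivative (boxbump n a b) (at (z - w)) v"
 if "cbox a b \<subseteq> disc"
proof -
 have "(boxbump n a b has_derivative frechet_derivative (boxbump n a b) (at (z - w))) (at (z - w))"
  by(rule test_functionD(1)[OF test_function_boxbump[OF that]])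
 moreover have "((%z. z - w) has_derivative (%v. v)) (at z)" by(auto intro!: derivative_eq_intros)
 ultimately have "((%z. boxbump n a b (z - w)) has_derivative frechet_derivative (boxbump n a b) (at (z - w))) (at z)"
  using diff_chain_at[of "%z. z - w" "%v. v" z] by(simp add: o_def)
 hence "(boxbump n (a + w) (b + w) has_derivative frechet_derivative (boxbump n a b) (at (z - w))) (at z)"
  by(simp add: boxbump_translate)
 thus ?thesis by(simp add: frechet_derivative_at[symmetric])
qed

lemma test_function_segment_integral:
 assumes p: "test_function p"
 shows "p z - p (z - w) = (LI t. indicator {0..1} t*frechet_derivative p (at (z - t *\<^sub>R w)) w)"
proof -
 have d: "((%t. - p (z - t *\<^sub>R w)) has_vector_derivative frechet_derivative p (at (z - t *\<^sub>R w)) w) (at t within {0..1})" for t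
 proof -
  have 1: "((%t. z - t *\<^sub>R w) has_derivative (%s. - (s *\<^sub>R w))) (at t)"
   by(auto intro!: derivative_eq_intros)
  have l: "linear (frechet_derivative p (at (z - t *\<^sub>R w)))"
   using test_functionD(1)[OF p] by(rule has_derivative_linear)
  have "((%t. p (z - t *\<^sub>R w)) has_derivative (%s. frechet_derivative p (at (z - t *\<^sub>R w)) (- (s *\<^sub>R w)))) (at t)"
   using diff_chain_at[OF 1 test_functionD(1)[OF p]] by(simp add: o_def)
  hence "((%t. - p (z - t *\<^sub>R w)) has_derivative (%s. - frechet_derivative p (at (z - t *\<^sub>R w)) (- (s *\<^sub>R w)))) (at t)"
   by(rule has_derivative_minus)
  hence "((%t. - p (z - t *\<^sub>R w)) has_vector_derivative frechet_derivative p (at (z - t *\<^sub>R w)) w) (at t)"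
   by(simp add: has_vector_derivative_def linear_neg[OF l] linear_scale[OF l])
  thus ?thesis by(rule has_vector_derivative_at_within)
 qed
 have c: "continuous_on {0..1} (%t. frechet_derivative p (at (z - t *\<^sub>R w)) w)"
  by(rule continuous_on_compose2[OF test_functionD(3)[OF p, of w]]) (auto intro!: continuous_intros)
 have "(LI t. indicator {0..1} t *\<^sub>R frechet_derivative p (at (z - t *\<^sub>R w)) w) = - p (z - 1 *\<^sub>R w) - - p (z - 0 *\<^sub>R w)"
  by(rule integral_FTC_atLeastAtMost) (use d c in auto)
 thus ?thesis by simp
qed

lemma integrable_bounded_mult:
 fixes f :: "'a => real"
 assumes "integrable M f" "g \<in> borel_measurable M" "!!x. \<bar>g x\<bar> <= B"
 shows "integrable M (%x. f x*g x)"
proof(rule Bochner_Integration.integrable_bound)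
 show "integrable M (%x. B*f x)" using assms(1) by simp
 have "norm (f x*g x) <= norm (B*f x)" for x
  using mult_left_mono[OF assms(3)[of x], of "\<bar>f x\<bar>"] order_trans[OF abs_ge_zero assms(3)[of x]]
  by(simp add: abs_mult mult.commute)
 thus "AE x in M. norm (f x*g x) <= norm (B*f x)" by simp
qed (use assms in auto)

text \<open>The two coefficients \<open>c\<close> and \<open>e\<close> let the shift along the
  segment sit on either factor, so the lemma justifies Fubini before and after a translation of
  variables.\<close>

lemma integrable_segment_product:
 fixes f :: "real^2 => real"
 assumes f: "integrable lborel f" and g: "g \<in> borel_measurable borel" "!!z. \<bar>g z\<bar> <= B"
 shows "integrable (lborel \<Otimes>\<^sub>M lborel) (%(z, t). indicator {0..1::real} t*(f (z + (c*t) *\<^sub>R w)*g (z + (e*t) *\<^sub>R w)))"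
proof -
 have [measurable]: "f \<in> borel_measurable borel" "g \<in> borel_measurable borel" using f g by auto
 have "integrable (lborel \<Otimes>\<^sub>M lborel) (%(t, z). indicator {0..1::real} t*(f (z + (c*t) *\<^sub>R w)*g (z + (e*t) *\<^sub>R w)))"
 proof(rule lborel_pair.Fubini_integrable)
  show "(%(t, z). indicator {0..1::real} t*(f (z + (c*t) *\<^sub>R w)*g (z + (e*t) *\<^sub>R w))) \<in> borel_measurable (lborel \<Otimes>\<^sub>M lborel)"
   by measurable
  have sl: "integrable lborel (%z. f (z + (c*t) *\<^sub>R w)*g (z + (e*t) *\<^sub>R w))" for t
  proof(rule integrable_bounded_mult[where B = B])
   show "integrable lborel (%z. f (z + (c*t) *\<^sub>R w))"
    using integrable_lborel_translate[OF f, of "(c*t) *\<^sub>R w"] by(simp add: add.commute)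
  qed (use g in auto)
  thus "AE t in lborel. integrable lborel (%z. case (t, z) of (t, z) => indicator {0..1::real} t*(f (z + (c*t) *\<^sub>R w)*g (z + (e*t) *\<^sub>R w)))"
   by simp
  have B0: "0 <= B" using order_trans[OF abs_ge_zero g(2)] .
  define C where "C = B*(LI z. \<bar>f z\<bar>)"
  show "integrable lborel (%t. (LI z. norm (case (t, z) of (t, z) => indicator {0..1::real} t*(f (z + (c*t) *\<^sub>R w)*g (z + (e*t) *\<^sub>R w)))))"
  proof(rule Bochner_Integration.integrable_bound[where f = "%t. indicator {0..1} t*C"])
   show "integrable lborel (%t. indicator {0..1::real} t*C)"
    using integrable_real_mult_indicator[of "{0..1}" lborel "%_. C"] by(intro integrable_mult_left) auto
   have "(LI z. norm (indicator {0..1::real} t*(f (z + (c*t) *\<^sub>R w)*g (z + (e*t) *\<^sub>R w)))) <= indicator {0..1} t*C" for t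
   proof(cases "t \<in> {0..1}")
    case True
    have "(LI z. norm (f (z + (c*t) *\<^sub>R w)*g (z + (e*t) *\<^sub>R w))) <= (LI z. B*\<bar>f ((c*t) *\<^sub>R w + z)\<bar>)"
    proof(rule integral_mono)
     show "integrable lborel (%z. norm (f (z + (c*t) *\<^sub>R w)*g (z + (e*t) *\<^sub>R w)))" using sl by simp
     show "integrable lborel (%z. B*\<bar>f ((c*t) *\<^sub>R w + z)\<bar>)"
      using integrable_lborel_translate[OF f, of "(c*t) *\<^sub>R w"] by simp
     show "norm (f (z + (c*t) *\<^sub>R w)*g (z + (e*t) *\<^sub>R w)) <= B*\<bar>f ((c*t) *\<^sub>R w + z)\<bar>" for z
      using mult_left_mono[OF g(2)[of "z + (e*t) *\<^sub>R w"], of "\<bar>f (z + (c*t) *\<^sub>R w)\<bar>"]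
      by(simp add: abs_mult mult.commute add.commute)
    qed
    also have "... = C" unfolding C_def
     using integral_lborel_translate[of "%z. \<bar>f z\<bar>" "(c*t) *\<^sub>R w"] by simp
    finally show ?thesis using True by simp
   qed simp
   moreover have "C \<ge> 0" unfolding C_def using B0 by simp
   ultimately show "AE t in lborel. norm (LI z. norm (case (t, z) of (t, z) => indicator {0..1::real} t*(f (z + (c*t) *\<^sub>R w)*g (z + (e*t) *\<^sub>R w))))
     <= norm (indicator {0..1} t*C)"
    by(intro AE_I2) (simp add: abs_mult)
  qed measurable
 qed
 from lborel_pair.integrable_product_swap[OF this] show ?thesis
  by(simp add: case_prod_beta)
qed

text \<open>For fixed \<open>w\<close> the defect \<open>k\<close> is tested against box bumps
  \<open>p\<close>. The difference \<open>p z - p (z - w)\<close> is an integral over translates of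
  the derivative of \<open>p\<close>; on each of them the weak gradient acts, and Fubini with a
  translation back turns the result into the integral of \<open>J*p\<close>.\<close>

theorem weak_gradient_segment:
 assumes hG: "weak_gradient h G"
 shows "AE z in lborel. z \<in> disc \<and> z + w \<in> disc -->
   h (z + w) - h z = (LI t. indicator {0..1} t*(G (z + t *\<^sub>R w) \<bullet> w))"
proof -
 have h: "integrable lborel h" and G: "integrable lborel G" using hG by(auto simp: weak_gradient_def)
 have [measurable]: "h \<in> borel_measurable borel" "G \<in> borel_measurable borel" using h G by auto
 define g where "g z = G z \<bullet> w" for z
 have g: "integrable lborel g" unfolding g_def using G by simp
 hence [measurable]: "g \<in> borel_measurable borel" by simp
 define J where "J z = (LI t. indicator {0..1} t*g (z + t *\<^sub>R w))" for z
 have Jp: "integrable (lborel \<Otimes>\<^sub>M lborel) (%(z, t). indicator {0..1::real} t*(g (z + (1*t) *\<^sub>R w)*1))"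
  by(rule integrable_segment_product[OF g, of "%_. 1" 1 1 w 0]) auto
 have J: "integrable lborel J"
  using lborel_pair.integrable_fst[of "%z t. indicator {0..1::real} t*g (z + t *\<^sub>R w)"] Jp
  unfolding J_def by simp
 define k where "k z = h (z + w) - h z - J z" for z
 have hw: "integrable lborel (%z. h (z + w))"
  using integrable_lborel_translate[OF h, of w] by(simp add: add.commute)
 have k: "integrable lborel k" unfolding k_def using h hw J by simp
 have "AE z in lborel. z \<in> disc \<inter> (%z. z + w) -` disc --> k z = 0"
 proof(rule AE_zero_if_box_integrals_zero[OF k])
  show "open (disc \<inter> (%z. z + w) -` disc)"
   by(intro continuous_open_preimage continuous_intros) auto
  fix a b :: "real^2" assume ab: "cbox a b \<subseteq> disc \<inter> (%z. z + w) -` disc"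
  have abd: "cbox a b \<subseteq> disc" using ab by auto
  \<comment> \<open>Convexity of the disc: if the box and its translate by \<open>w\<close> lie in
    the disc, so do all intermediate ones, and every shifted bump is an admissible test
    function.\<close>
  have abt: "cbox (a + t *\<^sub>R w) (b + t *\<^sub>R w) \<subseteq> disc" if t: "t \<in> {0..1}" for t
  proof
   fix z assume "z \<in> cbox (a + t *\<^sub>R w) (b + t *\<^sub>R w)"
   hence "z - t *\<^sub>R w \<in> cbox a b" by(auto simp: mem_box_cart algebra_simps)
   hence "z - t *\<^sub>R w \<in> disc" "z - t *\<^sub>R w + w \<in> disc" using ab by auto
   hence "(1 - t) *\<^sub>R (z - t *\<^sub>R w) + t *\<^sub>R (z - t *\<^sub>R w + w) \<in> disc"
    using t by(intro convexD[OF convex_ball]) auto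
   thus "z \<in> disc" by(simp add: algebra_simps)
  qed
  have zero: "(LI z. boxbump n a b z * k z) = 0" for n
  proof -
   define p where "p = boxbump n a b"
   have p: "test_function p" unfolding p_def by(rule test_function_boxbump[OF abd])
   have [measurable]: "p \<in> borel_measurable borel" "(%z. fder p z w) \<in> borel_measurable borel"
    using test_function_measurable[OF p] by auto
   obtain B where B: "0 < B" "!!z. \<bar>p z\<bar> <= B" "!!z. \<bar>fder p z w\<bar> <= B"
    using test_function_bounded[OF p] by blast
   define D where "D z = fder p z w" for z
   have Dm: "D \<in> borel_measurable borel" unfolding D_def by simp
   have pt: "(LI z. h z*D (z - t *\<^sub>R w)) = - (LI z. g z*p (z - t *\<^sub>R w))" if t: "t \<in> {0..1}" for t
   proof -
    have "test_function (boxbump n (a + t *\<^sub>R w) (b + t *\<^sub>R w))"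
     by(rule test_function_boxbump[OF abt[OF t]])
    hence "(LI z. h z*frechet_derivative (boxbump n (a + t *\<^sub>R w) (b + t *\<^sub>R w)) (at z) w) =
     - (LI z. (G z \<bullet> w)*boxbump n (a + t *\<^sub>R w) (b + t *\<^sub>R w) z)"
     using hG unfolding weak_gradient_def by blast
    thus ?thesis
     by(simp add: frechet_boxbump_translate[OF abd] boxbump_translate[symmetric] g_def D_def p_def)
   qed
   have I1: "integrable (lborel \<Otimes>\<^sub>M lborel) (%(z, t). indicator {0..1::real} t*(h (z + (0*t) *\<^sub>R w)*D (z + (-1*t) *\<^sub>R w)))"
    by(rule integrable_segment_product[OF h Dm, of B]) (use B in \<open>simp add: D_def\<close>)
   have I2: "integrable (lborel \<Otimes>\<^sub>M lborel) (%(z, t). indicator {0..1::real} t*(g (z + (1*t) *\<^sub>R w)*p (z + (0*t) *\<^sub>R w)))"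
    by(rule integrable_segment_product[OF g _ B(2)]) simp
   have "(LI z. h z*(p z - p (z - w))) = (LI z. (LI t. indicator {0..1} t*(h z*D (z - t *\<^sub>R w))))"
   proof -
    have "h z*(p z - p (z - w)) = (LI t. indicator {0..1} t*(h z*D (z - t *\<^sub>R w)))" for z
     unfolding test_function_segment_integral[OF p] D_def
     by(simp only: integral_mult_right_zero[symmetric] mult.left_commute)
    thus ?thesis by simp
   qed
   also have "... = (LI t. (LI z. indicator {0..1} t*(h z*D (z - t *\<^sub>R w))))"
    using lborel_pair.Fubini_integral[of "%z t. indicator {0..1::real} t*(h z*D (z - t *\<^sub>R w))"] I1
    by(simp add: case_prod_beta)
   also have "... = (LI t. (LI z. - (indicator {0..1} t*(g (z + t *\<^sub>R w)*p z))))"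
   proof(rule Bochner_Integration.integral_cong[OF refl])
    fix t :: real
    show "(LI z. indicator {0..1} t*(h z*D (z - t *\<^sub>R w))) = (LI z. - (indicator {0..1} t*(g (z + t *\<^sub>R w)*p z)))"
    proof(cases "t \<in> {0..1}")
     case True
     have "(LI z. g z*p (z - t *\<^sub>R w)) = (LI z. g (t *\<^sub>R w + z)*p (t *\<^sub>R w + z - t *\<^sub>R w))"
      by(rule integral_lborel_translate[symmetric]) measurable
     thus ?thesis using pt[OF True] True by(simp add: add.commute)
    qed simp
   qed
   also have "... = - (LI z. (LI t. indicator {0..1} t*(g (z + t *\<^sub>R w)*p z)))"
    using lborel_pair.Fubini_integral[of "%z t. indicator {0..1::real} t*(g (z + t *\<^sub>R w)*p z)"] I2
    by(simp add: case_prod_beta)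
   also have "(LI z. (LI t. indicator {0..1} t*(g (z + t *\<^sub>R w)*p z))) = (LI z. J z*p z)"
    unfolding J_def by(simp flip: integral_mult_left_zero mult.assoc)
   finally have A: "(LI z. h z*(p z - p (z - w))) = - (LI z. J z*p z)" .
   have h1: "integrable lborel (%z. h z*p z)" "integrable lborel (%z. h z*p (z - w))"
    "integrable lborel (%z. h (z + w)*p z)" "integrable lborel (%z. J z*p z)"
    by(rule integrable_bounded_mult[where B = B], use h hw J B(2) in auto)+
   have "(LI z. h z*p (z - w)) = (LI z. h (w + z)*p (w + z - w))"
    by(rule integral_lborel_translate[symmetric]) measurable
   hence tr: "(LI z. h z*p (z - w)) = (LI z. h (z + w)*p z)" by(simp add: add.commute)
   have "(LI z. h z*(p z - p (z - w))) = (LI z. h z*p z) - (LI z. h (z + w)*p z)"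
    using h1 tr by(simp add: right_diff_distrib)
   moreover have "(LI z. p z * k z) = (LI z. h (z + w)*p z - h z*p z - J z*p z)"
    by(simp add: k_def algebra_simps)
   ultimately show ?thesis using A h1 unfolding p_def by simp
  qed
  have "(%n. (LI z. boxbump n a b z * k z)) \<longlonglongrightarrow> (LI z. indicator (box a b) z * k z)"
  proof(rule integral_dominated_convergence[where w = "%z. \<bar>k z\<bar>"])
   show "AE z in lborel. (%n. boxbump n a b z * k z) \<longlonglongrightarrow> indicator (box a b) z * k z"
    by(intro AE_I2 tendsto_mult boxbump_tendsto tendsto_const)
   have "\<bar>boxbump n a b z * k z\<bar> <= \<bar>k z\<bar>" for n z
    using mult_right_mono[OF boxbump_bounds(2), of "\<bar>k z\<bar>" n a b z] boxbump_bounds(1)[of n a b z]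
    by(simp add: abs_mult)
   thus "AE z in lborel. norm (boxbump n a b z * k z) <= \<bar>k z\<bar>" for n by simp
   have "boxbump n a b \<in> borel_measurable borel" for n
    using test_function_measurable(1)[OF test_function_boxbump[OF abd]] .
   thus "(%z. boxbump n a b z * k z) \<in> borel_measurable lborel" for n using k by simp
  qed (use k in auto)
  thus "(LI z. indicator (box a b) z * k z) = 0"
   unfolding zero by(simp add: LIMSEQ_const_iff)
 qed
 thus ?thesis by eventually_elim (auto simp: k_def J_def g_def)
qed

subsection \<open>Averages over balls and approximate metric derivatives\<close>

abbreviation ball_integral :: "real^2 => real => (real^2 => ennreal) => ennreal" where
 "ball_integral z h f \<equiv> (LN x. indicator (ball z h) x*f x)"

definition reflect :: "real^2 => real^2 => real^2" where
 "reflect c x = (\<chi> i. c $ i*x $ i)"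

lemma reflect_distr:
 fixes c :: "real^2"
 assumes c: "!!i. \<bar>c $ i\<bar> = 1"
 shows "reflect c \<in> borel_measurable borel" "distr lborel borel (reflect c) = lborel"
proof -
 show "reflect c \<in> borel_measurable borel"
  unfolding reflect_def[abs_def] by(intro borel_measurable_continuous_onI continuous_intros)
 have cb: "\<bar>c \<bullet> j\<bar> = 1" if "j \<in> Basis" for j
  using that c by(auto simp: Basis_vec_def inner_axis)
 have eq: "0 + (\<Sum>j\<in>Basis. ((c \<bullet> j)*(x \<bullet> j)) *\<^sub>R j) = reflect c x" for x
 proof(rule euclidean_eqI)
  fix b :: "real^2" assume b: "b \<in> Basis"
  then obtain i where i: "b = axis i 1" by(auto simp: Basis_vec_def)
  have "(0 + (\<Sum>j\<in>Basis. ((c \<bullet> j)*(x \<bullet> j)) *\<^sub>R j)) \<bullet> b = (c \<bullet> b)*(x \<bullet> b)"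
   using b by(simp add: inner_sum_left_Basis)
  also have "... = reflect c x \<bullet> b" by(simp add: i inner_axis reflect_def)
  finally show "(0 + (\<Sum>j\<in>Basis. ((c \<bullet> j)*(x \<bullet> j)) *\<^sub>R j)) \<bullet> b = reflect c x \<bullet> b" .
 qed
 have eq': "(%x. 0 + (\<Sum>j\<in>Basis. ((c \<bullet> j)*(x \<bullet> j)) *\<^sub>R j)) = reflect c" using eq by(rule ext)
 have "lborel = density (distr lborel borel (%x. 0 + (\<Sum>j\<in>Basis. ((c \<bullet> j)*(x \<bullet> j)) *\<^sub>R j))) (%_. \<Prod>j\<in>(Basis::(real^2) set). \<bar>c \<bullet> j\<bar>)"
  using cb by(intro lborel_affine_euclidean) force
 also have "(%_::real^2. ennreal (\<Prod>j\<in>(Basis::(real^2) set). \<bar>c \<bullet> j\<bar>)) = (%_. 1)" using cb by simp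
 finally show "distr lborel borel (reflect c) = lborel" unfolding eq' density_1 by(rule sym)
qed

text \<open>The differentiation theorem is available only for cubes with corner \<open>z\<close>; applying it to the four reflections of \<open>f\<close>
covers a ball about \<open>z\<close>, whence the factor 4.\<close>

lemma AE_ball_average:
 fixes f :: "real^2 => real"
 assumes f: "integrable lborel f" "!!x. 0 <= f x"
 shows "AE z in lborel. \<forall>ep>0. \<forall>\<^sub>F h in at_right 0. ball_integral z h f <= ennreal (h^2*(4*f z + ep))"
proof -
 have [measurable]: "f \<in> borel_measurable borel" using f by simp
 define C where "C = {vector [1, 1], vector [1, -1], vector [-1, 1], vector [-1, -1 :: real] :: real^2}"
 have C: "finite C" "card C <= 4" unfolding C_def using card_length[of "[vector [1, 1], vector [1, -1], vector [-1, 1], vector [-1, -1 :: real] :: real^2]"] by auto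
 have c1: "\<bar>c $ i\<bar> = 1" if "c \<in> C" for c :: "real^2" and i
  using that exhaust_2[of i] unfolding C_def by(auto simp: vector_2)
 have rr: "reflect c (reflect c x) = x" if "c \<in> C" for c x :: "real^2"
 proof -
  have "c $ i*c $ i = 1" for i using c1[OF that, of i] by(metis abs_mult_self_eq mult_1)
  thus ?thesis by(simp add: vec_eq_iff reflect_def mult.assoc[symmetric])
 qed
 define q :: "real^2 => real^2 => real => (real^2) set"
  where "q c z h = {x. reflect c x \<in> cbox (reflect c z) (reflect c z + h *\<^sub>R 1)}" for c z h
 have rm [measurable]: "reflect c \<in> borel_measurable borel" if "c \<in> C" for c using reflect_distr(1) c1[OF that] by blast
 have qm [measurable]: "q c z h \<in> sets borel" if "c \<in> C" for c z h
  using measurable_sets[OF rm[OF that], of "cbox (reflect c z) (reflect c z + h *\<^sub>R 1)"] by(simp add: q_def vimage_def)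
 let ?qi = "%c z h. (LN x. indicator (q c z h) x*ennreal (f x))"
 have one: "AE z in lborel. \<forall>ep>0. \<forall>\<^sub>F h in at_right 0. ?qi c z h <= ennreal (h^2*(f z + ep))" if c: "c \<in> C" for c
 proof -
  note rd = reflect_distr[of c, OF c1[OF c]]
  note [measurable] = rm[OF c] qm[OF c]
  have i: "integrable lborel (%x. f (reflect c x))"
   by(rule integrable_distr[of "reflect c" lborel borel]) (use f rd in auto)
  let ?k = "%z h x. indicator (cbox z (z + h *\<^sub>R 1)) x*f (reflect c x)"
  have "AE z in distr lborel borel (reflect c). ((%h. (LI x. ?k z h x)/h^2) \<longlongrightarrow> f (reflect c z)) (at_right 0)"
   unfolding rd(2) by(rule AE_corner_average[OF i])
  hence "AE z in lborel. ((%h. (LI x. ?k (reflect c z) h x)/h^2) \<longlongrightarrow> f (reflect c (reflect c z))) (at_right 0)"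
   by(rule AE_distrD[rotated]) simp
  thus ?thesis
  proof eventually_elim
   case (elim z)
   have "?qi c z h = ennreal (LI x. ?k (reflect c z) h x)" for h
   proof -
    have "ennreal (LI x. ?k (reflect c z) h x) = (\<integral>\<^sup>+x. ennreal (?k (reflect c z) h x) \<partial>distr lborel borel (reflect c))"
     using integrable_mult_indicator[of "cbox (reflect c z) (reflect c z + h *\<^sub>R 1)" lborel "%x. f (reflect c x)"] i f(2)
     unfolding rd(2) by(intro nn_integral_eq_integral[symmetric]) auto
    also have "... = (LN x. ennreal (?k (reflect c z) h (reflect c x)))" by(rule nn_integral_distr) auto
    also have "... = ?qi c z h" by(rule nn_integral_cong) (simp add: q_def indicator_def rr[OF c])
    finally show ?thesis by simp
   qed
   moreover have "\<forall>\<^sub>F h in at_right 0. (LI x. ?k (reflect c z) h x) <= h^2*(f z + ep)" if "0 < ep" for ep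
    using order_tendstoD(2)[OF elim, of "f z + ep"] that eventually_at_right_less[of 0]
    by(auto simp: rr[OF c] pos_divide_less_eq mult.commute elim: eventually_elim2)
   ultimately show ?case by(simp only:) (blast intro: ennreal_leI eventually_mono)
  qed
 qed
 have "AE z in lborel. \<forall>c\<in>C. \<forall>ep>0. \<forall>\<^sub>F h in at_right 0. ?qi c z h <= ennreal (h^2*(f z + ep))"
  using one C(1) by(intro AE_finite_allI) auto
 thus ?thesis
 proof eventually_elim
  case (elim z)
  show ?case
  proof(intro allI impI)
   fix ep :: real assume e: "0 < ep"
   hence e4: "0 < ep/4" by simp
   have "\<forall>\<^sub>F h in at_right 0. \<forall>c\<in>C. ?qi c z h <= ennreal (h^2*(f z + ep/4))"
    by(intro eventually_ball_finite C(1) ballI) (rule mp[OF spec[OF bspec[OF elim]] e4])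
   thus "\<forall>\<^sub>F h in at_right 0. ball_integral z h f <= ennreal (h^2*(4*f z + ep))"
   proof eventually_elim
    case (elim h)
    have "ball_integral z h f <= (LN x. (\<Sum>c\<in>C. indicator (q c z h) x*ennreal (f x)))"
    proof(rule nn_integral_mono)
     fix x :: "real^2"
     show "indicator (ball z h) x*ennreal (f x) <= (\<Sum>c\<in>C. indicator (q c z h) x*ennreal (f x))"
     proof(cases "x \<in> ball z h")
      case True
      \<comment> \<open>The signs of the coordinates of \<open>x - z\<close> pick the reflected cube
        that contains \<open>x\<close>.\<close>
      define c :: "real^2" where "c = vector [if z $ 1 <= x $ 1 then 1 else -1, if z $ 2 <= x $ 2 then 1 else -1]"
      have cC: "c \<in> C" by(auto simp: c_def C_def)
      have "\<bar>x $ i - z $ i\<bar> <= h" for i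
       using component_le_norm_cart[of "x - z" i] True by(simp add: dist_norm norm_minus_commute)
      from this[of 1] this[of 2] have "x \<in> q c z h"
       by(auto simp: q_def mem_box_cart reflect_def c_def forall_2 vector_2)
      thus ?thesis using member_le_sum[OF cC _ C(1), of "%c. indicator (q c z h) x*ennreal (f x)"] True by simp
     qed simp
    qed
    also have "... = (\<Sum>c\<in>C. ?qi c z h)" by(rule nn_integral_sum) (use qm in measurable)
    also have "... <= of_nat (card C)*ennreal (h^2*(f z + ep/4))" using elim by(intro sum_bounded_above) auto
    also have "... <= of_nat 4*ennreal (h^2*(f z + ep/4))" using C(2) by(intro mult_right_mono of_nat_mono) auto
    also have "... = ennreal (4*(h^2*(f z + ep/4)))" using f(2)[of z] e by(subst ennreal_mult) auto
    also have "4*(h^2*(f z + ep/4)) = h^2*(4*f z + ep)" by(simp add: algebra_simps)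
    finally show ?case .
   qed
  qed
 qed
qed

text \<open>A Lebesgue point with value 0, except that integrals are compared with
  \<open>h^2\<close> instead of the area of the ball.\<close>

definition avg_zero :: "(real^2 => ennreal) => real^2 => bool" where
 "avg_zero f z \<longleftrightarrow> (\<forall>e>0. \<forall>\<^sub>F h in at_right 0. ball_integral z h f <= ennreal (e*h^2))"

text \<open>Lebesgue points of a map into a separable metric space: \<open>S z\<close> is replaced
  by a nearby point \<open>q\<close> of the countable set. The factor 4 lost in
  \<open>AE_ball_average\<close> is harmless because it multiplies a distance that can be made
  arbitrarily small.\<close>

lemma AE_avg_zero_dist:
 fixes S :: "real^2 => 'm::metric_space"
 assumes Q: "countable Q" "!!s ep. 0 < ep ==> \<exists>q\<in>Q. dist s q < ep"
  and int: "!!q. q \<in> Q ==> integrable lborel (%y. indicator disc y*dist (S y) q)"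
 shows "AE z in lborel. z \<in> disc --> avg_zero (%y. ennreal (indicator disc y*dist (S y) (S z))) z"
proof -
 let ?f = "%q x. indicator disc x*dist (S x) q"
 have "AE z in lborel. \<forall>q\<in>Q. \<forall>ep>0. \<forall>\<^sub>F h in at_right 0. ball_integral z h (?f q) <= ennreal (h^2*(4*?f q z + ep))"
  using Q(1) AE_ball_average[OF int] by(simp add: AE_ball_countable)
 thus ?thesis
 proof eventually_elim
  case (elim z)
  show ?case unfolding avg_zero_def
  proof(intro impI allI)
   fix ep :: real assume z: "z \<in> disc" and e: "0 < ep"
   obtain q where q: "q \<in> Q" "dist (S z) q < ep/16" using Q(2)[of "ep/16" "S z"] e by auto
   have [measurable]: "?f q \<in> borel_measurable borel" "ball z h \<in> sets borel" for h using int[OF q(1)] by auto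
   have "0 < ep/2" using e by simp
   with elim q(1) have "\<forall>\<^sub>F h in at_right 0. ball_integral z h (?f q) <= ennreal (h^2*(4*?f q z + ep/2))" by blast
   thus "\<forall>\<^sub>F h in at_right 0. ball_integral z h (?f (S z)) <= ennreal (ep*h^2)"
    using eventually_at_right_less[of 0]
   proof eventually_elim
    case (elim h)
    have "ball_integral z h (?f (S z)) <=
     (LN x. indicator (ball z h) x*ennreal (?f q x) + ennreal (dist (S z) q)*indicator (ball z h) x)"
     using dist_triangle2 by(intro nn_integral_mono) (auto simp: indicator_def ennreal_plus[symmetric] ennreal_leI simp del: ennreal_plus)
    also have "... = ball_integral z h (?f q) + ennreal (dist (S z) q*(pi*h^2))"
     using elim(2) by(subst nn_integral_add, measurable, measurable) (simp add: nn_integral_cmult_indicator emeasure_ball unit_ball_vol_2 ennreal_mult)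
    also have "... <= ennreal (h^2*(4*dist (S z) q + ep/2)) + ennreal (dist (S z) q*(4*h^2))"
     using elim z pi_less_4 by(intro add_mono ennreal_leI mult_left_mono mult_right_mono) auto
    also have "... = ennreal (h^2*(8*dist (S z) q + ep/2))"
     using e by(subst ennreal_plus[symmetric]) (auto simp: algebra_simps)
    also have "... <= ennreal (ep*h^2)"
     unfolding mult.commute[of ep] using q by(intro ennreal_leI mult_left_mono) auto
    finally show ?case .
   qed
  qed
 qed
qed

lemma nn_integral_affine:
 fixes f :: "real^2 => ennreal"
 assumes [measurable]: "f \<in> borel_measurable borel" and t: "0 < t"
 shows "(LN x. f x) = ennreal (t^2)*(LN y. f (a + t *\<^sub>R y))"
proof -
 have "(LN x. f x) = (\<integral>\<^sup>+x. f x \<partial>density (distr lborel borel (%x. a + t *\<^sub>R x)) (%_. \<bar>t\<bar>^DIM(real^2)))"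
  using t by(subst lborel_affine[of t a]) auto
 also have "... = (\<integral>\<^sup>+x. ennreal (\<bar>t\<bar>^DIM(real^2))*f x \<partial>distr lborel borel (%x. a + t *\<^sub>R x))"
  by(rule nn_integral_density) auto
 also have "... = (LN y. ennreal (\<bar>t\<bar>^DIM(real^2))*f (a + t *\<^sub>R y))"
  by(rule nn_integral_distr) auto
 also have "... = ennreal (\<bar>t\<bar>^DIM(real^2))*(LN y. f (a + t *\<^sub>R y))"
  by(rule nn_integral_cmult) measurable
 finally show ?thesis by simp
qed

text \<open>For fixed \<open>t\<close> the substitution of \<open>z + t *\<^sub>R (y - z)\<close>
  turns the ball of radius \<open>h\<close> into the one of radius \<open>t*h\<close>; the Jacobian
  \<open>t^2\<close> cancels against \<open>(t*h)^2\<close>, so the estimate is uniform in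
  \<open>t\<close>.\<close>

lemma avg_zero_segment:
 assumes [measurable]: "K \<in> borel_measurable borel" and K: "avg_zero K z"
 shows "avg_zero (%y. (LN t. indicator {0..1} t*K (z + t *\<^sub>R (y - z)))) z"
 unfolding avg_zero_def
proof(intro allI impI)
 fix ep :: real assume e: "0 < ep"
 let ?I = "indicator {0..1::real} :: real => ennreal"
 let ?k = "%h t y. indicator (ball z h) y*K (z + t *\<^sub>R (y - z))"
 have [measurable]: "ball z h \<in> sets borel" for h by simp
 obtain d where d: "0 < d" "!!h. 0 < h ==> h < d ==> ball_integral z h K <= ennreal (ep*h^2)"
  using K e unfolding avg_zero_def eventually_at_right_field by blast
 have "ball_integral z h (%y. (LN t. ?I t*K (z + t *\<^sub>R (y - z)))) <= ennreal (ep*h^2)" if h: "0 < h" "h < d" for h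
 proof -
  have "ball_integral z h (%y. (LN t. ?I t*K (z + t *\<^sub>R (y - z)))) = (LN y. (LN t. ?I t*?k h t y))"
   by(subst nn_integral_cmult[symmetric], measurable) (simp add: mult.left_commute)
  also have "... = (LN t. (LN y. ?I t*?k h t y))"
   by(rule lborel_pair.Fubini'[symmetric]) measurable
  also have "... <= (LN t. ennreal (ep*h^2)*?I t)"
  proof(rule nn_integral_mono_AE)
   have "AE t in lborel. t ~= (0::real)" by(rule AE_lborel_singleton)
   thus "AE t in lborel. (LN y. ?I t*?k h t y) <= ennreal (ep*h^2)*?I t"
   proof eventually_elim
    case (elim t)
    show ?case
    proof(cases "t \<in> {0..1}")
     case True
     hence t: "0 < t" "t <= 1" using elim by auto
     have "dist z ((z - t *\<^sub>R z) + t *\<^sub>R y) = t*dist z y" for y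
      using t norm_scaleR[of t "z - y"] by(simp add: dist_norm algebra_simps)
     hence b: "z + t *\<^sub>R y - t *\<^sub>R z \<in> ball z (h*t) \<longleftrightarrow> y \<in> ball z h" for y using t by(simp add: algebra_simps)
     have "ball_integral z (t*h) K = ennreal (t^2)*(LN y. ?k h t y)"
      by(subst nn_integral_affine[OF _ t(1), of _ "z - t *\<^sub>R z"], measurable)
       (simp add: b indicator_def algebra_simps of_bool_def if_distrib del: mem_ball cong: if_cong)
     moreover have "0 < t*h" "t*h < d" using t h mult_right_mono[OF t(2), of h] by(simp, linarith)
     ultimately have "ennreal (t^2)*(LN y. ?k h t y) <= ennreal (ep*(t*h)^2)"
      using d(2)[of "t*h"] by simp
     also have "... = ennreal (t^2)*ennreal (ep*h^2)"
      using e by(subst ennreal_mult[symmetric]) (auto simp: power_mult_distrib mult_ac)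
     finally have "(LN y. ?k h t y) <= ennreal (ep*h^2)"
      using t by(subst (asm) ennreal_mult_le_mult_iff) auto
     thus ?thesis using True by simp
    qed simp
   qed
  qed
  also have "... = ennreal (ep*h^2)" by(simp add: nn_integral_cmult_indicator)
  finally show ?thesis .
 qed
 thus "\<forall>\<^sub>F h in at_right 0. ball_integral z h (%y. (LN t. ?I t*K (z + t *\<^sub>R (y - z)))) <= ennreal (ep*h^2)"
  unfolding eventually_at_right_field using d(1) by blast
qed

text \<open>The points where the \<open>n\<close>th partial sum exceeds \<open>(1/2) ^ n\<close> are removed only inside a ball about \<open>z\<close> so small that
everything removed has density 0 at \<open>z\<close>.\<close>

lemma avg_zero_density:
 assumes [measurable]: "!!j::nat. f j \<in> borel_measurable borel" and f: "!!j. avg_zero (f j) z" and z: "z \<in> disc"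
 obtains A where "A \<subseteq> disc" "density_one A z" "!!j. (f j \<longlongrightarrow> 0) (at z within A)"
proof -
 let ?g = "%n x. \<Sum>j\<le>n. f j x"
 have [measurable]: "ball z h \<in> sets borel" for h by simp
 have "\<exists>d>0. \<forall>h. 0 < h \<and> h <= d --> ball_integral z h (?g n) <= ennreal ((1/4) ^ n*h^2)" for n
 proof -
  \<comment> \<open>The sum has \<open>n + 1\<close> terms, so it gets total mean
    \<open>(1/4) ^ n\<close>; Markov's inequality at height \<open>(1/2) ^ n\<close> leaves a set of
    measure at most \<open>(1/2) ^ n*h^2\<close>.\<close>
  define e where "e = (1/4::real) ^ n/(real n + 1)"
  have e: "0 < e" "(real n + 1)*e = (1/4) ^ n" by(auto simp: e_def)
  have "\<forall>\<^sub>F h in at_right 0. \<forall>j\<in>{..n}. ball_integral z h (f j) <= ennreal (e*h^2)"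
   using f e(1) unfolding avg_zero_def by(intro eventually_ball_finite) auto
  then obtain d where d: "0 < d" "!!h j. 0 < h ==> h < d ==> j <= n ==> ball_integral z h (f j) <= ennreal (e*h^2)"
   unfolding eventually_at_right_field by auto
  have "ball_integral z h (?g n) <= ennreal ((1/4) ^ n*h^2)" if "0 < h" "h <= d/2" for h
  proof -
   have "ball_integral z h (?g n) = (\<Sum>j\<le>n. ball_integral z h (f j))"
    unfolding sum_distrib_left by(subst nn_integral_sum) measurable
   also have "... <= of_nat (card {..n})*ennreal (e*h^2)" using d that by(intro sum_bounded_above) auto
   also have "... = ennreal ((real n + 1)*e*h^2)" using e(1) by(simp add: ennreal_mult ennreal_of_nat_eq_real_of_nat mult.assoc add.commute)
   finally show ?thesis unfolding e(2) .
  qed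
  thus ?thesis using d(1) by(intro exI[of _ "d/2"]) auto
 qed
 hence "\<forall>n. \<exists>d>0. \<forall>h. 0 < h \<and> h <= d --> ball_integral z h (?g n) <= ennreal ((1/4) ^ n*h^2)" by blast
 from choice[OF this] obtain d where d: "d n > 0" "!!h. 0 < h ==> h <= d n ==> ball_integral z h (?g n) <= ennreal ((1/4) ^ n*h^2)" for n
  by blast
 define E where "E n = {y. ennreal ((1/2) ^ n) < ?g n y}" for n
 have [measurable]: "E n \<in> sets borel" for n unfolding E_def by measurable
 have Em: "emeasure lborel (E n \<inter> ball z h) <= ennreal ((1/2) ^ n*h^2)" if h: "0 < h" "h <= d n" for n h
 proof -
  have "ennreal ((1/2) ^ n)*emeasure lborel (E n \<inter> ball z h) = (LN x. ennreal ((1/2) ^ n)*indicator (E n \<inter> ball z h) x)"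
   by(rule nn_integral_cmult_indicator[symmetric]) simp
  also have "... <= ball_integral z h (?g n)"
   by(intro nn_integral_mono) (auto simp: E_def split: split_indicator)
  also have "... <= ennreal ((1/4) ^ n*h^2)" by(rule d(2)[OF h])
  also have "(1/4::real) ^ n = (1/2) ^ n*(1/2) ^ n" by(simp flip: power_mult_distrib)
  also have "ennreal ((1/2) ^ n*(1/2) ^ n*h^2) = ennreal ((1/2) ^ n)*ennreal ((1/2) ^ n*h^2)"
   by(subst ennreal_mult[symmetric]) (auto simp: mult.assoc)
  finally show ?thesis by(subst (asm) ennreal_mult_le_mult_iff) auto
 qed
 define B where "B = (\<Union>n. E n \<inter> ball z (d n))"
 have [measurable]: "B \<in> sets borel" unfolding B_def by measurable
 define A where "A = disc - B"
 have BE: "emeasure lborel (B \<inter> ball z h) <= ennreal (2*(1/2) ^ N*h^2)" if h: "0 < h" "h <= d N" for N h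
 proof -
  \<comment> \<open>A point of some \<open>E n\<close> with \<open>n < N\<close> also lies in
    \<open>E N\<close>, since the partial sums grow and the thresholds fall. So only indices from
    \<open>N\<close> on count, and their measures form a geometric series.\<close>
  have "B \<inter> ball z h \<subseteq> (\<Union>n. E (n + N) \<inter> ball z (min h (d (n + N))))"
  proof
   fix y assume "y \<in> B \<inter> ball z h"
   then obtain n where n: "y \<in> E n" "y \<in> ball z (d n)" "y \<in> ball z h" by(auto simp: B_def)
   show "y \<in> (\<Union>n. E (n + N) \<inter> ball z (min h (d (n + N))))"
   proof(cases "n < N")
    case True
    have "ennreal ((1/2) ^ N) <= ennreal ((1/2) ^ n)" using True by(intro ennreal_leI power_decreasing) auto
    also have "ennreal ((1/2) ^ n) < ?g n y" using n(1) by(simp add: E_def)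
    also have "... <= ?g N y" using True by(intro sum_mono2) auto
    finally have "y \<in> E (0 + N)" by(simp add: E_def)
    moreover have "y \<in> ball z (min h (d (0 + N)))" using n(3) h by auto
    ultimately show ?thesis by blast
   next
    case False
    hence "n = (n - N) + N" by simp
    thus ?thesis using n by(intro UN_I[of "n - N"]) auto
   qed
  qed
  hence "emeasure lborel (B \<inter> ball z h) <= emeasure lborel (\<Union>n. E (n + N) \<inter> ball z (min h (d (n + N))))"
   by(rule emeasure_mono) measurable
  also have "... <= (\<Sum>n. emeasure lborel (E (n + N) \<inter> ball z (min h (d (n + N)))))"
   by(rule emeasure_subadditive_countably) auto
  also have "... <= (\<Sum>n. ennreal ((1/2) ^ n*((1/2) ^ N*h^2)))"
  proof(rule suminf_le)
   fix n
   have m: "0 < min h (d (n + N))" "min h (d (n + N)) <= d (n + N)" using h d(1)[of "n + N"] by auto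
   have "emeasure lborel (E (n + N) \<inter> ball z (min h (d (n + N)))) <= ennreal ((1/2) ^ (n + N)*(min h (d (n + N)))^2)"
    by(rule Em[OF m])
   also have "... <= ennreal ((1/2) ^ (n + N)*h^2)"
    using m(1) by(intro ennreal_leI mult_left_mono power_mono) auto
   finally show "emeasure lborel (E (n + N) \<inter> ball z (min h (d (n + N)))) <= ennreal ((1/2) ^ n*((1/2) ^ N*h^2))"
    by(simp add: power_add mult.assoc)
  qed auto
  also have "... = ennreal (\<Sum>n. (1/2) ^ n*((1/2) ^ N*h^2))"
   by(rule suminf_ennreal2) (auto intro!: summable_mult2 summable_geometric)
  also have "(\<Sum>n. (1/2::real) ^ n*((1/2) ^ N*h^2)) = 2*(1/2) ^ N*h^2"
   by(simp add: suminf_mult2[symmetric] suminf_geometric summable_geometric)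
  finally show ?thesis .
 qed
 have Asets: "A \<in> sets borel" unfolding A_def by measurable
 have ratio: "1 - 2*(1/2) ^ N <= measure lebesgue (A \<inter> ball z r)/measure lebesgue (ball z r) \<and>
   measure lebesgue (A \<inter> ball z r)/measure lebesgue (ball z r) <= 1"
  if r: "0 < r" "r <= d N" "r <= 1 - norm z" for r N
 proof -
  have mb: "measure lebesgue (ball z r) = pi*r^2" using r by(simp add: content_ball unit_ball_vol_2)
  have pos: "0 < pi*r^2" using r by simp
  have bd: "ball z r \<subseteq> disc"
  proof
   fix y assume "y \<in> ball z r"
   hence "norm (y - z) < r" by(simp add: dist_norm norm_minus_commute)
   thus "y \<in> disc" using norm_triangle_sub[of y z] r(3) by simp
  qed
  have e1: "A \<inter> ball z r = ball z r - (B \<inter> ball z r)" using bd by(auto simp: A_def)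
  have lm: "B \<inter> ball z r \<in> lmeasurable" by(rule bounded_set_imp_lmeasurable) (auto intro: bounded_subset[of "ball z r"])
  have "measure lebesgue (A \<inter> ball z r) = measure lebesgue (ball z r) - measure lebesgue (B \<inter> ball z r)"
   unfolding e1 by(rule measurable_measure_Diff) (use lm in auto)
  moreover have "measure lebesgue (B \<inter> ball z r) <= 2*(1/2) ^ N*r^2"
  proof -
   have "measure lborel (B \<inter> ball z r) <= 2*(1/2) ^ N*r^2"
    unfolding measure_def using BE[OF r(1,2)] r by(intro enn2real_leI) auto
   thus ?thesis by simp
  qed
  moreover have "2*(1/2) ^ N*r^2 <= 2*(1/2) ^ N*(pi*r^2)"
   using pi_ge_two by(intro mult_left_mono) (auto simp: mult_le_cancel_right1)
  ultimately have "measure lebesgue (A \<inter> ball z r) \<ge> (1 - 2*(1/2) ^ N)*(pi*r^2)"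
   "measure lebesgue (A \<inter> ball z r) <= pi*r^2"
   unfolding mb using measure_nonneg[of lebesgue "B \<inter> ball z r"] unfolding left_diff_distrib mult_1 mult.assoc by linarith+
  thus ?thesis unfolding mb using pos by(simp add: pos_le_divide_eq pos_divide_le_eq)
 qed
 have half0: "(%n. 2*(1/2::real) ^ n) \<longlonglongrightarrow> 2*0" by(intro tendsto_mult_left LIMSEQ_power_zero) simp
 have "density_one A z"
  unfolding density_one_def
 proof
  show "A \<in> sets lebesgue" using Asets by simp
  show "((%r. measure lebesgue (A \<inter> ball z r)/measure lebesgue (ball z r)) \<longlongrightarrow> 1) (at_right 0)"
  proof(rule tendstoI)
   fix e :: real assume e: "0 < e"
   have "eventually (%n. 2*(1/2::real) ^ n < e) sequentially" using half0 e by(intro order_tendstoD) auto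
   then obtain N where N: "2*(1/2::real) ^ N < e" by(auto simp: eventually_sequentially)
   have "eventually (%r::real. 0 < r \<and> r < min (d N) (1 - norm z)) (at_right 0)"
    using d(1)[of N] z by(intro eventually_conj eventually_at_right_less) (auto simp: eventually_at_right[of 0 1] intro: exI[of _ "min (d N) (1 - norm z)"])
   thus "eventually (%r. dist (measure lebesgue (A \<inter> ball z r)/measure lebesgue (ball z r)) 1 < e) (at_right 0)"
   proof eventually_elim
    case (elim r)
    thus ?case using ratio[of r N] N by(simp add: dist_real_def abs_less_iff)
   qed
  qed
 qed
 moreover have "(f j \<longlongrightarrow> 0) (at z within A)" for j
 proof(rule order_tendstoI)
  fix e :: ennreal assume e: "0 < e"
  have "(%n. ennreal ((1/2) ^ n)) \<longlonglongrightarrow> ennreal 0" by(intro tendsto_ennrealI LIMSEQ_power_zero) simp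
  hence "eventually (%n. ennreal ((1/2) ^ n) < e) sequentially" using e by(intro order_tendstoD) auto
  hence "eventually (%n. ennreal ((1/2) ^ n) < e \<and> j <= n) sequentially" by(intro eventually_conj eventually_ge_at_top)
  then obtain N where N: "ennreal ((1/2) ^ N) < e" "j <= N" by(auto simp: eventually_sequentially)
  have "eventually (%y. y \<in> A \<and> y \<in> ball z (d N)) (at z within A)"
   using d(1)[of N] by(auto simp: eventually_at dist_commute intro!: exI[of _ "d N"])
  thus "eventually (%y. f j y < e) (at z within A)"
  proof eventually_elim
   case (elim y)
   hence "y \<notin> E N" by(auto simp: A_def B_def)
   hence "?g N y < e" using N by(auto simp: E_def not_less)
   moreover have "f j y <= ?g N y" using N(2) member_le_sum[of j "{..N}" "%j. f j y"] by simp
   ultimately show ?case by simp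
  qed
 qed auto
 moreover have "A \<subseteq> disc" by(auto simp: A_def)
 ultimately show ?thesis by(intro that)
qed

section \<open>Uniqueness of the approximate metric derivative\<close>

lemma sn_diff_le: "\<bar>sn s v - sn s w\<bar> <= (sn s (axis 1 1) + sn s (axis 2 1))*norm (v - w)"
proof -
 have "sn s v <= sn s w + sn s (v - w)" using sn_triangle[of s w "v - w"] by simp
 moreover have "sn s w <= sn s v + sn s (w - v)" using sn_triangle[of s v "w - v"] by simp
 moreover have "sn s (w - v) = sn s (v - w)" using sn_scaleR[of s "- 1" "v - w"] by simp
 ultimately show ?thesis using sn_le_norm[of s "v - w"] by linarith
qed

lemma continuous_on_sn: "continuous_on A (sn s)"
proof -
 define C where "C = sn s (axis 1 1) + sn s (axis 2 1)"
 have "0 <= C" by(simp add: C_def sn_nonneg)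
 hence "C-lipschitz_on A (sn s)"
  by(intro lipschitz_onI) (auto simp: dist_norm C_def sn_diff_le)
 thus ?thesis by(rule lipschitz_on_continuous_on)
qed

lemma density_one_complement:
 assumes A: "density_one A z" and c: "0 < c"
 shows "eventually (%r. measure lebesgue (ball z r - A) <= c*measure lebesgue (ball z r)) (at_right 0)"
proof -
 have As: "A \<in> sets lebesgue"
  and lim: "((%r. measure lebesgue (A \<inter> ball z r)/measure lebesgue (ball z r)) \<longlongrightarrow> 1) (at_right 0)"
  using A by(auto simp: density_one_def)
 have "eventually (%r. 1 - c < measure lebesgue (A \<inter> ball z r)/measure lebesgue (ball z r)) (at_right 0)"
  using lim c by(intro order_tendstoD) auto
 moreover have "eventually (%r::real. 0 < r) (at_right 0)" by(rule eventually_at_right_less)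
 ultimately show ?thesis
 proof eventually_elim
  case (elim r)
  have pos: "0 < measure lebesgue (ball z r)" using elim by simp
  have lm: "A \<inter> ball z r \<in> lmeasurable"
   using As by(intro bounded_set_imp_lmeasurable) (auto intro: bounded_subset[of "ball z r"])
  have "ball z r - A = ball z r - (A \<inter> ball z r)" by auto
  hence "measure lebesgue (ball z r - A) = measure lebesgue (ball z r) - measure lebesgue (A \<inter> ball z r)"
   using lm measurable_measure_Diff[of "ball z r" lebesgue "A \<inter> ball z r"] by auto
  moreover have "(1 - c)*measure lebesgue (ball z r) <= measure lebesgue (A \<inter> ball z r)"
   using elim pos by(simp add: pos_less_divide_eq)
  ultimately show ?case by(simp add: algebra_simps)
 qed
qed

text \<open>If the seminorms differ at the unit vector \<open>w\<close>, they differ by a definite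
  proportion on the ball \<open>b\<close> of radius \<open>e*r/2\<close> about
  \<open>z + (r/2) *\<^sub>R w\<close>, so \<open>b\<close> misses the intersection of the two
  density sets. But \<open>b\<close> fills the fraction \<open>e^2/4\<close> of the ball of radius
  \<open>r\<close>, and the two complements together at most \<open>e^2/8\<close>.\<close>

lemma has_apmd_unique:
 assumes s: "has_apmd d u z s" and s': "has_apmd d u z s'"
 shows "s = s'"
proof(rule ccontr)
 assume "s ~= s'"
 then obtain x where x: "sn s x ~= sn s' x" by(auto simp: sn_inject[symmetric] fun_eq_iff)
 hence x0: "x ~= 0" by auto
 define w where "w = x /\<^sub>R norm x"
 have w: "norm w = 1" using x0 by(simp add: w_def)
 have "x = norm x *\<^sub>R w" using x0 by(simp add: w_def)
 hence "sn s x = norm x * sn s w" "sn s' x = norm x * sn s' w" by(metis sn_scaleR abs_norm_cancel)+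
 hence ne: "sn s w ~= sn s' w" using x by auto
 define h where "h = \<bar>sn s w - sn s' w\<bar>"
 have h: "0 < h" using ne by(simp add: h_def)
 define C where "C = (sn s (axis 1 1) + sn s (axis 2 1)) + (sn s' (axis 1 1) + sn s' (axis 2 1)) + 1"
 have C: "1 <= C" by(simp add: C_def sn_nonneg)
 define e where "e = min (1/2) (h/(2*C))"
 have e: "0 < e" "e <= 1/2" "C*e <= h/2" using h C by(auto simp: e_def min_def field_simps)
 obtain A where A: "A \<subseteq> disc" "density_one A z" "((%y. (d (u z) (u y) - sn s (y - z))/norm (y - z)) \<longlongrightarrow> 0) (at z within A)"
  using s unfolding has_apmd_def by blast
 obtain A' where A': "A' \<subseteq> disc" "density_one A' z" "((%y. (d (u z) (u y) - sn s' (y - z))/norm (y - z)) \<longlongrightarrow> 0) (at z within A')"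
  using s' unfolding has_apmd_def by blast
 have e8: "0 < h/16" using h by simp
 obtain r1 where r1: "r1 > 0" "!!y. y \<in> A ==> y ~= z ==> dist y z < r1 ==> \<bar>(d (u z) (u y) - sn s (y - z))/norm (y - z)\<bar> < h/16"
  using A(3)[THEN tendstoD, OF e8] by(auto simp: eventually_at)
 obtain r2 where r2: "r2 > 0" "!!y. y \<in> A' ==> y ~= z ==> dist y z < r2 ==> \<bar>(d (u z) (u y) - sn s' (y - z))/norm (y - z)\<bar> < h/16"
  using A'(3)[THEN tendstoD, OF e8] by(auto simp: eventually_at)
 have c: "0 < e^2/16" using e by simp
 have "eventually (%r. 0 < r \<and> r < min r1 r2 \<and> measure lebesgue (ball z r - A) <= e^2/16*measure lebesgue (ball z r) \<and>
   measure lebesgue (ball z r - A') <= e^2/16*measure lebesgue (ball z r)) (at_right 0)"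
  using r1(1) r2(1)
  by(intro eventually_conj density_one_complement A(2) A'(2) c eventually_at_right_less)
   (auto simp: eventually_at_right[of 0 1] intro: exI[of _ "min r1 r2"])
 from eventually_happens'[OF trivial_limit_at_right_real this]
 obtain r where "0 < r \<and> r < min r1 r2 \<and> measure lebesgue (ball z r - A) <= e^2/16*measure lebesgue (ball z r) \<and>
   measure lebesgue (ball z r - A') <= e^2/16*measure lebesgue (ball z r)" ..
 hence r: "0 < r" "r < r1" "r < r2" "measure lebesgue (ball z r - A) <= e^2/16*measure lebesgue (ball z r)"
   "measure lebesgue (ball z r - A') <= e^2/16*measure lebesgue (ball z r)"
  by simp_all
 define b where "b = ball (z + (r/2) *\<^sub>R w) (e*r/2)"
 have empty: "b \<inter> A \<inter> A' = {}"
 proof(rule ccontr)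
  assume "b \<inter> A \<inter> A' ~= {}"
  then obtain y where y: "y \<in> b" "y \<in> A" "y \<in> A'" by blast
  define p where "p = y - z"
  have pb: "norm (p - (r/2) *\<^sub>R w) < e*r/2"
   using y(1) by(simp add: b_def p_def dist_norm norm_minus_commute algebra_simps)
  have er: "e*r/2 <= r/4" using e r by simp
  have nw: "norm ((r/2) *\<^sub>R w) = r/2" using w r by simp
  have pl: "r/4 <= norm p" using norm_triangle_ineq2[of "(r/2) *\<^sub>R w" "(r/2) *\<^sub>R w - p"] pb er nw
   by(simp add: norm_minus_commute)
  have pu: "norm p < r" using norm_triangle_sub[of p "(r/2) *\<^sub>R w"] pb er nw r(1) by linarith
  have p0: "0 < norm p" using pl r(1) by linarith
  have yz: "y ~= z" "dist y z < r1" "dist y z < r2" using p0 pu r by(auto simp: p_def dist_norm)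
  have "\<bar>(sn s' p - sn s p)/norm p\<bar> < h/8"
  proof -
   have "(sn s' p - sn s p)/norm p = (d (u z) (u y) - sn s p)/norm p - (d (u z) (u y) - sn s' p)/norm p"
    by(simp add: diff_divide_distrib)
   thus ?thesis using r1(2)[OF y(2) yz(1,2)] r2(2)[OF y(3) yz(1,3)] unfolding p_def by linarith
  qed
  hence up: "\<bar>sn s' p - sn s p\<bar> < h/8*norm p" using p0 by(simp add: abs_divide pos_divide_less_eq)
  have sw: "sn s ((r/2) *\<^sub>R w) = r/2 * sn s w" "sn s' ((r/2) *\<^sub>R w) = r/2 * sn s' w" using r by(simp_all add: sn_scaleR)
  have "\<bar>sn s p - sn s ((r/2) *\<^sub>R w)\<bar> + \<bar>sn s' p - sn s' ((r/2) *\<^sub>R w)\<bar> <= C*norm (p - (r/2) *\<^sub>R w)"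
   using sn_diff_le[of s p "(r/2) *\<^sub>R w"] sn_diff_le[of s' p "(r/2) *\<^sub>R w"] norm_ge_zero[of "p - (r/2) *\<^sub>R w"]
   unfolding C_def distrib_right by linarith
  also have "... <= C*(e*r/2)" using pb C by(intro mult_left_mono) auto
  also have "... = (C*e)*(r/2)" by simp
  also have "... <= h/2*(r/2)" using e(3) r(1) by(intro mult_right_mono) auto
  finally have "\<bar>sn s p - sn s ((r/2) *\<^sub>R w)\<bar> + \<bar>sn s' p - sn s' ((r/2) *\<^sub>R w)\<bar> <= h*r/4" by simp
  moreover have "\<bar>sn s ((r/2) *\<^sub>R w) - sn s' ((r/2) *\<^sub>R w)\<bar> = h*r/2"
  proof -
   have "sn s ((r/2) *\<^sub>R w) - sn s' ((r/2) *\<^sub>R w) = r/2*(sn s w - sn s' w)" unfolding sw by(simp add: algebra_simps)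
   hence "\<bar>sn s ((r/2) *\<^sub>R w) - sn s' ((r/2) *\<^sub>R w)\<bar> = r/2*h"
    using r(1) by(simp only: abs_mult h_def)
   thus ?thesis by simp
  qed
  ultimately have "h*r/4 <= \<bar>sn s' p - sn s p\<bar>" by linarith
  moreover have "h/8*norm p <= h/8*r" using pu h by(intro mult_left_mono) auto
  ultimately show False using up mult_pos_pos[OF h r(1)] by linarith
 qed
 have bs: "b \<subseteq> ball z r"
 proof
  fix y assume "y \<in> b"
  hence "norm (y - z - (r/2) *\<^sub>R w) < e*r/2" by(simp add: b_def dist_norm norm_minus_commute algebra_simps)
  moreover have "e*r/2 <= r/4" using e r by simp
  moreover have "norm ((r/2) *\<^sub>R w) = r/2" using w r by simp
  ultimately have "norm (y - z) < r" using norm_triangle_sub[of "y - z" "(r/2) *\<^sub>R w"] r(1) by linarith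
  thus "y \<in> ball z r" by(simp add: dist_norm norm_minus_commute)
 qed
 have As: "A \<in> sets lebesgue" "A' \<in> sets lebesgue" using A A' by(auto simp: density_one_def)
 have lm: "ball z r - A \<in> lmeasurable" "ball z r - A' \<in> lmeasurable"
  using As by(auto intro!: bounded_set_imp_lmeasurable intro: bounded_subset[of "ball z r"])
 have "b \<subseteq> (ball z r - A) \<union> (ball z r - A')" using bs empty by blast
 hence "measure lebesgue b <= measure lebesgue ((ball z r - A) \<union> (ball z r - A'))"
  using lm by(intro measure_mono_fmeasurable fmeasurable.Un) (auto simp: b_def)
 also have "... <= measure lebesgue (ball z r - A) + measure lebesgue (ball z r - A')"
  using lm by(intro measure_Un_le) auto
 also have "... <= e^2/8*measure lebesgue (ball z r)" using r by simp
 also have "... = e^2/8*(pi*r^2)" using r by(simp add: content_ball unit_ball_vol_2)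
 finally have "measure lebesgue b <= e^2/8*(pi*r^2)" .
 moreover have "measure lebesgue b = pi*(e*r/2)^2" using e r by(simp add: b_def content_ball unit_ball_vol_2)
 hence "measure lebesgue b = e^2/4*(pi*r^2)" by(simp add: power_mult_distrib power_divide)
 moreover have "0 < e^2*(pi*r^2)" using e r by simp
 ultimately show False by linarith
qed

lemma apmd_eqI:
 assumes "has_apmd d u z s"
 shows "apmd d u z = s"
 unfolding apmd_def using assms by(rule the_equality) (rule has_apmd_unique[OF _ assms])

lemma density_one_diff_null:
 assumes A: "density_one A z" and N: "N \<in> null_sets lebesgue"
 shows "density_one (A - N) z"
proof -
 have "measure lebesgue ((A - N) \<inter> ball z r) = measure lebesgue (A \<inter> ball z r)" for r
 proof -
  have "(A - N) \<inter> ball z r = (A \<inter> ball z r) - N" by auto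
  moreover have "emeasure lebesgue (A \<inter> ball z r - N) = emeasure lebesgue (A \<inter> ball z r)"
   using A N by(intro emeasure_Diff_null_set) (auto simp: density_one_def)
  ultimately show ?thesis by(simp add: measure_def)
 qed
 thus ?thesis using A N by(auto simp: density_one_def)
qed

section \<open>Distances of seminorms and suprema of linear functionals\<close>

lemma dist_sn_le: "v \<in> sphere 0 1 ==> \<bar>sn s v - sn s' v\<bar> <= dist s s'"
 unfolding dist_seminorm2_def by(rule cSUP_upper[OF _ bdd_sn_diff])

lemma dist_sn_leI: "(!!v. norm v = 1 ==> \<bar>sn s v - sn s' v\<bar> <= c) ==> dist s s' <= c"
 unfolding dist_seminorm2_def by(intro cSUP_least[OF sphere2_nonempty]) auto

lemma sn_diff_le_dist: "\<bar>sn s v - sn s' v\<bar> <= dist s s'*norm v"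
proof(cases "v = 0")
 case False
 define w where "w = v /\<^sub>R norm v"
 have w: "norm w = 1" "v = norm v *\<^sub>R w" using False by(auto simp: w_def)
 have "sn s v = norm v * sn s w" "sn s' v = norm v * sn s' w" using w(2) by(metis sn_scaleR abs_norm_cancel)+
 hence "\<bar>sn s v - sn s' v\<bar> = norm v * \<bar>sn s w - sn s' w\<bar>"
  by(simp add: abs_mult flip: right_diff_distrib)
 also have "... <= norm v * dist s s'" using w(1) by(intro mult_left_mono dist_sn_le) auto
 finally show ?thesis by(simp add: mult.commute)
qed simp

text \<open>The value 0 for unbounded families only makes the operation total.\<close>

lift_definition supsn :: "(nat => real^2) => seminorm2" is
 "%G w. if bounded (range G) then (SUP i. \<bar>G i \<bullet> w\<bar>) else 0"
proof -
 fix G :: "nat => real^2"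
 let ?s = "%w. if bounded (range G) then (SUP i. \<bar>G i \<bullet> w\<bar>) else 0"
 show "(\<forall>x y. ?s (x + y) <= ?s x + ?s y) \<and> (\<forall>c x. ?s (c *\<^sub>R x) = \<bar>c\<bar>*?s x)"
 proof(cases "bounded (range G)")
  case True
  then obtain B where B: "!!i. norm (G i) <= B" by(auto simp: bounded_iff)
  have bd: "bdd_above (range (%i. \<bar>G i \<bullet> w\<bar>))" for w
  proof(rule bdd_aboveI2)
   fix i
   have "\<bar>G i \<bullet> w\<bar> <= norm (G i)*norm w" by(rule Cauchy_Schwarz_ineq2)
   also have "... <= B*norm w" using B by(intro mult_right_mono) auto
   finally show "\<bar>G i \<bullet> w\<bar> <= B*norm w" .
  qed
  have up: "\<bar>G i \<bullet> w\<bar> <= (SUP i. \<bar>G i \<bullet> w\<bar>)" for i w by(rule cSUP_upper[OF _ bd]) simp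
  have tri: "(SUP i. \<bar>G i \<bullet> (x + y)\<bar>) <= (SUP i. \<bar>G i \<bullet> x\<bar>) + (SUP i. \<bar>G i \<bullet> y\<bar>)" for x y
  proof(rule cSUP_least)
   fix i
   have "\<bar>G i \<bullet> (x + y)\<bar> <= \<bar>G i \<bullet> x\<bar> + \<bar>G i \<bullet> y\<bar>" by(simp add: inner_add_right)
   thus "\<bar>G i \<bullet> (x + y)\<bar> <= (SUP i. \<bar>G i \<bullet> x\<bar>) + (SUP i. \<bar>G i \<bullet> y\<bar>)"
    using up[of i x] up[of i y] by linarith
  qed simp
  have le: "(SUP i. \<bar>G i \<bullet> (c *\<^sub>R x)\<bar>) <= \<bar>c\<bar>*(SUP i. \<bar>G i \<bullet> x\<bar>)" for c x
   by(rule cSUP_least) (auto simp: abs_mult intro!: mult_left_mono up)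
  have "(SUP i. \<bar>G i \<bullet> (c *\<^sub>R x)\<bar>) = \<bar>c\<bar>*(SUP i. \<bar>G i \<bullet> x\<bar>)" for c x
  proof(cases "c = 0")
   case False
   have "(SUP i. \<bar>G i \<bullet> x\<bar>) <= \<bar>inverse c\<bar>*(SUP i. \<bar>G i \<bullet> (c *\<^sub>R x)\<bar>)"
    using le[of "inverse c" "c *\<^sub>R x"] False by simp
   hence "\<bar>c\<bar>*(SUP i. \<bar>G i \<bullet> x\<bar>) <= (SUP i. \<bar>G i \<bullet> (c *\<^sub>R x)\<bar>)"
    using False by(simp add: field_simps)
   thus ?thesis using le[of c x] by linarith
  qed simp
  thus ?thesis using tri True by simp
 qed simp
qed

lemma sn_supsn_ge:
 assumes "bounded (range G)"
 shows "\<bar>G i \<bullet> w\<bar> <= sn (supsn G) w"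
proof -
 obtain B where B: "!!i. norm (G i) <= B" using assms by(auto simp: bounded_iff)
 have bd: "bdd_above (range (%i. \<bar>G i \<bullet> w\<bar>))"
 proof(rule bdd_aboveI2)
  fix i
  have "\<bar>G i \<bullet> w\<bar> <= norm (G i)*norm w" by(rule Cauchy_Schwarz_ineq2)
  also have "... <= B*norm w" using B by(intro mult_right_mono) auto
  finally show "\<bar>G i \<bullet> w\<bar> <= B*norm w" .
 qed
 show ?thesis using assms by(simp add: supsn.rep_eq cSUP_upper[OF _ bd])
qed

lemma sn_supsn_le:
 assumes "!!i. \<bar>G i \<bullet> w\<bar> <= c" "0 <= c"
 shows "sn (supsn G) w <= c"
 using assms by(auto simp: supsn.rep_eq intro!: cSUP_least)

lemma sn_supsn_le_norm:
 assumes "!!i. norm (G i) <= c"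
 shows "sn (supsn G) w <= c*norm w"
proof(rule sn_supsn_le)
 have c: "0 <= c" using order_trans[OF norm_ge_zero assms] .
 show "\<bar>G i \<bullet> w\<bar> <= c*norm w" for i
  using Cauchy_Schwarz_ineq2[of "G i" w] mult_right_mono[OF assms[of i], of "norm w"] by simp
 show "0 <= c*norm w" using c by simp
qed

lemma sn_supsn_less:
 assumes "bounded (range G)" "c < sn (supsn G) w" "0 <= c"
 obtains i where "c < \<bar>G i \<bullet> w\<bar>"
 using sn_supsn_le[of G w c] assms by(meson not_le)

text \<open>Compactness of the unit circle makes finitely many functionals nearly optimal in all
  directions; only finitely many gradients can be controlled simultaneously near a point.\<close>

lemma sn_supsn_finite_approx:
 assumes G: "bounded (range G)" and e: "0 < ep"
 obtains M where "!!w. \<exists>i<M. sn (supsn G) w - ep*norm w <= \<bar>G i \<bullet> w\<bar>"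
proof -
 let ?s = "sn (supsn G)"
 define O' where "O' i = {v. ?s v - ep < \<bar>G i \<bullet> v\<bar>}" for i
 have op: "open (O' i)" for i unfolding O'_def
  by(intro open_Collect_less continuous_intros continuous_on_sn)
 have cov: "sphere 0 1 \<subseteq> (\<Union>i\<in>UNIV. O' i)"
 proof
  fix v :: "real^2" assume "v \<in> sphere 0 1"
  have "\<exists>i. ?s v - ep < \<bar>G i \<bullet> v\<bar>"
  proof(cases "0 <= ?s v - ep")
   case True
   thus ?thesis using sn_supsn_less[OF G, of "?s v - ep" v] e by auto
  next
   case False
   thus ?thesis by(intro exI[of _ 0]) linarith
  qed
  thus "v \<in> (\<Union>i\<in>UNIV. O' i)" by(auto simp: O'_def)
 qed
 obtain C where C: "finite C" "sphere 0 1 \<subseteq> (\<Union>i\<in>C. O' i)"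
  using compactE_image[OF compact_sphere, of UNIV O' 0 1] op cov by auto
 obtain M where M: "!!i. i \<in> C ==> i < M" using C(1) finite_nat_set_iff_bounded by auto
 show ?thesis
 proof(rule that[of M])
  fix w :: "real^2"
  show "\<exists>i<M. ?s w - ep*norm w <= \<bar>G i \<bullet> w\<bar>"
  proof(cases "w = 0")
   case True
   have "C ~= {}" using C(2) by auto
   thus ?thesis using M True by auto
  next
   case False
   define v where "v = w /\<^sub>R norm w"
   have v: "norm v = 1" "w = norm w *\<^sub>R v" using False by(auto simp: v_def)
   then obtain i where i: "i \<in> C" "?s v - ep < \<bar>G i \<bullet> v\<bar>" using C(2) by(force simp: O'_def)
   have "norm w*(?s v - ep) <= norm w*\<bar>G i \<bullet> v\<bar>" using i(2) by(intro mult_left_mono) auto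
   moreover have "?s w = norm w*?s v" using v(2) by(metis sn_scaleR abs_norm_cancel)
   moreover have "\<bar>G i \<bullet> w\<bar> = norm w*\<bar>G i \<bullet> v\<bar>" by(subst v(2)) (simp add: abs_mult)
   ultimately show ?thesis using M[OF i(1)] by(auto simp: algebra_simps)
  qed
 qed
qed

lemma borel_measurable_sn_supsn:
 assumes [measurable]: "!!i. G i \<in> borel_measurable M" and b: "!!z. z \<in> space M ==> bounded (range (%i. G i z))"
 shows "(%z. sn (supsn (%i. G i z)) w) \<in> borel_measurable M"
proof(subst borel_measurable_iff_le, intro allI)
 fix a
 have "{z \<in> space M. sn (supsn (%i. G i z)) w <= a} = (if 0 <= a then {z \<in> space M. \<forall>i. \<bar>G i z \<bullet> w\<bar> <= a} else {})"
 proof(cases "0 <= a")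
  case True
  have "sn (supsn (%i. G i z)) w <= a \<longleftrightarrow> (\<forall>i. \<bar>G i z \<bullet> w\<bar> <= a)" if "z \<in> space M" for z
   using sn_supsn_ge[OF b[OF that], of _ w] sn_supsn_le[of "%i. G i z" w a] True by(meson order_trans)
  thus ?thesis using True by auto
 next
  case False
  thus ?thesis using sn_nonneg[of _ w] by(auto simp: not_le intro: less_le_trans)
 qed
 thus "{z \<in> space M. sn (supsn (%i. G i z)) w <= a} \<in> sets M" by simp
qed

lemma borel_measurable_dist_seminorm:
 assumes "!!w. (%z. sn (S z) w) \<in> borel_measurable M"
 shows "(%z. dist (S z) q) \<in> borel_measurable M"
proof -
 obtain D where D: "countable D" "D \<subseteq> sphere (0::real^2) 1" "sphere 0 1 \<subseteq> closure D"
  using separable[of "sphere (0::real^2) 1"] by blast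
 have [measurable]: "!!w. (%z. sn (S z) w) \<in> borel_measurable M" by fact
 have eq: "dist (S z) q <= a \<longleftrightarrow> (\<forall>v\<in>D. \<bar>sn (S z) v - sn q v\<bar> <= a)" for z a
 proof
  assume "dist (S z) q <= a"
  thus "\<forall>v\<in>D. \<bar>sn (S z) v - sn q v\<bar> <= a" using dist_sn_le D(2) by(meson order_trans subsetD)
 next
  assume a: "\<forall>v\<in>D. \<bar>sn (S z) v - sn q v\<bar> <= a"
  show "dist (S z) q <= a"
  proof(rule dist_sn_leI)
   fix v :: "real^2" assume "norm v = 1"
   hence "v \<in> closure D" using D(3) by auto
   moreover have "closed {v. \<bar>sn (S z) v - sn q v\<bar> <= a}"
    by(intro closed_Collect_le continuous_intros continuous_on_sn)
   hence "closure D \<subseteq> {v. \<bar>sn (S z) v - sn q v\<bar> <= a}"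
    using a by(intro closure_minimal) auto
   ultimately show "\<bar>sn (S z) v - sn q v\<bar> <= a" by blast
  qed
 qed
 show ?thesis
  unfolding borel_measurable_iff_le eq using D(1) by(auto intro!: sets.sets_Collect_countable_Ball)
qed

section \<open>The metric derivative as a supremum of gradients\<close>

lemma ennreal_le_addI:
 assumes "ennreal a <= ennreal b + ennreal c*f" "f < ennreal e" "0 <= b" "0 <= c" "0 <= e"
 shows "a <= b + c*e"
proof -
 have "ennreal c*f <= ennreal c*ennreal e" using assms by(intro mult_left_mono) auto
 hence "ennreal a <= ennreal b + ennreal c*ennreal e"
  using assms(1) by(meson add_left_mono order_trans)
 also have "... = ennreal (b + c*e)" using assms by(simp add: ennreal_mult)
 finally have "ennreal a <= ennreal (b + c*e)" .
 moreover have "0 <= b + c*e" using assms by simp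
 ultimately show ?thesis by(simp only: ennreal_le_iff)
qed

lemma nn_integral_unit_interval_const: "(LN t. indicator {0..1::real} t*c) = c"
proof -
 have "(LN t. c*indicator {0..1::real} t) = c" by(simp add: nn_integral_cmult_indicator)
 thus ?thesis by(simp add: mult.commute)
qed

text \<open>The increment of \<open>h i\<close> from \<open>z\<close> to \<open>y\<close> is the
  integral of \<open>G i\<close> along the segment. Bounding it by the seminorm field
  \<open>S\<close> and choosing \<open>x i\<close> close to \<open>v z\<close> gives the upper
  estimate; the lower one uses the continuity of the single gradients at \<open>z\<close> in the
  averaged sense, for finitely many \<open>i\<close>.\<close>

theorem AE_has_apmd_supsn:
 fixes v :: "real^2 => 'a::metric_space" and x :: "nat => 'a"
 assumes wg: "!!i. weak_gradient (h i) (G i)"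
  and Gg: "!!i z. norm (G i z) <= g z"
  and g: "integrable lborel (%z. indicator disc z*g z)"
  and hv: "AE z in lborel. z \<in> disc --> (\<forall>i. h i z = dist (v z) (x i)) \<and> (\<forall>l>0. \<exists>i. dist (v z) (x i) < l)"
  and Q: "countable Q" "!!(s::seminorm2) l. 0 < l ==> \<exists>q\<in>Q. dist s q < l"
 shows "AE z in lborel. z \<in> disc --> has_apmd dist v z (supsn (%i. G i z))"
proof -
 have Gi: "integrable lborel (G i)" and hi: "integrable lborel (h i)" for i using wg by(auto simp: weak_gradient_def)
 have [measurable]: "G i \<in> borel_measurable borel" "h i \<in> borel_measurable borel" for i using Gi[of i] hi[of i] by auto
 have disc_m [measurable]: "disc \<in> sets borel" by simp
 have g0: "0 <= g z" for z using order_trans[OF norm_ge_zero Gg] .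
 have bd: "bounded (range (%i. G i z))" for z using Gg by(auto simp: bounded_iff)
 define S where "S z = supsn (%i. G i z)" for z
 have Sm: "(%z. sn (S z) w) \<in> borel_measurable borel" for w
  unfolding S_def by(rule borel_measurable_sn_supsn) (use bd in auto)
 have Sd [measurable]: "(%z. dist (S z) q) \<in> borel_measurable borel" for q
  by(rule borel_measurable_dist_seminorm[OF Sm])
 have Sd' [measurable]: "(%z. dist (S z) q) \<in> borel_measurable lborel" for q using Sd by simp
 have Gd [measurable]: "(%z. dist (G i z) q) \<in> borel_measurable lborel" for i q
  using measurable_lborel1 by measurable
 have discI: "integrable lborel (%y. indicator disc y*c)" for c :: real
  by(rule integrable_mult_left, rule integrable_real_indicator) (simp_all add: emeasure_lborel_ball_finite[unfolded infinity_ennreal_def])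
 have S0: "sn (S z) w <= g z*norm w" for z w unfolding S_def by(rule sn_supsn_le_norm[OF Gg])
 have dS: "dist (S y) q <= g y + dist (Abs_seminorm2 (%_. 0)) q" for y q
 proof -
  have z: "sn (Abs_seminorm2 (%_. 0)) w = 0" for w by(simp add: Abs_seminorm2_inverse)
  have "dist (S y) (Abs_seminorm2 (%_. 0)) <= g y"
   by(rule dist_sn_leI) (use S0[of y] in \<open>simp add: z sn_nonneg, metis mult_1_right\<close>)
  thus ?thesis using dist_triangle[of "S y" q "Abs_seminorm2 (%_. 0)"] by linarith
 qed
 have Sint: "integrable lborel (%y. indicator disc y*dist (S y) q)" for q
 proof(rule Bochner_Integration.integrable_bound)
  show "integrable lborel (%y. indicator disc y*g y + indicator disc y*dist (Abs_seminorm2 (%_. 0)) q)"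
   using g discI by(intro Bochner_Integration.integrable_add)
  show "AE y in lborel. norm (indicator disc y*dist (S y) q) <= norm (indicator disc y*g y + indicator disc y*dist (Abs_seminorm2 (%_. 0)) q)"
   using dS g0 by(intro AE_I2) (auto split: split_indicator)
 qed measurable
 have aS: "AE z in lborel. z \<in> disc --> avg_zero (%y. ennreal (indicator disc y*dist (S y) (S z))) z"
  by(rule AE_avg_zero_dist[OF Q Sint])
 obtain R :: "(real^2) set" where R: "countable R" "!!X. open X ==> X ~= {} ==> \<exists>d\<in>R. d \<in> X"
  using countable_dense_setE by blast
 have aG: "AE z in lborel. z \<in> disc --> avg_zero (%y. ennreal (indicator disc y*dist (G i y) (G i z))) z" for i
 proof(rule AE_avg_zero_dist[OF R(1)])
  fix s :: "real^2" and l :: real assume "0 < l"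
  thus "\<exists>q\<in>R. dist s q < l" using R(2)[of "ball s l"] by auto
 next
  fix q :: "real^2"
  show "integrable lborel (%y. indicator disc y*dist (G i y) q)"
  proof(rule Bochner_Integration.integrable_bound)
   show "integrable lborel (%y. norm (G i y) + indicator disc y*norm q)"
    using Gi discI by(intro Bochner_Integration.integrable_add) auto
   show "AE y in lborel. norm (indicator disc y*dist (G i y) q) <= norm (norm (G i y) + indicator disc y*norm q)"
    using norm_triangle_ineq4 by(intro AE_I2) (auto simp: dist_norm split: split_indicator)
  qed measurable
 qed
 define J where "J i z w = (LI t. indicator {0..1} t*(G i (z + t *\<^sub>R w) \<bullet> w))" for i z w
 define P where "P z w \<longleftrightarrow> (z \<in> disc \<and> z + w \<in> disc --> (\<forall>i. h i (z + w) - h i z = J i z w))" for z w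
 have "AE w in lborel. AE z in lborel. P z w"
 proof(rule AE_I2)
  fix w
  have "AE z in lborel. \<forall>i. z \<in> disc \<and> z + w \<in> disc --> h i (z + w) - h i z = J i z w"
   unfolding AE_all_countable J_def using weak_gradient_segment[OF wg] by blast
  thus "AE z in lborel. P z w" unfolding P_def by eventually_elim blast
 qed
 moreover have "{p \<in> space (lborel \<Otimes>\<^sub>M lborel). P (fst p) (snd p)} \<in> sets (lborel \<Otimes>\<^sub>M lborel)"
 proof -
  have "Measurable.pred (borel \<Otimes>\<^sub>M borel) (%p. P (fst p) (snd p))"
   unfolding P_def J_def by measurable
  moreover have "sets (lborel \<Otimes>\<^sub>M lborel) = sets (borel \<Otimes>\<^sub>M (borel :: (real^2) measure) :: ((real^2) \<times> (real^2)) measure)"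
   by(intro sets_pair_measure_cong sets_lborel)
  ultimately show ?thesis by(simp add: pred_def space_pair_measure)
 qed
 \<comment> \<open>The segment identity was known for every \<open>w\<close> at almost every
   \<open>z\<close>; after the exchange it holds at almost every \<open>z\<close> for almost every
   endpoint, and the exceptional endpoints can be deleted from the density set.\<close>
 ultimately have aP: "AE z in lborel. AE w in lborel. P z w"
  by(subst lborel_pair.AE_commute)
 define good where "good z \<longleftrightarrow> (z \<in> disc --> (\<forall>i. h i z = dist (v z) (x i)) \<and> (\<forall>l>0. \<exists>i. dist (v z) (x i) < l))" for z
 have ag: "AE z in lborel. good z" using hv unfolding good_def .
 have "AE z in lborel. \<forall>i. z \<in> disc --> avg_zero (%y. ennreal (indicator disc y*dist (G i y) (G i z))) z"
  unfolding AE_all_countable using aG by blast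
 with aS aP ag show ?thesis
 proof eventually_elim
  case (elim z)
  show ?case
  proof
   assume z: "z \<in> disc"
   \<comment> \<open>Index 0 measures the oscillation of \<open>S\<close> at \<open>z\<close>, index
     \<open>Suc i\<close> that of \<open>G i\<close>. Listing both in one sequence yields one
     density set for all.\<close>
   define K where "K j y = ennreal (indicator disc y*(case j of 0 => dist (S y) (S z) | Suc i => dist (G i y) (G i z)))" for j y
   define F where "F j y = (LN t. indicator {0..1::real} t*K j (z + t *\<^sub>R (y - z)))" for j y
   have [measurable]: "K j \<in> borel_measurable borel" for j unfolding K_def by(cases j) (simp_all, measurable)
   have Fm [measurable]: "F j \<in> borel_measurable borel" for j unfolding F_def by measurable
   have "avg_zero (K j) z" for j unfolding K_def using elim(1,4) z by(cases j) auto
   hence Fz: "avg_zero (F j) z" for j unfolding F_def[abs_def] by(intro avg_zero_segment) auto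
   obtain A0 where A0: "A0 \<subseteq> disc" "density_one A0 z" "!!j. (F j \<longlongrightarrow> 0) (at z within A0)"
    using avg_zero_density[of F z, OF Fm Fz z] by blast
   define N where "N = {y. \<not> (P z (y - z) \<and> good y)}"
   have "AE y in lborel. P z (y - z)"
   proof -
    have "AE w in distr lborel borel ((+) (- z)). P z w" unfolding lborel_distr_plus by(rule elim(2))
    hence "AE y in lborel. P z (- z + y)" by(rule AE_distrD[rotated]) simp
    thus ?thesis by simp
   qed
   hence "AE y in lborel. P z (y - z) \<and> good y" using ag by eventually_elim blast
   then obtain N0 where N0: "N0 \<in> null_sets lborel" "N \<subseteq> N0"
    unfolding N_def eventually_ae_filter by auto
   have N: "N \<in> null_sets lebesgue" using N0 null_sets_completion_iff2 by blast
   define A where "A = A0 - N"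
   have Ad: "density_one A z" unfolding A_def by(rule density_one_diff_null[OF A0(2) N])
   have AA0: "A \<subseteq> A0" by(auto simp: A_def)
   have FevA: "eventually (%y. F j y < ennreal e) (at z within A)" if "0 < e" for j and e :: real
    using that by(intro order_tendstoD(2)[OF tendsto_within_subset[OF A0(3) AA0]]) simp
   have segd: "z + t *\<^sub>R (y - z) \<in> disc" if "t \<in> {0..1}" "y \<in> disc" for t y
   proof -
    have "(1 - t) *\<^sub>R z + t *\<^sub>R y \<in> disc" using that z by(intro convexD[OF convex_ball]) auto
    thus ?thesis by(simp add: algebra_simps)
   qed
   have hd: "h i y - h i z = J i z (y - z)" "h i y = dist (v y) (x i)" "h i z = dist (v z) (x i)" if "y \<in> A" for i y
   proof -
    have "P z (y - z)" "good y" "y \<in> disc" using that A0(1) by(auto simp: A_def N_def)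
    thus "h i y - h i z = J i z (y - z)" "h i y = dist (v y) (x i)" "h i z = dist (v z) (x i)"
     using z elim(3) by(auto simp: P_def good_def)
   qed
   have upper: "ennreal (dist (v z) (v y)) <= ennreal (sn (S z) (y - z)) + ennreal (norm (y - z))*F 0 y" if y: "y \<in> A" for y
   proof -
    define w where "w = y - z"
    have yd: "y \<in> disc" using y A0(1) by(auto simp: A_def)
    have Jb: "ennreal \<bar>J i z w\<bar> <= ennreal (sn (S z) w) + ennreal (norm w)*F 0 y" for i
    proof -
     have "ennreal \<bar>J i z w\<bar> <= (LN t. ennreal (norm (indicator {0..1} t*(G i (z + t *\<^sub>R w) \<bullet> w))))"
      unfolding J_def using integral_norm_bound_ennreal[of lborel "%t. indicator {0..1} t*(G i (z + t *\<^sub>R w) \<bullet> w)"]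
      by(cases "integrable lborel (%t. indicator {0..1} t*(G i (z + t *\<^sub>R w) \<bullet> w))") (auto simp: not_integrable_integral_eq)
     also have "... <= (LN t. indicator {0..1::real} t*ennreal (sn (S z) w) + ennreal (norm w)*(indicator {0..1} t*K 0 (z + t *\<^sub>R w)))"
     proof(rule nn_integral_mono)
      fix t :: real
      show "ennreal (norm (indicator {0..1} t*(G i (z + t *\<^sub>R w) \<bullet> w))) <= indicator {0..1::real} t*ennreal (sn (S z) w) + ennreal (norm w)*(indicator {0..1} t*K 0 (z + t *\<^sub>R w))"
      proof(cases "t \<in> {0..1}")
       case True
       have "\<bar>G i (z + t *\<^sub>R w) \<bullet> w\<bar> <= sn (S (z + t *\<^sub>R w)) w"
        unfolding S_def by(rule sn_supsn_ge[OF bd])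
       also have "... <= sn (S z) w + norm w*dist (S (z + t *\<^sub>R w)) (S z)"
        using sn_diff_le_dist[of "S (z + t *\<^sub>R w)" w "S z"] by(simp add: mult.commute)
       finally have "ennreal \<bar>G i (z + t *\<^sub>R w) \<bullet> w\<bar> <= ennreal (sn (S z) w + norm w*dist (S (z + t *\<^sub>R w)) (S z))"
        by(rule ennreal_leI)
       thus ?thesis using True segd[OF True yd]
        by(simp add: K_def w_def ennreal_plus sn_nonneg ennreal_mult)
      qed simp
     qed
     also have "... = (LN t. indicator {0..1::real} t*ennreal (sn (S z) w)) +
       (LN t. ennreal (norm w)*(indicator {0..1::real} t*K 0 (z + t *\<^sub>R w)))"
      by(rule nn_integral_add) measurable
     also have "... = ennreal (sn (S z) w) + ennreal (norm w)*F 0 y"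
      by(subst nn_integral_cmult) (simp_all add: nn_integral_unit_interval_const F_def w_def)
     finally show ?thesis .
    qed
    have "dist (v z) (v y) <= \<bar>J i z w\<bar> + 2*dist (v z) (x i)" for i
    proof -
     have "dist (v z) (v y) <= dist (v y) (x i) + dist (v z) (x i)" using dist_triangle2[of "v z" "v y" "x i"] by(simp add: dist_commute)
     thus ?thesis using hd[OF y, of i] unfolding w_def by linarith
    qed
    hence "ennreal (dist (v z) (v y)) <= ennreal (sn (S z) w) + ennreal (norm w)*F 0 y + ennreal e" if ep: "0 < e" for e
    proof -
     \<comment> \<open>Distances to a point close to \<open>v z\<close> nearly recover the distance
       from \<open>v z\<close>.\<close>
     obtain i where i: "dist (v z) (x i) < e/2" using elim(3) z half_gt_zero[OF ep] unfolding good_def by blast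
     hence "dist (v z) (v y) <= \<bar>J i z w\<bar> + e" using \<open>\<And>i. dist (v z) (v y) \<le> \<bar>J i z w\<bar> + 2 * dist (v z) (x i)\<close>[of i] by linarith
     hence "ennreal (dist (v z) (v y)) <= ennreal (\<bar>J i z w\<bar> + e)" by(rule ennreal_leI)
     also have "... = ennreal \<bar>J i z w\<bar> + ennreal e" using ep by simp
     also have "... <= ennreal (sn (S z) w) + ennreal (norm w)*F 0 y + ennreal e" using Jb[of i] by(intro add_right_mono)
     finally show ?thesis .
    qed
    hence "ennreal (dist (v z) (v y)) <= ennreal (sn (S z) w) + ennreal (norm w)*F 0 y"
     by(rule ennreal_le_epsilon)
    thus ?thesis unfolding w_def .
   qed
   have lower: "\<bar>G i z \<bullet> (y - z)\<bar> <= dist (v z) (v y) + norm (y - z)*e" if y: "y \<in> A" and F: "F (Suc i) y < ennreal e" and e: "0 < e" for i y e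
   proof -
    define w where "w = y - z"
    have yd: "y \<in> disc" using y A0(1) by(auto simp: A_def)
    define k where "k t = indicator {0..1} t*((G i (z + t *\<^sub>R w) - G i z) \<bullet> w)" for t :: real
    have [measurable]: "k \<in> borel_measurable borel" unfolding k_def by measurable
    have kb: "(LN t. ennreal (norm (k t))) <= ennreal (norm w)*F (Suc i) y"
    proof -
     have "(LN t. ennreal (norm (k t))) <= (LN t. ennreal (norm w)*(indicator {0..1} t*K (Suc i) (z + t *\<^sub>R w)))"
     proof(rule nn_integral_mono)
      fix t :: real
      show "ennreal (norm (k t)) <= ennreal (norm w)*(indicator {0..1} t*K (Suc i) (z + t *\<^sub>R w))"
      proof(cases "t \<in> {0..1}")
       case True
       have "\<bar>(G i (z + t *\<^sub>R w) - G i z) \<bullet> w\<bar> <= norm w*dist (G i (z + t *\<^sub>R w)) (G i z)"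
        using Cauchy_Schwarz_ineq2[of "G i (z + t *\<^sub>R w) - G i z" w] by(simp add: dist_norm mult.commute)
       hence "ennreal \<bar>(G i (z + t *\<^sub>R w) - G i z) \<bullet> w\<bar> <= ennreal (norm w*dist (G i (z + t *\<^sub>R w)) (G i z))" by(rule ennreal_leI)
       thus ?thesis using True segd[OF True yd] by(simp add: K_def w_def ennreal_mult k_def)
      qed (simp add: k_def)
     qed
     also have "... = ennreal (norm w)*F (Suc i) y"
      by(subst nn_integral_cmult) (simp_all add: F_def w_def)
     finally show ?thesis .
    qed
    have fin: "ennreal (norm w)*F (Suc i) y < \<infinity>"
     using F by(auto simp: ennreal_mult_less_top intro: less_trans[OF _ ennreal_less_top])
    have kint: "integrable lborel k" using kb fin by(intro integrableI_bounded) (auto intro: le_less_trans)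
    have cint: "integrable lborel (%t. indicator {0..1::real} t*(G i z \<bullet> w))" by(intro integrable_mult_left) simp
    have "J i z w = (LI t. k t + indicator {0..1::real} t*(G i z \<bullet> w))"
     unfolding J_def k_def by(rule Bochner_Integration.integral_cong[OF refl]) (simp add: inner_diff_left algebra_simps)
    also have "... = (LI t. k t) + G i z \<bullet> w"
     using kint cint by(subst Bochner_Integration.integral_add) auto
    finally have "G i z \<bullet> w = (h i y - h i z) - (LI t. k t)" using hd(1)[OF y, of i] by(simp add: w_def)
    moreover have "\<bar>h i y - h i z\<bar> <= dist (v z) (v y)"
     unfolding hd(2,3)[OF y] using abs_dist_diff_le[of "v y" "x i" "v z"] by(simp add: dist_commute)
    moreover have "\<bar>(LI t. k t)\<bar> <= norm w*e"
    proof -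
     have "ennreal \<bar>(LI t. k t)\<bar> <= (LN t. ennreal (norm (k t)))"
      using integral_norm_bound_ennreal[OF kint] by simp
     hence "ennreal \<bar>(LI t. k t)\<bar> <= ennreal 0 + ennreal (norm w)*F (Suc i) y" using kb by simp
     from ennreal_le_addI[OF this F] e show ?thesis by simp
    qed
    ultimately show ?thesis unfolding w_def by linarith
   qed
   have "((%y. (dist (v z) (v y) - sn (S z) (y - z))/norm (y - z)) \<longlongrightarrow> 0) (at z within A)"
   proof(rule tendstoI)
    fix e :: real assume e: "0 < e"
    hence e3: "0 < e/3" by simp
    obtain M where M: "!!w. \<exists>i<M. sn (S z) w - e/3*norm w <= \<bar>G i z \<bullet> w\<bar>"
     using sn_supsn_finite_approx[OF bd e3, of z] unfolding S_def by blast
    have "eventually (%y. \<forall>j\<in>{..M}. F j y < ennreal (e/3)) (at z within A)"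
     using FevA[OF e3] by(intro eventually_ball_finite) auto
    moreover have "eventually (%y. y \<in> A \<and> y ~= z) (at z within A)"
     by(auto simp: eventually_at intro: exI[of _ 1])
    ultimately show "eventually (%y. dist ((dist (v z) (v y) - sn (S z) (y - z))/norm (y - z)) 0 < e) (at z within A)"
    proof eventually_elim
     case (elim y)
     have pos: "0 < norm (y - z)" using elim by simp
     have F0: "F 0 y < ennreal (e/3)" using elim by simp
     have u: "dist (v z) (v y) <= sn (S z) (y - z) + norm (y - z)*(e/3)"
      by(rule ennreal_le_addI[OF upper F0]) (use elim e in \<open>auto simp: sn_nonneg\<close>)
     obtain i where i: "i < M" "sn (S z) (y - z) - e/3*norm (y - z) <= \<bar>G i z \<bullet> (y - z)\<bar>" using M by blast
     have "F (Suc i) y < ennreal (e/3)" using elim i(1) by simp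
     hence "\<bar>G i z \<bullet> (y - z)\<bar> <= dist (v z) (v y) + norm (y - z)*(e/3)"
      using elim e3 by(intro lower) auto
     hence "\<bar>dist (v z) (v y) - sn (S z) (y - z)\<bar> <= 2*(e/3)*norm (y - z)"
      using i(2) u by(simp only: abs_le_iff mult.commute[of "norm (y - z)"] distrib_right mult_2) linarith
     also have "... < e*norm (y - z)" using e pos by simp
     finally show ?case using pos by(simp add: abs_divide pos_divide_less_eq)
    qed
   qed
   thus "has_apmd dist v z (supsn (%i. G i z))"
    unfolding has_apmd_def S_def using Ad A0(1) AA0 by blast
  qed
 qed
qed

section \<open>Borel representatives of Sobolev functions\<close>

lemma AE_lebesgue_on_disc: "(AED z. P z) \<longleftrightarrow> (AE z in lborel. z \<in> disc --> P z)"
proof -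
 have "(AE z in lebesgue. z \<in> disc --> P z) \<longleftrightarrow> (AE z in lborel. z \<in> disc --> P z)"
 proof
  assume "AE z in lebesgue. z \<in> disc --> P z"
  then obtain N where N: "N \<in> null_sets lebesgue" "{z. \<not> (z \<in> disc --> P z)} \<subseteq> N"
   unfolding eventually_ae_filter by auto
  then obtain N' where "N' \<in> null_sets lborel" "N \<subseteq> N'" using null_sets_completion_iff2 by blast
  thus "AE z in lborel. z \<in> disc --> P z"
   unfolding eventually_ae_filter using N by(intro bexI[of _ N']) auto
 qed (rule AE_completion)
 thus ?thesis by(subst AE_restrict_space_iff) auto
qed

lemma disc_lebesgue_integral:
 fixes f f' :: "real^2 => 'b::{banach, second_countable_topology}"
 assumes f': "f' \<in> borel_measurable borel" "!!z. z \<notin> disc ==> f' z = 0"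
  and eq: "AED z. f' z = f z" and f: "f \<in> BD"
 shows "integrable (lebesgue_on disc) f \<longleftrightarrow> integrable lborel f'"
  "integral\<^sup>L (lebesgue_on disc) f = integral\<^sup>L lborel f'"
proof -
 have m': "f' \<in> borel_measurable lebesgue" by(rule measurable_completion) (use f'(1) in simp)
 have m: "f' \<in> BD" by(rule measurable_restrict_space1[OF m'])
 have i: "(%z. indicator disc z *\<^sub>R f' z) = f'" using f'(2) by(auto simp: fun_eq_iff split: split_indicator)
 have d: "disc \<inter> space lebesgue \<in> sets (lebesgue :: (real^2) measure)" by auto
 have "integrable (lebesgue_on disc) f \<longleftrightarrow> integrable (lebesgue_on disc) f'"
  using eq by(intro integrable_cong_AE f m) (auto simp: eq_commute)
 also have "... \<longleftrightarrow> integrable lborel f'"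
  using integrable_restrict_space[OF d, of f'] integrable_completion[of f' lborel] f'(1) i by simp
 finally show "integrable (lebesgue_on disc) f \<longleftrightarrow> integrable lborel f'" .
 have "integral\<^sup>L (lebesgue_on disc) f = integral\<^sup>L (lebesgue_on disc) f'"
  using eq by(intro integral_cong_AE f m) (auto simp: eq_commute)
 also have "... = integral\<^sup>L lborel f'"
  using integral_restrict_space[OF d, of f'] integral_completion[of f' lborel] f'(1) i by simp
 finally show "integral\<^sup>L (lebesgue_on disc) f = integral\<^sup>L lborel f'" .
qed

lemma borel_representative_real:
 fixes f :: "real^2 => real"
 assumes f: "f \<in> BD"
 shows "\<exists>f'. f' \<in> borel_measurable borel \<and> (\<forall>z. z \<notin> disc --> f' z = 0) \<and> (AED z. f' z = f z)"
proof -
 have d: "disc \<inter> space lebesgue \<in> sets (lebesgue :: (real^2) measure)" by auto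
 have "(%z. indicator disc z *\<^sub>R f z) \<in> borel_measurable lebesgue"
  using borel_measurable_restrict_space_iff[OF d, of f] f by simp
 from completion_ex_borel_measurable_real[OF this] obtain g where
  g: "g \<in> borel_measurable lborel" "AE z in lborel. indicator disc z *\<^sub>R f z = g z" by blast
 have [measurable]: "g \<in> borel_measurable borel" using g(1) by simp
 have "(%z. indicator disc z*g z) \<in> borel_measurable borel"
  by(intro borel_measurable_times borel_measurable_indicator) auto
 moreover have "AED z. indicator disc z*g z = f z"
  unfolding AE_lebesgue_on_disc using g(2) by eventually_elim auto
 ultimately show ?thesis by(intro exI[of _ "%z. indicator disc z*g z"]) auto
qed

lemma borel_measurable_vec_nth:
 fixes f :: "'a => real^'n"
 assumes "f \<in> borel_measurable M"
 shows "(%x. f x $ i) \<in> borel_measurable M"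
proof -
 have "(%x. f x \<bullet> axis i 1) \<in> borel_measurable M" using assms by measurable
 thus ?thesis by(simp add: inner_axis)
qed

lemma borel_representative_vec:
 fixes f :: "real^2 => real^2"
 assumes f: "f \<in> BD"
 shows "\<exists>f'. f' \<in> borel_measurable borel \<and> (\<forall>z. z \<notin> disc --> f' z = 0) \<and> (AED z. f' z = f z)"
proof -
 have "\<exists>f'. f' \<in> borel_measurable borel \<and> (\<forall>z. z \<notin> disc --> f' z = 0) \<and> (AED z. f' z = f z $ i)" for i
  by(rule borel_representative_real) (rule borel_measurable_vec_nth[OF f])
 hence "\<forall>i. \<exists>f'. f' \<in> borel_measurable borel \<and> (\<forall>z. z \<notin> disc --> f' z = 0) \<and> (AED z. f' z = f z $ i)" ..
 from choice[OF this] obtain g where g: "\<forall>i. g i \<in> borel_measurable borel \<and> (\<forall>z. z \<notin> disc --> g i z = 0) \<and> (AED z. g i z = f z $ i)" ..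
 define f' :: "real^2 => real^2" where "f' z = g 1 z *\<^sub>R axis 1 1 + g 2 z *\<^sub>R axis 2 1" for z
 have [measurable]: "g i \<in> borel_measurable borel" for i using g by blast
 have "f' \<in> borel_measurable borel" unfolding f'_def by measurable
 moreover have "AED z. f' z = f z"
 proof -
  have "AED z. g 1 z = f z $ 1" "AED z. g 2 z = f z $ 2" using g by blast+
  thus ?thesis
   by eventually_elim (simp add: f'_def vec_eq_iff forall_2 axis_def)
 qed
 ultimately show ?thesis using g by(intro exI[of _ f']) (auto simp: f'_def)
qed

lemma integrable_if_square_integrable:
 fixes f :: "real^2 => 'b::euclidean_space"
 assumes "L2_disc f"
 shows "integrable (lebesgue_on disc) f"
proof(rule Bochner_Integration.integrable_bound)
 show "integrable (lebesgue_on disc) (%z. 1 + (norm (f z))^2)"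
 proof(intro Bochner_Integration.integrable_add)
  have "integrable (lebesgue_on disc) (%z::real^2. 1::real)"
   using emeasure_lborel_ball_finite[of "0::real^2" 1]
   by(simp add: integrable_restrict_space integrable_iff_bounded nn_integral_completion emeasure_restrict_space)
  thus "integrable (lebesgue_on disc) (%z::real^2. 1::real)" .
 qed (use assms in \<open>simp add: L2_disc_def\<close>)
 show "AED z. norm (f z) <= norm (1 + (norm (f z))^2)"
 proof(rule AE_I2)
  fix z
  have "0 <= (norm (f z) - 1)^2" by simp
  hence "2*norm (f z) <= 1 + (norm (f z))^2" by(simp add: power2_eq_square algebra_simps)
  thus "norm (f z) <= norm (1 + (norm (f z))^2)" using norm_ge_zero[of "f z"] zero_le_power2[of "norm (f z)"] unfolding real_norm_def by linarith
 qed
qed (use assms in \<open>simp add: L2_disc_def\<close>)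

lemma frechet_derivative_axis_expansion:
 assumes "test_function p"
 shows "fder p z w = w $ 1*fder p z (axis 1 1) + w $ 2*fder p z (axis 2 1)"
proof -
 have l: "linear (fder p z)"
  by(rule has_derivative_linear[OF test_functionD(1)[OF assms]])
 have "w = w $ 1 *\<^sub>R axis 1 1 + w $ 2 *\<^sub>R axis 2 1"
  by(simp add: vec_eq_iff forall_2 axis_def)
 hence "fder p z w = fder p z (w $ 1 *\<^sub>R axis 1 1 + w $ 2 *\<^sub>R axis 2 1)" by simp
 thus ?thesis by(simp add: linear_add[OF l] linear_cmul[OF l])
qed

lemma test_function_measurable_on:
 assumes "test_function p"
 shows "p \<in> BD" "(%z. fder p z w) \<in> BD"
proof -
 have "p \<in> borel_measurable lebesgue" "(%z. fder p z w) \<in> borel_measurable lebesgue"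
  using test_function_measurable[OF assms] by(auto intro!: measurable_completion)
 thus "p \<in> BD" "(%z. fder p z w) \<in> BD"
  by(auto intro: measurable_restrict_space1)
qed

lemma sobolev_gradient_borel_representatives:
 assumes fG: "sobolev_gradient f G"
 shows "\<exists>h H. weak_gradient h H \<and> (AED z. h z = f z \<and> H z = G z)"
proof -
 have L: "L2_disc f" "L2_disc G" using fG by(auto simp: sobolev_gradient_def)
 hence fm: "f \<in> BD" and Gm: "G \<in> BD"
  by(auto simp: L2_disc_def)
 obtain h where h: "h \<in> borel_measurable borel" "!!z. z \<notin> disc ==> h z = 0" "AED z. h z = f z"
  using borel_representative_real[OF fm] by auto
 obtain H where H: "H \<in> borel_measurable borel" "!!z. z \<notin> disc ==> H z = 0" "AED z. H z = G z"
  using borel_representative_vec[OF Gm] by auto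
 have ih: "integrable lborel h" using disc_lebesgue_integral(1)[OF h fm] integrable_if_square_integrable[OF L(1)] by simp
 have iH: "integrable lborel H" using disc_lebesgue_integral(1)[OF H Gm] integrable_if_square_integrable[OF L(2)] by simp
 have test: "(LI z. h z*fder p z w) = - (LI z. (H z \<bullet> w)*p z)" if p: "test_function p" for p w
 proof -
  note m = test_function_measurable[OF p]
  have a: "(LI z. h z*fder p z (axis i 1)) = - (LI z. (H z $ i)*p z)" for i
  proof -
   have "(LINT z|lebesgue_on disc. f z*fder p z (axis i 1)) = (LI z. h z*fder p z (axis i 1))"
    by(rule disc_lebesgue_integral(2)) (use h m fm test_function_measurable_on[OF p] in auto)
   moreover have "(LINT z|lebesgue_on disc. G z $ i*p z) = (LI z. H z $ i*p z)"
   proof(rule disc_lebesgue_integral(2))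
    show "(%z. H z $ i*p z) \<in> borel_measurable borel"
     using H(1) m by(intro borel_measurable_times borel_measurable_vec_nth) auto
    show "(%z. G z $ i*p z) \<in> BD"
     using Gm test_function_measurable_on[OF p] by(intro borel_measurable_times borel_measurable_vec_nth) auto
   qed (use H in auto)
   ultimately show ?thesis using fG p unfolding sobolev_gradient_def by simp
  qed
  obtain B1 where B1: "!!z. \<bar>fder p z (axis 1 1)\<bar> <= B1" "!!z. \<bar>p z\<bar> <= B1" using test_function_bounded[OF p] by blast
  obtain B2 where B2: "!!z. \<bar>fder p z (axis 2 1)\<bar> <= B2" using test_function_bounded[OF p] by blast
  have i1: "integrable lborel (%z. h z*fder p z (axis 1 1))" by(rule integrable_bounded_mult[OF ih _ B1(1)]) (use m in auto)
  have i2: "integrable lborel (%z. h z*fder p z (axis 2 1))" by(rule integrable_bounded_mult[OF ih _ B2]) (use m in auto)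
  have iHi: "integrable lborel (%z. H z $ i*p z)" for i
  proof(rule integrable_bounded_mult[OF _ _ B1(2)])
   have "integrable lborel (%z. H z \<bullet> axis i 1)" using iH by simp
   thus "integrable lborel (%z. H z $ i)" by(simp add: inner_axis)
  qed (use m in auto)
  have "(LI z. h z*fder p z w) =
   (LI z. w $ 1*(h z*fder p z (axis 1 1)) + w $ 2*(h z*fder p z (axis 2 1)))"
   by(rule Bochner_Integration.integral_cong[OF refl]) (simp add: frechet_derivative_axis_expansion[OF p, of _ w] algebra_simps)
  also have "... = w $ 1*(LI z. h z*fder p z (axis 1 1)) + w $ 2*(LI z. h z*fder p z (axis 2 1))"
   using i1 i2 by(subst Bochner_Integration.integral_add) auto
  also have "... = - (w $ 1*(LI z. H z $ 1*p z) + w $ 2*(LI z. H z $ 2*p z))"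
   unfolding a by simp
  also have "w $ 1*(LI z. H z $ 1*p z) + w $ 2*(LI z. H z $ 2*p z) = (LI z. w $ 1*(H z $ 1*p z) + w $ 2*(H z $ 2*p z))"
   using iHi by(subst Bochner_Integration.integral_add) auto
  also have "... = (LI z. (H z \<bullet> w)*p z)"
   by(rule Bochner_Integration.integral_cong[OF refl]) (simp add: inner_vec_def sum_2 algebra_simps)
  finally show ?thesis .
 qed
 have "AED z. h z = f z \<and> H z = G z" using h(3) H(3) by eventually_elim simp
 moreover have "weak_gradient h H" unfolding weak_gradient_def using ih iH h(2) H(2) test by blast
 ultimately show ?thesis by blast
qed

section \<open>Separability of the seminorms and of the essential image\<close>

lemma dist_sn_scale_le: "dist (sn_scale c s) (sn_scale c q) <= \<bar>c\<bar>*dist s q"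
proof(rule dist_sn_leI)
 fix v :: "real^2" assume "norm v = 1"
 hence "\<bar>sn s v - sn q v\<bar> <= dist s q" using sn_diff_le_dist[of s v q] by simp
 thus "\<bar>sn (sn_scale c s) v - sn (sn_scale c q) v\<bar> <= \<bar>c\<bar>*dist s q"
  by(simp add: sn_scale.rep_eq right_diff_distrib[symmetric] abs_mult mult_left_mono)
qed

lemma seminorm_countable_dense:
 assumes I: "definition_of_energy I"
 shows "\<exists>Q :: seminorm2 set. countable Q \<and> (\<forall>s. \<forall>ep>0. \<exists>q\<in>Q. dist s q < ep)"
proof -
 define K where "K = I -` {0..1}"
 have "compact K" using I by(simp add: definition_of_energy_def K_def)
 hence tb: "\<forall>e>0. \<exists>k. finite k \<and> k \<subseteq> K \<and> K \<subseteq> (\<Union>x\<in>k. ball x e)"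
  by(intro seq_compact_imp_totally_bounded) (simp add: compact_eq_seq_compact_metric)
 have "\<forall>n::nat. \<exists>k. finite k \<and> k \<subseteq> K \<and> K \<subseteq> (\<Union>x\<in>k. ball x (1/real (Suc n)))"
  by(intro allI mp[OF spec[OF tb]]) simp
 from choice[OF this] obtain k where k: "\<forall>n::nat. finite (k n) \<and> k n \<subseteq> K \<and> K \<subseteq> (\<Union>x\<in>k n. ball x (1/real (Suc n)))" ..
 define Q where "Q = (\<Union>m::nat. sn_scale (real m) ` (\<Union>n. k n))"
 have "countable Q" unfolding Q_def using k by(intro countable_UN countable_image) (auto intro: countable_finite)
 moreover have "\<exists>q\<in>Q. dist s q < ep" if e: "0 < ep" for s ep
 proof -
  obtain m0 :: nat where m0: "I s <= real m0" using real_arch_simple by blast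
  define m where "m = Suc m0"
  have m: "real m > 0" "I s <= (real m)^2"
   using m0 by(auto simp: m_def power2_eq_square algebra_simps intro: order_trans)
  define s' where "s' = sn_scale (1/real m) s"
  have "I s' = (1/real m)^2*I s" using I by(simp add: definition_of_energy_def s'_def)
  hence "s' \<in> K" using m I by(simp add: K_def definition_of_energy_def power_divide divide_le_eq)
  obtain n :: nat where n: "1/real (Suc n) < ep/real m" using e m nat_approx_posE[of "ep/real m"] by auto
  obtain q where q: "q \<in> k n" "dist q s' < 1/real (Suc n)" using k \<open>s' \<in> K\<close> by fastforce
  have ss: "s = sn_scale (real m) s'" using m by(simp add: s'_def sn_inject[symmetric] sn_scale.rep_eq fun_eq_iff)
  have "dist s (sn_scale (real m) q) <= real m*dist s' q" using dist_sn_scale_le[of "real m" s' q] ss by simp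
  also have "... < real m*(ep/real m)" using q n m by(intro mult_strict_left_mono) (auto simp: dist_commute)
  finally have "dist s (sn_scale (real m) q) < ep" using m by simp
  thus ?thesis using q(1) unfolding Q_def by blast
 qed
 ultimately show ?thesis by blast
qed

lemma essential_dense_sequence:
 assumes "essentially_separably_valued u"
 obtains x :: "nat => 'a::metric_space" where "AED z. \<forall>e>0. \<exists>i. dist (u z) (x i) < e"
proof -
 obtain N where N: "N \<in> null_sets lebesgue" "separable_space (top_of_set (u ` (disc - N)))"
  using assms unfolding essentially_separably_valued_def by blast
 obtain C where C: "countable C" "C \<subseteq> u ` (disc - N)" "top_of_set (u ` (disc - N)) closure_of C = u ` (disc - N)"
  using N(2) unfolding separable_space_def by auto
 \<comment> \<open>An arbitrary point keeps the set nonempty, so that it can be enumerated.\<close>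
 define C' where "C' = insert undefined C"
 define x where "x = from_nat_into C'"
 have rx: "range x = C'" unfolding x_def C'_def using C(1) by(intro range_from_nat_into) auto
 have good: "\<exists>i. dist (u z) (x i) < e" if "z \<in> disc - N" and "0 < e" for z e
 proof -
  have "u z \<in> top_of_set (u ` (disc - N)) closure_of C" using C(3) that by blast
  hence "u z \<in> closure C"
   using closure_mono[of "u ` (disc - N) \<inter> C" C] by(auto simp: closure_of_subtopology euclidean_closure_of)
  hence "\<exists>c\<in>C. dist c (u z) < e" using that(2) by(simp only: closure_approachable)
  then obtain c where c: "c \<in> range x" "dist (u z) c < e" using rx unfolding C'_def by(auto simp: dist_commute)
  thus ?thesis by auto
 qed
 have "AE z in lebesgue. z \<notin> N" by(rule AE_not_in[OF N(1)])
 hence "AED z. \<forall>e>0. \<exists>i. dist (u z) (x i) < e"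
  by(subst AE_restrict_space_iff) (use good in \<open>auto elim!: eventually_mono\<close>)
 thus ?thesis by(rule that)
qed

theorem AE_has_apmd_of_gradients:
 fixes v :: "real^2 => 'a::metric_space" and x :: "nat => 'a"
 assumes I: "definition_of_energy I"
  and sg: "!!i. sobolev_gradient (%z. dist (v z) (x i)) (G i)"
  and Gg: "!!i. AED z. norm (G i z) <= g z" and g: "L2_disc g"
  and dense: "AED z. \<forall>e>0. \<exists>i. dist (v z) (x i) < e"
 shows "AED z. has_apmd dist v z (supsn (%i. G i z))"
proof -
 have "\<forall>i. \<exists>p. weak_gradient (fst p) (snd p) \<and> (AED z. fst p z = dist (v z) (x i) \<and> snd p z = G i z)"
  using sobolev_gradient_borel_representatives[OF sg] by simp
 from choice[OF this] obtain p where p: "\<forall>i. weak_gradient (fst (p i)) (snd (p i)) \<and> (AED z. fst (p i) z = dist (v z) (x i) \<and> snd (p i) z = G i z)" ..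
 define h where "h i = fst (p i)" for i
 define H where "H i = snd (p i)" for i
 have hH: "weak_gradient (h i) (H i)" for i using p by(simp add: h_def H_def)
 have ae: "AED z. h i z = dist (v z) (x i) \<and> H i z = G i z" for i using p by(simp add: h_def H_def)
 have gm: "g \<in> BD" using g by(simp add: L2_disc_def)
 obtain g' where g': "g' \<in> borel_measurable borel" "!!z. z \<notin> disc ==> g' z = 0" "AED z. g' z = g z"
  using borel_representative_real[OF gm] by auto
 note [measurable] = g'(1)
 have [measurable]: "H i \<in> borel_measurable borel" for i using hH[of i] by(auto simp: weak_gradient_def)
 \<comment> \<open>Almost no point is bad. Setting the gradients to 0 there makes the bound by
   \<open>g'\<close> valid everywhere, as \<open>AE_has_apmd_supsn\<close> requires.\<close>
 define bad where "bad z \<longleftrightarrow> (\<exists>i. g' z < norm (H i z))" for z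
 have [measurable]: "Measurable.pred borel bad" unfolding bad_def by measurable
 have aeb: "AED z. \<forall>i. h i z = dist (v z) (x i) \<and> H i z = G i z \<and> norm (H i z) <= g' z"
  unfolding AE_all_countable
 proof
  fix i
  show "AED z. h i z = dist (v z) (x i) \<and> H i z = G i z \<and> norm (H i z) <= g' z"
   using ae[of i] Gg[of i] g'(3) by eventually_elim simp
 qed
 define K where "K i z = (if bad z then 0 else H i z)" for i z
 have [measurable]: "K i \<in> borel_measurable borel" for i unfolding K_def by measurable
 have Hoff: "H i z = 0" "h i z = 0" if "z \<notin> disc" for i z using hH[of i] that by(auto simp: weak_gradient_def)
 have KH: "AE z in lborel. K i z = H i z" for i
  using aeb unfolding AE_lebesgue_on_disc
  by eventually_elim (use Hoff in \<open>auto simp: K_def bad_def not_less[symmetric]\<close>)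
 have wK: "weak_gradient (h i) (K i)" for i
 proof -
  have "(LI z. (H i z \<bullet> w)*f z) = (LI z. (K i z \<bullet> w)*f z)" if f: "test_function f" for f w
  proof(rule integral_cong_AE)
   have [measurable]: "f \<in> borel_measurable borel" using test_function_measurable[OF f] by simp
   show "(%z. (H i z \<bullet> w)*f z) \<in> borel_measurable lborel" "(%z. (K i z \<bullet> w)*f z) \<in> borel_measurable lborel"
    by measurable
   show "AE z in lborel. (H i z \<bullet> w)*f z = (K i z \<bullet> w)*f z" using KH[of i] by eventually_elim simp
  qed
  moreover have "integrable lborel (K i) \<longleftrightarrow> integrable lborel (H i)"
   by(rule integrable_cong_AE) (use KH in auto)
  ultimately show ?thesis using hH[of i] Hoff unfolding weak_gradient_def by(simp add: K_def)
 qed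
 obtain Q :: "seminorm2 set" where Q: "countable Q" "\<forall>s. \<forall>e>0. \<exists>q\<in>Q. dist s q < e"
  using seminorm_countable_dense[OF I] by blast
 have "AE z in lborel. z \<in> disc --> has_apmd dist v z (supsn (%i. K i z))"
 proof(rule AE_has_apmd_supsn[where g = "%z. \<bar>g' z\<bar>", OF wK _ _ _ Q(1)])
  show "\<exists>q\<in>Q. dist s q < e" if "0 < e" for s e using Q(2) that by blast
  show "norm (K i z) <= \<bar>g' z\<bar>" for i z
  proof(cases "bad z")
   case False
   hence "norm (H i z) <= g' z" by(simp add: bad_def not_less)
   thus ?thesis using False by(simp add: K_def)
  qed (simp add: K_def)
  have "integrable lborel g'" using disc_lebesgue_integral(1)[OF g' gm] integrable_if_square_integrable[OF g] by simp
  moreover have "(%z. indicator disc z*\<bar>g' z\<bar>) = (%z. \<bar>g' z\<bar>)" using g'(2) by(auto simp: fun_eq_iff split: split_indicator)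
  ultimately show "integrable lborel (%z. indicator disc z*\<bar>g' z\<bar>)" by simp
  have "AED z. (\<forall>i. h i z = dist (v z) (x i)) \<and> (\<forall>e>0. \<exists>i. dist (v z) (x i) < e)"
   using aeb dense by eventually_elim blast
  thus "AE z in lborel. z \<in> disc --> (\<forall>i. h i z = dist (v z) (x i)) \<and> (\<forall>e>0. \<exists>i. dist (v z) (x i) < e)"
   unfolding AE_lebesgue_on_disc .
 qed
 hence "AED z. has_apmd dist v z (supsn (%i. K i z))" unfolding AE_lebesgue_on_disc .
 moreover have "AED z. \<forall>i. K i z = G i z"
  using aeb
 proof eventually_elim
  case (elim z)
  hence "\<not> bad z" unfolding bad_def by(meson not_less)
  thus ?case using elim by(simp add: K_def)
 qed
 ultimately show ?thesis by eventually_elim simp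
qed

subsection \<open>Steklov averages\<close>

text \<open>The mean over a square with corner \<open>z\<close> serves as mollifier. For a weakly
  differentiable function it is continuously differentiable on smaller discs, which is enough for
  the chain rule, and corner averages give its convergence almost everywhere.\<close>

definition steklov :: "real => (real^2 => real) => real^2 => real" where
 "steklov t f z = (LI p. indicator (cbox 0 (t *\<^sub>R 1)) p*f (z + p))/t^2"

lemma integrable_steklov_kernel:
 fixes f :: "real^2 => real"
 assumes "integrable lborel f"
 shows "integrable lborel (%p. indicator (cbox a b) p*f (z + p))"
 using integrable_mult_indicator[of "cbox a b" lborel "%p. f (z + p)"] integrable_lborel_translate[OF assms, of z] by simp

lemma steklov_corner:
 assumes f: "integrable lborel f"
 shows "steklov t f z = (LI q. indicator (cbox z (z + t *\<^sub>R 1)) q*f q)/t^2"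
proof -
 have [measurable]: "f \<in> borel_measurable borel" using f by simp
 have "(LI q. indicator (cbox z (z + t *\<^sub>R 1)) q*f q) = (LI p. indicator (cbox z (z + t *\<^sub>R 1)) (z + p)*f (z + p))"
  by(rule integral_lborel_translate[symmetric]) measurable
 also have "... = (LI p. indicator (cbox 0 (t *\<^sub>R 1)) p*f (z + p))"
  by(rule Bochner_Integration.integral_cong[OF refl]) (simp add: indicator_def mem_box_cart)
 finally show ?thesis by(simp add: steklov_def)
qed

lemma abs_steklov_le:
 assumes f: "integrable lborel f"
 shows "\<bar>steklov t f z\<bar> <= (LI q. \<bar>f q\<bar>)/t^2"
proof -
 have "\<bar>(LI q. indicator (cbox z (z + t *\<^sub>R 1)) q*f q)\<bar> <= (LI q. \<bar>f q\<bar>)"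
 proof -
  have "\<bar>(LI q. indicator (cbox z (z + t *\<^sub>R 1)) q*f q)\<bar> <= (LI q. \<bar>indicator (cbox z (z + t *\<^sub>R 1)) q*f q\<bar>)"
   using integral_norm_bound[of lborel "%q. indicator (cbox z (z + t *\<^sub>R 1)) q*f q"] by simp
  also have "... <= (LI q. \<bar>f q\<bar>)"
   using integrable_steklov_kernel[OF f, of z "z + t *\<^sub>R 1" 0] f
   by(intro integral_mono) (auto simp: indicator_def)
  finally show ?thesis .
 qed
 thus ?thesis unfolding steklov_corner[OF f] by(simp add: divide_right_mono)
qed

lemma continuous_steklov:
 assumes f: "integrable lborel f"
 shows "continuous_on UNIV (steklov ta f)"
proof -
 have [measurable]: "f \<in> borel_measurable borel" using f by simp
 let ?C = "%z::real^2. cbox z (z + ta *\<^sub>R 1)"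
 have "isCont (%z. (LI q. indicator (?C z) q*f q)) z" for z
 proof(rule continuous_at_sequentiallyI)
  fix s :: "nat => real^2" assume s: "s \<longlonglongrightarrow> z"
  show "(%n. (LI q. indicator (?C (s n)) q*f q)) \<longlonglongrightarrow> (LI q. indicator (?C z) q*f q)"
  proof(rule integral_dominated_convergence)
   show "integrable lborel (%q. \<bar>f q\<bar>)" using f by simp
   show "AE q in lborel. (%n. indicator (?C (s n)) q*f q) \<longlonglongrightarrow> indicator (?C z) q*f q"
    using AE_not_negligible(2)[OF negligible_frontier_interval[of z "z + ta *\<^sub>R 1"]]
   proof eventually_elim
    case (elim q)
    have t: "(%n. s n $ i) \<longlonglongrightarrow> z $ i" for i using s by(rule tendsto_vec_nth)
    have "eventually (%n. (q \<in> ?C (s n)) = (q \<in> ?C z)) sequentially"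
    proof(cases "q \<in> ?C z")
     case True
     hence "q \<in> box z (z + ta *\<^sub>R 1)" using elim by blast
     hence b: "z $ i < q $ i" "q $ i - ta < z $ i" for i by(auto simp: mem_box_cart less_diff_eq diff_less_eq add.commute)
     have "eventually (%n. \<forall>i. s n $ i < q $ i \<and> q $ i - ta < s n $ i) sequentially"
      by(intro eventually_all_finite eventually_conj order_tendstoD[OF t] b)
     thus ?thesis by eventually_elim (use True in \<open>auto simp: mem_box_cart less_imp_le algebra_simps\<close>)
    next
     case False
     then obtain i where "q $ i < z $ i \<or> z $ i < q $ i - ta" by(auto simp: mem_box_cart not_le less_diff_eq)
     hence "eventually (%n. q $ i < s n $ i \<or> s n $ i < q $ i - ta) sequentially"
          proof
      assume "q $ i < z $ i"
      from order_tendstoD(1)[OF t this] show ?thesis by eventually_elim simp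
     next
      assume "z $ i < q $ i - ta"
      from order_tendstoD(2)[OF t this] show ?thesis by eventually_elim simp
     qed
     thus ?thesis
     proof eventually_elim
      case (elim n)
      hence "\<not> (s n $ i <= q $ i \<and> q $ i <= s n $ i + ta)" by auto
      hence "q \<notin> ?C (s n)" by(auto simp: mem_box_cart)
      thus ?case using False by blast
     qed
    qed
    hence "eventually (%n. indicator (?C (s n)) q*f q = indicator (?C z) q*f q) sequentially"
     by eventually_elim (simp add: indicator_def)
    thus ?case by(rule tendsto_eventually)
   qed
   show "AE q in lborel. norm (indicator (?C (s n)) q*f q) <= \<bar>f q\<bar>" for n
    by(auto simp: indicator_def)
  qed measurable
 qed
 hence "continuous_on UNIV (%z. (LI q. indicator (?C z) q*f q))"
  by(simp add: continuous_at_imp_continuous_on)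
 thus ?thesis unfolding steklov_corner[OF f, abs_def] divide_inverse by(intro continuous_intros)
qed

lemma steklov_tendsto:
 assumes f: "integrable lborel f"
 shows "AE z in lborel. (%n. steklov (inverse (Suc n)) f z) \<longlonglongrightarrow> f z"
 using AE_corner_average[OF f]
proof eventually_elim
 case (elim z)
 have "filterlim (%n. inverse (real (Suc n))) (at_right 0) sequentially"
  unfolding filterlim_at using LIMSEQ_inverse_real_of_nat by(auto simp: field_simps)
 from filterlim_compose[OF elim this] show ?case unfolding steklov_corner[OF f] .
qed

text \<open>Averaging does not increase the norm in \<open>L^1\<close>, by Fubini; with convergence
  almost everywhere this is the situation of Scheffe's lemma.\<close>

lemma steklov_tendsto_L1:
 assumes f: "integrable lborel f"
 shows "(%n. (LN z. ennreal (norm (steklov (inverse (Suc n)) f z - f z)))) \<longlonglongrightarrow> 0"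
proof(rule Scheffe_lemma2[OF _ f steklov_tendsto[OF f]])
 have [measurable]: "f \<in> borel_measurable borel" using f by simp
 fix n
 show "steklov (inverse (Suc n)) f \<in> borel_measurable lborel"
  using borel_measurable_continuous_onI[OF continuous_steklov[OF f]] by simp
 define t where "t = inverse (real (Suc n))"
 have t: "0 < t" by(simp add: t_def)
 let ?C = "cbox 0 (t *\<^sub>R 1) :: (real^2) set"
 have vol: "emeasure lborel ?C = ennreal (t^2)"
 proof -
  have "!!b. b \<in> (Basis :: (real^2) set) ==> (t *\<^sub>R 1) \<bullet> b = t" by(auto simp: Basis_vec_def inner_axis)
  thus ?thesis using t by(simp add: emeasure_lborel_cbox_eq)
 qed
 have "(LN z. ennreal (norm (steklov t f z))) <= (LN z. ennreal (inverse (t^2))*(LN p. indicator ?C p*ennreal (norm (f (z + p)))))"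
 proof(rule nn_integral_mono)
  fix z
  have "ennreal \<bar>(LI p. indicator ?C p*f (z + p))\<bar> <= (LN p. ennreal (norm (indicator ?C p*f (z + p))))"
   using integral_norm_bound_ennreal[OF integrable_steklov_kernel[OF f]] by simp
  also have "... = (LN p. indicator ?C p*ennreal (norm (f (z + p))))"
   by(intro nn_integral_cong) (simp add: indicator_def)
  finally have "ennreal (inverse (t^2))*ennreal \<bar>(LI p. indicator ?C p*f (z + p))\<bar> <= ennreal (inverse (t^2))*(LN p. indicator ?C p*ennreal (norm (f (z + p))))"
   by(rule mult_left_mono) simp
  thus "ennreal (norm (steklov t f z)) <= ennreal (inverse (t^2))*(LN p. indicator ?C p*ennreal (norm (f (z + p))))"
   by(simp add: steklov_def divide_inverse abs_mult ennreal_mult mult.commute)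
 qed
 also have "... = ennreal (inverse (t^2))*(LN z. (LN p. indicator ?C p*ennreal (norm (f (z + p)))))"
  by(rule nn_integral_cmult) measurable
 also have "(LN z. (LN p. indicator ?C p*ennreal (norm (f (z + p))))) = (LN p. (LN z. indicator ?C p*ennreal (norm (f (z + p)))))"
  by(rule lborel_pair.Fubini'[symmetric]) measurable
 also have "... = (LN p. (LN z. ennreal (norm (f z)))*indicator ?C p)"
 proof(rule nn_integral_cong)
  fix p :: "real^2"
  have "(LN z. ennreal (norm (f z))) = (\<integral>\<^sup>+z. ennreal (norm (f z)) \<partial>distr lborel borel ((+) p))"
   by(simp add: lborel_distr_plus)
  also have "... = (LN z. ennreal (norm (f (z + p))))"
   by(subst nn_integral_distr) (auto simp: add.commute)
  finally show "(LN z. indicator ?C p*ennreal (norm (f (z + p)))) = (LN z. ennreal (norm (f z)))*indicator ?C p"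
   by(simp add: indicator_def)
 qed
 also have "... = (LN z. ennreal (norm (f z)))*ennreal (t^2)"
  by(simp add: nn_integral_cmult_indicator vol)
 also have "ennreal (inverse (t^2))*((LN z. ennreal (norm (f z)))*ennreal (t^2)) = (LN z. ennreal (norm (f z)))"
 proof -
  have "ennreal (inverse (t^2))*ennreal (t^2) = 1" using t by(simp flip: ennreal_mult)
  thus ?thesis using mult.left_commute[of "ennreal (inverse (t^2))"] by simp
 qed
 finally show "(LN z. ennreal (norm (steklov (inverse (Suc n)) f z))) <= (LN z. ennreal (norm (f z)))"
  by(simp add: t_def)
qed

text \<open>The segment identity is integrated over the square of shifts. Shifts have norm at most
  \<open>2*ta\<close>, so the margins keep both shifted endpoints in the disc. After averaging, the
  identity holds at every point and not merely almost everywhere.\<close>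

lemma steklov_increment:
 assumes hG: "weak_gradient h G" and ta: "0 < ta" and z: "norm z + 2*ta < 1" "norm (z + w) + 2*ta < 1"
 shows "steklov ta h (z + w) - steklov ta h z = (LI t. indicator {0..1} t * steklov ta (%q. G q \<bullet> w) (z + t *\<^sub>R w))"
proof -
 have h: "integrable lborel h" and G: "integrable lborel (%q. G q \<bullet> w)" using hG by(auto simp: weak_gradient_def)
 have [measurable]: "h \<in> borel_measurable borel" "(%q. G q \<bullet> w) \<in> borel_measurable borel" using h G by auto
 have [measurable]: "G \<in> borel_measurable borel" using hG by(auto simp: weak_gradient_def)
 let ?C = "cbox 0 (ta *\<^sub>R 1) :: (real^2) set"
 have Cn: "norm p <= 2*ta" if "p \<in> ?C" for p
  using norm_le_l1_cart[of p] that by(auto simp: mem_box_cart sum_2 forall_2)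
 have ind: "(%z. indicator ?C (z - a) :: real) \<in> borel_measurable borel" for a by measurable
 have "ta^2*(steklov ta h (z + w) - steklov ta h z) = (LI p. indicator ?C p*h (z + w + p) - indicator ?C p*h (z + p))"
  using ta unfolding steklov_def by(subst Bochner_Integration.integral_diff) (auto intro: integrable_steklov_kernel[OF h] simp: right_diff_distrib)
 also have "... = (LI p. (LI t. indicator {0..1} t*(G (z + p + t *\<^sub>R w) \<bullet> w*indicator ?C p)))"
 proof(rule integral_cong_AE)
  have "AE q in distr lborel borel ((+) z). q \<in> disc \<and> q + w \<in> disc -->
    h (q + w) - h q = (LI t. indicator {0..1} t*(G (q + t *\<^sub>R w) \<bullet> w))"
   unfolding lborel_distr_plus by(rule weak_gradient_segment[OF hG])
  hence "AE p in lborel. z + p \<in> disc \<and> z + p + w \<in> disc -->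
    h (z + p + w) - h (z + p) = (LI t. indicator {0..1} t*(G (z + p + t *\<^sub>R w) \<bullet> w))"
   by(rule AE_distrD[rotated]) simp
  thus "AE p in lborel. indicator ?C p*h (z + w + p) - indicator ?C p*h (z + p) = (LI t. indicator {0..1} t*(G (z + p + t *\<^sub>R w) \<bullet> w*indicator ?C p))"
  proof eventually_elim
   case (elim p)
   show ?case
   proof(cases "p \<in> ?C")
    case True
    have "norm (z + p) < 1" "norm (z + w + p) < 1"
     using Cn[OF True] norm_triangle_ineq[of z p] norm_triangle_ineq[of "z + w" p] z by linarith+
    thus ?thesis using elim True by(simp add: add_ac)
   qed simp
  qed
 qed measurable
 also have "... = (LI t. (LI p. indicator {0..1} t*(G (z + p + t *\<^sub>R w) \<bullet> w*indicator ?C p)))"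
 proof(rule lborel_pair.Fubini_integral[symmetric])
  have "integrable (lborel \<Otimes>\<^sub>M lborel) (%(p, t). indicator {0..1::real} t*(G (z + (p + (1*t) *\<^sub>R w)) \<bullet> w*indicator ?C (p + (0*t) *\<^sub>R w)))"
   by(rule integrable_segment_product[OF integrable_lborel_translate[OF G], where B = 1]) (auto simp: indicator_def)
  thus "integrable (lborel \<Otimes>\<^sub>M lborel) (%(p, t). indicator {0..1::real} t*(G (z + p + t *\<^sub>R w) \<bullet> w*indicator ?C p))"
   by(simp add: add_ac)
 qed
 also have "... = (LI t. ta^2*(indicator {0..1} t * steklov ta (%q. G q \<bullet> w) (z + t *\<^sub>R w)))"
  using ta by(intro Bochner_Integration.integral_cong refl) (simp add: steklov_def add_ac mult_ac)
 also have "... = ta^2*(LI t. indicator {0..1} t * steklov ta (%q. G q \<bullet> w) (z + t *\<^sub>R w))" by simp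
 finally show ?thesis using ta by simp
qed

definition steklov_vec :: "real => (real^2 => real^2) => real^2 => real^2" where
 "steklov_vec t G z = (\<chi> i. steklov t (%q. G q $ i) z)"

lemma steklov_inner:
 assumes "integrable lborel G"
 shows "steklov t (%q. G q \<bullet> w) z = steklov_vec t G z \<bullet> w"
proof -
 have Gi: "integrable lborel (%q. G q $ i)" for i
  using integrable_inner_left[of "axis i 1" lborel G] assms by(simp add: inner_axis)
 note k = integrable_steklov_kernel[OF Gi, of 0 "t *\<^sub>R 1" z]
 have "(LI p. indicator (cbox 0 (t *\<^sub>R 1)) p*(G (z + p) \<bullet> w)) =
  (LI p. w $ 1*(indicator (cbox 0 (t *\<^sub>R 1)) p*G (z + p) $ 1) + w $ 2*(indicator (cbox 0 (t *\<^sub>R 1)) p*G (z + p) $ 2))"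
  by(rule Bochner_Integration.integral_cong[OF refl]) (simp add: inner_vec_def sum_2 algebra_simps)
 also have "... = w $ 1*(LI p. indicator (cbox 0 (t *\<^sub>R 1)) p*G (z + p) $ 1) + w $ 2*(LI p. indicator (cbox 0 (t *\<^sub>R 1)) p*G (z + p) $ 2)"
  using k by(subst Bochner_Integration.integral_add) auto
 finally show ?thesis by(simp add: steklov_def steklov_vec_def inner_vec_def sum_2 add_divide_distrib mult.commute)
qed

text \<open>The averaged gradient is continuous, so the integral formula for increments yields a
  genuine derivative.\<close>

lemma steklov_has_derivative:
 assumes hG: "weak_gradient h G" and ta: "0 < ta" and z: "norm z + 2*ta < 1"
 shows "(steklov ta h has_derivative (%w. steklov_vec ta G z \<bullet> w)) (at z)"
proof -
 have G: "integrable lborel G" and Gi: "integrable lborel (%q. G q \<bullet> axis i 1)" for i using hG by(auto simp: weak_gradient_def)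
 have cv: "continuous_on UNIV (steklov_vec ta G)"
  unfolding steklov_vec_def[abs_def] by(intro continuous_on_vec_lambda continuous_steklov) (use Gi in \<open>simp add: inner_axis\<close>)
 have [measurable]: "steklov_vec ta G \<in> borel_measurable borel" by(rule borel_measurable_continuous_onI[OF cv])
 show ?thesis unfolding has_derivative_at_alt
 proof(intro conjI allI impI)
  show "bounded_linear (%w. steklov_vec ta G z \<bullet> w)" by(rule bounded_linear_inner_right)
  fix e :: real assume e: "0 < e"
  have "isCont (steklov_vec ta G) z" using cv by(simp add: continuous_on_eq_continuous_at)
  then obtain d where d: "d > 0" "!!q. dist q z < d ==> dist (steklov_vec ta G q) (steklov_vec ta G z) < e"
   using e unfolding continuous_at_eps_delta by blast
  define d' where "d' = min d (1 - 2*ta - norm z)"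
  show "\<exists>d>0. \<forall>y. norm (y - z) < d --> norm (steklov ta h y - steklov ta h z - steklov_vec ta G z \<bullet> (y - z)) <= e*norm (y - z)"
  proof(intro exI[of _ d'] conjI allI impI)
   show "0 < d'" using d z by(simp add: d'_def)
   fix y assume y: "norm (y - z) < d'"
   define w where "w = y - z"
   have "norm (z + w) <= norm z + norm w" by(rule norm_triangle_ineq)
   hence "norm (z + w) + 2*ta < 1" using y by(simp add: w_def d'_def)
   from steklov_increment[OF hG ta z this]
   have eq: "steklov ta h y - steklov ta h z = (LI t. indicator {0..1} t*(steklov_vec ta G (z + t *\<^sub>R w) \<bullet> w))"
    by(simp add: w_def steklov_inner[OF G])
   define k where "k t = indicator {0..1::real} t*((steklov_vec ta G (z + t *\<^sub>R w) - steklov_vec ta G z) \<bullet> w)" for t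
   have kb: "norm (k t) <= e*norm w*indicator {0..1} t" for t
   proof(cases "t \<in> {0..1}")
    case True
    have "norm (t *\<^sub>R w) <= 1*norm w" using True by(simp only: norm_scaleR) (intro mult_right_mono, auto)
    hence "dist (z + t *\<^sub>R w) z < d" using y by(simp add: dist_norm w_def d'_def)
    hence "norm (steklov_vec ta G (z + t *\<^sub>R w) - steklov_vec ta G z) <= e" using d(2) by(simp add: dist_norm less_imp_le)
    hence "\<bar>(steklov_vec ta G (z + t *\<^sub>R w) - steklov_vec ta G z) \<bullet> w\<bar> <= e*norm w"
     by(intro order_trans[OF Cauchy_Schwarz_ineq2 mult_right_mono]) simp_all
    thus ?thesis using True by(simp add: k_def)
   qed (simp add: k_def)
   have ci: "integrable lborel (%t. c*indicator {0..1::real} t)" for c :: real by(intro integrable_mult_right) simp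
   have ki: "integrable lborel k"
   proof(rule Bochner_Integration.integrable_bound[OF ci[of "e*norm w"]])
    show "k \<in> borel_measurable lborel" unfolding k_def by measurable
    show "AE t in lborel. norm (k t) <= norm (e*norm w*indicator {0..1} t)" using kb e by(auto simp: abs_mult)
   qed
   have "(LI t. indicator {0..1} t*(steklov_vec ta G (z + t *\<^sub>R w) \<bullet> w)) = (LI t. k t + (steklov_vec ta G z \<bullet> w)*indicator {0..1::real} t)"
    by(rule Bochner_Integration.integral_cong[OF refl]) (simp add: k_def inner_diff_left algebra_simps)
   also have "... = (LI t. k t) + steklov_vec ta G z \<bullet> w"
    using ki ci by(subst Bochner_Integration.integral_add) auto
   finally have "steklov ta h y - steklov ta h z - steklov_vec ta G z \<bullet> (y - z) = (LI t. k t)" using eq by(simp add: w_def)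
   moreover have "norm (LI t. k t) <= (LI t. e*norm w*indicator {0..1::real} t)"
    by(rule Bochner_Integration.integral_norm_bound_integral[OF ki ci]) (rule kb)
   ultimately show "norm (steklov ta h y - steklov ta h z - steklov_vec ta G z \<bullet> (y - z)) <= e*norm (y - z)"
    by(simp add: w_def)
  qed
 qed
qed

subsection \<open>Composition with bi-Lipschitz maps\<close>

text \<open>The inverse \<open>P\<close>, the exceptional set \<open>Z\<close> and the derivative
  are part of the data, and one constant bounds both directions; so the notion is symmetric, see
  \<open>bilip_disc_inverse\<close>.\<close>

definition bilip_disc :: "real => (real^2) set => (real^2 => real^2) => (real^2 => real^2 => real^2) => (real^2 => real^2) => bool" where
 "bilip_disc L Z F DF P \<longleftrightarrow> 0 < L \<and> negligible Z \<and> Z \<subseteq> disc \<and>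
  (\<forall>z\<in>disc. F z \<in> disc \<and> P z \<in> disc \<and> P (F z) = z \<and> F (P z) = z) \<and>
  (\<forall>z\<in>disc. \<forall>w\<in>disc. dist (F z) (F w) <= L*dist z w \<and> dist (P z) (P w) <= L*dist z w) \<and>
  (\<forall>z\<in>disc - Z. (F has_derivative DF z) (at z))"

lemma bilip_discD:
 assumes "bilip_disc L Z F DF P"
 shows "0 < L" "negligible Z" "Z \<subseteq> disc"
  "!!z. z \<in> disc ==> F z \<in> disc" "!!z. z \<in> disc ==> P z \<in> disc"
  "!!z. z \<in> disc ==> P (F z) = z" "!!z. z \<in> disc ==> F (P z) = z"
  "!!z w. z \<in> disc ==> w \<in> disc ==> dist (F z) (F w) <= L*dist z w"
  "!!z w. z \<in> disc ==> w \<in> disc ==> dist (P z) (P w) <= L*dist z w"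
  "!!z. z \<in> disc ==> z \<notin> Z ==> (F has_derivative DF z) (at z)"
 using assms unfolding bilip_disc_def by blast+

lemma has_derivative_quotient_tendsto:
 fixes f :: "'a::real_normed_vector => 'b::real_normed_vector"
 assumes d: "(f has_derivative D) (at z)" and e: "e \<longlonglongrightarrow> 0" "!!n. 0 < e n"
 shows "(%n. (f (z + e n *\<^sub>R w) - f z) /\<^sub>R e n) \<longlonglongrightarrow> D w"
proof -
 interpret bounded_linear D by(rule has_derivative_bounded_linear[OF d])
 have "((%t. z + t *\<^sub>R w) has_derivative (%t. t *\<^sub>R w)) (at (0::real))"
  by(auto intro!: derivative_eq_intros)
 hence "((%t. f (z + t *\<^sub>R w)) has_derivative (%t. D (t *\<^sub>R w))) (at 0)"
  using diff_chain_at[of "%t. z + t *\<^sub>R w" "%t. t *\<^sub>R w" 0 f D] d by(simp add: o_def)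
 hence "((%t. norm (f (z + t *\<^sub>R w) - f (z + 0 *\<^sub>R w) - D ((t - 0) *\<^sub>R w))/norm (t - 0)) \<longlongrightarrow> 0) (at 0)"
  unfolding has_derivative_iff_norm by blast
 moreover have "filterlim e (at 0) sequentially"
  unfolding filterlim_at using e by(auto simp: less_imp_neq[symmetric])
 ultimately have "(%n. norm (f (z + e n *\<^sub>R w) - f (z + 0 *\<^sub>R w) - D ((e n - 0) *\<^sub>R w))/norm (e n - 0)) \<longlonglongrightarrow> 0"
  by(rule filterlim_compose)
 moreover have "norm (f (z + e n *\<^sub>R w) - f (z + 0 *\<^sub>R w) - D ((e n - 0) *\<^sub>R w))/norm (e n - 0) = norm ((f (z + e n *\<^sub>R w) - f z) /\<^sub>R e n - D w)" for n
 proof -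
  have "(f (z + e n *\<^sub>R w) - f z) /\<^sub>R e n - D w = (f (z + e n *\<^sub>R w) - f z - e n *\<^sub>R D w) /\<^sub>R e n"
   using e(2)[of n] by(simp add: scaleR_diff_right)
  thus ?thesis using e(2)[of n]
   by(simp only: diff_0_right scaleR_zero_left add_0_right scaleR norm_scaleR) (simp add: divide_inverse mult.commute)
 qed
 ultimately have "(%n. norm ((f (z + e n *\<^sub>R w) - f z) /\<^sub>R e n - D w)) \<longlonglongrightarrow> 0" by simp
 thus ?thesis by(rule LIM_zero_cancel[OF tendsto_norm_zero_cancel])
qed

lemma inverse_Suc_mult_tendsto: "(%n. c*inverse (real (Suc n))) \<longlonglongrightarrow> 0"
 using tendsto_mult_left[OF LIMSEQ_inverse_real_of_nat, of c] by simp

lemma bilip_disc_facts: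
 assumes b: "bilip_disc L Z F DF P"
 shows "continuous_on disc F" "continuous_on disc P" "inj_on F disc" "F ` disc = disc"
  "!!N. negligible N ==> N \<subseteq> disc ==> negligible (F ` N)"
  "!!N. negligible N ==> negligible {z \<in> disc. F z \<in> N}"
  "!!z w. z \<in> disc ==> z \<notin> Z ==> norm (DF z w) <= L*norm w \<and> norm w <= L*norm (DF z w)"
proof -
 note D = bilip_discD[OF b]
 have neg: "negligible (f ` N)" if "!!z w. z \<in> disc ==> w \<in> disc ==> dist (f z) (f w) <= L*dist z w" "negligible N" "N \<subseteq> disc" for f :: "real^2 => real^2" and N
 proof(rule negligible_locally_Lipschitz_image)
  fix x assume "x \<in> N"
  thus "\<exists>T B. open T \<and> x \<in> T \<and> (\<forall>y\<in>N \<inter> T. norm (f y - f x) <= B*norm (y - x))"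
   using that by(intro exI[of _ UNIV] exI[of _ L]) (auto simp: dist_norm subset_iff)
 qed (use that in auto)
 show "continuous_on disc F" "continuous_on disc P"
  by(rule lipschitz_on_continuous_on[of L], rule lipschitz_onI, use D in auto)+
 show "inj_on F disc" by(rule inj_on_inverseI[of _ P]) (rule D(6))
 show "F ` disc = disc"
 proof(intro equalityI subsetI)
  fix y assume "y \<in> disc"
  thus "y \<in> F ` disc" using D(5,7)[of y] by(intro image_eqI[of _ _ "P y"]) auto
 qed (use D(4) in auto)
 show "negligible (F ` N)" if "negligible N" "N \<subseteq> disc" for N by(rule neg[OF D(8) that])
 show "negligible {z \<in> disc. F z \<in> N}" if "negligible N" for N
 proof(rule negligible_subset)
  show "negligible (P ` (N \<inter> disc))" by(rule neg[OF D(9)]) (use that in \<open>auto intro: negligible_Int\<close>)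
  show "{z \<in> disc. F z \<in> N} \<subseteq> P ` (N \<inter> disc)"
  proof
   fix z assume "z \<in> {z \<in> disc. F z \<in> N}"
   thus "z \<in> P ` (N \<inter> disc)" using D(4,6)[of z] by(intro image_eqI[of _ _ "F z"]) auto
  qed
 qed
 fix z w assume z: "z \<in> disc" "z \<notin> Z"
 have lin: "bounded_linear (DF z)" by(rule has_derivative_bounded_linear[OF D(10)[OF z]])
 define e where "e n = inverse (real (Suc n))" for n
 have e: "e \<longlonglongrightarrow> 0" "!!n. 0 < e n" unfolding e_def by(rule LIMSEQ_inverse_real_of_nat) simp
 have lim: "(%n. norm ((F (z + e n *\<^sub>R w) - F z) /\<^sub>R e n)) \<longlonglongrightarrow> norm (DF z w)"
  by(intro tendsto_norm has_derivative_quotient_tendsto[OF D(10)[OF z] e])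
 have "(%n. z + e n *\<^sub>R w) \<longlonglongrightarrow> z + 0 *\<^sub>R w" by(intro tendsto_intros e)
 hence "eventually (%n. z + e n *\<^sub>R w \<in> disc) sequentially"
  by(rule topological_tendstoD) (use z in auto)
 hence ev: "eventually (%n. norm ((F (z + e n *\<^sub>R w) - F z) /\<^sub>R e n) <= L*norm w \<and> norm w <= L*norm ((F (z + e n *\<^sub>R w) - F z) /\<^sub>R e n)) sequentially"
 proof eventually_elim
  case (elim n)
  have "dist (F (z + e n *\<^sub>R w)) (F z) <= L*dist (z + e n *\<^sub>R w) z" by(rule D(8)[OF elim z(1)])
  moreover have "dist (z + e n *\<^sub>R w) z <= L*dist (F (z + e n *\<^sub>R w)) (F z)"
   using D(9)[OF D(4)[OF elim] D(4)[OF z(1)]] D(6)[OF elim] D(6)[OF z(1)] by simp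
  moreover have "norm ((F (z + e n *\<^sub>R w) - F z) /\<^sub>R e n) = norm (F (z + e n *\<^sub>R w) - F z)/e n"
   using e(2)[of n] by(simp only: norm_scaleR) (simp add: divide_inverse mult.commute)
  ultimately show ?case using e(2)[of n] by(simp only: dist_norm) (simp add: field_simps)
 qed
 show "norm (DF z w) <= L*norm w \<and> norm w <= L*norm (DF z w)"
 proof
  show "norm (DF z w) <= L*norm w" by(rule tendsto_upperbound[OF lim]) (use ev in \<open>auto elim: eventually_mono\<close>)
  show "norm w <= L*norm (DF z w)" by(rule tendsto_lowerbound[OF tendsto_mult_left[OF lim]]) (use ev in \<open>auto elim: eventually_mono\<close>)
 qed
qed

lemma bilip_disc_inverse:
 assumes b: "bilip_disc L Z F DF P"
 shows "bilip_disc L (F ` Z) P (%y. inv (DF (P y))) F"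
  "!!z w. z \<in> disc ==> z \<notin> Z ==> DF z (inv (DF z) w) = w"
proof -
 note D = bilip_discD[OF b] and N = bilip_disc_facts[OF b]
 have surj: "DF z (inv (DF z) w) = w" and inj: "inv (DF z) (DF z w) = w" and lin: "bounded_linear (inv (DF z))"
  if z: "z \<in> disc" "z \<notin> Z" for z w
 proof -
  have l: "linear (DF z)" by(rule has_derivative_linear[OF D(10)[OF z]])
  have i: "inj (DF z)" unfolding linear_injective_0[OF l]
   using N(7)[OF z] by(metis mult_zero_right norm_le_zero_iff norm_zero)
  hence s: "surj (DF z)" by(rule linear_inj_imp_surj[OF l])
  show "DF z (inv (DF z) w) = w" by(rule surj_f_inv_f[OF s])
  show "inv (DF z) (DF z w) = w" by(rule inv_f_f[OF i])
  show "bounded_linear (inv (DF z))"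
   using inj_linear_imp_inv_linear[OF l i] by(simp add: linear_conv_bounded_linear)
 qed
 show "!!z w. z \<in> disc ==> z \<notin> Z ==> DF z (inv (DF z) w) = w" by(rule surj)
 have "(P has_derivative inv (DF (P y))) (at y)" if y: "y \<in> disc" "y \<notin> F ` Z" for y
 proof(rule has_derivative_inverse_basic[where f = F and f' = "DF (P y)" and T = disc])
  have p: "P y \<in> disc" "P y \<notin> Z" using D(5,7)[OF y(1)] y(2) by(auto simp: image_iff)
  show "(F has_derivative DF (P y)) (at (P y))" by(rule D(10)[OF p])
  show "bounded_linear (inv (DF (P y)))" by(rule lin[OF p])
  show "inv (DF (P y)) \<circ> DF (P y) = id" using inj[OF p] by(simp add: fun_eq_iff)
  show "continuous (at y) P" using N(2) y(1) by(simp add: continuous_on_eq_continuous_at)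
 qed (use D(7) y in auto)
 moreover have "negligible (F ` Z)" "F ` Z \<subseteq> disc" using N(5)[OF D(2,3)] D(3,4) by auto
 ultimately show "bilip_disc L (F ` Z) P (%y. inv (DF (P y))) F"
  unfolding bilip_disc_def using D(1,4,5,6,7,8,9) by(intro conjI ballI) simp_all
qed

lemma nn_integral_bilip_disc:
 assumes b: "bilip_disc L Z F DF P" and k: "k \<in> borel_measurable borel"
 shows "(LN y. indicator disc y * k y) = (\<integral>\<^sup>+z. indicator (disc - Z) z*ennreal \<bar>det (matrix (DF z))\<bar> * k (F z) \<partial>lebesgue)"
  "(%z. indicator (disc - Z) z*\<bar>det (matrix (DF z))\<bar>) \<in> borel_measurable lebesgue"
proof -
 note D = bilip_discD[OF b] and N = bilip_disc_facts[OF b]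
 have Zs: "Z \<in> sets lebesgue" using D(2) by(simp add: negligible_imp_sets)
 define S where "S = disc - Z"
 have S: "S \<in> sets lebesgue" unfolding S_def using Zs by auto
 have dS: "(F has_derivative DF z) (at z within T)" if "z \<in> S" for z T
  using D(10) that by(auto simp: S_def intro: has_derivative_at_withinI)
 define J where "J z = indicator S z*\<bar>det (matrix (DF z))\<bar>" for z
 have Jm [measurable]: "J \<in> borel_measurable lebesgue"
 proof -
  have "(%z. det (matrix (DF z))) \<in> borel_measurable (lebesgue_on S)" by(rule borel_measurable_det_Jacobian[OF S dS])
  hence "(%z. \<bar>det (matrix (DF z))\<bar>) \<in> borel_measurable (lebesgue_on S)" by measurable
  thus ?thesis unfolding J_def using borel_measurable_restrict_space_iff[of S lebesgue "%z. \<bar>det (matrix (DF z))\<bar>"] S by simp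
 qed
 thus "(%z. indicator (disc - Z) z*\<bar>det (matrix (DF z))\<bar>) \<in> borel_measurable lebesgue" unfolding J_def S_def .
 have indm: "(indicator disc :: real^2 => ennreal) \<in> borel_measurable borel" by(rule borel_measurable_indicator) simp
 define F0 where "F0 z = (if z \<in> disc then F z else 0)" for z
 have F0b [measurable]: "F0 \<in> borel_measurable borel" unfolding F0_def
  by(rule borel_measurable_continuous_on_if) (use N(1) in auto)
 have F0m [measurable]: "F0 \<in> lebesgue \<rightarrow>\<^sub>M borel" by(rule measurable_completion) (use F0b in simp)
 define M where "M = distr (density lebesgue (%z. ennreal (J z))) borel F0"
 have "M = density lborel (indicator disc)"
 proof(rule measure_eqI)
  fix A :: "(real^2) set" assume "A \<in> sets M"
  hence A: "A \<in> sets borel" by(simp add: M_def)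
  define T where "T = {z \<in> S. F z \<in> A}"
  have "F0 -` A \<inter> space lebesgue \<in> sets lebesgue" by(rule measurable_sets[OF F0m A])
  hence "S \<inter> F0 -` A \<in> sets lebesgue" using S by simp
  moreover have "T = S \<inter> F0 -` A" by(auto simp: T_def F0_def S_def)
  ultimately have T: "T = S \<inter> F0 -` A" "T \<in> sets lebesgue" by simp_all
  have TS: "T \<subseteq> S" "T \<subseteq> disc" by(auto simp: T_def S_def)
  have im: "F ` T = A \<inter> disc - F ` Z"
  proof(intro equalityI subsetI)
   fix y assume "y \<in> F ` T"
   thus "y \<in> A \<inter> disc - F ` Z" using D(3,4) inj_onD[OF N(3)] by(auto simp: T_def S_def subset_iff)
  next
   fix y assume y: "y \<in> A \<inter> disc - F ` Z"
   thus "y \<in> F ` T" using D(5,7)[of y] by(intro image_eqI[of _ _ "P y"]) (auto simp: T_def S_def image_iff)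
  qed
  have nF: "negligible (F ` Z)" by(rule N(5)[OF D(2,3)])
  have lm: "F ` T \<in> lmeasurable" unfolding im
  proof(rule bounded_set_imp_lmeasurable)
   show "A \<inter> disc - F ` Z \<in> sets lebesgue" using A nF by(auto simp: negligible_imp_sets)
   show "bounded (A \<inter> disc - F ` Z)" by(rule bounded_subset[OF bounded_ball[of 0 1]]) auto
  qed
  have "((%z. \<bar>det (matrix (DF z))\<bar>) has_integral measure lebesgue (F ` T)) T"
   using has_measure_differentiable_image[OF T(2), of F DF "measure lebesgue (F ` T)"] dS[OF subsetD[OF TS(1)]] lm inj_on_subset[OF N(3) TS(2)]
   by blast
  from nn_integral_has_integral_lebesgue[OF _ this]
  have i: "(LN z. ennreal (indicator T z*\<bar>det (matrix (DF z))\<bar>)) = ennreal (measure lebesgue (F ` T))" by simp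
  have "emeasure M A = emeasure (density lebesgue (%z. ennreal (J z))) (F0 -` A \<inter> space lebesgue)"
   unfolding M_def by(subst emeasure_distr) (use A in auto)
  also have "... = (\<integral>\<^sup>+z. ennreal (J z)*indicator (F0 -` A \<inter> space lebesgue) z \<partial>lebesgue)"
   by(rule emeasure_density) (use measurable_sets[OF F0m A] in auto)
  also have "... = (LN z. ennreal (indicator T z*\<bar>det (matrix (DF z))\<bar>))"
   unfolding nn_integral_completion by(rule nn_integral_cong) (simp add: J_def T(1) indicator_def)
  also have "... = emeasure lebesgue (F ` T)" unfolding i using lm by(simp add: emeasure_eq_measure2)
  also have "... = emeasure lebesgue (A \<inter> disc)" unfolding im
   by(rule emeasure_Diff_null_set) (use A nF in \<open>auto simp: negligible_iff_null_sets\<close>)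
  also have "... = emeasure (density lborel (indicator disc)) A"
  proof -
   have "emeasure (density lborel (indicator disc)) A = (LN y. indicator disc y*indicator A y)"
    by(rule emeasure_density) (use A indm in simp_all)
   also have "... = (LN y. indicator (A \<inter> disc) y)" by(rule nn_integral_cong) (auto simp: indicator_def)
   also have "... = emeasure lborel (A \<inter> disc)" using A by(intro nn_integral_indicator) auto
   finally show ?thesis using A by simp
  qed
  finally show "emeasure M A = emeasure (density lborel (indicator disc)) A" .
 qed (simp add: M_def)
 hence "(\<integral>\<^sup>+y. k y \<partial>density lborel (indicator disc)) = (\<integral>\<^sup>+y. k y \<partial>M)" by simp
 also have "... = (\<integral>\<^sup>+z. k (F0 z) \<partial>density lebesgue (%z. ennreal (J z)))"
  unfolding M_def by(rule nn_integral_distr) (use k in auto)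
 also have "... = (\<integral>\<^sup>+z. ennreal (J z) * k (F0 z) \<partial>lebesgue)"
 proof(rule nn_integral_density)
  show "(%z. k (F0 z)) \<in> borel_measurable lebesgue" by(rule measurable_compose[OF F0m k])
 qed measurable
 also have "... = (\<integral>\<^sup>+z. indicator (disc - Z) z*ennreal \<bar>det (matrix (DF z))\<bar> * k (F z) \<partial>lebesgue)"
  by(rule nn_integral_cong) (auto simp: J_def S_def F0_def indicator_def)
 finally show "(LN y. indicator disc y * k y) = (\<integral>\<^sup>+z. indicator (disc - Z) z*ennreal \<bar>det (matrix (DF z))\<bar> * k (F z) \<partial>lebesgue)"
  using nn_integral_density[of "indicator disc" lborel k] k indm by simp
qed

text \<open>Difference quotients have integral 0 by translation invariance, and the Lipschitz bound
  with bounded support dominates them.\<close>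

lemma integral_derivative_zero:
 fixes f :: "real^2 => real"
 assumes lip: "!!z w. norm w < de ==> \<bar>f (z + w) - f z\<bar> <= C*norm w" and de: "0 < de" "de <= 1"
  and supp: "!!z. 1 <= norm z ==> f z = 0"
  and d: "AE z in lebesgue. (f has_derivative D z) (at z)"
  and m: "(%z. D z w) \<in> borel_measurable lebesgue"
 shows "(\<integral>z. D z w \<partial>lebesgue) = 0"
proof -
 have C0: "0 <= C" using order_trans[OF abs_ge_zero lip[of "(de/2) *\<^sub>R axis 1 1" 0]] de by(simp add: zero_le_mult_iff)
 have cf: "continuous_on UNIV f"
 proof(rule continuous_at_imp_continuous_on, rule ballI)
  fix z
  have "((%w. f (z + w)) \<longlongrightarrow> f z) (at 0)"
  proof(rule Lim_null_comparison[THEN LIM_zero_cancel])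
   show "eventually (%w. norm (f (z + w) - f z) <= C*norm w) (at 0)"
    unfolding eventually_at using de(1) lip by(intro exI[of _ de]) auto
   show "((%w::real^2. C*norm w) \<longlongrightarrow> 0) (at 0)" by(intro tendsto_mult_right_zero tendsto_norm_zero tendsto_ident_at)
  qed
  thus "isCont f z" by(simp add: isCont_iff)
 qed
 have fm [measurable]: "f \<in> borel_measurable borel" by(rule borel_measurable_continuous_onI[OF cf])
 obtain B where B: "0 < B" "!!z. norm (f z) <= B"
  using continuous_compact_support_bounded[OF cf compact_cball[of 0 1]] supp by(auto simp: less_imp_le)
 have ballint: "integrable lborel (%z::real^2. c*indicator (cball 0 2) z)" for c :: real
  using emeasure_bounded_finite[OF bounded_cball[of "0::real^2" 2]] by(intro integrable_mult_right integrable_real_indicator) auto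
 have fi: "integrable lborel f"
  by(rule Bochner_Integration.integrable_bound[OF ballint[of B]]) (use B supp in \<open>auto simp: indicator_def not_le\<close>)
 define h where "h = de/(1 + norm w)"
 have nw: "0 < 1 + norm w" using norm_ge_zero[of w] by linarith
 have h: "0 < h" "h*norm w < de" using de nw by(auto simp: h_def pos_divide_less_eq)
 define e where "e n = h*inverse (real (Suc n))" for n
 have e: "e \<longlonglongrightarrow> 0" "!!n. 0 < e n" unfolding e_def by(rule inverse_Suc_mult_tendsto) (use h in simp)
 have ew: "norm (e n *\<^sub>R w) < de" for n
 proof -
  have "e n <= h" using h by(simp add: e_def field_simps)
  hence "e n*norm w <= h*norm w" by(rule mult_right_mono) simp
  thus ?thesis using h e(2)[of n] by simp
 qed
 define u where "u n z = (f (z + e n *\<^sub>R w) - f z) /\<^sub>R e n" for n z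
 have um [measurable]: "u n \<in> borel_measurable borel" for n unfolding u_def by measurable
 have iu: "(\<integral>z. u n z \<partial>lebesgue) = 0" for n
 proof -
  have "(\<integral>z. u n z \<partial>lebesgue) = (LI z. u n z)" by(rule integral_completion) simp
  also have "... = ((LI z. f (e n *\<^sub>R w + z)) - (LI z. f z)) /\<^sub>R e n"
   unfolding u_def using fi integrable_lborel_translate[OF fi, of "e n *\<^sub>R w"] by(simp add: add.commute)
  also have "... = 0" by(simp add: integral_lborel_translate)
  finally show ?thesis .
 qed
 have "(%n. \<integral>z. u n z \<partial>lebesgue) \<longlonglongrightarrow> (\<integral>z. D z w \<partial>lebesgue)"
 proof(rule integral_dominated_convergence[OF m])
  show "u n \<in> borel_measurable lebesgue" for n by(rule measurable_completion) simp
  show "integrable lebesgue (%z::real^2. C*norm w*indicator (cball 0 2) z)"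
   using ballint[of "C*norm w"] borel_measurable_integrable[OF ballint[of "C*norm w"]] by(subst integrable_completion) auto
  show "AE z in lebesgue. (%n. u n z) \<longlonglongrightarrow> D z w"
   using d unfolding u_def by eventually_elim (rule has_derivative_quotient_tendsto[OF _ e])
  have "norm (u n z) <= C*norm w*indicator (cball 0 2) z" for n z
  proof(cases "norm z <= 2")
   case True
   have "\<bar>f (z + e n *\<^sub>R w) - f z\<bar> <= C*(e n*norm w)" using lip[OF ew, of z n] e(2)[of n] by simp
   thus ?thesis using True e(2)[of n] by(simp add: u_def abs_mult field_simps)
  next
   case False
   have "norm z <= norm (z + e n *\<^sub>R w) + norm (e n *\<^sub>R w)" by(metis add_diff_cancel_right' norm_triangle_ineq4)
   hence "1 <= norm (z + e n *\<^sub>R w)" using False ew[of n] de by linarith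
   thus ?thesis using supp False by(simp add: u_def)
  qed
  thus "AE z in lebesgue. norm (u n z) <= C*norm w*indicator (cball 0 2) z" for n by simp
 qed
 thus ?thesis unfolding iu by(simp add: LIMSEQ_const_iff)
qed

lemma test_function_lipschitz:
 assumes p: "test_function p"
 shows "\<exists>B. \<forall>z w. \<bar>p z\<bar> <= B \<and> \<bar>fder p z w\<bar> <= B*norm w \<and> \<bar>p z - p w\<bar> <= B*norm (z - w)"
proof -
 obtain B1 where B1: "0 < B1" "!!z. \<bar>p z\<bar> <= B1" "!!z. \<bar>fder p z (axis 1 1)\<bar> <= B1" using test_function_bounded[OF p] by blast
 obtain B2 where B2: "0 < B2" "!!z. \<bar>fder p z (axis 2 1)\<bar> <= B2" using test_function_bounded[OF p] by blast
 have d: "\<bar>fder p z w\<bar> <= (B1 + B2)*norm w" for z w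
 proof -
  have "\<bar>fder p z w\<bar> <= \<bar>w $ 1\<bar>*\<bar>fder p z (axis 1 1)\<bar> + \<bar>w $ 2\<bar>*\<bar>fder p z (axis 2 1)\<bar>"
   unfolding frechet_derivative_axis_expansion[OF p, of z w] abs_mult[symmetric] by(rule abs_triangle_ineq)
  also have "... <= norm w*B1 + norm w*B2"
   by(intro add_mono mult_mono component_le_norm_cart B1 B2) auto
  finally show ?thesis by(simp add: algebra_simps)
 qed
 have on: "onorm (fder p z) <= B1 + B2" for z
  by(rule onorm_bound) (use B1 B2 d in auto)
 have "\<bar>p z - p w\<bar> <= (B1 + B2)*norm (z - w)" for z w
  using differentiable_bound[of UNIV p "%z. fder p z" "B1 + B2" w z] test_functionD(1)[OF p] on
  by(simp add: norm_minus_commute abs_minus_commute)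
 moreover have "\<bar>p z\<bar> <= B1 + B2" for z using B1(2)[of z] B2(1) by linarith
 ultimately show ?thesis using d by(intro exI[of _ "B1 + B2"]) blast
qed

text \<open>The entries of the derivative of the inverse are at most \<open>L\<close> in modulus, so
  its determinant is at most \<open>2*L^2\<close>.\<close>

lemma nn_integral_comp_bilip_le:
 assumes b: "bilip_disc L Z F DF P" and k: "k \<in> borel_measurable borel"
 shows "(LN z. indicator disc z * k (F z)) <= ennreal (2*L^2)*(LN y. indicator disc y * k y)"
proof -
 note D = bilip_discD[OF b] and N = bilip_disc_facts[OF b]
 note b' = bilip_disc_inverse(1)[OF b]
 define F0 where "F0 z = (if z \<in> disc then F z else 0)" for z
 have F0b: "F0 \<in> borel_measurable borel" unfolding F0_def
  by(rule borel_measurable_continuous_on_if) (use N(1) in auto)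
 let ?J = "%y. \<bar>det (matrix (inv (DF (P y))))\<bar>"
 have Jb: "?J y <= 2*L^2" if y: "y \<in> disc" "y \<notin> F ` Z" for y
 proof -
  let ?A = "matrix (inv (DF (P y)))"
  have c: "\<bar>?A $ i $ j\<bar> <= L" for i j
  proof -
   have "norm (inv (DF (P y)) (axis j 1)) <= L" using bilip_disc_facts(7)[OF b' y, of "axis j 1"] by simp
   thus ?thesis using component_le_norm_cart[of "inv (DF (P y)) (axis j 1)" i] by(simp add: matrix_def)
  qed
  have p: "\<bar>?A $ i $ j*?A $ i' $ j'\<bar> <= L*L" for i j i' j'
   unfolding abs_mult by(intro mult_mono c) (use D(1) in auto)
  show ?thesis using p[of 1 1 2 2] p[of 1 2 2 1] unfolding det_2 power2_eq_square by linarith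
 qed
 have "(LN z. indicator disc z * k (F z)) = (LN z. indicator disc z * k (F0 z))"
  by(rule nn_integral_cong) (simp add: F0_def indicator_def)
 also have "... = (\<integral>\<^sup>+y. indicator (disc - F ` Z) y*ennreal (?J y) * k (F0 (P y)) \<partial>lebesgue)"
  by(rule nn_integral_bilip_disc(1)[OF b']) (rule measurable_compose[OF F0b k])
 also have "... <= (\<integral>\<^sup>+y. ennreal (2*L^2)*(indicator disc y * k y) \<partial>lebesgue)"
 proof(rule nn_integral_mono)
  fix y :: "real^2"
  show "indicator (disc - F ` Z) y*ennreal (?J y) * k (F0 (P y)) <= ennreal (2*L^2)*(indicator disc y * k y)"
   using Jb[of y] D(5,7)[of y] by(auto simp: indicator_def F0_def intro!: mult_right_mono ennreal_leI)
 qed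
 also have "... = ennreal (2*L^2)*(LN y. indicator disc y * k y)"
  unfolding nn_integral_completion using k by(intro nn_integral_cmult borel_measurable_times_ennreal borel_measurable_indicator) simp_all
 finally show ?thesis .
qed

text \<open>The transpose of \<open>DF z\<close> applied to \<open>G (F z)\<close>, which is the
  gradient of a composition.\<close>

definition pullback_gradient :: "(real^2) set => (real^2 => real^2) => (real^2 => real^2 => real^2) => (real^2 => real^2) => real^2 => real^2" where
 "pullback_gradient Z F DF G z = (if z \<in> disc - Z then (\<chi> i. G (F z) \<bullet> DF z (axis i 1)) else 0)"

lemma pullback_gradient_inner:
 assumes b: "bilip_disc L Z F DF P" and z: "z \<in> disc" "z \<notin> Z"
 shows "pullback_gradient Z F DF G z \<bullet> w = G (F z) \<bullet> DF z w" "norm (pullback_gradient Z F DF G z) <= L*norm (G (F z))"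
proof -
 note D = bilip_discD[OF b] and N = bilip_disc_facts[OF b]
 have l: "linear (DF z)" by(rule has_derivative_linear[OF D(10)[OF z]])
 show eq: "pullback_gradient Z F DF G z \<bullet> w = G (F z) \<bullet> DF z w" for w
 proof -
  have "w = w $ 1 *\<^sub>R axis 1 1 + w $ 2 *\<^sub>R axis 2 1" by(simp add: vec_eq_iff forall_2 axis_def)
  hence "DF z w = DF z (w $ 1 *\<^sub>R axis 1 1 + w $ 2 *\<^sub>R axis 2 1)" by simp
  hence "DF z w = w $ 1 *\<^sub>R DF z (axis 1 1) + w $ 2 *\<^sub>R DF z (axis 2 1)" by(simp add: linear_add[OF l] linear_cmul[OF l])
  thus ?thesis using z by(simp add: pullback_gradient_def inner_vec_def[of "vec_lambda _"] sum_2 inner_add_right algebra_simps)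
 qed
 let ?p = "pullback_gradient Z F DF G z"
 have "norm ?p*norm ?p = G (F z) \<bullet> DF z ?p" using eq[of ?p] by(simp add: power2_norm_eq_inner[symmetric] power2_eq_square)
 also have "... <= norm (G (F z))*(L*norm ?p)"
  using norm_cauchy_schwarz[of "G (F z)" "DF z ?p"] mult_left_mono[OF conjunct1[OF N(7)[OF z, of ?p]], of "norm (G (F z))"] by simp
 finally have "norm ?p*norm ?p <= (L*norm (G (F z)))*norm ?p" by(simp add: mult_ac)
 thus "norm ?p <= L*norm (G (F z))" using D(1) by(cases "?p = 0") (auto dest: mult_right_le_imp_le)
qed

section \<open>Measurability and square integrability of compositions\<close>

definition on_disc :: "(real^2 => real^2) => real^2 => real^2" where
 "on_disc F z = (if z \<in> disc then F z else 0)"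

lemma measurable_on_disc:
 assumes "continuous_on disc F"
 shows "on_disc F \<in> borel_measurable borel" "on_disc F \<in> lebesgue \<rightarrow>\<^sub>M borel"
proof -
 show 1: "on_disc F \<in> borel_measurable borel" unfolding on_disc_def[abs_def]
  by(rule borel_measurable_continuous_on_if) (use assms in auto)
 show "on_disc F \<in> lebesgue \<rightarrow>\<^sub>M borel" by(rule measurable_completion) (use 1 in simp)
qed

text \<open>Continuity handles Borel sets only. For Lebesgue sets the preimages of null sets must be
  null, which the Lipschitz inverse guarantees.\<close>

lemma bilip_disc_measurable:
 assumes b: "bilip_disc L Z F DF P"
 shows "F \<in> lebesgue_on disc \<rightarrow>\<^sub>M lebesgue_on disc"
proof(rule measurableI)
 note D = bilip_discD[OF b] and N = bilip_disc_facts[OF b]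
 show "F z \<in> space (lebesgue_on disc)" if "z \<in> space (lebesgue_on disc)" for z using that D(4) by simp
 fix A :: "(real^2) set" assume A0: "A \<in> sets (lebesgue_on disc)"
 hence A: "A \<in> sets lebesgue" "A \<subseteq> disc"
  by(auto simp: sets_restrict_space)
 obtain S M M' where S: "A = S \<union> M" "M \<subseteq> M'" "M' \<in> null_sets lborel" "S \<in> sets lborel"
  using A(1) by(rule sets_completionE)
 have "negligible M" using S(2,3) by(auto simp: negligible_iff_null_sets null_sets_completion_iff2)
 hence "{z \<in> disc. F z \<in> M} \<in> sets lebesgue" by(intro negligible_imp_sets N(6))
 moreover have "on_disc F -` S \<inter> disc \<in> sets lebesgue"
  using measurable_sets[OF measurable_on_disc(1)[OF N(1)], of S] S(4) by(intro sets.Int) auto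
 ultimately have "on_disc F -` S \<inter> disc \<union> {z \<in> disc. F z \<in> M} \<in> sets lebesgue" by(rule sets.Un[rotated])
 moreover have "F -` A \<inter> space (lebesgue_on disc) = on_disc F -` S \<inter> disc \<union> {z \<in> disc. F z \<in> M}"
  by(auto simp: S(1) on_disc_def)
 ultimately show "F -` A \<inter> space (lebesgue_on disc) \<in> sets (lebesgue_on disc)"
  by(auto simp: sets_restrict_space_iff)
qed

lemma AE_comp_bilip:
 assumes b: "bilip_disc L Z F DF Ph" and P: "AED z. P z"
 shows "AED z. P (F z)"
proof -
 note D = bilip_discD[OF b] and N = bilip_disc_facts[OF b]
 have "AE z in lborel. z \<in> disc --> P z" using P unfolding AE_lebesgue_on_disc .
 then obtain M where M: "M \<in> null_sets lborel" "{z \<in> space lborel. \<not> (z \<in> disc --> P z)} \<subseteq> M"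
  unfolding eventually_ae_filter by auto
 have "negligible M" using M(1) by(simp add: negligible_iff_null_sets null_sets_completionI)
 from AE_not_in[OF N(6)[OF this, unfolded negligible_iff_null_sets]]
 have "AE z in lborel. z \<notin> {z \<in> disc. F z \<in> M}" by(simp add: AE_completion_iff)
 thus ?thesis unfolding AE_lebesgue_on_disc
  by eventually_elim (use M(2) D(4) in auto)
qed

lemma L2_disc_comp:
 assumes b: "bilip_disc L Z F DF P" and f: "L2_disc f"
 shows "L2_disc (%z. f (F z))"
proof -
 note D = bilip_discD[OF b] and N = bilip_disc_facts[OF b]
 have fm: "f \<in> BD" and fi: "integrable (lebesgue_on disc) (%z. (norm (f z))^2)"
  using f by(auto simp: L2_disc_def)
 have m: "(%z. f (F z)) \<in> BD"
  by(rule measurable_compose[OF bilip_disc_measurable[OF b] fm])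
 have n2m: "(%z. (norm (f z))^2) \<in> BD" using fm by measurable
 obtain k where k: "k \<in> borel_measurable borel" "!!z. z \<notin> disc ==> k z = 0" "AED z. k z = (norm (f z))^2"
  using borel_representative_real[OF n2m] by blast
 have "integrable lborel k" using disc_lebesgue_integral(1)[OF k n2m] fi by simp
 hence fin: "(LN y. ennreal (norm (k y))) < \<infinity>" by(simp add: integrable_iff_bounded)
 have "(\<integral>\<^sup>+z. ennreal (norm ((norm (f (F z)))^2)) \<partial>lebesgue_on disc) = (\<integral>\<^sup>+z. ennreal (norm (k (F z))) \<partial>lebesgue_on disc)"
  using AE_comp_bilip[OF b k(3)] by(intro nn_integral_cong_AE) (auto elim: eventually_mono)
 also have "... = (LN z. indicator disc z*ennreal (norm (k (F z))))"
  by(simp add: nn_integral_restrict_space nn_integral_completion mult.commute)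
 also have "... <= ennreal (2*L^2)*(LN y. indicator disc y*ennreal (norm (k y)))"
  using k(1) by(intro nn_integral_comp_bilip_le[OF b]) auto
 also have "(LN y. indicator disc y*ennreal (norm (k y))) = (LN y. ennreal (norm (k y)))"
  using k(2) by(intro nn_integral_cong) (auto simp: indicator_def)
 also have "ennreal (2*L^2)*... < \<infinity>" using fin by(simp add: ennreal_mult_less_top)
 finally show ?thesis using m unfolding L2_disc_def integrable_iff_bounded by(auto intro!: borel_measurable_power borel_measurable_norm)
qed

lemma pullback_gradient_measurable:
 fixes DF :: "real^2 => real^2 => real^2"
 assumes b: "bilip_disc L Z F DF P" and G: "G \<in> BD"
 shows "pullback_gradient Z F DF G \<in> BD"
  "(%z. indicator (disc - Z) z*(DF z w $ i)) \<in> BD"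
proof -
 note D = bilip_discD[OF b] and N = bilip_disc_facts[OF b]
 have Zs: "Z \<in> sets lebesgue" using D(2) by(simp add: negligible_imp_sets)
 define S where "S = disc - Z"
 have S: "S \<in> sets lebesgue" unfolding S_def using Zs by auto
 have dS: "(F has_derivative DF z) (at z within S)" if "z \<in> S" for z
  using D(10) that by(auto simp: S_def intro: has_derivative_at_withinI)
 have e: "(%z. indicator S z*(DF z (axis n 1) $ m)) \<in> BD" for n m
 proof(rule measurable_restrict_space1)
  have "(%z. matrix (DF z) $ m $ n) \<in> borel_measurable (lebesgue_on S)"
   by(rule borel_measurable_partial_derivatives[OF S dS])
  hence "(%z. DF z (axis n 1) $ m) \<in> borel_measurable (lebesgue_on S)" by(simp add: matrix_def)
  thus "(%z. indicator S z*(DF z (axis n 1) $ m)) \<in> borel_measurable lebesgue"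
   using borel_measurable_restrict_space_iff[of S lebesgue "%z. DF z (axis n 1) $ m"] S by simp
 qed
 have ex: "indicator S z*(DF z w $ m) = w $ 1*(indicator S z*(DF z (axis 1 1) $ m)) + w $ 2*(indicator S z*(DF z (axis 2 1) $ m))" for z w m
 proof(cases "z \<in> S")
  case True
  have l: "linear (DF z)" by(rule has_derivative_linear[OF dS[OF True]])
  have "w = w $ 1 *\<^sub>R axis 1 1 + w $ 2 *\<^sub>R axis 2 1" by(simp add: vec_eq_iff forall_2 axis_def)
  hence "DF z w = DF z (w $ 1 *\<^sub>R axis 1 1 + w $ 2 *\<^sub>R axis 2 1)" by(rule arg_cong)
  thus ?thesis using True by(simp add: linear_add[OF l] linear_cmul[OF l])
 qed simp
 show "(%z. indicator (disc - Z) z*(DF z w $ i)) \<in> BD"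
  unfolding S_def[symmetric] ex[of _ w i] by(intro borel_measurable_add borel_measurable_times e) auto
 have GF: "(%z. G (F z) $ m) \<in> BD" for m
  by(intro borel_measurable_vec_nth measurable_compose[OF bilip_disc_measurable[OF b] G])
 have "(%z. \<Sum>i\<in>UNIV. (\<Sum>m\<in>UNIV. G (F z) $ m*(indicator S z*(DF z (axis i 1) $ m))) *\<^sub>R (axis i 1 :: real^2)) \<in> BD"
  by(intro borel_measurable_sum borel_measurable_scaleR borel_measurable_times e GF) auto
 also have "(%z. \<Sum>i\<in>UNIV. (\<Sum>m\<in>UNIV. G (F z) $ m*(indicator S z*(DF z (axis i 1) $ m))) *\<^sub>R (axis i 1 :: real^2)) = pullback_gradient Z F DF G"
  by(auto simp: fun_eq_iff pullback_gradient_def S_def vec_eq_iff sum_2 forall_2 axis_def inner_vec_def indicator_def)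
 finally show "pullback_gradient Z F DF G \<in> BD" .
qed

lemma L2_disc_bound:
 assumes g: "L2_disc g" and f: "f \<in> BD" and le: "AED z. norm (f z) <= C*norm (g z)"
 shows "L2_disc f"
 unfolding L2_disc_def
proof
 show "integrable (lebesgue_on disc) (%z. (norm (f z))^2)"
 proof(rule Bochner_Integration.integrable_bound)
  show "integrable (lebesgue_on disc) (%z. C^2*(norm (g z))^2)" using g by(simp add: L2_disc_def)
  show "AED z. norm ((norm (f z))^2) <= norm (C^2*(norm (g z))^2)"
   using le
  proof eventually_elim
   case (elim z)
   hence "(norm (f z))^2 <= (C*norm (g z))^2" by(intro power_mono) auto
   thus ?case by(simp add: power_mult_distrib)
  qed
 qed (use f in measurable)
qed (rule f)

text \<open>After mollification the ordinary chain and product rules hold off \<open>Z\<close>. The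
  product with the test function is Lipschitz at small scale with compact support, so its derivative
  integrates to 0. The radii \<open>r\<close> and \<open>rh\<close> and the bound on
  \<open>t\<close> keep \<open>F z\<close> where the average is differentiable.\<close>

lemma steklov_comp_test_integral:
 fixes DF :: "real^2 => real^2 => real^2"
 assumes b: "bilip_disc L Z F DF P" and hH: "weak_gradient h H" and ph: "test_function ph"
  and r: "0 < r" "r < 1" "!!z. r < norm z ==> ph z = 0" "!!z w. r < norm z ==> fder ph z w = 0"
  and rh: "!!z. norm z <= (1 + r)/2 ==> norm (F z) < rh" and t: "0 < t" "rh + 2*t < 1"
 shows "(\<integral>z. indicator (disc - Z) z*((steklov_vec t H (on_disc F z) \<bullet> DF z w)*ph z + steklov t h (on_disc F z)*fder ph z w) \<partial>lebesgue) = 0"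
  (is "(\<integral>z. ?D z w \<partial>lebesgue) = 0")
proof -
 note D = bilip_discD[OF b] and N = bilip_disc_facts[OF b]
 have Zs: "Z \<in> sets lebesgue" using D(2) by(simp add: negligible_imp_sets)
 have h: "integrable lborel h" and H: "integrable lborel H" and Hi: "integrable lborel (%q. H q $ i)" for i
  using hH integrable_inner_left[of "axis i 1" lborel H] by(auto simp: weak_gradient_def inner_axis)
 define r' where "r' = (1 + r)/2"
 have r': "r < r'" "r' < 1" using r by(auto simp: r'_def field_simps)
 define A where "A = (LI q. \<bar>h q\<bar>)/t^2"
 have A: "\<bar>steklov t h z\<bar> <= A" for z unfolding A_def by(rule abs_steklov_le[OF h])
 have A0: "0 <= A" using order_trans[OF abs_ge_zero A] .
 define A' where "A' = (\<Sum>i\<in>UNIV. (LI q. \<bar>H q $ i\<bar>)/t^2)"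
 have A': "norm (steklov_vec t H z) <= A'" for z
  unfolding A'_def by(rule order_trans[OF norm_le_l1_cart sum_mono]) (simp add: steklov_vec_def abs_steklov_le[OF Hi])
 have A'0: "0 <= A'" using order_trans[OF norm_ge_zero A'] .
 have sl: "\<bar>steklov t h p - steklov t h q\<bar> <= A'*norm (p - q)" if "norm p < rh" "norm q < rh" for p q
 proof -
  have "norm (steklov t h p - steklov t h q) <= A'*norm (p - q)"
  proof(rule differentiable_bound[of "ball 0 rh"])
   fix x assume "x \<in> ball (0::real^2) rh"
   hence "norm x + 2*t < 1" using t by simp
   from steklov_has_derivative[OF hH t(1) this]
   show "(steklov t h has_derivative (%w. steklov_vec t H x \<bullet> w)) (at x within ball 0 rh)" by(rule has_derivative_at_withinI)
   show "onorm (%w. steklov_vec t H x \<bullet> w) <= A'"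
   proof(rule onorm_bound[OF A'0])
    fix w show "norm (steklov_vec t H x \<bullet> w) <= A'*norm w"
     using Cauchy_Schwarz_ineq2[of "steklov_vec t H x" w] mult_right_mono[OF A'[of x], of "norm w"] by simp
   qed
  qed (use that in auto)
  thus ?thesis by simp
 qed
 obtain B where B: "!!z. \<bar>ph z\<bar> <= B" "!!z w. \<bar>ph z - ph w\<bar> <= B*norm (z - w)" using test_function_lipschitz[OF ph] by blast
 have B0: "0 <= B" using order_trans[OF abs_ge_zero B(1)] .
 define a where "a z = steklov t h (F z)" for z
 \<comment> \<open>The test function vanishes beyond \<open>r\<close> already; the cutoff at
   \<open>r'\<close> confines \<open>a\<close> to the region where its Lipschitz bound is
   known.\<close>
 define f where "f z = (if norm z < r' then a z*ph z else 0)" for z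
 have fr: "f z = 0" if "r < norm z" for z using r(3)[OF that] by(simp add: f_def)
 define de where "de = (1 - r)/2"
 show ?thesis
 proof(rule integral_derivative_zero[where f = f and C = "A*B + A'*L*B" and de = de])
  show "0 < de" "de <= 1" using r by(auto simp: de_def)
  show "f z = 0" if "1 <= norm z" for z using fr that r by simp
  show "\<bar>f (z + w) - f z\<bar> <= (A*B + A'*L*B)*norm w" if w: "norm w < de" for z w
  proof(cases "norm z <= r \<or> norm (z + w) <= r")
   case True
   have "norm (z + w) <= norm z + norm w" "norm z <= norm (z + w) + norm w"
    using norm_triangle_ineq[of z w] norm_triangle_ineq4[of "z + w" w] by simp_all
   hence n: "norm z < r'" "norm (z + w) < r'" using True w by(auto simp: de_def r'_def field_simps)
   have d: "z \<in> disc" "z + w \<in> disc" using n r' by auto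
   have "\<bar>a (z + w) - a z\<bar> <= A'*norm (F (z + w) - F z)"
    unfolding a_def by(rule sl; rule rh) (use n in \<open>simp_all add: r'_def\<close>)
   also have "... <= A'*(L*norm w)" using D(8)[OF d(2,1)] A'0 by(intro mult_left_mono) (simp_all add: dist_norm)
   finally have al: "\<bar>a (z + w) - a z\<bar> <= A'*L*norm w" by(simp add: mult.assoc)
   have "f (z + w) - f z = a (z + w)*(ph (z + w) - ph z) + (a (z + w) - a z)*ph z"
    using n by(simp add: f_def algebra_simps)
   also have "\<bar>...\<bar> <= \<bar>a (z + w)\<bar>*\<bar>ph (z + w) - ph z\<bar> + \<bar>a (z + w) - a z\<bar>*\<bar>ph z\<bar>"
    by(metis abs_mult abs_triangle_ineq)
   also have "... <= A*(B*norm w) + A'*L*norm w*B"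
    using A[of "F (z + w)"] B(2)[of "z + w" z] B(1)[of z] al A0 A'0 D(1)
    by(intro add_mono mult_mono) (auto simp: a_def)
   finally show ?thesis by(simp add: algebra_simps)
  next
   case False
   thus ?thesis using fr A0 B0 A'0 D(1) by simp
  qed
  have "AE z in lebesgue. z \<notin> Z" using D(2) by(rule AE_not_negligible)
  thus "AE z in lebesgue. (f has_derivative ?D z) (at z)"
  proof eventually_elim
   case (elim z)
   show ?case
   proof(cases "norm z < r'")
    case True
    hence z: "z \<in> disc" using r' by simp
    have "norm (F z) + 2*t < 1" using rh[of z] True t by(simp add: r'_def)
    from diff_chain_at[OF D(10)[OF z elim] steklov_has_derivative[OF hH t(1) this]]
    have "(a has_derivative (%w. steklov_vec t H (F z) \<bullet> DF z w)) (at z)" by(simp add: o_def a_def[abs_def])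
    from has_derivative_mult[OF this test_functionD(1)[OF ph]]
    have "((%z. a z*ph z) has_derivative (%w. a z*fder ph z w + (steklov_vec t H (F z) \<bullet> DF z w)*ph z)) (at z)" .
    moreover have "(%w. a z*fder ph z w + (steklov_vec t H (F z) \<bullet> DF z w)*ph z) = ?D z"
     using z elim by(simp add: fun_eq_iff on_disc_def a_def)
    ultimately have "((%z. a z*ph z) has_derivative ?D z) (at z)" by simp
    thus ?thesis
     by(rule has_derivative_transform_within_open[of _ _ _ _ "ball 0 r'"]) (use True in \<open>auto simp: f_def\<close>)
   next
    case False
    hence "r < norm z" using r' by simp
    hence "?D z = (%w. 0)" using r(3,4) by(simp add: fun_eq_iff)
    moreover have "(f has_derivative (%w. 0)) (at z)"
    proof(rule has_derivative_transform_within_open[of "%_. 0"])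
     show "open (- cball (0::real^2) r)" by auto
    qed (use fr \<open>r < norm z\<close> in auto)
    ultimately show ?thesis by simp
   qed
  qed
  have F0m: "on_disc F \<in> lebesgue \<rightarrow>\<^sub>M borel" by(rule measurable_on_disc(2)[OF N(1)])
  have s1: "(%z. steklov t k (on_disc F z)) \<in> borel_measurable lebesgue" if "integrable lborel k" for k
   by(rule measurable_compose[OF F0m borel_measurable_continuous_onI[OF continuous_steklov[OF that]]])
  have dm: "(%z. indicator (disc - Z) z*(DF z w $ i)) \<in> borel_measurable lebesgue" for i
   using pullback_gradient_measurable(2)[OF b, of "%_. 0" w i] borel_measurable_restrict_space_iff[of disc lebesgue "%z. indicator (disc - Z) z*(DF z w $ i)"]
   by(simp add: mult.assoc[symmetric] indicator_inter_arith[symmetric] Int_absorb1)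
  have tm: "ph \<in> borel_measurable lebesgue" "(%z. fder ph z w) \<in> borel_measurable lebesgue"
   using test_function_measurable[OF ph] by(auto intro!: measurable_completion)
  have im: "(indicator (disc - Z) :: real^2 => real) \<in> borel_measurable lebesgue"
   by(intro borel_measurable_indicator sets.Diff Zs) auto
  have "(%z. (\<Sum>i\<in>UNIV. steklov t (%q. H q $ i) (on_disc F z)*(indicator (disc - Z) z*(DF z w $ i)))*ph z +
    indicator (disc - Z) z*(steklov t h (on_disc F z)*fder ph z w)) \<in> borel_measurable lebesgue"
   by(intro borel_measurable_add borel_measurable_sum borel_measurable_times s1 h Hi dm tm im)
  also have "(%z. (\<Sum>i\<in>UNIV. steklov t (%q. H q $ i) (on_disc F z)*(indicator (disc - Z) z*(DF z w $ i)))*ph z +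
    indicator (disc - Z) z*(steklov t h (on_disc F z)*fder ph z w)) = (%z. ?D z w)"
   by(auto simp: fun_eq_iff inner_vec_def steklov_vec_def indicator_def)
  finally show "(%z. ?D z w) \<in> borel_measurable lebesgue" .
 qed
qed

lemma integrable_on_disc_comp:
 fixes k m :: "real^2 => real"
 assumes b: "bilip_disc L Z F DF P" and k: "k \<in> borel_measurable borel" "(LN y. indicator disc y*ennreal \<bar>k y\<bar>) < \<infinity>"
  and m: "m \<in> borel_measurable lebesgue" "!!z. \<bar>m z\<bar> <= C"
 shows "(\<integral>\<^sup>+z. ennreal (norm (indicator disc z * k (on_disc F z)*m z)) \<partial>lebesgue)
   <= ennreal (C*(2*L^2))*(LN y. indicator disc y*ennreal \<bar>k y\<bar>)" (is ?le)
  and "integrable lebesgue (%z. indicator disc z * k (on_disc F z)*m z)"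
proof -
 note D = bilip_discD[OF b] and N = bilip_disc_facts[OF b]
 have C0: "0 <= C" using order_trans[OF abs_ge_zero m(2)] .
 have F0b: "on_disc F \<in> borel_measurable borel" by(rule measurable_on_disc(1)[OF N(1)])
 have kF: "(%z. k (on_disc F z)) \<in> borel_measurable borel" by(rule measurable_compose[OF F0b k(1)])
 have "(\<integral>\<^sup>+z. ennreal (norm (indicator disc z * k (on_disc F z)*m z)) \<partial>lebesgue) <= (LN z. ennreal C*(indicator disc z*ennreal \<bar>k (on_disc F z)\<bar>))"
  unfolding nn_integral_completion
 proof(rule nn_integral_mono)
  fix z
  have "norm (indicator disc z * k (on_disc F z)*m z) <= C*(indicator disc z*\<bar>k (on_disc F z)\<bar>)"
   using mult_right_mono[OF m(2)[of z], of "\<bar>k (on_disc F z)\<bar>"] by(simp add: abs_mult mult.commute indicator_def)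
  thus "ennreal (norm (indicator disc z * k (on_disc F z)*m z)) <= ennreal C*(indicator disc z*ennreal \<bar>k (on_disc F z)\<bar>)"
   using C0 ennreal_leI by(fastforce simp: ennreal_mult[symmetric] indicator_def)
 qed
 also have "... = ennreal C*(LN z. indicator disc z*ennreal \<bar>k (on_disc F z)\<bar>)"
  using kF by(intro nn_integral_cmult borel_measurable_times_ennreal borel_measurable_indicator) auto
 also have "(LN z. indicator disc z*ennreal \<bar>k (on_disc F z)\<bar>) = (LN z. indicator disc z*ennreal \<bar>k (F z)\<bar>)"
  by(rule nn_integral_cong) (simp add: on_disc_def indicator_def)
 also have "ennreal C*... <= ennreal C*(ennreal (2*L^2)*(LN y. indicator disc y*ennreal \<bar>k y\<bar>))"
  using k(1) by(intro mult_left_mono nn_integral_comp_bilip_le[OF b]) auto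
 finally show le: ?le using C0 by(simp add: ennreal_mult mult.assoc)
 show "integrable lebesgue (%z. indicator disc z * k (on_disc F z)*m z)"
 proof(rule integrableI_bounded)
  have "(%z. k (on_disc F z)) \<in> borel_measurable lebesgue" by(rule measurable_completion) (use kF in simp)
  thus "(%z. indicator disc z * k (on_disc F z)*m z) \<in> borel_measurable lebesgue"
   using m(1) by(intro borel_measurable_times borel_measurable_indicator) auto
  show "(\<integral>\<^sup>+z. ennreal (norm (indicator disc z * k (on_disc F z)*m z)) \<partial>lebesgue) < \<infinity>"
   using le by(rule le_less_trans) (use k(2) in \<open>simp add: ennreal_mult_less_top\<close>)
 qed
qed

text \<open>Composition with \<open>F\<close> costs at most the factor \<open>2*L^2\<close> in
  \<open>L^1\<close>, and the bounded factor \<open>m\<close> at most \<open>C\<close>; so the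
  convergence of the averages carries over.\<close>

lemma steklov_comp_tendsto:
 fixes k m :: "real^2 => real"
 assumes b: "bilip_disc L Z F DF P" and k: "integrable lborel k"
  and m: "m \<in> borel_measurable lebesgue" "!!z. \<bar>m z\<bar> <= C"
 shows "(%n. \<integral>z. indicator disc z * steklov (inverse (Suc n)) k (on_disc F z)*m z \<partial>lebesgue)
   \<longlonglongrightarrow> (\<integral>z. indicator disc z * k (on_disc F z)*m z \<partial>lebesgue)"
  "integrable lebesgue (%z. indicator disc z * k (on_disc F z)*m z)"
  "integrable lebesgue (%z. indicator disc z * steklov (inverse (Suc n)) k (on_disc F z)*m z)"
proof -
 have km [measurable]: "k \<in> borel_measurable borel" using k by simp
 have sm [measurable]: "steklov t k \<in> borel_measurable borel" for t by(rule borel_measurable_continuous_onI[OF continuous_steklov[OF k]])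
 have le: "(LN y. indicator disc y*ennreal (g y)) <= (LN y. ennreal (g y))" for g :: "real^2 => real"
  by(rule nn_integral_mono) (simp add: indicator_def)
 have kf: "(LN y. indicator disc y*ennreal \<bar>k y\<bar>) < \<infinity>"
  using k le[of "%y. \<bar>k y\<bar>"] by(auto simp: integrable_iff_bounded intro: le_less_trans)
 show ki: "integrable lebesgue (%z. indicator disc z * k (on_disc F z)*m z)"
  by(rule integrable_on_disc_comp(2)[OF b _ kf m]) simp
 show si: "integrable lebesgue (%z. indicator disc z * steklov (inverse (Suc n)) k (on_disc F z)*m z)" for n
 proof(rule integrable_on_disc_comp(2)[OF b _ _ m])
  let ?B = "(LI q. \<bar>k q\<bar>)/(inverse (real (Suc n)))^2"
  have "(LN y. indicator disc y*ennreal \<bar>steklov (inverse (Suc n)) k y\<bar>) <= (LN y. ennreal ?B*indicator (disc :: (real^2) set) y)"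
   by(intro nn_integral_mono) (auto simp: indicator_def intro!: ennreal_leI abs_steklov_le[OF k])
  also have "... = ennreal ?B*emeasure lborel (disc :: (real^2) set)" by(rule nn_integral_cmult_indicator) simp
  also have "... < \<infinity>" using emeasure_lborel_ball_finite[of "0::real^2" 1] by(simp add: ennreal_mult_less_top)
  finally show "(LN y. indicator disc y*ennreal \<bar>steklov (inverse (Suc n)) k y\<bar>) < \<infinity>" .
 qed simp
 show "(%n. \<integral>z. indicator disc z * steklov (inverse (Suc n)) k (on_disc F z)*m z \<partial>lebesgue)
   \<longlonglongrightarrow> (\<integral>z. indicator disc z * k (on_disc F z)*m z \<partial>lebesgue)"
 proof(rule tendsto_L1_int[OF si ki])
  let ?a = "%n. (LN y. ennreal (norm (steklov (inverse (Suc n)) k y - k y)))"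
  have lim: "(%n. ennreal (C*(2*L^2))*?a n) \<longlonglongrightarrow> 0"
   using ennreal_tendsto_cmult[OF _ steklov_tendsto_L1[OF k], of "ennreal (C*(2*L^2))"] by simp
  have fin: "eventually (%n. ?a n < 1) sequentially" by(rule order_tendstoD(2)[OF steklov_tendsto_L1[OF k]]) simp
  show "(%n. \<integral>\<^sup>+z. ennreal (norm (indicator disc z * steklov (inverse (Suc n)) k (on_disc F z)*m z - indicator disc z * k (on_disc F z)*m z)) \<partial>lebesgue) \<longlonglongrightarrow> 0"
  proof(rule tendsto_sandwich[OF _ _ tendsto_const lim])
   show "eventually (%n. (\<integral>\<^sup>+z. ennreal (norm (indicator disc z * steklov (inverse (Suc n)) k (on_disc F z)*m z - indicator disc z * k (on_disc F z)*m z)) \<partial>lebesgue) <= ennreal (C*(2*L^2))*?a n) sequentially"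
    using fin
   proof eventually_elim
    case (elim n)
    let ?d = "%y. steklov (inverse (Suc n)) k y - k y"
    have fd: "(LN y. indicator disc y*ennreal \<bar>?d y\<bar>) <= ?a n" using le[of "%y. \<bar>?d y\<bar>"] by simp
    also have "?a n < \<infinity>" using elim by(rule less_trans) simp
    finally have fin': "(LN y. indicator disc y*ennreal \<bar>?d y\<bar>) < \<infinity>" .
    have "(\<integral>\<^sup>+z. ennreal (norm (indicator disc z*?d (on_disc F z)*m z)) \<partial>lebesgue) <= ennreal (C*(2*L^2))*(LN y. indicator disc y*ennreal \<bar>?d y\<bar>)"
     by(rule integrable_on_disc_comp(1)[OF b _ fin' m]) measurable
    also have "... <= ennreal (C*(2*L^2))*?a n" by(rule mult_left_mono[OF fd]) simp
    finally show ?case by(simp add: left_diff_distrib right_diff_distrib)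
   qed
  qed simp
 qed
qed

text \<open>Every term of the weak formulation for the mollified function converges. The functions
  \<open>m0\<close> and \<open>m1\<close> collect the bounded factors coming from the test function
  and from \<open>DF\<close>, so that only \<open>h\<close> and the components of \<open>H\<close>
  are mollified.\<close>

lemma sobolev_gradient_comp_bilip:
 fixes DF :: "real^2 => real^2 => real^2"
 assumes b: "bilip_disc L Z F DF P" and sg: "sobolev_gradient f G"
 shows "sobolev_gradient (%z. f (F z)) (pullback_gradient Z F DF G)"
proof -
 note D = bilip_discD[OF b] and N = bilip_disc_facts[OF b]
 have Lf: "L2_disc f" and LG: "L2_disc G" using sg by(auto simp: sobolev_gradient_def)
 have Gm: "G \<in> BD" using LG by(simp add: L2_disc_def)
 have Zs: "Z \<in> sets lebesgue" using D(2) by(simp add: negligible_imp_sets)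
 obtain h H where hH: "weak_gradient h H" and "AED z. h z = f z \<and> H z = G z"
  using sobolev_gradient_borel_representatives[OF sg] by blast
 from AE_comp_bilip[OF b this(2)] have ae: "AED z. h (F z) = f (F z) \<and> H (F z) = G (F z)" .
 have h: "integrable lborel h" and Hi: "integrable lborel (%q. H q $ i)" for i
  using hH integrable_inner_left[of "axis i 1" lborel H] by(auto simp: weak_gradient_def inner_axis)
 have pg: "L2_disc (pullback_gradient Z F DF G)"
 proof(rule L2_disc_bound[OF L2_disc_comp[OF b LG] pullback_gradient_measurable(1)[OF b Gm]])
  have "norm (pullback_gradient Z F DF G z) <= L*norm (G (F z))" for z
   using pullback_gradient_inner(2)[OF b, of z G] D(1) by(cases "z \<in> disc - Z") (auto simp: pullback_gradient_def)
  thus "AED z. norm (pullback_gradient Z F DF G z) <= L*norm (G (F z))" by simp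
 qed
 have "(LINT z|lebesgue_on disc. f (F z)*fder p z (axis i 1)) = - (LINT z|lebesgue_on disc. pullback_gradient Z F DF G z $ i*p z)"
  if p: "test_function p" for p i
 proof -
  define w :: "real^2" where "w = axis i 1"
  obtain K where K: "compact K" "K \<subseteq> disc" "!!z. z \<notin> K ==> p z = 0" "!!z w. z \<notin> K ==> fder p z w = 0"
   using test_function_support[OF p] by blast
  have sup1: "\<exists>s<1. \<forall>z\<in>C. norm (g z) <= s" if cg: "compact C" "continuous_on C g" "g ` C \<subseteq> disc" for C :: "(real^2) set" and g :: "real^2 => real^2"
  proof(cases "C = {}")
   case False
   obtain x where "x \<in> C" "\<forall>y\<in>C. norm (g y) <= norm (g x)"
    using continuous_attains_sup[OF cg(1) False continuous_on_norm[OF cg(2)]] by blast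
   thus ?thesis using cg(3) by(intro exI[of _ "norm (g x)"]) auto
  qed (auto intro: exI[of _ 0])
  obtain r0 where r0: "r0 < 1" "\<forall>z\<in>K. norm z <= r0" using sup1[OF K(1), of "%z. z"] K(2) by(auto simp: continuous_on_id)
  define r where "r = max r0 (1/2)"
  have r: "0 < r" "r < 1" "!!z. r < norm z ==> p z = 0" "!!z w. r < norm z ==> fder p z w = 0"
  proof -
   show "0 < r" "r < 1" using r0 by(auto simp: r_def)
   fix z :: "real^2" assume "r < norm z"
   hence "z \<notin> K" using r0(2) by(auto simp: r_def)
   thus "p z = 0" "!!w. fder p z w = 0" using K(3,4) by auto
  qed
  have cb: "cball 0 ((1 + r)/2) \<subseteq> disc" using r by auto
  obtain rh0 where rh0: "rh0 < 1" "\<forall>z\<in>cball 0 ((1 + r)/2). norm (F z) <= rh0"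
  proof -
   have "F ` cball 0 ((1 + r)/2) \<subseteq> disc" using D(4) cb by blast
   from sup1[OF compact_cball continuous_on_subset[OF N(1) cb] this] show ?thesis using that by blast
  qed
  define rh where "rh = (rh0 + 1)/2"
  have rh: "rh < 1" "!!z. norm z <= (1 + r)/2 ==> norm (F z) < rh" using rh0 by(force simp: rh_def)+
  obtain B where B: "!!z. \<bar>p z\<bar> <= B" "!!z w. \<bar>fder p z w\<bar> <= B*norm w" using test_function_lipschitz[OF p] by blast
  have B0: "0 <= B" using order_trans[OF abs_ge_zero B(1)] .
  have tm: "p \<in> borel_measurable lebesgue" "(%z. fder p z w) \<in> borel_measurable lebesgue"
   using test_function_measurable[OF p] by(auto intro!: measurable_completion)
  have dm: "(%z. indicator (disc - Z) z*(DF z w $ j)) \<in> borel_measurable lebesgue" for j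
   using pullback_gradient_measurable(2)[OF b, of "%_. 0" w j] borel_measurable_restrict_space_iff[of disc lebesgue "%z. indicator (disc - Z) z*(DF z w $ j)"]
   by(simp add: mult.assoc[symmetric] indicator_inter_arith[symmetric] Int_absorb1)
  define m0 where "m0 z = indicator (disc - Z) z*fder p z w" for z
  define m1 where "m1 j z = indicator (disc - Z) z*(DF z w $ j)*p z" for j z
  have m0: "m0 \<in> borel_measurable lebesgue" "!!z. \<bar>m0 z\<bar> <= B*norm w"
  proof -
   show "m0 \<in> borel_measurable lebesgue" unfolding m0_def
    by(intro borel_measurable_times tm borel_measurable_indicator sets.Diff Zs) auto
   show "\<bar>m0 z\<bar> <= B*norm w" for z using B(2) B0 by(simp add: m0_def indicator_def)
  qed
  have m1: "m1 j \<in> borel_measurable lebesgue" "!!z. \<bar>m1 j z\<bar> <= L*norm w*B" for j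
  proof -
   show "m1 j \<in> borel_measurable lebesgue" unfolding m1_def by(rule borel_measurable_times[OF dm tm(1)])
   fix z
   show "\<bar>m1 j z\<bar> <= L*norm w*B"
   proof(cases "z \<in> disc - Z")
    case True
    have "\<bar>DF z w $ j\<bar> <= L*norm w" using component_le_norm_cart[of "DF z w" j] N(7)[of z w] True by simp
    thus ?thesis using True B(1)[of z] D(1) by(simp add: m1_def abs_mult mult_mono)
   qed (use D(1) B0 in \<open>simp add: m1_def\<close>)
  qed
  let ?t0 = "%k. \<integral>z. indicator disc z * k (on_disc F z)*m0 z \<partial>lebesgue"
  let ?t1 = "%j k. \<integral>z. indicator disc z * k (on_disc F z)*m1 j z \<partial>lebesgue"
  \<comment> \<open>Only for large \<open>n\<close>: the side of the square must be less than half
    of the margin \<open>1 - rh\<close>.\<close>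
  have zero: "eventually (%n. ?t0 (steklov (inverse (Suc n)) h) + (\<Sum>j\<in>UNIV. ?t1 j (steklov (inverse (Suc n)) (%q. H q $ j))) = 0) sequentially"
  proof -
   have "eventually (%n. inverse (real (Suc n)) < (1 - rh)/2) sequentially"
    by(rule order_tendstoD(2)[OF LIMSEQ_inverse_real_of_nat]) (use rh in simp)
   thus ?thesis
   proof eventually_elim
    case (elim n)
    define t where "t = inverse (real (Suc n))"
    have t: "0 < t" "rh + 2*t < 1" using elim by(auto simp: t_def)
    have "(\<integral>z. indicator disc z * steklov t h (on_disc F z)*m0 z + (\<Sum>j\<in>UNIV. indicator disc z * steklov t (%q. H q $ j) (on_disc F z)*m1 j z) \<partial>lebesgue) = 0"
    proof(rule trans[OF Bochner_Integration.integral_cong[OF refl] steklov_comp_test_integral[OF b hH p r rh(2) t, of w]])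
     fix z
     show "indicator disc z * steklov t h (on_disc F z)*m0 z + (\<Sum>j\<in>UNIV. indicator disc z * steklov t (%q. H q $ j) (on_disc F z)*m1 j z) =
      indicator (disc - Z) z*((steklov_vec t H (on_disc F z) \<bullet> DF z w)*p z + steklov t h (on_disc F z)*fder p z w)"
      by(auto simp: m0_def m1_def indicator_def inner_vec_def steklov_vec_def sum_2 algebra_simps)
    qed simp_all
    moreover have "integrable lebesgue (%z. indicator disc z * steklov t h (on_disc F z)*m0 z)"
      "integrable lebesgue (%z. indicator disc z * steklov t (%q. H q $ j) (on_disc F z)*m1 j z)" for j
     unfolding t_def by(rule steklov_comp_tendsto(3)[OF b h m0], rule steklov_comp_tendsto(3)[OF b Hi m1])
    ultimately show ?case
     unfolding t_def[symmetric] by(simp only: Bochner_Integration.integral_add Bochner_Integration.integrable_sum Bochner_Integration.integral_sum)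
   qed
  qed
  have "(%n. ?t0 (steklov (inverse (Suc n)) h) + (\<Sum>j\<in>UNIV. ?t1 j (steklov (inverse (Suc n)) (%q. H q $ j)))) \<longlonglongrightarrow> ?t0 h + (\<Sum>j\<in>UNIV. ?t1 j (%q. H q $ j))"
   by(intro tendsto_add tendsto_sum steklov_comp_tendsto(1)[OF b h m0] steklov_comp_tendsto(1)[OF b Hi m1])
  moreover have "(%n. ?t0 (steklov (inverse (Suc n)) h) + (\<Sum>j\<in>UNIV. ?t1 j (steklov (inverse (Suc n)) (%q. H q $ j)))) \<longlonglongrightarrow> 0"
   by(rule tendsto_eventually[OF zero])
  ultimately have sum0: "?t0 h + (\<Sum>j\<in>UNIV. ?t1 j (%q. H q $ j)) = 0" by(rule LIMSEQ_unique)
  have nZ: "AE z in lebesgue. z \<notin> Z" using D(2) by(rule AE_not_negligible)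
  have ae': "AE z in lebesgue. z \<in> disc --> h (F z) = f (F z) \<and> H (F z) = G (F z)" using ae by(subst (asm) AE_restrict_space_iff) auto
  have "(LINT z|lebesgue_on disc. f (F z)*fder p z w) = (\<integral>z. indicator disc z *\<^sub>R (f (F z)*fder p z w) \<partial>lebesgue)"
   by(rule integral_restrict_space) simp
  also have "... = ?t0 h"
  proof(rule integral_cong_AE)
   have "(%z. f (F z)*fder p z w) \<in> BD"
    using L2_disc_comp[OF b Lf] test_function_measurable_on[OF p] by(auto simp: L2_disc_def)
   thus "(%z. indicator disc z *\<^sub>R (f (F z)*fder p z w)) \<in> borel_measurable lebesgue"
    by(subst borel_measurable_restrict_space_iff[symmetric]) auto
   show "(%z. indicator disc z*h (on_disc F z)*m0 z) \<in> borel_measurable lebesgue"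
    using steklov_comp_tendsto(2)[OF b h m0] by simp
   show "AE z in lebesgue. indicator disc z *\<^sub>R (f (F z)*fder p z w) = indicator disc z*h (on_disc F z)*m0 z"
    using nZ ae' by eventually_elim (auto simp: indicator_def m0_def on_disc_def)
  qed
  finally have e1: "(LINT z|lebesgue_on disc. f (F z)*fder p z w) = ?t0 h" .
  have "(LINT z|lebesgue_on disc. pullback_gradient Z F DF G z $ i*p z) = (\<integral>z. indicator disc z *\<^sub>R (pullback_gradient Z F DF G z $ i*p z) \<partial>lebesgue)"
   by(rule integral_restrict_space) simp
  also have "... = (\<integral>z. (\<Sum>j\<in>UNIV. indicator disc z*H (on_disc F z) $ j*m1 j z) \<partial>lebesgue)"
  proof(rule integral_cong_AE)
   have "(%z. pullback_gradient Z F DF G z $ i*p z) \<in> BD"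
    using pg test_function_measurable_on[OF p] by(intro borel_measurable_times borel_measurable_vec_nth) (auto simp: L2_disc_def)
   thus "(%z. indicator disc z *\<^sub>R (pullback_gradient Z F DF G z $ i*p z)) \<in> borel_measurable lebesgue"
    by(subst borel_measurable_restrict_space_iff[symmetric]) auto
   show "(%z. \<Sum>j\<in>UNIV. indicator disc z*H (on_disc F z) $ j*m1 j z) \<in> borel_measurable lebesgue"
    using steklov_comp_tendsto(2)[OF b Hi m1] by(intro borel_measurable_sum) simp
   show "AE z in lebesgue. indicator disc z *\<^sub>R (pullback_gradient Z F DF G z $ i*p z) = (\<Sum>j\<in>UNIV. indicator disc z*H (on_disc F z) $ j*m1 j z)"
    using nZ ae' by eventually_elim (auto simp: indicator_def m1_def on_disc_def pullback_gradient_def inner_vec_def w_def sum_2 algebra_simps)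
  qed
  also have "... = (\<Sum>j\<in>UNIV. ?t1 j (%q. H q $ j))"
   using steklov_comp_tendsto(2)[OF b Hi m1] by(intro Bochner_Integration.integral_sum) simp
  finally show ?thesis using e1 sum0 unfolding w_def by simp
 qed
 thus ?thesis using L2_disc_comp[OF b Lf] pg unfolding sobolev_gradient_def by blast
qed

section \<open>Sobolev maps and metric derivatives under reparametrization\<close>

lemma dist_lipschitz: "1-lipschitz_on UNIV (%p. dist p (x::'a::metric_space))"
proof(rule lipschitz_onI)
 show "dist (dist p x) (dist q x) <= 1*dist p q" for p q
  using abs_dist_diff_le[of p x q] by(simp add: dist_real_def dist_commute)
qed simp

lemma sobolev_map_gradients:
 fixes v :: "real^2 => 'a::metric_space"
 assumes v: "sobolev_map v"
 shows "\<exists>x G g. L2_disc (g :: real^2 => real) \<and> (\<forall>i::nat. sobolev_gradient (%z. dist (v z) (x i)) (G i)) \<and>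
  (AED z. (\<forall>i. norm (G i z) <= g z) \<and> (\<forall>e>0. \<exists>i. dist (v z) (x i) < e))"
proof -
 obtain x :: "nat => 'a" where x: "AED z. \<forall>e>0. \<exists>i. dist (v z) (x i) < e"
  using essential_dense_sequence[of v] v by(auto simp: sobolev_map_def)
 obtain g :: "real^2 => real" where g: "L2_disc g" and vg: "!!f :: 'a => real. 1-lipschitz_on UNIV f ==>
     \<exists>G. sobolev_gradient (f \<circ> v) G \<and> (AED z. norm (G z) <= g z)"
  using v unfolding sobolev_map_def by blast
 have "\<forall>i. \<exists>G. sobolev_gradient (%z. dist (v z) (x i)) G \<and> (AED z. norm (G z) <= g z)"
  using vg[OF dist_lipschitz] by(simp add: o_def)
 from choice[OF this] obtain G where G: "\<forall>i. sobolev_gradient (%z. dist (v z) (x i)) (G i) \<and> (AED z. norm (G i z) <= g z)" ..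
 hence "AED z. \<forall>i. norm (G i z) <= g z" unfolding AE_all_countable by blast
 hence "AED z. (\<forall>i. norm (G i z) <= g z) \<and> (\<forall>e>0. \<exists>i. dist (v z) (x i) < e)"
  using x by eventually_elim blast
 thus ?thesis using g G by blast
qed

lemma sobolev_map_comp_bilip:
 fixes v :: "real^2 => 'a::metric_space" and DF :: "real^2 => real^2 => real^2"
 assumes b: "bilip_disc L Z F DF P" and v: "sobolev_map v"
 shows "sobolev_map (%z. v (F z))"
proof -
 note D = bilip_discD[OF b] and N = bilip_disc_facts[OF b]
 have pb: "norm (pullback_gradient Z F DF G z) <= L*norm (G (F z))" for G z
  using pullback_gradient_inner(2)[OF b, of z G] D(1) by(cases "z \<in> disc - Z") (auto simp: pullback_gradient_def)
 have vm: "v \<in> BD" using v by(simp add: sobolev_map_def)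
 have "(%z. v (F z)) \<in> BD"
  by(rule measurable_compose[OF bilip_disc_measurable[OF b] vm])
 moreover have "essentially_separably_valued (%z. v (F z))"
 proof -
  obtain M where M: "M \<in> null_sets lebesgue" "separable_space (top_of_set (v ` (disc - M)))"
   using v unfolding sobolev_map_def essentially_separably_valued_def by blast
  define M' where "M' = {z \<in> disc. F z \<in> M}"
  have "M' \<in> null_sets lebesgue" unfolding M'_def using N(6)[of M] M(1) by(simp add: negligible_iff_null_sets)
  moreover have "(%z. v (F z)) ` (disc - M') = v ` (disc - M)"
  proof(intro equalityI subsetI)
   fix p assume "p \<in> v ` (disc - M)"
   then obtain y where "y \<in> disc" "y \<notin> M" "p = v y" by auto
   thus "p \<in> (%z. v (F z)) ` (disc - M')" using D(5,7)[of y] by(intro image_eqI[of _ _ "P y"]) (auto simp: M'_def)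
  qed (use D(4) in \<open>auto simp: M'_def\<close>)
  ultimately show ?thesis unfolding essentially_separably_valued_def using M(2) by metis
 qed
 moreover obtain g :: "real^2 => real" where g: "L2_disc g" and vg: "!!f :: 'a => real. 1-lipschitz_on UNIV f ==>
     \<exists>G. sobolev_gradient (f \<circ> v) G \<and> (AED z. norm (G z) <= g z)"
  using v unfolding sobolev_map_def by blast
 have gL: "L2_disc (%z. L*g (F z))"
  by(rule L2_disc_bound[OF L2_disc_comp[OF b g], where C = L])
   (use L2_disc_comp[OF b g] D(1) in \<open>auto simp: L2_disc_def abs_mult\<close>)
 have "\<exists>G. sobolev_gradient (f \<circ> (%z. v (F z))) G \<and> (AED z. norm (G z) <= L*g (F z))"
  if f: "1-lipschitz_on UNIV f" for f :: "'a => real"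
 proof -
  obtain G where G: "sobolev_gradient (f \<circ> v) G" "AED z. norm (G z) <= g z" using vg[OF f] by blast
  have "AED z. norm (pullback_gradient Z F DF G z) <= L*g (F z)"
   using AE_comp_bilip[OF b G(2)]
  proof eventually_elim
   case (elim z)
   thus ?case using pb[of G z] mult_left_mono[OF elim, of L] D(1) by linarith
  qed
  thus ?thesis using sobolev_gradient_comp_bilip[OF b G(1)] by(auto simp: o_def)
 qed
 ultimately show ?thesis using gL unfolding sobolev_map_def by blast
qed

lemma supsn_pullback:
 assumes b: "bilip_disc L Z F DF P" and z: "z \<in> disc" "z \<notin> Z" and bd: "!!i. norm (G i (F z)) <= c"
 shows "supsn (%i. pullback_gradient Z F DF (G i) z) = sn_comp (supsn (%i. G i (F z))) (matrix (DF z))"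
proof -
 note D = bilip_discD[OF b]
 have "bounded (range (%i. G i (F z)))" using bd by(auto simp: bounded_iff)
 moreover have "bounded (range (%i. pullback_gradient Z F DF (G i) z))"
 proof -
  have "norm (pullback_gradient Z F DF (G i) z) <= L*c" for i
   using pullback_gradient_inner(2)[OF b z, of "G i"] mult_left_mono[OF bd[of i], of L] D(1) by linarith
  thus ?thesis by(auto simp: bounded_iff)
 qed
 moreover have "matrix (DF z) *v w = DF z w" for w
  using matrix_works[of "DF z" w] has_derivative_linear[OF D(10)[OF z]] by(simp add: linear_matrix_vector_mul_eq)
 ultimately show ?thesis
  by(simp add: sn_inject[symmetric] fun_eq_iff supsn.rep_eq sn_comp.rep_eq pullback_gradient_inner(1)[OF b z])
qed

text \<open>One sequence \<open>x\<close> serves for \<open>v\<close> and for the composition. The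
  gradients of the distances pull back one by one, and a supremum of functionals composed with a
  linear map is the composed supremum.\<close>

lemma AE_apmd_comp_bilip:
 fixes v :: "real^2 => 'a::metric_space"
 assumes I: "definition_of_energy I" and b: "bilip_disc L Z F DF P" and v: "sobolev_map v"
 shows "AED z. apmd dist (%z. v (F z)) z = sn_comp (apmd dist v (F z)) (matrix (DF z))"
proof -
 note D = bilip_discD[OF b]
 obtain x G and g :: "real^2 => real" where g: "L2_disc g" and sg: "!!i::nat. sobolev_gradient (%z. dist (v z) (x i)) (G i)"
  and ae: "AED z. (\<forall>i. norm (G i z) <= g z) \<and> (\<forall>e>0. \<exists>i. dist (v z) (x i) < e)"
  using sobolev_map_gradients[OF v] by blast
 have Gg: "AED z. norm (G i z) <= g z" for i using ae by eventually_elim blast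
 have dense: "AED z. \<forall>e>0. \<exists>i. dist (v z) (x i) < e" using ae by eventually_elim blast
 have a1: "AED z. has_apmd dist v z (supsn (%i. G i z))"
  by(rule AE_has_apmd_of_gradients[OF I sg Gg g dense])
 have gL: "L2_disc (%z. L*g (F z))"
  by(rule L2_disc_bound[OF L2_disc_comp[OF b g], where C = L])
   (use L2_disc_comp[OF b g] D(1) in \<open>auto simp: L2_disc_def abs_mult\<close>)
 have a2: "AED z. has_apmd dist (%z. v (F z)) z (supsn (%i. pullback_gradient Z F DF (G i) z))"
 proof(rule AE_has_apmd_of_gradients[OF I _ _ gL AE_comp_bilip[OF b dense]])
  show "sobolev_gradient (%z. dist (v (F z)) (x i)) (pullback_gradient Z F DF (G i))" for i
   by(rule sobolev_gradient_comp_bilip[OF b sg])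
  show "AED z. norm (pullback_gradient Z F DF (G i) z) <= L*g (F z)" for i
   using AE_comp_bilip[OF b Gg[of i]]
  proof eventually_elim
   case (elim z)
   show ?case
   proof(cases "z \<in> disc - Z")
    case True
    hence "norm (pullback_gradient Z F DF (G i) z) <= L*norm (G i (F z))" by(intro pullback_gradient_inner(2)[OF b]) auto
    thus ?thesis using mult_left_mono[OF elim, of L] D(1) by linarith
   next
    case False
    have "0 <= g (F z)" using elim norm_ge_zero order_trans by blast
    thus ?thesis using False D(1) by(simp add: pullback_gradient_def del: Diff_iff)
   qed
  qed
 qed
 show ?thesis using AE_comp_bilip[OF b a1] a2 AE_disc_not_negligible[OF D(2)] AE_comp_bilip[OF b ae]
 proof eventually_elim
  case (elim z)
  hence "supsn (%i. pullback_gradient Z F DF (G i) z) = sn_comp (supsn (%i. G i (F z))) (matrix (DF z))"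
   by(intro supsn_pullback[OF b, where c = "g (F z)"]) auto
  thus ?case using elim by(simp add: apmd_eqI)
 qed
qed

section \<open>Measurability and size of the metric derivative\<close>

lemma borel_measurable_separable_metric:
 fixes S :: "'b => 'm::metric_space"
 assumes Q: "countable Q" "!!s ep. 0 < ep ==> \<exists>q\<in>Q. dist s q < ep"
  and m: "!!q. q \<in> Q ==> (%z. dist (S z) q) \<in> borel_measurable M"
 shows "S \<in> borel_measurable M"
proof(rule borel_measurableI)
 fix U :: "'m set" assume U: "open U"
 define P where "P = {(q, n::nat). q \<in> Q \<and> ball q (1/real (Suc n)) \<subseteq> U}"
 have "P \<subseteq> Q \<times> UNIV" by(auto simp: P_def)
 moreover have "countable (Q \<times> (UNIV :: nat set))" using Q(1) by simp
 ultimately have cP: "countable P" by(rule countable_subset)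
 have "S -` U \<inter> space M = (\<Union>p\<in>P. {z \<in> space M. dist (S z) (fst p) < 1/real (Suc (snd p))})"
 proof(intro equalityI subsetI)
  fix z assume z: "z \<in> S -` U \<inter> space M"
  obtain e where e: "e > 0" "ball (S z) e \<subseteq> U" using U z by(auto simp: open_contains_ball)
  obtain n where n: "1/real (Suc n) < e/2" using e nat_approx_posE[of "e/2"] by auto
  obtain q where q: "q \<in> Q" "dist (S z) q < 1/real (Suc n)" using Q(2)[of "1/real (Suc n)" "S z"] by auto
  have "ball q (1/real (Suc n)) \<subseteq> ball (S z) e"
  proof
   fix y assume "y \<in> ball q (1/real (Suc n))"
   thus "y \<in> ball (S z) e" using q(2) n dist_triangle[of "S z" y q] by simp
  qed
  hence "(q, n) \<in> P" using q e by(auto simp: P_def)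
  thus "z \<in> (\<Union>p\<in>P. {z \<in> space M. dist (S z) (fst p) < 1/real (Suc (snd p))})" using q z by force
 qed (auto simp: P_def subset_iff dist_commute)
 also have "... \<in> sets M"
 proof(rule sets.countable_UN'[OF cP], rule subsetI, elim imageE, hypsubst)
  fix p assume "p \<in> P"
  hence [measurable]: "(%z. dist (S z) (fst p)) \<in> borel_measurable M" using m by(auto simp: P_def)
  show "{z \<in> space M. dist (S z) (fst p) < 1/real (Suc (snd p))} \<in> sets M" by measurable
 qed
 finally show "S -` U \<inter> space M \<in> sets M" .
qed

text \<open>Completeness of Lebesgue measure: changing the values on a null set is harmless, however
  irregular the new values are.\<close>

lemma measurable_on_disc_cong_AE:
 assumes S: "S \<in> lebesgue_on disc \<rightarrow>\<^sub>M N" and eq: "AED z. T z = S z" and sp: "!!z. T z \<in> space N"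
 shows "T \<in> lebesgue_on disc \<rightarrow>\<^sub>M N"
proof(rule measurableI)
 fix A assume A: "A \<in> sets N"
 have "AE z in lebesgue. z \<in> disc --> T z = S z" using eq by(subst (asm) AE_restrict_space_iff) auto
 then obtain M where M: "M \<in> null_sets lebesgue" "{z. \<not> (z \<in> disc --> T z = S z)} \<subseteq> M"
  unfolding eventually_ae_filter by auto
 have s: "S -` A \<inter> disc \<in> sets lebesgue" using measurable_sets[OF S A] by(simp add: sets_restrict_space_iff)
 have "M \<in> sets lebesgue" using M(1) by auto
 moreover have "T -` A \<inter> disc \<inter> M \<in> sets lebesgue"
  by(rule null_setsD2[OF null_sets_completion_subset[OF _ M(1)]]) auto
 ultimately have "(S -` A \<inter> disc - M) \<union> (T -` A \<inter> disc \<inter> M) \<in> sets lebesgue" using s by auto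
 moreover have "(S -` A \<inter> disc - M) \<union> (T -` A \<inter> disc \<inter> M) = T -` A \<inter> disc" using M(2) by auto
 ultimately show "T -` A \<inter> space (lebesgue_on disc) \<in> sets (lebesgue_on disc)"
  by(simp add: sets_restrict_space_iff)
qed (use sp in auto)

lemma energy_density_bound:
 assumes I: "definition_of_energy I" and s: "!!w. sn s w <= c*norm w" "0 <= c"
 shows "I s <= c^2*I sn_euclid"
proof -
 have "\<forall>w. sn s w <= sn (sn_scale c sn_euclid) w" using s by(simp add: sn_scale.rep_eq sn_euclid.rep_eq)
 hence "I s <= I (sn_scale c sn_euclid)" using I unfolding definition_of_energy_def by blast
 also have "... = c^2*I sn_euclid" using I s(2) unfolding definition_of_energy_def by blast
 finally show ?thesis .
qed

text \<open>The metric derivative is a definite description with arbitrary values on a null set. Its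
  measurability comes from the measurable field \<open>S\<close>, built from gradients that are set
  to 0 where their bound fails.\<close>

lemma apmd_measurable_bounded:
 fixes v :: "real^2 => 'a::metric_space"
 assumes I: "definition_of_energy I" and v: "sobolev_map v"
 shows "apmd dist v \<in> BD"
  and "\<exists>g :: real^2 => real. L2_disc g \<and> (AED z. \<forall>w. sn (apmd dist v z) w <= g z*norm w)"
proof -
 obtain x G and g :: "real^2 => real" where g: "L2_disc g" and sg: "!!i::nat. sobolev_gradient (%z. dist (v z) (x i)) (G i)"
  and ae: "AED z. (\<forall>i. norm (G i z) <= g z) \<and> (\<forall>e>0. \<exists>i. dist (v z) (x i) < e)"
  using sobolev_map_gradients[OF v] by blast
 have Gg: "AED z. norm (G i z) <= g z" for i using ae by eventually_elim blast
 have dense: "AED z. \<forall>e>0. \<exists>i. dist (v z) (x i) < e" using ae by eventually_elim blast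
 have a1: "AED z. has_apmd dist v z (supsn (%i. G i z))"
  by(rule AE_has_apmd_of_gradients[OF I sg Gg g dense])
 have [measurable]: "G i \<in> BD" "g \<in> BD" for i
  using sg[of i] g by(auto simp: sobolev_gradient_def L2_disc_def)
 define ok where "ok z \<longleftrightarrow> (\<forall>i. norm (G i z) <= g z)" for z
 have [measurable]: "Measurable.pred (lebesgue_on disc) ok" unfolding ok_def by measurable
 define K where "K i z = (if ok z then G i z else 0)" for i z
 have Km: "K i \<in> BD" for i unfolding K_def by measurable
 have bd: "bounded (range (%i. K i z))" for z
  unfolding bounded_iff by(intro exI[of _ "\<bar>g z\<bar>"]) (auto simp: K_def ok_def intro: order_trans)
 define S where "S z = supsn (%i. K i z)" for z
 have "(%z. sn (S z) w) \<in> BD" for w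
  unfolding S_def by(rule borel_measurable_sn_supsn[OF Km bd])
 from borel_measurable_dist_seminorm[OF this]
 have dm: "(%z. dist (S z) q) \<in> BD" for q .
 obtain Q :: "seminorm2 set" where Q: "countable Q" "\<forall>s. \<forall>e>0. \<exists>q\<in>Q. dist s q < e"
  using seminorm_countable_dense[OF I] by blast
 have Sm: "S \<in> BD"
  by(rule borel_measurable_separable_metric[OF Q(1)]) (use Q(2) dm in auto)
 have eq: "AED z. apmd dist v z = supsn (%i. G i z) \<and> ok z"
  using a1 ae by eventually_elim (simp add: apmd_eqI ok_def)
 hence "AED z. apmd dist v z = S z"
  by eventually_elim (simp add: S_def K_def)
 from measurable_on_disc_cong_AE[OF Sm this]
 show "apmd dist v \<in> BD" by simp
 have "AED z. \<forall>w. sn (apmd dist v z) w <= g z*norm w"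
  using eq by eventually_elim (simp add: ok_def sn_supsn_le_norm)
 thus "\<exists>g :: real^2 => real. L2_disc g \<and> (AED z. \<forall>w. sn (apmd dist v z) w <= g z*norm w)" using g by blast
qed

subsection \<open>Reparametrizations of spanning maps\<close>

definition to_vec :: "complex => real^2" where "to_vec z = vector [Re z, Im z]"
definition to_complex :: "real^2 => complex" where "to_complex x = Complex (x $ 1) (x $ 2)"

lemma to_vec_to_complex [simp]: "to_vec (to_complex x) = x" "to_complex (to_vec z) = z"
 by(simp_all add: to_vec_def to_complex_def vec_eq_iff forall_2)

lemma to_complex_linear: "to_complex (x + y) = to_complex x + to_complex y" "to_complex (x - y) = to_complex x - to_complex y"
  "to_complex (c *\<^sub>R x) = c *\<^sub>R to_complex x"
 and to_vec_linear: "to_vec (z + w) = to_vec z + to_vec w" "to_vec (z - w) = to_vec z - to_vec w" "to_vec (c *\<^sub>R z) = c *\<^sub>R to_vec z"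
 by(simp_all add: to_vec_def to_complex_def vec_eq_iff forall_2 complex_eq_iff)

lemma norm_to_complex [simp]: "norm (to_complex x) = norm x"
 by(simp add: to_complex_def cmod_def norm_vec_def L2_set_def sum_2)

lemma norm_to_vec [simp]: "norm (to_vec z) = norm z"
 using norm_to_complex[of "to_vec z"] by simp

lemma dist_to_vec: "dist (to_vec z) (to_vec w) = norm (z - w)"
 by(simp add: dist_norm flip: to_vec_linear)

lemma bounded_linear_to_vec: "bounded_linear to_vec" "bounded_linear to_complex"
 by(auto intro!: bounded_linear_intro[where K = 1] simp: to_vec_linear to_complex_linear)

lemma to_complex_measurable [measurable]: "to_complex \<in> borel_measurable borel"
 by(rule borel_measurable_continuous_onI[OF linear_continuous_on[OF bounded_linear_to_vec(2)]])

lemma distr_to_complex: "distr lborel borel to_complex = lborel"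
proof(rule lborel_eqI[symmetric])
 fix l u :: complex assume b: "!!b. b \<in> Basis ==> l \<bullet> b <= u \<bullet> b"
 have v: "to_complex -` box l u = box (to_vec l) (to_vec u)"
  by(auto simp: in_box_complex_iff mem_box_cart forall_2 to_complex_def to_vec_def)
 have B2: "(Basis :: (real^2) set) = {axis 1 1, axis 2 1}" by(auto simp: Basis_vec_def) (metis exhaust_2)
 have "emeasure (distr lborel borel to_complex) (box l u) = emeasure lborel (box (to_vec l) (to_vec u))"
  by(subst emeasure_distr) (auto simp: v)
 also have "... = (\<Prod>b\<in>Basis. (to_vec u - to_vec l) \<bullet> b)"
  by(rule emeasure_lborel_box) (use b[of 1] b[of \<i>] in \<open>auto simp: B2 Basis_complex_def inner_axis to_vec_def\<close>)
 also have "(\<Prod>b\<in>Basis. (to_vec u - to_vec l) \<bullet> b) = (\<Prod>b\<in>Basis. (u - l) \<bullet> b)"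
 proof -
  have "axis 1 1 ~= (axis 2 1 :: real^2)" by(simp add: axis_eq_axis)
  moreover have "(1::complex) ~= \<i>" by(simp add: complex_eq_iff)
  ultimately show ?thesis unfolding B2 Basis_complex_def by(simp add: inner_axis to_vec_def)
 qed
 finally show "emeasure (distr lborel borel to_complex) (box l u) = (\<Prod>b\<in>Basis. (u - l) \<bullet> b)" .
qed simp

text \<open>Complements \<open>bilip_disc\<close> on the closed disc. By the last clause radii are
  mapped into radii near the circle, which is what the composition of traces needs.\<close>

definition radial_homeo :: "real => real => (real^2 => real^2) => (real^2 => real^2) => bool" where
 "radial_homeo L r F P \<longleftrightarrow> 0 < L \<and> r < 1 \<and>
  (\<forall>z. norm z <= 1 --> norm (F z) <= 1 \<and> norm (P z) <= 1 \<and> P (F z) = z \<and> F (P z) = z) \<and>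
  (\<forall>z. norm z = 1 --> norm (F z) = 1 \<and> norm (P z) = 1) \<and>
  (\<forall>z w. norm z <= 1 --> norm w <= 1 --> dist (F z) (F w) <= L*dist z w \<and> dist (P z) (P w) <= L*dist z w) \<and>
  (\<forall>z. r <= norm z --> norm z <= 1 --> F z = norm (F z) *\<^sub>R F (sgn z))"

text \<open>The dilatation is bounded by \<open>k\<close> almost everywhere, but close to the
  prescribed \<open>m\<close> only off \<open>B\<close>. \<open>B\<close> is Borel so that
  Borel-Cantelli applies to a sequence of such sets.\<close>

definition qc_disc :: "real => (real^2 => complex) => real => (real^2 => real^2) => (real^2 => real^2) =>
  (real^2 => real^2 => real^2) => real => real => (real^2) set => (real^2) set => bool" where
 "qc_disc k m e F P DF L r Z B \<longleftrightarrow> bilip_disc L Z F DF P \<and> radial_homeo L r F P \<and>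
  B \<in> sets borel \<and> emeasure lborel B <= ennreal e \<and>
  (\<forall>z\<in>disc - Z. \<exists>a b. DF z = (%w. to_vec (a*to_complex w + b*cnj (to_complex w))) \<and> a ~= 0 \<and>
    norm b <= k*norm a \<and> (z \<notin> B --> norm (b - m z*a) <= e*norm a))"

theorem qc_disc_exists:
 assumes k: "0 <= k" "k < 1" and e: "0 < e" "e <= (1 - k)/2"
  and mk: "!!z. norm (m z) <= k" and cont: "continuous_on UNIV m"
 shows "\<exists>F P DF L r Z B. qc_disc ((1 + k)/2) m e F P DF L r Z B"
proof -
 have mk': "!!z. norm ((m \<circ> to_vec) z) <= k" using mk by simp
 have cont': "continuous_on UNIV (m \<circ> to_vec)"
  by(rule continuous_on_compose2[OF cont linear_continuous_on[OF bounded_linear_to_vec(1)], unfolded o_def[symmetric]]) auto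
 show ?thesis
 proof(rule beltrami_approximation[OF k e mk' cont'])
 fix f l L r B0 Z0 assume lL: "0 < l" "0 < L"
  and lo: "!!z w. norm z <= 1 ==> norm w <= 1 ==> l*norm (z - w) <= norm (f z - f w)"
  and up: "!!z w. norm z <= 1 ==> norm w <= 1 ==> norm (f z - f w) <= L*norm (z - w)"
  and im: "f ` ball 0 1 = ball 0 1" "f ` sphere 0 1 = sphere 0 1"
  and r: "0 < r" "r < 1" "!!z :: complex. r <= norm z ==> norm z <= 1 ==> f z = of_real (norm (f z))*f (sgn z)"
  and Z0: "negligible Z0" and B0: "B0 \<in> lmeasurable" "measure lebesgue B0 < e"
  and der: "!!z. norm z < 1 ==> z \<notin> Z0 ==> \<exists>a b. (f has_derivative (%w. a*w + b*cnj w)) (at z) \<and> a ~= 0 \<and>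
    norm b <= (1 + k)/2*norm a \<and> (z \<notin> B0 --> norm (b - (m \<circ> to_vec) z*a) <= e*norm a)"
 have inj: "inj_on f (cball 0 1)"
 proof(rule inj_onI)
  fix z w assume "z \<in> cball 0 1" "w \<in> cball 0 1" "f z = f w"
  hence "l*norm (z - w) <= 0" using lo[of z w] by simp
  thus "z = w" using lL by(simp add: mult_le_0_iff)
 qed
 define g where "g = the_inv_into (cball 0 1) f"
 have imc: "f ` cball 0 1 = cball 0 1" 
 proof -
  have u: "cball 0 1 = ball 0 1 \<union> sphere (0::complex) 1" by auto
  show ?thesis unfolding u image_Un im ..
 qed
 have gf: "g (f z) = z" if "norm z <= 1" for z unfolding g_def by(rule the_inv_into_f_f[OF inj]) (use that in simp)
 have fg: "f (g z) = z" "norm (g z) <= 1" if "norm z <= 1" for z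
  using f_the_inv_into_f[OF inj, of z] the_inv_into_into[OF inj, of z "cball 0 1"] imc that unfolding g_def by auto
 have fb: "norm (f z) < 1" if "norm z < 1" for z using that im(1) by(metis imageI mem_ball_0)
 have fs: "norm (f z) = 1" if "norm z = 1" for z using that im(2) by(metis imageI mem_sphere_0)
 have gs: "norm (g z) = 1" if "norm z = 1" for z using fg[of z] fb[of "g z"] that by fastforce
 have gb: "norm (g z) < 1" if "norm z < 1" for z using fg[of z] fs[of "g z"] that by fastforce
 have gl: "norm (g z - g w) <= inverse l*norm (z - w)" if "norm z <= 1" "norm w <= 1" for z w
  using lo[OF fg(2)[OF that(1)] fg(2)[OF that(2)]] lL that by(simp add: fg field_simps)
 define K where "K = max L (inverse l)"
 have K: "L <= K" "inverse l <= K" "0 < K" using lL by(auto simp: K_def)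
 define F where "F x = to_vec (f (to_complex x))" for x
 define P where "P x = to_vec (g (to_complex x))" for x
 have lip: "dist (F z) (F w) <= K*dist z w \<and> dist (P z) (P w) <= K*dist z w" if "norm z <= 1" "norm w <= 1" for z w
 proof
  have d: "norm (to_complex z - to_complex w) = dist z w" by(simp add: dist_norm flip: to_complex_linear)
  show "dist (F z) (F w) <= K*dist z w"
   using up[of "to_complex z" "to_complex w"] that mult_right_mono[OF K(1), of "dist z w"] unfolding F_def dist_to_vec d by simp
  show "dist (P z) (P w) <= K*dist z w"
   using gl[of "to_complex z" "to_complex w"] that mult_right_mono[OF K(2), of "dist z w"] unfolding P_def dist_to_vec d by simp
 qed
 have rad: "radial_homeo K r F P" unfolding radial_homeo_def
 proof(intro conjI allI impI)
  fix z :: "real^2" assume z: "r <= norm z" "norm z <= 1"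
  have sg: "sgn (to_complex z) = to_complex (sgn z)" by(simp add: sgn_div_norm to_complex_linear)
  have "f (to_complex z) = of_real (norm (f (to_complex z)))*f (sgn (to_complex z))" using r(3) z by simp
  hence "F z = to_vec (norm (f (to_complex z)) *\<^sub>R f (to_complex (sgn z)))" unfolding F_def sg by(simp add: scaleR_conv_of_real)
  thus "F z = norm (F z) *\<^sub>R F (sgn z)" unfolding F_def norm_to_vec by(simp only: to_vec_linear)
 qed (use K r lip gf fg fs gs fb in \<open>auto simp: F_def P_def order_le_less\<close>)
 define Z where "Z = to_vec ` (Z0 \<inter> ball 0 1)"
 have Zn: "negligible Z" unfolding Z_def
 proof(rule negligible_locally_Lipschitz_image)
  show "negligible (Z0 \<inter> ball 0 1)" using Z0 by(rule negligible_subset) auto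
  show "\<exists>T B. open T \<and> x \<in> T \<and> (\<forall>y\<in>Z0 \<inter> ball 0 1 \<inter> T. norm (to_vec y - to_vec x) <= B*norm (y - x))" for x
   by(intro exI[of _ UNIV] exI[of _ 1]) (simp flip: to_vec_linear)
 qed simp
 have nZ: "to_complex z \<notin> Z0" if "norm z < 1" "z \<notin> Z" for z
  using that image_eqI[of z to_vec "to_complex z" "Z0 \<inter> ball 0 1"] by(auto simp: Z_def)
 have "\<forall>z\<in>disc - Z. \<exists>p. (f has_derivative (%w. fst p*w + snd p*cnj w)) (at (to_complex z)) \<and> fst p ~= 0 \<and>
    norm (snd p) <= (1 + k)/2*norm (fst p) \<and> (to_complex z \<notin> B0 --> norm (snd p - m z*fst p) <= e*norm (fst p))"
 proof
  fix z assume "z \<in> disc - Z"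
  hence "norm (to_complex z) < 1" "to_complex z \<notin> Z0" using nZ[of z] by auto
  from der[OF this] show "\<exists>p. (f has_derivative (%w. fst p*w + snd p*cnj w)) (at (to_complex z)) \<and> fst p ~= 0 \<and>
    norm (snd p) <= (1 + k)/2*norm (fst p) \<and> (to_complex z \<notin> B0 --> norm (snd p - m z*fst p) <= e*norm (fst p))"
   by auto
 qed
 from bchoice[OF this] obtain p where p: "\<forall>z\<in>disc - Z. (f has_derivative (%w. fst (p z)*w + snd (p z)*cnj w)) (at (to_complex z)) \<and> fst (p z) ~= 0 \<and>
    norm (snd (p z)) <= (1 + k)/2*norm (fst (p z)) \<and> (to_complex z \<notin> B0 --> norm (snd (p z) - m z*fst (p z)) <= e*norm (fst (p z)))" ..
 define DF where "DF z w = to_vec (fst (p z)*to_complex w + snd (p z)*cnj (to_complex w))" for z w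
 have "(F has_derivative DF z) (at z)" if z: "z \<in> disc - Z" for z
 proof -
  have "(f has_derivative (%w. fst (p z)*w + snd (p z)*cnj w)) (at (to_complex z))" using p z by blast
  from diff_chain_at[OF bounded_linear_imp_has_derivative[OF bounded_linear_to_vec(2)] this]
  have "(f \<circ> to_complex has_derivative (%w. fst (p z)*w + snd (p z)*cnj w) \<circ> to_complex) (at z)" .
  from bounded_linear.has_derivative[OF bounded_linear_to_vec(1) this]
  show ?thesis by(simp add: F_def[abs_def] DF_def[abs_def] o_def)
 qed
 moreover have "Z \<subseteq> disc" by(auto simp: Z_def)
 ultimately have bil: "bilip_disc K Z F DF P"
  unfolding bilip_disc_def using K Zn lip fb gb gf fg by(auto simp: F_def P_def less_imp_le)
 obtain S M M' where S: "B0 = S \<union> M" "M \<subseteq> M'" "M' \<in> null_sets lborel" "S \<in> sets lborel"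
  using fmeasurableD[OF B0(1)] by(rule sets_completionE)
 \<comment> \<open>\<open>B0\<close> is only Lebesgue measurable; replacing its null part
   \<open>M\<close> by the Borel null set \<open>M'\<close> gives a Borel set of the same
   measure.\<close>
 define B where "B = to_complex -` (S \<union> M')"
 have "emeasure lborel B = emeasure (distr lborel borel to_complex) (S \<union> M')"
  unfolding B_def using S by(subst emeasure_distr) auto
 also have "... = emeasure lborel S" unfolding distr_to_complex using S by(intro emeasure_Un_null_set) auto
 also have "... = emeasure lebesgue S" using S by simp
 also have "... <= emeasure lebesgue B0" by(rule emeasure_mono) (use S(1) B0 in \<open>auto simp: fmeasurableD\<close>)
 also have "... = ennreal (measure lebesgue B0)" using B0 by(simp add: emeasure_eq_measure2)
 also have "... <= ennreal e" using B0 by(intro ennreal_leI) simp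
 finally have "emeasure lborel B <= ennreal e" .
 moreover have "B \<in> sets borel"
 proof -
  have "S \<union> M' \<in> sets borel" using S by auto
  from measurable_sets[OF to_complex_measurable this] show ?thesis by(simp add: B_def)
 qed
 moreover have "\<forall>z\<in>disc - Z. \<exists>a b. DF z = (%w. to_vec (a*to_complex w + b*cnj (to_complex w))) \<and> a ~= 0 \<and>
    norm b <= (1 + k)/2*norm a \<and> (z \<notin> B --> norm (b - m z*a) <= e*norm a)"
 proof
  fix z assume z: "z \<in> disc - Z"
  have "to_complex z \<notin> B0" if "z \<notin> B" using that S by(auto simp: B_def)
  thus "\<exists>a b. DF z = (%w. to_vec (a*to_complex w + b*cnj (to_complex w))) \<and> a ~= 0 \<and>
    norm b <= (1 + k)/2*norm a \<and> (z \<notin> B --> norm (b - m z*a) <= e*norm a)"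
   using p z by(intro exI[of _ "fst (p z)"] exI[of _ "snd (p z)"]) (auto simp: DF_def[abs_def])
 qed
 ultimately show "\<exists>F P DF L r Z B. qc_disc ((1 + k)/2) m e F P DF L r Z B"
  using bil rad unfolding qc_disc_def by blast
 qed
qed

section \<open>Angles, boundary values and traces\<close>

lemma circle_point_to_vec: "circle_point t = to_vec (cis t)"
 by(simp add: circle_point_def to_vec_def)

lemma norm_circle_point [simp]: "norm (circle_point t) = 1"
 by(simp add: circle_point_to_vec)

text \<open>For angles at distance at most 1 the difference is a value of the principal logarithm,
  and \<open>norm_Ln_le\<close> compares arc with chord.\<close>

lemma circle_point_dist:
 shows "dist (circle_point s) (circle_point t) <= \<bar>s - t\<bar>"
  and "\<bar>s - t\<bar> <= 1 ==> \<bar>s - t\<bar> <= 10*dist (circle_point s) (circle_point t)"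
proof -
 have d: "dist (circle_point s) (circle_point t) = norm (cis s - cis t)" by(simp add: circle_point_to_vec dist_to_vec)
 show "dist (circle_point s) (circle_point t) <= \<bar>s - t\<bar>"
  unfolding d using norm_exp_ii_diff_le[of "- s" "- t"] by(simp add: cis_conv_exp abs_minus_commute)
 assume st: "\<bar>s - t\<bar> <= 1"
 have L: "Ln (cis (s - t)) = \<i> * of_real (s - t)"
  unfolding cis_conv_exp by(rule Ln_exp) (use st pi_gt3 in auto)
 have "\<bar>s - t\<bar> = norm (Ln (cis (s - t)))" unfolding L by(simp only: norm_mult norm_ii norm_of_real mult_1)
 also have "... <= 10*norm (cis (s - t) - 1)" by(rule norm_Ln_le) auto
 also have "norm (cis (s - t) - 1) = norm (cis t*(cis (s - t) - 1))" by(simp add: norm_mult)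
 also have "cis t*(cis (s - t) - 1) = cis s - cis t" by(simp add: right_diff_distrib cis_mult)
 finally show "\<bar>s - t\<bar> <= 10*dist (circle_point s) (circle_point t)" unfolding d .
qed

lemma circle_point_surj:
 assumes "norm z = 1"
 shows "\<exists>t. 0 <= t \<and> t <= 2*pi \<and> z = circle_point t"
proof -
 have "exp (\<i> * of_real (Arg2pi (to_complex z))) = to_complex z"
  using complex_norm_eq_1_exp[of "to_complex z"] assms by simp
 hence "to_vec (cis (Arg2pi (to_complex z))) = to_vec (to_complex z)" by(simp add: cis_conv_exp)
 thus ?thesis using Arg2pi_ge_0[of "to_complex z"] Arg2pi_lt_2pi[of "to_complex z"]
  by(intro exI[of _ "Arg2pi (to_complex z)"]) (simp add: circle_point_to_vec)
qed

lemma radial_homeoD: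
 assumes "radial_homeo L r F P"
 shows "0 < L" "r < 1" "!!z. norm z <= 1 ==> norm (F z) <= 1" "!!z. norm z <= 1 ==> norm (P z) <= 1"
  "!!z. norm z <= 1 ==> P (F z) = z" "!!z. norm z <= 1 ==> F (P z) = z"
  "!!z. norm z = 1 ==> norm (F z) = 1" "!!z. norm z = 1 ==> norm (P z) = 1"
  "!!z w. norm z <= 1 ==> norm w <= 1 ==> dist (F z) (F w) <= L*dist z w"
  "!!z w. norm z <= 1 ==> norm w <= 1 ==> dist (P z) (P w) <= L*dist z w"
  "!!z. r <= norm z ==> norm z <= 1 ==> F z = norm (F z) *\<^sub>R F (sgn z)"
 using assms unfolding radial_homeo_def by simp_all

text \<open>On an interval of length 1 the angle is a Lipschitz function of the point, so the map of
  angles induced by \<open>F\<close> is Lipschitz with constant \<open>10*L\<close> there; countably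
  many intervals suffice.\<close>

lemma negligible_circle_angles:
 assumes rad: "radial_homeo L r F P" and N: "negligible N"
 shows "negligible {th \<in> {0..2*pi}. \<exists>th'\<in>N. circle_point th = F (circle_point th')}"
proof -
 note R = radial_homeoD[OF rad]
 define T where "T j = {th \<in> {real j..real j + 1}. \<exists>th'\<in>N. circle_point th = F (circle_point th')}" for j :: nat
 have "negligible (T j)" for j
 proof -
  define M where "M = {th' \<in> N. \<exists>th. th \<in> {real j..real j + 1} \<and> circle_point th = F (circle_point th')}"
  define g where "g th' = (SOME th. th \<in> {real j..real j + 1} \<and> circle_point th = F (circle_point th'))" for th'
  have g: "g th' \<in> {real j..real j + 1} \<and> circle_point (g th') = F (circle_point th')" if "th' \<in> M" for th'
   unfolding g_def by(rule someI_ex) (use that in \<open>simp add: M_def\<close>)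
  have "negligible (g ` M)"
  proof(rule negligible_locally_Lipschitz_image)
   show "negligible M" using N by(rule negligible_subset) (auto simp: M_def)
   fix x assume x: "x \<in> M"
   have "\<bar>g y - g x\<bar> <= (10*L)*\<bar>y - x\<bar>" if y: "y \<in> M" for y
   proof -
    have "\<bar>g y - g x\<bar> <= 10*dist (circle_point (g y)) (circle_point (g x))"
     by(rule circle_point_dist(2)) (use g[OF x] g[OF y] in auto)
    also have "... = 10*dist (F (circle_point y)) (F (circle_point x))" using g[OF x] g[OF y] by simp
    also have "... <= 10*(L*dist (circle_point y) (circle_point x))" using R(9)[of "circle_point y" "circle_point x"] by simp
    also have "... <= 10*(L*\<bar>y - x\<bar>)" using R(1) circle_point_dist(1)[of y x] by simp
    finally show ?thesis by simp
   qed
   thus "\<exists>T B. open T \<and> x \<in> T \<and> (\<forall>y\<in>M \<inter> T. norm (g y - g x) <= B*norm (y - x))"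
    by(intro exI[of _ UNIV] exI[of _ "10*L"]) simp
  qed simp
  moreover have "T j \<subseteq> g ` M"
  proof
   fix th assume th: "th \<in> T j"
   then obtain th' where t: "th' \<in> N" "circle_point th = F (circle_point th')" "th \<in> {real j..real j + 1}" by(auto simp: T_def)
   hence M: "th' \<in> M" by(auto simp: M_def)
   have "\<bar>th - g th'\<bar> <= 10*dist (circle_point th) (circle_point (g th'))"
    by(rule circle_point_dist(2)) (use g[OF M] t in auto)
   hence "th = g th'" using g[OF M] t by simp
   thus "th \<in> g ` M" using M by blast
  qed
  ultimately show ?thesis by(rule negligible_subset)
 qed
 hence "negligible (\<Union>j. T j)" by(intro negligible_countable_Union) auto
 moreover have "{th \<in> {0..2*pi}. \<exists>th'\<in>N. circle_point th = F (circle_point th')} \<subseteq> (\<Union>j. T j)"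
 proof
  fix th assume th: "th \<in> {th \<in> {0..2*pi}. \<exists>th'\<in>N. circle_point th = F (circle_point th')}"
  hence "th \<in> T (nat \<lfloor>th\<rfloor>)" unfolding T_def using floor_correct[of th] by auto
  thus "th \<in> (\<Union>j. T j)" by blast
 qed
 ultimately show ?thesis by(rule negligible_subset)
qed

text \<open>Near the circle \<open>P\<close> sends the radius to \<open>e\<close> into the radius to
  \<open>P e\<close>, with \<open>s t\<close> tending to 1 from below; so the radial limit of the
  composition is a radial limit of \<open>v'\<close>. The exceptional angles remain null by
  \<open>negligible_circle_angles\<close>.\<close>

lemma has_trace_comp:
 assumes b: "bilip_disc K Z F DF P" and rad: "radial_homeo L r F P" and tr: "has_trace v c"
 shows "has_trace (%z. v (P z)) (%z. c (P z))"
proof -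
 note D = bilip_discD[OF b] and R = radial_homeoD[OF rad] and b' = bilip_disc_inverse(1)[OF b]
 obtain v' where v': "AED z. v' z = v z"
  and lim: "AE th in lebesgue_on {0..2*pi}. ((%t. v' (t *\<^sub>R circle_point th)) \<longlongrightarrow> c (circle_point th)) (at_left 1)"
  using tr unfolding has_trace_def by blast
 have "AE th in lebesgue. th \<in> {0..2*pi} --> ((%t. v' (t *\<^sub>R circle_point th)) \<longlongrightarrow> c (circle_point th)) (at_left 1)"
  using lim by(subst (asm) AE_restrict_space_iff) auto
 then obtain N where N: "N \<in> null_sets lebesgue"
  "{th \<in> space lebesgue. \<not> (th \<in> {0..2*pi} --> ((%t. v' (t *\<^sub>R circle_point th)) \<longlongrightarrow> c (circle_point th)) (at_left 1))} \<subseteq> N"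
  unfolding eventually_ae_filter by auto
 define T where "T = {th \<in> {0..2*pi}. \<exists>th'\<in>N. circle_point th = F (circle_point th')}"
 have "negligible T" unfolding T_def by(rule negligible_circle_angles[OF rad]) (use N(1) in \<open>simp add: negligible_iff_null_sets\<close>)
 hence nT: "AE th in lebesgue. th \<notin> T" by(rule AE_not_negligible)
 have key: "((%t. v' (P (t *\<^sub>R circle_point th))) \<longlongrightarrow> c (P (circle_point th))) (at_left 1)" if th: "th \<in> {0..2*pi}" "th \<notin> T" for th
 proof -
  define e where "e = circle_point th"
  have e: "norm e = 1" by(simp add: e_def)
  obtain th' where th': "0 <= th'" "th' <= 2*pi" "P e = circle_point th'" using circle_point_surj[OF R(8)[OF e]] by blast
  have "F (circle_point th') = circle_point th" using R(6)[of e] e th'(3) by(simp add: e_def)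
  hence "th' \<notin> N" using th unfolding T_def by(metis (mono_tags, lifting) mem_Collect_eq)
  hence lim': "((%t. v' (t *\<^sub>R P e)) \<longlongrightarrow> c (P e)) (at_left 1)" using N(2) th' by auto
  define s where "s t = norm (P (t *\<^sub>R e))" for t
  have near: "eventually (%t. t \<in> {0<..<1}) (at_left (1::real))" by(rule eventually_at_left_real) simp
  have slim: "(s \<longlongrightarrow> 1) (at_left 1)"
  proof(rule Lim_null_comparison[THEN LIM_zero_cancel])
   show "eventually (%t. norm (s t - 1) <= L*(1 - t)) (at_left 1)"
    using near
   proof eventually_elim
    case (elim t)
    have "\<bar>s t - norm (P e)\<bar> <= dist (P (t *\<^sub>R e)) (P e)" unfolding s_def dist_norm by(rule norm_triangle_ineq3)
    also have "... <= L*dist (t *\<^sub>R e) e" by(rule R(10)) (use elim e in auto)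
    also have "dist (t *\<^sub>R e) e = 1 - t"
    proof -
     have "t *\<^sub>R e - e = (t - 1) *\<^sub>R e" by(simp add: algebra_simps)
     thus ?thesis using elim e by(simp add: dist_norm)
    qed
    finally show ?case using R(8)[OF e] by simp
   qed
   have "((%t. L*(1 - t)) \<longlongrightarrow> L*(1 - 1)) (at_left (1::real))" by(intro tendsto_intros)
   thus "((%t. L*(1 - t)) \<longlongrightarrow> 0) (at_left (1::real))" by simp
  qed
  have "filterlim s (at_left 1) (at_left 1)"
   unfolding filterlim_at
  proof
   show "eventually (%t. s t \<in> {..<1} \<and> s t ~= 1) (at_left 1)"
    using near
   proof eventually_elim
    case (elim t)
    hence "t *\<^sub>R e \<in> disc" using e by simp
    from D(5)[OF this] show ?case by(simp add: s_def)
   qed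
  qed (rule slim)
  from filterlim_compose[OF lim' this]
  have "((%t. v' (s t *\<^sub>R P e)) \<longlongrightarrow> c (P e)) (at_left 1)" .
  moreover have "eventually (%t. v' (s t *\<^sub>R P e) = v' (P (t *\<^sub>R e))) (at_left 1)"
   using near order_tendstoD(1)[OF slim R(2)] order_tendstoD(1)[OF slim zero_less_one]
  proof eventually_elim
   case (elim t)
   define z where "z = P (t *\<^sub>R e)"
   have te: "norm (t *\<^sub>R e) <= 1" using elim e by simp
   have z: "r <= norm z" "norm z <= 1" "z ~= 0" "F z = t *\<^sub>R e"
    using elim R(4)[OF te] R(6)[OF te] by(auto simp: z_def s_def)
   \<comment> \<open>The radial clause concerns \<open>F\<close>; applied at
     \<open>z = P (t *\<^sub>R e)\<close> it identifies the direction of \<open>z\<close> as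
     \<open>P e\<close>.\<close>
   have "t *\<^sub>R e = t *\<^sub>R F (sgn z)" using R(11)[OF z(1,2)] z(4) elim e by simp
   hence "F (sgn z) = e" using elim by simp
   hence "P e = sgn z" using R(5)[of "sgn z"] by(metis norm_sgn order_refl zero_le_one)
   hence "s t *\<^sub>R P e = z" using z(3) by(simp add: s_def z_def[symmetric] sgn_div_norm)
   thus ?case by(simp add: z_def)
  qed
  ultimately have "((%t. v' (P (t *\<^sub>R e))) \<longlongrightarrow> c (P e)) (at_left 1)" by(rule Lim_transform_eventually)
  thus ?thesis by(simp add: e_def)
 qed
 have "AE th in lebesgue_on {0..2*pi}. ((%t. v' (P (t *\<^sub>R circle_point th))) \<longlongrightarrow> c (P (circle_point th))) (at_left 1)"
  using nT key by(subst AE_restrict_space_iff) (auto elim: eventually_mono)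
 moreover have "AED z. v' (P z) = v (P z)" by(rule AE_comp_bilip[OF b' v'])
 ultimately show ?thesis unfolding has_trace_def by(intro exI[of _ "%z. v' (P z)"]) simp
qed

theorem spanning_maps_comp:
 assumes b: "bilip_disc K Z F DF P" and rad: "radial_homeo L r F P" and v: "v \<in> spanning_maps G"
 shows "(%z. v (P z)) \<in> spanning_maps G"
proof -
 note R = radial_homeoD[OF rad] and b' = bilip_disc_inverse(1)[OF b]
 obtain c where sv: "sobolev_map v" and c: "has_trace v c" "continuous_on (sphere 0 1) c" "weakly_monotone_param G c"
  using v unfolding spanning_maps_def by blast
 let ?S = "sphere (0::real^2) 1"
 have cF: "continuous_on ?S F" "continuous_on ?S P"
  by(rule lipschitz_on_continuous_on[of L], rule lipschitz_onI, use R in auto)+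
 have imS: "P ` ?S = ?S" "F ` ?S = ?S"
 proof -
  show "P ` ?S = ?S"
  proof(intro equalityI subsetI)
   fix y assume "y \<in> ?S"
   thus "y \<in> P ` ?S" using R(5)[of y] R(7)[of y] by(intro image_eqI[of _ _ "F y"]) auto
  qed (use R(8) in auto)
  show "F ` ?S = ?S"
  proof(intro equalityI subsetI)
   fix y assume "y \<in> ?S"
   thus "y \<in> F ` ?S" using R(6)[of y] R(8)[of y] by(intro image_eqI[of _ _ "P y"]) auto
  qed (use R(7) in auto)
 qed
 have hom: "homeomorphism ?S ?S P F"
  by(rule homeomorphismI[OF cF(2,1)]) (use imS R(5,6) in auto)
 have "continuous_on ?S (%z. c (P z))" by(rule continuous_on_compose2[OF c(2) cF(2)]) (use imS in auto)
 moreover have "weakly_monotone_param G (%z. c (P z))"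
 proof -
  obtain h where h: "!!k::nat. \<exists>h'. homeomorphism ?S G (h k) h'" "uniform_limit ?S h c sequentially"
   using c(3) unfolding weakly_monotone_param_def by blast
  have "\<exists>h'. homeomorphism ?S G (%z. h k (P z)) h'" for k
   using h(1)[of k] homeomorphism_compose[OF hom] by(auto simp: o_def)
  moreover have "uniform_limit ?S (%k z. h k (P z)) (%z. c (P z)) sequentially"
   unfolding uniform_limit_iff
  proof(intro allI impI)
   fix e :: real assume "0 < e"
   hence "eventually (%n. \<forall>x\<in>?S. dist (h n x) (c x) < e) sequentially" using h(2) unfolding uniform_limit_iff by blast
   thus "eventually (%n. \<forall>x\<in>?S. dist (h n (P x)) (c (P x)) < e) sequentially"
    by eventually_elim (use imS in blast)
  qed
  ultimately show ?thesis unfolding weakly_monotone_param_def by(intro exI[of _ "%k z. h k (P z)"]) blast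
 qed
 ultimately show ?thesis
  using sobolev_map_comp_bilip[OF b' sv] has_trace_comp[OF b rad c(1)] unfolding spanning_maps_def by blast
qed

subsection \<open>Energy and Jacobian under linear maps\<close>

definition cmat :: "complex => complex => real^2^2" where
 "cmat a b = matrix (%w. to_vec (a*to_complex w + b*cnj (to_complex w)))"

lemma cmat_mult_vec: "cmat a b *v w = to_vec (a*to_complex w + b*cnj (to_complex w))"
proof -
 have "linear (%w. to_vec (a*to_complex w + b*cnj (to_complex w)))"
  by(intro linearI) (simp_all add: to_complex_linear to_vec_linear[symmetric] algebra_simps)
 thus ?thesis unfolding cmat_def using matrix_works[of "%w. to_vec (a*to_complex w + b*cnj (to_complex w))" w]
  by(simp add: linear_matrix_vector_mul_eq)
qed

lemma cmat_entries: "cmat a b $ 1 $ 1 = Re (a + b)" "cmat a b $ 2 $ 1 = Im (a + b)"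
  "cmat a b $ 1 $ 2 = Im (b - a)" "cmat a b $ 2 $ 2 = Re (a - b)"
 by(simp_all add: cmat_def matrix_def to_vec_def to_complex_def axis_def complex_eq_iff)

lemma det_cmat: "det (cmat a b) = (norm a)^2 - (norm b)^2"
 unfolding det_2 cmat_entries cmod_power2 by(simp add: power2_eq_square algebra_simps)

lemma cmat_surj: "\<exists>al be. T = cmat al be"
proof -
 obtain a b c d where e: "T $ 1 $ 1 = a" "T $ 1 $ 2 = b" "T $ 2 $ 1 = c" "T $ 2 $ 2 = d" by blast
 have "T = cmat (Complex ((a + d)/2) ((c - b)/2)) (Complex ((a - d)/2) ((c + b)/2))"
  by(simp add: vec_eq_iff forall_2 cmat_entries e field_simps)
 thus ?thesis by blast
qed

text \<open>The determinant of \<open>cmat 1 n\<close> is \<open>1 - (norm n)^2\<close>. As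
  \<open>I\<close> has degree 2, dividing by it amounts to normalising the matrix to determinant
  1.\<close>

definition dilated_energy :: "(seminorm2 => real) => seminorm2 => complex => real" where
 "dilated_energy I s n = I (sn_comp s (cmat 1 n))/(1 - (norm n)^2)"

text \<open>Up to a rotation and a scaling, \<open>a w + b cnj w\<close> is \<open>w + n cnj w\<close> with \<open>n = b / cnj a\<close>; so the energy of \<open>s \<circ> T\<close>
for \<open>T\<close> in \<open>SL\<^sub>2\<close> depends on \<open>n\<close> alone.\<close>

lemma energy_cmat:
 assumes I: "definition_of_energy I" and a: "a ~= 0"
 shows "I (sn_comp s (cmat a b)) = (norm a)^2*I (sn_comp s (cmat 1 (b/cnj a)))"
proof -
 define T where "T = cmat (sgn a) 0"
 have nT: "T *v w = to_vec (sgn a*to_complex w)" for w by(simp add: T_def cmat_mult_vec)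
 have "orthogonal_transformation ((*v) T)"
  unfolding orthogonal_transformation using a by(simp add: nT norm_mult norm_sgn)
 hence oT: "orthogonal_matrix T" using orthogonal_transformation_matrix[of "(*v) T"] by simp
 have dT: "det T = 1" using a by(simp add: T_def det_cmat norm_sgn)
 have eq: "sn_comp s (cmat a b) = sn_scale (norm a) (sn_comp (sn_comp s (cmat 1 (b/cnj a))) T)"
 proof -
  have "sn s (cmat a b *v w) = \<bar>norm a\<bar> * sn s (cmat 1 (b/cnj a) *v (T *v w))" for w
  proof -
   have "norm a *\<^sub>R (1*(sgn a*to_complex w) + (b/cnj a)*cnj (sgn a*to_complex w)) = a*to_complex w + b*cnj (to_complex w)"
    using a by(simp add: sgn_eq scaleR_conv_of_real field_simps)
   hence "cmat a b *v w = norm a *\<^sub>R (cmat 1 (b/cnj a) *v (T *v w))"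
    by(simp only: cmat_mult_vec nT to_vec_linear(3)[symmetric] to_vec_to_complex)
   thus ?thesis by(simp only: sn_scaleR)
  qed
  thus ?thesis by(simp add: sn_inject[symmetric] fun_eq_iff sn_scale.rep_eq sn_comp.rep_eq)
 qed
 show ?thesis unfolding eq using I oT dT by(simp add: definition_of_energy_def)
qed

lemma energy_nonneg: "definition_of_energy I ==> 0 <= I s"
 by(simp add: definition_of_energy_def)

lemma energy_comp_le:
 assumes I: "definition_of_energy I" and s: "!!w. sn s w <= c*norm w" "0 <= c"
 shows "I (sn_comp s (cmat 1 n)) <= (c*(1 + norm n))^2*I sn_euclid"
proof(rule energy_density_bound[OF I])
 fix w
 have "norm (to_complex w + n*cnj (to_complex w)) <= norm w + norm n*norm w"
  using norm_triangle_ineq[of "to_complex w" "n*cnj (to_complex w)"] by(simp add: norm_mult)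
 hence "c*norm (cmat 1 n *v w) <= c*(norm w + norm n*norm w)" using s(2) by(intro mult_left_mono) (simp_all add: cmat_mult_vec)
 thus "sn (sn_comp s (cmat 1 n)) w <= c*(1 + norm n)*norm w"
  using s(1)[of "cmat 1 n *v w"] by(simp add: sn_comp.rep_eq algebra_simps)
qed (use s(2) in simp)

lemma dist_sn_comp_cmat:
 shows "dist (sn_comp s (cmat 1 n)) (sn_comp s (cmat 1 n')) <= (sn s (axis 1 1) + sn s (axis 2 1))*norm (n - n')"
  and "dist (sn_comp s (cmat 1 n)) (sn_comp s' (cmat 1 n)) <= (1 + norm n)*dist s s'"
proof -
 show "dist (sn_comp s (cmat 1 n)) (sn_comp s (cmat 1 n')) <= (sn s (axis 1 1) + sn s (axis 2 1))*norm (n - n')"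
 proof(rule dist_sn_leI)
  fix w :: "real^2" assume w: "norm w = 1"
  have "cmat 1 n *v w - cmat 1 n' *v w = to_vec ((n - n')*cnj (to_complex w))"
   by(simp add: cmat_mult_vec algebra_simps flip: to_vec_linear)
  hence "norm (cmat 1 n *v w - cmat 1 n' *v w) = norm (n - n')" using w by(simp add: norm_mult)
  thus "\<bar>sn (sn_comp s (cmat 1 n)) w - sn (sn_comp s (cmat 1 n')) w\<bar> <= (sn s (axis 1 1) + sn s (axis 2 1))*norm (n - n')"
   using sn_diff_le[of s "cmat 1 n *v w" "cmat 1 n' *v w"] by(simp add: sn_comp.rep_eq)
 qed
 show "dist (sn_comp s (cmat 1 n)) (sn_comp s' (cmat 1 n)) <= (1 + norm n)*dist s s'"
 proof(rule dist_sn_leI)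
  fix w :: "real^2" assume w: "norm w = 1"
  have "norm (cmat 1 n *v w) <= 1 + norm n"
   using norm_triangle_ineq[of "to_complex w" "n*cnj (to_complex w)"] w by(simp add: cmat_mult_vec norm_mult)
  hence "dist s s'*norm (cmat 1 n *v w) <= dist s s'*(1 + norm n)" by(rule mult_left_mono) simp
  thus "\<bar>sn (sn_comp s (cmat 1 n)) w - sn (sn_comp s' (cmat 1 n)) w\<bar> <= (1 + norm n)*dist s s'"
   using sn_diff_le_dist[of s "cmat 1 n *v w" s'] by(simp add: sn_comp.rep_eq mult.commute)
 qed
qed

lemma tendsto_energy_comp:
 assumes I: "definition_of_energy I" and f: "(f \<longlongrightarrow> n) A"
 shows "((%x. I (sn_comp s (cmat 1 (f x)))) \<longlongrightarrow> I (sn_comp s (cmat 1 n))) A"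
proof -
 have cI: "isCont I t" for t using I by(simp add: definition_of_energy_def continuous_on_eq_continuous_at)
 have "((%x. sn_comp s (cmat 1 (f x))) \<longlongrightarrow> sn_comp s (cmat 1 n)) A"
 proof(rule tendsto_dist_iff[THEN iffD2], rule Lim_null_comparison)
  show "eventually (%x. norm (dist (sn_comp s (cmat 1 (f x))) (sn_comp s (cmat 1 n))) <= (sn s (axis 1 1) + sn s (axis 2 1))*norm (f x - n)) A"
   using dist_sn_comp_cmat(1) by simp
  have "((%x. f x - n) \<longlongrightarrow> 0) A" using f by(rule LIM_zero)
  thus "((%x. (sn s (axis 1 1) + sn s (axis 2 1))*norm (f x - n)) \<longlongrightarrow> 0) A"
   by(intro tendsto_mult_right_zero tendsto_norm_zero)
 qed
 thus ?thesis by(rule isCont_tendsto_compose[OF cI])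
qed

lemma tendsto_dilated_energy:
 assumes I: "definition_of_energy I" and f: "(f \<longlongrightarrow> n) A" and n: "norm n < 1"
 shows "((%x. dilated_energy I s (f x)) \<longlongrightarrow> dilated_energy I s n) A"
proof -
 have "1 - (norm n)^2 ~= 0" using n power_strict_mono[of "norm n" 1 2] by simp
 thus ?thesis unfolding dilated_energy_def
  by(intro tendsto_intros tendsto_energy_comp[OF I] f)
qed

lemma dilated_energy_measurable:
 assumes I: "definition_of_energy I" and S: "S \<in> borel_measurable M"
 shows "(%z. dilated_energy I (S z) n) \<in> borel_measurable M"
proof -
 have c: "continuous_on UNIV (%s. sn_comp s (cmat 1 n))"
  by(rule lipschitz_on_continuous_on[of "1 + norm n"], rule lipschitz_onI) (use dist_sn_comp_cmat(2) in auto)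
 have "continuous_on UNIV I" using I by(simp add: definition_of_energy_def)
 from continuous_on_compose2[OF this c] have "continuous_on UNIV (%s. I (sn_comp s (cmat 1 n)))" by simp
 hence "continuous_on UNIV (%s. dilated_energy I s n)" unfolding dilated_energy_def divide_inverse
  by(rule continuous_on_mult_right)
 from borel_measurable_continuous_onI[OF this] show ?thesis by(rule measurable_compose[OF S])
qed

lemma energy_sl2:
 assumes I: "definition_of_energy I" and T: "det (T :: real^2^2) = 1"
 shows "\<exists>n. norm n < 1 \<and> I (sn_comp s T) = dilated_energy I s n"
proof -
 obtain a b where ab: "T = cmat a b" using cmat_surj by blast
 have d: "(norm a)^2 - (norm b)^2 = 1" using T by(simp add: ab det_cmat)
 hence a: "a ~= 0" by(auto simp: algebra_simps) (metis add_eq_0_iff_both_eq_0 not_one_le_zero zero_le_power2 add_increasing2 less_eq_real_def norm_zero power_zero_numeral)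
 define n where "n = b/cnj a"
 have n2: "(norm n)^2 = (norm b)^2/(norm a)^2" by(simp add: n_def norm_divide power_divide)
 have a2: "(norm a)^2 > 0" using a by simp
 have e: "1 - (norm n)^2 = 1/(norm a)^2" unfolding n2 using d a2 by(simp add: field_simps)
 hence "(norm n)^2 < 1^2" using a2 by(smt (verit) divide_pos_pos one_power2)
 hence "norm n < 1" by(rule power2_less_imp_less) simp
 moreover have "I (sn_comp s T) = dilated_energy I s n"
  unfolding ab energy_cmat[OF I a] dilated_energy_def e n_def[symmetric] by simp
 ultimately show ?thesis by blast
qed

lemma dilated_energy_sl2:
 assumes I: "definition_of_energy I" and n: "norm n < 1"
 shows "\<exists>T :: real^2^2. det T = 1 \<and> I (sn_comp s T) = dilated_energy I s n"
proof -
 have p: "0 < 1 - (norm n)^2" using n power_strict_mono[of "norm n" 1 2] by simp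
 define a where "a = inverse (sqrt (1 - (norm n)^2))"
 have a: "a > 0" "a^2 = inverse (1 - (norm n)^2)" using p by(simp_all add: a_def power_inverse)
 have "det (cmat a (n*a)) = a^2*(1 - (norm n)^2)" using a(1) by(simp add: det_cmat norm_mult power_mult_distrib algebra_simps)
 hence "det (cmat a (n*a)) = 1" using p by(simp add: a(2))
 moreover have "I (sn_comp s (cmat a (n*a))) = dilated_energy I s n"
  using energy_cmat[OF I, of "of_real a" s "n*a"] a p
  by(simp add: dilated_energy_def divide_inverse mult.commute mult.left_commute)
 ultimately show ?thesis by blast
qed

lemma jac_hat_facts:
 assumes I: "definition_of_energy I"
 shows "0 <= jac_hat I s" "jac_hat I s <= I s" "norm nu < 1 ==> jac_hat I s <= dilated_energy I s nu"
  "det T = 1 ==> jac_hat I s <= I (sn_comp s T)"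
  "jac_hat I s < c ==> \<exists>nu. norm nu < 1 \<and> dilated_energy I s nu < c"
  "dilated_energy I s 0 = I s"
proof -
 have ne: "{T :: real^2^2. det T = 1} ~= {}" using det_I[where 'a = real and 'n = 2] by blast
 have bd: "bdd_below ((%T. I (sn_comp s T)) ` {T. det T = 1})"
  using energy_nonneg[OF I] by(intro bdd_belowI2[of _ 0]) simp
 show "0 <= jac_hat I s" unfolding jac_hat_def using ne energy_nonneg[OF I] by(intro cINF_greatest)
 show l: "jac_hat I s <= I (sn_comp s T)" if "det T = 1" for T
  unfolding jac_hat_def using that by(intro cINF_lower[OF bd]) simp
 have "sn_comp s (mat 1) = s" by(simp add: sn_inject[symmetric] fun_eq_iff sn_comp.rep_eq)
 thus "jac_hat I s <= I s" using l[of "mat 1"] by simp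
 have "sn_comp s (cmat 1 0) = s" by(simp add: sn_inject[symmetric] fun_eq_iff sn_comp.rep_eq cmat_mult_vec)
 thus "dilated_energy I s 0 = I s" by(simp add: dilated_energy_def)
 show "jac_hat I s <= dilated_energy I s nu" if "norm nu < 1"
  using dilated_energy_sl2[OF I that, of s] l by metis
 show "\<exists>nu. norm nu < 1 \<and> dilated_energy I s nu < c" if "jac_hat I s < c"
 proof -
  have "\<exists>T\<in>{T :: real^2^2. det T = 1}. I (sn_comp s T) < c"
   using that unfolding jac_hat_def by(simp only: cINF_less_iff[OF ne bd])
  then obtain T :: "real^2^2" where T: "det T = 1" "I (sn_comp s T) < c" by auto
  show ?thesis using energy_sl2[OF I T(1), of s] T(2) by auto
 qed
qed

text \<open>The inverse of \<open>a*w + b*cnj w\<close> has coefficients \<open>cnj a/d\<close> and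
  \<open>- b/d\<close>, where \<open>d\<close> is the determinant; so its parameter in the sense of
  \<open>dilated_energy\<close> is \<open>- b/a\<close>. This is the origin of the opposite sign of
  \<open>n\<close> and \<open>m\<close> below.\<close>

lemma qc_derivative_energy:
 assumes I: "definition_of_energy I" and D: "D = (%w. to_vec (a*to_complex w + b*cnj (to_complex w)))"
  and a: "a ~= 0" and k: "norm b <= k*norm a" "k < 1" and iv: "!!w. D (D' w) = w"
 shows "\<bar>det (matrix D)\<bar>*I (sn_comp s (matrix D')) = dilated_energy I s (- b/a)"
proof -
 define d where "d = (norm a)^2 - (norm b)^2"
 have "k*norm a < 1*norm a" using k(2) a by(intro mult_strict_right_mono) auto
 hence "norm b < norm a" using k(1) by simp
 hence d: "d > 0" unfolding d_def using power_strict_mono[of "norm b" "norm a" 2] by simp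
 have dc: "of_real d = a*cnj a - b*cnj b" unfolding d_def of_real_diff complex_norm_square ..
 have md: "matrix D = cmat a b" unfolding D cmat_def ..
 have D'eq: "D' w = to_vec ((cnj a / of_real d)*to_complex w + (- b / of_real d)*cnj (to_complex w))" for w
 proof -
  define p where "p = to_complex (D' w)"
  have "to_complex (D (D' w)) = to_complex w" by(simp add: iv)
  hence w: "to_complex w = a*p + b*cnj p" by(simp add: D p_def)
  have "cnj a*to_complex w - b*cnj (to_complex w) = of_real d*p"
   unfolding w dc by(simp add: algebra_simps)
  hence "p = (cnj a / of_real d)*to_complex w + (- b / of_real d)*cnj (to_complex w)"
   using d by(simp add: field_simps)
  thus ?thesis unfolding p_def by(metis to_vec_to_complex(1))
 qed
 have mD': "matrix D' = cmat (cnj a / of_real d) (- b / of_real d)"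
  unfolding cmat_def D'eq[abs_def] ..
 have q: "(- b / of_real d)/cnj (cnj a / of_real d) = - b/a" using d a by simp
 have "\<bar>det (matrix D)\<bar>*I (sn_comp s (matrix D')) = d*((norm (cnj a / of_real d))^2*I (sn_comp s (cmat 1 (- b/a))))"
 proof -
  have nz: "cnj a / of_real d ~= 0" using d a by simp
  have "I (sn_comp s (matrix D')) = (norm (cnj a / of_real d))^2*I (sn_comp s (cmat 1 (- b/a)))"
   unfolding mD' energy_cmat[OF I nz] q ..
  moreover have "\<bar>det (matrix D)\<bar> = d" unfolding md det_cmat d_def[symmetric] using d by simp
  ultimately show ?thesis by simp
 qed
 also have "(norm (cnj a / of_real d))^2 = (norm a)^2/d^2" using d by(simp add: norm_divide power_divide)
 also have "d*((norm a)^2/d^2*I (sn_comp s (cmat 1 (- b/a)))) = (norm a)^2/d*I (sn_comp s (cmat 1 (- b/a)))"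
  using d by(simp add: power2_eq_square)
 also have "(norm a)^2/d = 1/(1 - (norm (- b/a))^2)"
  using d a by(simp add: d_def norm_divide power_divide field_simps)
 finally show ?thesis by(simp add: dilated_energy_def)
qed

text \<open>The energy of the reparametrized map as an integral in the source variable of
  \<open>v\<close>: the metric derivative of \<open>v\<close> is fixed, and only the parameter
  \<open>n\<close>, close to \<open>- m\<close> off \<open>B\<close>, varies.\<close>

definition energy_transfer where
 "energy_transfer I v P k m e B u n \<longleftrightarrow>
  u \<in> BD \<and>
  energy I dist (%z. v (P z)) = (\<integral>\<^sup>+z. u z \<partial>lebesgue_on disc) \<and>
  (AED z. u z = ennreal (dilated_energy I (apmd dist v z) (n z)) \<and>
    norm (n z) <= k \<and> (z \<notin> B --> norm (n z + m z) <= e))"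

text \<open>Change of variables along \<open>F\<close>. The metric derivative of the composition at
  \<open>F z\<close> is that of \<open>v\<close> at \<open>z\<close> composed with the inverse of
  \<open>DF z\<close>, and the Jacobian factor combines with it to
  \<open>dilated_energy\<close>.\<close>

lemma energy_qc_comp:
 fixes v :: "real^2 => 'a::metric_space"
 assumes I: "definition_of_energy I" and q: "qc_disc k m e F P DF L r Z B" and k: "k < 1" and v: "sobolev_map v"
 shows "\<exists>u n. energy_transfer I v P k m e B u n"
proof -
 have b: "bilip_disc L Z F DF P" using q by(simp add: qc_disc_def)
 note D = bilip_discD[OF b] and N = bilip_disc_facts[OF b] and b' = bilip_disc_inverse(1)[OF b]
 let ?w = "%z. v (P z)"
 let ?A = "%y. I (apmd dist ?w y)"
 have sw: "sobolev_map ?w" by(rule sobolev_map_comp_bilip[OF b' v])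
 have cI: "I \<in> borel_measurable borel" using I by(intro borel_measurable_continuous_onI) (simp add: definition_of_energy_def)
 have Am: "?A \<in> BD"
  by(rule measurable_compose[OF apmd_measurable_bounded(1)[OF I sw] cI])
 obtain h where h: "h \<in> borel_measurable borel" "!!z. z \<notin> disc ==> h z = 0" "AED z. h z = ?A z"
  using borel_representative_real[OF Am] by auto
 have hm: "h \<in> BD"
  by(rule measurable_restrict_space1, rule measurable_completion) (use h(1) in simp)
 define u where "u z = ennreal (indicator (disc - Z) z*\<bar>det (matrix (DF z))\<bar>)*ennreal (h (F z))" for z
 have um: "u \<in> BD" unfolding u_def
  using measurable_restrict_space1[OF nn_integral_bilip_disc(2)[OF b, of "%_. 0"]] measurable_compose[OF bilip_disc_measurable[OF b] hm]
  by simp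
 have on: "(\<integral>\<^sup>+z. f z \<partial>lebesgue_on disc) = (\<integral>\<^sup>+z. indicator disc z*f z \<partial>lebesgue)" for f :: "real^2 => ennreal"
  by(simp add: nn_integral_restrict_space mult.commute)
 have "energy I dist ?w = (\<integral>\<^sup>+z. ennreal (h z) \<partial>lebesgue_on disc)"
  unfolding energy_def using h(3) by(intro nn_integral_cong_AE) (auto elim: eventually_mono)
 also have "... = (LN z. indicator disc z*ennreal (h z))" unfolding on nn_integral_completion ..
 also have "... = (\<integral>\<^sup>+z. indicator (disc - Z) z*ennreal \<bar>det (matrix (DF z))\<bar>*ennreal (h (F z)) \<partial>lebesgue)"
  by(rule nn_integral_bilip_disc(1)[OF b]) (use h(1) in measurable)
 also have "... = (\<integral>\<^sup>+z. u z \<partial>lebesgue_on disc)" unfolding on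
  by(rule nn_integral_cong) (auto simp: u_def indicator_def)
 finally have eu: "energy I dist ?w = (\<integral>\<^sup>+z. u z \<partial>lebesgue_on disc)" .
 have "\<forall>z\<in>disc - Z. \<exists>n. norm n <= k \<and> (z \<notin> B --> norm (n + m z) <= e) \<and>
   (\<forall>s. \<bar>det (matrix (DF z))\<bar>*I (sn_comp s (matrix (inv (DF z)))) = dilated_energy I s n)"
 proof
  fix z assume z: "z \<in> disc - Z"
  obtain al be where ab: "DF z = (%w. to_vec (al*to_complex w + be*cnj (to_complex w)))" "al ~= 0"
    "norm be <= k*norm al" "z \<notin> B --> norm (be - m z*al) <= e*norm al"
   using q z unfolding qc_disc_def by blast
  have "norm (- be/al) <= k" using ab by(simp add: norm_divide divide_le_eq)
  moreover have "norm (- be/al + m z) <= e" if "z \<notin> B"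
  proof -
   have "- be/al + m z = - ((be - m z*al)/al)" using ab(2) by(simp add: field_simps)
   hence "norm (- be/al + m z) = norm (be - m z*al)/norm al" by(simp only: norm_minus_cancel norm_divide)
   thus ?thesis using ab(2,4) that by(simp add: divide_le_eq)
  qed
  moreover have "\<bar>det (matrix (DF z))\<bar>*I (sn_comp s (matrix (inv (DF z)))) = dilated_energy I s (- be/al)" for s
   by(rule qc_derivative_energy[OF I ab(1-3) k bilip_disc_inverse(2)[OF b]]) (use z in auto)
  ultimately show "\<exists>n. norm n <= k \<and> (z \<notin> B --> norm (n + m z) <= e) \<and>
   (\<forall>s. \<bar>det (matrix (DF z))\<bar>*I (sn_comp s (matrix (inv (DF z)))) = dilated_energy I s n)" by blast
 qed
 from bchoice[OF this] obtain n where n: "\<forall>z\<in>disc - Z. norm (n z) <= k \<and> (z \<notin> B --> norm (n z + m z) <= e) \<and>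
   (\<forall>s. \<bar>det (matrix (DF z))\<bar>*I (sn_comp s (matrix (inv (DF z)))) = dilated_energy I s (n z))" ..
 note nZ = AE_disc_not_negligible[OF D(2)]
 have "AED z. u z = ennreal (dilated_energy I (apmd dist v z) (n z)) \<and>
    norm (n z) <= k \<and> (z \<notin> B --> norm (n z + m z) <= e)"
  using nZ AE_comp_bilip[OF b h(3)] AE_comp_bilip[OF b AE_apmd_comp_bilip[OF I b' v]]
 proof eventually_elim
  case (elim z)
  have "h (F z) = I (sn_comp (apmd dist v z) (matrix (inv (DF z))))"
   using elim D(6)[of z] by simp
  hence "u z = ennreal (\<bar>det (matrix (DF z))\<bar>*I (sn_comp (apmd dist v z) (matrix (inv (DF z)))))"
   using elim(1) energy_nonneg[OF I] by(simp add: u_def ennreal_mult)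
  thus ?case using n elim(1) by simp
 qed
 thus ?thesis unfolding energy_transfer_def using um eu by blast
qed

subsection \<open>Choice of the dilatation\<close>

text \<open>The nearest-point projection to the closed disc of radius \<open>K\<close> restores the
  bound without affecting the limit.\<close>

lemma ae_continuous_approximation:
 fixes c :: "real^2 => complex"
 assumes c: "c \<in> BD" "!!z. norm (c z) <= K" "0 <= K"
 shows "\<exists>g :: nat => real^2 => complex. (\<forall>n. continuous_on UNIV (g n)) \<and> (\<forall>n z. norm (g n z) <= K) \<and>
  (AED z. (%n. g n z) \<longlonglongrightarrow> c z)"
proof -
 have "c measurable_on disc" using c(1) by(simp add: measurable_on_iff_borel_measurable)
 then obtain N g where N: "negligible N" and g: "!!n. continuous_on UNIV (g n)"
   "!!x. x \<notin> N ==> (%n::nat. g n x) \<longlonglongrightarrow> (if x \<in> disc then c x else 0)"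
  unfolding measurable_on_def by blast
 let ?p = "closest_point (cball (0::complex) K)"
 have pc: "continuous_on UNIV ?p" using c(3) by(intro continuous_on_closest_point) auto
 have "continuous_on UNIV (%z. ?p (g n z))" for n by(rule continuous_on_compose2[OF pc g(1)]) simp
 moreover have "norm (?p (g n z)) <= K" for n z
  using closest_point_in_set[of "cball (0::complex) K" "g n z"] c(3) by simp
 moreover have "AED z. (%n. ?p (g n z)) \<longlonglongrightarrow> c z"
  using AE_disc_not_negligible[OF N]
  proof eventually_elim
   case (elim z)
   have "isCont ?p (c z)" using pc by(simp add: continuous_on_eq_continuous_at)
   hence "(%n. ?p (g n z)) \<longlonglongrightarrow> ?p (c z)" using g(2)[of z] elim by(auto intro: isCont_tendsto_compose)
   moreover have "?p (c z) = c z" by(rule closest_point_self) (use c(2) elim in simp)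
   ultimately show ?case using elim by simp
  qed
 ultimately show ?thesis by(intro exI[of _ "%n z. ?p (g n z)"]) blast
qed

text \<open>The best of 0 and the first \<open>n\<close> points of the sequence, found by running
  comparison. It is a measurable selection with finitely many values, which cannot exceed the value
  at 0.\<close>

primrec greedy :: "(seminorm2 => real) => (nat => complex) => seminorm2 => nat => complex" where
 "greedy I q s 0 = 0"
| "greedy I q s (Suc n) = (if dilated_energy I s (q n) < dilated_energy I s (greedy I q s n) then q n else greedy I q s n)"

text \<open>At a fixed stage only 0 and the first \<open>n\<close> points occur, so one
  \<open>K < 1\<close> serves for all seminorms although the infimum may require parameters close to
  the circle.\<close>

lemma greedy_bound:
 assumes "!!n. norm (q n) < 1"
 shows "\<exists>K<1. 0 <= K \<and> (\<forall>s. norm (greedy I q s n) <= K)"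
proof(induction n)
 case (Suc n)
 then obtain K where K: "K < 1" "0 <= K" "!!s. norm (greedy I q s n) <= K" by blast
 thus ?case using assms[of n] by(intro exI[of _ "max K (norm (q n))"]) (auto simp: le_max_iff_disj)
qed (auto intro: exI[of _ 0])

lemma greedy_le:
 "dilated_energy I s (greedy I q s n) <= dilated_energy I s 0"
 "j < n ==> dilated_energy I s (greedy I q s n) <= dilated_energy I s (q j)"
 by(induction n) (auto simp: less_Suc_eq)

lemma greedy_measurable:
 assumes I: "definition_of_energy I" and S: "S \<in> borel_measurable M"
 shows "(%z. greedy I q (S z) n) \<in> borel_measurable M" "(%z. dilated_energy I (S z) (greedy I q (S z) n)) \<in> borel_measurable M"
proof -
 note [measurable] = dilated_energy_measurable[OF I S]
 have "(%z. greedy I q (S z) n) \<in> borel_measurable M \<and> (%z. dilated_energy I (S z) (greedy I q (S z) n)) \<in> borel_measurable M"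
 proof(induction n)
  case (Suc n)
  hence [measurable]: "(%z. greedy I q (S z) n) \<in> borel_measurable M" "(%z. dilated_energy I (S z) (greedy I q (S z) n)) \<in> borel_measurable M" by auto
  have e: "dilated_energy I (S z) (greedy I q (S z) (Suc n)) =
   (if dilated_energy I (S z) (q n) < dilated_energy I (S z) (greedy I q (S z) n) then dilated_energy I (S z) (q n) else dilated_energy I (S z) (greedy I q (S z) n))" for z by simp
  show ?case unfolding e unfolding greedy.simps by(intro conjI) measurable
 qed simp
 thus "(%z. greedy I q (S z) n) \<in> borel_measurable M" "(%z. dilated_energy I (S z) (greedy I q (S z) n)) \<in> borel_measurable M" by auto
qed

lemma dense_in_unit_ball: "\<exists>q :: nat => complex. (\<forall>n. norm (q n) < 1) \<and> (\<forall>U. open U --> U \<inter> ball 0 1 ~= {} --> (\<exists>n. q n \<in> U))"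
proof -
 obtain D :: "complex set" where D: "countable D" "!!X. open X ==> X ~= {} ==> \<exists>d\<in>D. d \<in> X"
  using countable_dense_setE by blast
 have ne: "D \<inter> ball 0 1 ~= {}" using D(2)[of "ball 0 1"] by auto
 have r: "range (from_nat_into (D \<inter> ball 0 1)) = D \<inter> ball 0 1" using D(1) ne by(intro range_from_nat_into) auto
 have "\<exists>n. from_nat_into (D \<inter> ball 0 1) n \<in> U" if U: "open U" "U \<inter> ball 0 1 ~= {}" for U
 proof -
  obtain d where "d \<in> D" "d \<in> U \<inter> ball 0 1" using D(2)[OF open_Int[OF U(1) open_ball] U(2)] by blast
  thus ?thesis using r by(metis IntD1 IntD2 IntI imageE)
 qed
 moreover have "norm (from_nat_into (D \<inter> ball 0 1) n) < 1" for n using from_nat_into[OF ne, of n] by simp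
 ultimately show ?thesis by(intro exI[of _ "from_nat_into (D \<inter> ball 0 1)"]) blast
qed

text \<open>A near-optimal parameter stays near-optimal on a neighbourhood, which the dense sequence
  eventually hits.\<close>

lemma greedy_tendsto_jac_hat:
 assumes I: "definition_of_energy I" and q: "!!n. norm (q n) < 1" "!!U. open U ==> U \<inter> ball 0 1 ~= {} ==> \<exists>n. q n \<in> U"
 shows "(%n. dilated_energy I s (greedy I q s n)) \<longlonglongrightarrow> jac_hat I s"
proof(rule order_tendstoI)
 have ge: "jac_hat I s <= dilated_energy I s (greedy I q s n)" for n
 proof -
  obtain K where "K < 1" "norm (greedy I q s n) <= K" using greedy_bound[of q I n] q(1) by blast
  thus ?thesis by(intro jac_hat_facts(3)[OF I]) simp
 qed
 show "eventually (%n. a < dilated_energy I s (greedy I q s n)) sequentially" if "a < jac_hat I s" for a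
  using less_le_trans[OF that ge] by simp
 fix a assume "jac_hat I s < a"
 from jac_hat_facts(5)[OF I this] obtain nu where nu: "norm nu < 1" "dilated_energy I s nu < a" by blast
 have "((%x. dilated_energy I s x) \<longlongrightarrow> dilated_energy I s nu) (nhds nu)"
  by(rule tendsto_dilated_energy[OF I _ nu(1)]) (rule filterlim_ident)
 from order_tendstoD(2)[OF this nu(2)]
 obtain U where U: "open U" "nu \<in> U" "\<forall>x\<in>U. dilated_energy I s x < a" unfolding eventually_nhds by blast
 have "U \<inter> ball 0 1 ~= {}" using U(2) nu(1) by auto
 then obtain j where "q j \<in> U" using q(2)[OF U(1)] by blast
 hence j: "dilated_energy I s (q j) < a" using U by blast
 have "dilated_energy I s (greedy I q s n) < a" if "Suc j <= n" for n
  using greedy_le(2)[of j n I s q] that j by simp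
 thus "eventually (%n. dilated_energy I s (greedy I q s n) < a) sequentially"
  unfolding eventually_sequentially by blast
qed

section \<open>Comparison of the minimal energy with the integral of the Jacobian\<close>

lemma reparametrization_step:
 fixes v :: "real^2 => 'a::metric_space"
 assumes I: "definition_of_energy I" and v: "v \<in> spanning_maps G" and K: "0 <= K" "K < 1"
  and e: "0 < e" "e <= (1 - K)/2" and m: "!!z. norm (m z) <= K" "continuous_on UNIV m"
 shows "\<exists>p. (%z. v (fst p z)) \<in> spanning_maps G \<and> fst (snd p) \<in> sets borel \<and> emeasure lborel (fst (snd p)) <= ennreal e \<and>
  energy_transfer I v (fst p) ((1 + K)/2) m e (fst (snd p)) (fst (snd (snd p))) (snd (snd (snd p)))"
proof -
 obtain F P DF L r Z B where q: "qc_disc ((1 + K)/2) m e F P DF L r Z B"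
  using qc_disc_exists[OF K e m] by blast
 have sv: "sobolev_map v" using v by(simp add: spanning_maps_def)
 obtain u n where "energy_transfer I v P ((1 + K)/2) m e B u n"
  using energy_qc_comp[OF I q _ sv] K(2) by auto
 moreover have "(%z. v (P z)) \<in> spanning_maps G"
  using q unfolding qc_disc_def by(blast intro: spanning_maps_comp[OF _ _ v])
 ultimately show ?thesis using q unfolding qc_disc_def by(intro exI[of _ "(P, B, u, n)"]) simp
qed

text \<open>The majorant for dominated convergence: \<open>1 + norm nu\<close> is at most 2, whence
  the 4 in \<open>C\<close>, and the denominator is at least \<open>1 - k^2\<close>. It depends on
  the dilatation bound alone, not on the Lipschitz constants of the reparametrizations.\<close>

lemma energy_bound_finite:
 fixes v :: "real^2 => 'a::metric_space"
 assumes I: "definition_of_energy I" and v: "sobolev_map v" and k: "0 <= k" "k < 1"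
 shows "\<exists>w :: real^2 => ennreal. w \<in> BD \<and> (\<integral>\<^sup>+z. w z \<partial>lebesgue_on disc) < \<infinity> \<and>
  (AED z. \<forall>nu. norm nu <= k --> ennreal (dilated_energy I (apmd dist v z) nu) <= w z)"
proof -
 obtain g :: "real^2 => real" where g: "L2_disc g" "AED z. \<forall>w. sn (apmd dist v z) w <= g z*norm w"
  using apmd_measurable_bounded(2)[OF I v] by blast
 define C where "C = 4*I sn_euclid/(1 - k^2)"
 have k2: "0 < 1 - k^2" using k power_strict_mono[of k 1 2] by simp
 have C0: "0 <= C" using k2 energy_nonneg[OF I] by(simp add: C_def)
 define w where "w z = ennreal (C*(norm (g z))^2)" for z
 have gm: "g \<in> BD" and gi: "integrable (lebesgue_on disc) (%z. C*(norm (g z))^2)"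
  using g(1) by(auto simp: L2_disc_def)
 have "w \<in> BD" unfolding w_def using gm by measurable
 moreover have "(\<integral>\<^sup>+z. w z \<partial>lebesgue_on disc) < \<infinity>"
  using gi C0 unfolding integrable_iff_bounded w_def by(simp add: abs_mult)
 moreover have "AED z. \<forall>nu. norm nu <= k --> ennreal (dilated_energy I (apmd dist v z) nu) <= w z"
  using g(2)
 proof eventually_elim
  case (elim z)
  have g0: "0 <= g z" using elim[rule_format, of "axis 1 1"] sn_nonneg[of "apmd dist v z" "axis 1 1"] by simp
  have "dilated_energy I (apmd dist v z) nu <= C*(norm (g z))^2" if nu: "norm nu <= k" for nu
  proof -
   have "I (sn_comp (apmd dist v z) (cmat 1 nu)) <= (g z*(1 + norm nu))^2*I sn_euclid"
    by(rule energy_comp_le[OF I]) (use elim g0 in auto)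
   also have "... <= (g z*2)^2*I sn_euclid"
    using nu k g0 by(intro mult_right_mono power_mono mult_left_mono energy_nonneg[OF I]) auto
   finally have n: "I (sn_comp (apmd dist v z) (cmat 1 nu)) <= 4*I sn_euclid*(norm (g z))^2" by(simp add: power_mult_distrib mult_ac)
   have "(norm nu)^2 <= k^2" using nu by(intro power_mono) auto
   hence "dilated_energy I (apmd dist v z) nu <= 4*I sn_euclid*(norm (g z))^2/(1 - k^2)"
    unfolding dilated_energy_def using k2 n energy_nonneg[OF I] by(intro frac_le) auto
   thus ?thesis by(simp add: C_def)
  qed
  thus ?case unfolding w_def by(auto intro: ennreal_leI)
 qed
 ultimately show ?thesis by blast
qed

text \<open>Two limits in succession. At a fixed greedy stage \<open>N\<close> continuous
  coefficients and vanishing errors produce spanning maps, each of energy at least \<open>E\<close>,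
  whose energies tend to the integral of \<open>m N\<close>; letting \<open>N\<close> grow replaces
  this by the integral of \<open>jac_hat\<close>.\<close>

theorem energy_le_integral_jac_hat:
 fixes v :: "real^2 => 'a::metric_space"
 assumes I: "definition_of_energy I" and v: "v \<in> spanning_maps G"
  and E: "!!w. w \<in> spanning_maps G ==> E <= energy I dist w"
 shows "E <= (\<integral>\<^sup>+z. ennreal (jac_hat I (apmd dist v z)) \<partial>lebesgue_on disc)"
  and "(%z. jac_hat I (apmd dist v z)) \<in> BD"
proof -
 have sv: "sobolev_map v" using v by(simp add: spanning_maps_def)
 define S where "S = apmd dist v"
 have Sm: "S \<in> BD" unfolding S_def by(rule apmd_measurable_bounded(1)[OF I sv])
 obtain q :: "nat => complex" where q: "!!n. norm (q n) < 1" "!!U. open U ==> U \<inter> ball 0 1 ~= {} ==> \<exists>n. q n \<in> U"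
  using dense_in_unit_ball by blast
 define c where "c n z = greedy I q (S z) n" for n z
 define m where "m n z = dilated_energy I (S z) (c n z)" for n z
 have cm: "c n \<in> BD" and mm [measurable]: "m n \<in> BD" for n
  unfolding m_def c_def by(rule greedy_measurable[OF I Sm])+
 have ml: "(%n. m n z) \<longlonglongrightarrow> jac_hat I (S z)" for z
  unfolding m_def c_def by(rule greedy_tendsto_jac_hat[OF I q])
 have "(%z. jac_hat I (S z)) \<in> BD"
  by(rule borel_measurable_LIMSEQ_real[OF ml mm])
 thus jm: "(%z. jac_hat I (apmd dist v z)) \<in> BD" by(simp add: S_def)
 let ?J = "\<integral>\<^sup>+z. ennreal (jac_hat I (S z)) \<partial>lebesgue_on disc"
 \<comment> \<open>The bound for the parameter 0 dominates every \<open>m n\<close>, since the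
   greedy choice never exceeds its initial value.\<close>
 obtain w0 where w0: "w0 \<in> BD" "(\<integral>\<^sup>+z. w0 z \<partial>lebesgue_on disc) < \<infinity>"
  "AED z. \<forall>nu. norm nu <= 0 --> ennreal (dilated_energy I (S z) nu) <= w0 z"
  using energy_bound_finite[OF I sv order_refl zero_less_one] unfolding S_def by blast
 have mw: "AED z. ennreal (m n z) <= w0 z" for n
  using w0(3)
 proof eventually_elim
  case (elim z)
  have "ennreal (m n z) <= ennreal (dilated_energy I (S z) 0)" unfolding m_def c_def by(rule ennreal_leI[OF greedy_le(1)])
  also have "... <= w0 z" using elim by simp
  finally show ?case .
 qed
 have mlim: "(%n. \<integral>\<^sup>+z. ennreal (m n z) \<partial>lebesgue_on disc) \<longlonglongrightarrow> ?J"
  by(rule nn_integral_dominated_convergence[OF _ _ w0(1) mw w0(2)])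
   (use jm ml in \<open>auto simp: S_def intro!: tendsto_ennrealI\<close>)
 have Jfin: "?J < \<infinity>"
 proof -
  have "?J <= (\<integral>\<^sup>+z. w0 z \<partial>lebesgue_on disc)"
   using w0(3) by(intro nn_integral_mono_AE, elim eventually_mono)
    (metis ennreal_leI jac_hat_facts(2,6)[OF I] norm_zero order_refl order_trans)
  thus ?thesis using w0(2) by(rule le_less_trans)
 qed
 have "E <= ?J"
 proof(rule ennreal_le_epsilon)
  fix e :: real assume e: "0 < e"
  have "?J < ?J + ennreal e" using ennreal_add_left_cancel_less[of ?J 0 "ennreal e"] Jfin e by simp
  from order_tendstoD(2)[OF mlim this] obtain N where N: "(\<integral>\<^sup>+z. ennreal (m N z) \<partial>lebesgue_on disc) < ?J + ennreal e"
   unfolding eventually_sequentially by blast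
  obtain K where K: "K < 1" "0 <= K" "!!z. norm (c N z) <= K" using greedy_bound[of q I N] q(1) unfolding c_def by blast
  \<comment> \<open>The sign compensates that a coefficient \<open>m\<close> enters the energy as
    the parameter \<open>- m\<close>.\<close>
  have "(%z. - c N z) \<in> BD" using cm[of N] by measurable
  from ae_continuous_approximation[OF this, of K] K(2,3) obtain g :: "nat => real^2 => complex" where
   g: "!!n. continuous_on UNIV (g n)" "!!n z. norm (g n z) <= K" "AED z. (%n. g n z) \<longlonglongrightarrow> - c N z" by auto
  \<comment> \<open>The first entry makes the measures of the exceptional sets summable, the second
    is what the Beltrami approximation asks for.\<close>
  define ep where "ep n = min ((1/2) ^ n) ((1 - K)/2)" for n :: nat
  have ep: "0 < ep n" "ep n <= (1 - K)/2" "ep n <= (1/2) ^ n" for n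
  proof -
   show "0 < ep n" using K by(simp add: ep_def)
   show "ep n <= (1 - K)/2" unfolding ep_def by(rule min.cobounded2)
   show "ep n <= (1/2) ^ n" unfolding ep_def by(rule min.cobounded1)
  qed
  define k where "k = (1 + K)/2"
  have k: "0 <= k" "k < 1" using K by(auto simp: k_def)
  have "\<forall>n. \<exists>p. (%z. v (fst p z)) \<in> spanning_maps G \<and> fst (snd p) \<in> sets borel \<and> emeasure lborel (fst (snd p)) <= ennreal (ep n) \<and>
    energy_transfer I v (fst p) k (g n) (ep n) (fst (snd p)) (fst (snd (snd p))) (snd (snd (snd p)))"
   unfolding k_def using reparametrization_step[OF I v K(2,1) ep(1,2) g(2,1)] by blast
  from choice[OF this] obtain p where p: "\<forall>n. (%z. v (fst (p n) z)) \<in> spanning_maps G \<and> fst (snd (p n)) \<in> sets borel \<and>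
    emeasure lborel (fst (snd (p n))) <= ennreal (ep n) \<and>
    energy_transfer I v (fst (p n)) k (g n) (ep n) (fst (snd (p n))) (fst (snd (snd (p n)))) (snd (snd (snd (p n))))" ..
  define B where "B n = fst (snd (p n))" for n
  define u where "u n = fst (snd (snd (p n)))" for n
  define nu where "nu n = snd (snd (snd (p n)))" for n
  have B: "B n \<in> sets borel" "emeasure lborel (B n) <= ennreal (ep n)" for n using p by(simp_all add: B_def)
  have um: "u n \<in> BD"
   and Eu: "E <= (\<integral>\<^sup>+z. u n z \<partial>lebesgue_on disc)"
   and unu: "AED z. u n z = ennreal (dilated_energy I (S z) (nu n z)) \<and> norm (nu n z) <= k \<and> (z \<notin> B n --> norm (nu n z + g n z) <= ep n)" for n
   using p E[of "%z. v (fst (p n) z)"] unfolding energy_transfer_def B_def u_def nu_def S_def by auto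
  \<comment> \<open>Borel-Cantelli: almost every point leaves the exceptional sets for good, so the
    parameters converge there to the greedy coefficient.\<close>
  have "AE z in lborel. eventually (%n. z \<in> space lborel - B n) sequentially"
  proof(rule borel_cantelli_AE1)
   show "B n \<in> sets lborel" for n using B by simp
   show fin: "emeasure lborel (B n) < \<infinity>" for n using B(2)[of n] by(rule le_less_trans) simp
   show "summable (%n. measure lborel (B n))"
   proof(rule summable_comparison_test')
    show "summable (%n. (1/2 :: real) ^ n)" by(rule summable_geometric) simp
    fix n
    have "measure lborel (B n) <= ep n" unfolding measure_def using B(2)[of n] ep(1)[of n] by(intro enn2real_leI) auto
    thus "norm (measure lborel (B n)) <= (1/2) ^ n" using ep(3)[of n] by simp
   qed
  qed
  hence evB: "AED z. eventually (%n. z \<notin> B n) sequentially"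
   unfolding AE_lebesgue_on_disc by eventually_elim simp
  have "AED z. \<forall>n. u n z = ennreal (dilated_energy I (S z) (nu n z)) \<and> norm (nu n z) <= k \<and> (z \<notin> B n --> norm (nu n z + g n z) <= ep n)"
   unfolding AE_all_countable using unu by blast
  hence lim: "AED z. (%n. u n z) \<longlonglongrightarrow> ennreal (m N z)"
   using evB g(3)
  proof eventually_elim
   case (elim z)
   have "(%n. nu n z + g n z) \<longlonglongrightarrow> 0"
   proof(rule Lim_null_comparison)
    show "eventually (%n. norm (nu n z + g n z) <= (1/2) ^ n) sequentially"
     using elim(2) by eventually_elim (use elim(1) ep(3) order_trans in blast)
    show "(%n. (1/2 :: real) ^ n) \<longlonglongrightarrow> 0" by(rule LIMSEQ_power_zero) simp
   qed
   from tendsto_diff[OF this elim(3)] have "(%n. nu n z) \<longlonglongrightarrow> c N z" by simp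
   hence "(%n. dilated_energy I (S z) (nu n z)) \<longlonglongrightarrow> m N z"
    unfolding m_def by(rule tendsto_dilated_energy[OF I]) (use K(1) K(3)[of z] in simp)
   thus ?case using elim(1) by(simp add: tendsto_ennrealI)
  qed
  obtain w where w: "w \<in> BD" "(\<integral>\<^sup>+z. w z \<partial>lebesgue_on disc) < \<infinity>"
   "AED z. \<forall>nu. norm nu <= k --> ennreal (dilated_energy I (S z) nu) <= w z"
   using energy_bound_finite[OF I sv k] unfolding S_def by blast
  have uw: "AED z. u n z <= w z" for n
   using unu[of n] w(3) by eventually_elim simp
  have "(%n. \<integral>\<^sup>+z. u n z \<partial>lebesgue_on disc) \<longlonglongrightarrow> (\<integral>\<^sup>+z. ennreal (m N z) \<partial>lebesgue_on disc)"
   by(rule nn_integral_dominated_convergence[OF um _ w(1) uw w(2) lim]) measurable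
  hence "E <= (\<integral>\<^sup>+z. ennreal (m N z) \<partial>lebesgue_on disc)"
   by(rule LIMSEQ_le_const) (use Eu in blast)
  thus "E <= ?J + ennreal e" using N by simp
 qed
 thus "E <= (\<integral>\<^sup>+z. ennreal (jac_hat I (apmd dist v z)) \<partial>lebesgue_on disc)" by(simp add: S_def)
qed

theorem theorem4p3:
  fixes I :: "seminorm2 \<Rightarrow> real"
    and \<Gamma> :: "'a :: complete_space set"
    and u :: "real^2 \<Rightarrow> 'a"
    and Q :: real
  assumes energy: "definition_of_energy I" "quasi_convex I"
    and proper: "\<And>S :: 'a set. closed S \<Longrightarrow> bounded S \<Longrightarrow> compact S"
    and curve: "jordan_curve \<Gamma>"
    and Q: "Q > 0" "\<And>s. energy_minimal I s \<Longrightarrow> sn_quasiconformal Q s"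
    and u: "u \<in> spanning_maps \<Gamma>"
    and minimal: "\<And>v. v \<in> spanning_maps \<Gamma> \<Longrightarrow> energy I dist u \<le> energy I dist v"
  shows "(\<forall>v\<in>spanning_maps \<Gamma>. area I dist u \<le> area I dist v) \<and> quasiconformal Q u"
proof
 note I = energy(1)
 let ?J = "%v::real^2 => 'a. \<integral>\<^sup>+z. ennreal (jac_hat I (apmd dist v z)) \<partial>lebesgue_on disc"
 \<comment> \<open>Minimality enters through this comparison. It is used for every competitor, and
   with \<open>v = u\<close> it forces equality.\<close>
 have le: "energy I dist u <= ?J v" if "v \<in> spanning_maps \<Gamma>" for v
  by(rule energy_le_integral_jac_hat(1)[OF I that minimal])
 have jm: "(%z. jac_hat I (apmd dist v z)) \<in> BD" if "v \<in> spanning_maps \<Gamma>" for v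
  by(rule energy_le_integral_jac_hat(2)[OF I that minimal])
 have Ju: "?J u <= energy I dist u"
  unfolding energy_def by(intro nn_integral_mono ennreal_leI jac_hat_facts(2)[OF I])
 \<comment> \<open>The normalising factor is common to all spanning maps, so areas compare as the
   integrals of \<open>jac_hat\<close> do.\<close>
 have area: "area I dist v = ennreal (1/jac_hat I sn_euclid)*?J v" if "v \<in> spanning_maps \<Gamma>" for v
 proof -
  have "area I dist v = (\<integral>\<^sup>+z. ennreal (1/jac_hat I sn_euclid)*ennreal (jac_hat I (apmd dist v z)) \<partial>lebesgue_on disc)"
   unfolding area_def jacobian_def using jac_hat_facts(1)[OF I] by(simp add: ennreal_mult[symmetric])
  also have "... = ennreal (1/jac_hat I sn_euclid)*?J v" by(rule nn_integral_cmult) (use jm[OF that] in measurable)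
  finally show ?thesis .
 qed
 show "\<forall>v\<in>spanning_maps \<Gamma>. area I dist u <= area I dist v"
 proof
  fix v assume v: "v \<in> spanning_maps \<Gamma>"
  show "area I dist u <= area I dist v"
   unfolding area[OF u] area[OF v] by(intro mult_left_mono order_trans[OF Ju le[OF v]]) simp
 qed
 have su: "sobolev_map u" using u by(simp add: spanning_maps_def)
 have Im: "(%z. I (apmd dist u z)) \<in> BD"
  using measurable_compose[OF apmd_measurable_bounded(1)[OF I su], of I borel] I
  by(simp add: definition_of_energy_def borel_measurable_continuous_onI)
 obtain w where w: "w \<in> BD" "(\<integral>\<^sup>+z. w z \<partial>lebesgue_on disc) < \<infinity>"
  "AED z. \<forall>n. norm n <= 0 --> ennreal (dilated_energy I (apmd dist u z) n) <= w z"
  using energy_bound_finite[OF I su order_refl zero_less_one] by blast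
 have "energy I dist u <= (\<integral>\<^sup>+z. w z \<partial>lebesgue_on disc)"
  unfolding energy_def using w(3) by(intro nn_integral_mono_AE) (auto elim!: eventually_mono simp: jac_hat_facts(6)[OF I])
 \<comment> \<open>Finiteness permits subtracting the two integrals in what follows.\<close>
 hence fin: "energy I dist u < \<infinity>" using w(2) by(rule le_less_trans)
 \<comment> \<open>The integrands are ordered pointwise and have equal finite integrals, so they
   agree almost everywhere; there the infimum over matrices of determinant 1 is attained at the
   identity.\<close>
 have "AED z. ennreal (I (apmd dist u z)) - ennreal (jac_hat I (apmd dist u z)) = 0"
 proof(subst nn_integral_0_iff_AE[symmetric])
  have "(\<integral>\<^sup>+z. ennreal (I (apmd dist u z)) - ennreal (jac_hat I (apmd dist u z)) \<partial>lebesgue_on disc) = energy I dist u - ?J u"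
   unfolding energy_def
  proof(rule nn_integral_diff)
   show "?J u ~= \<infinity>" using Ju fin by(auto simp: top_unique)
  qed (use Im jm[OF u] jac_hat_facts(2)[OF I] in \<open>auto intro!: ennreal_leI\<close>)
  also have "... = 0" using le[OF u] fin by(simp add: diff_eq_0_iff_ennreal)
  finally show "(\<integral>\<^sup>+z. ennreal (I (apmd dist u z)) - ennreal (jac_hat I (apmd dist u z)) \<partial>lebesgue_on disc) = 0" .
 qed (use Im jm[OF u] in measurable)
 hence "AED z. sn_quasiconformal Q (apmd dist u z)"
 proof eventually_elim
  case (elim z)
  have "ennreal (I (apmd dist u z)) <= ennreal (jac_hat I (apmd dist u z))"
   using elim by(simp add: diff_eq_0_iff_ennreal)
  hence "I (apmd dist u z) <= jac_hat I (apmd dist u z)" using jac_hat_facts(1)[OF I] by(simp add: ennreal_le_iff)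
  hence "energy_minimal I (apmd dist u z)"
   unfolding energy_minimal_def using jac_hat_facts(4)[OF I] order_trans by blast
  thus ?case by(rule Q(2))
 qed
 thus "quasiconformal Q u" using su by(simp add: quasiconformal_def)
qed

end
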